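(* Let $N\ge 1$ and $m\ge 2$ be integers and let $\Omega\subset\mathbb{R}^N$ be a bounded domain (with Lipschitz boundary if $N\ge 2$). Let $\lambda_{m,k}(\Omega)$, $k\in\mathbb{N}$, be the $k$-th Dirichlet eigenvalue in $\Omega$ of the $m$-order logarithmic Laplacian $\mathcal{L}_m$, and let $\mathcal{N}_m(\lambda)=\#\{k:\lambda_{m,k}(\Omega)<\lambda\}$. Then $$\lim_{\lambda\to+\infty} e^{-\frac N2\lambda^{\frac1m}}\,\mathcal{N}_m(\lambda)=\frac{T_N|\Omega|}{N}$$ and $$\lim_{\lambda\to+\infty}\lambda^{-\frac{m-1}{m}}e^{-\frac N2\lambda^{\frac1m}}\sum_k(\lambda-\lambda_{m,k}(\Omega))_+=\frac{2m}{N^2}\,T_N|\Omega|,$$ where $T_N=\frac{\omega_N}{(2\pi)^N}$ and $a_+=\max\{0,a\}$.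
   Context: $\omega_N$ denotes the surface measure of the unit sphere in $\mathbb{R}^N$ and $|\Omega|$ the Lebesgue measure of $\Omega$. The Fourier transform is $\hat u(\xi)=\int_{\mathbb{R}^N}e^{-i\xi\cdot x}u(x)\,dx$. The $m$-order logarithmic Laplacian $\mathcal{L}_m$ is the operator with Fourier symbol $(2\log|\xi|)^m$. Functions on $\Omega$ are extended by zero to $\mathbb{R}^N$. Let $\mathbb{H}_{m,0}(\Omega)$ be the closure of $C_c^\infty(\Omega)$ with respect to the norm $\|u\|_m=\big(\int_{\mathbb{R}^N}(\log(e+|\xi|))^m|\hat u(\xi)|^2d\xi\big)^{1/2}$; it embeds compactly in $L^2(\Omega)$. The form $(u,v)_m=\frac1{(2\pi)^N}\int_{\mathbb{R}^N}(2\log|\xi|)^m\hat u(\xi)\overline{\hat v(\xi)}\,d\xi$ with domain $\mathbb{H}_{m,0}(\Omega)$ is closed, symmetric and semibounded from below. The Dirichlet eigenvalues of $\mathcal{L}_m$ in $\Omega$ (i.e. of $\mathcal{L}_mu=\lambda u$ in $\Omega$, $u=0$ in $\mathbb{R}^N\setminus\Omega$) are the numbers $\lambda$ for which there is $0\ne\phi\in\mathbb{H}_{m,0}(\Omega)$ with $(\phi,v)_m=\lambda\int_\Omega\phi v\,dx$ for all $v\in\mathbb{H}_{m,0}(\Omega)$; counted with multiplicity they form a sequence $-\infty<\lambda_{m,1}(\Omega)\le\lambda_{m,2}(\Omega)\le\cdots\to+\infty$. *)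

theory Defs
  imports "HOL-Analysis.Analysis"
begin

text \<open>
  The space R^N is an arbitrary Euclidean space \<open>'a\<close> with \<open>N = DIM('a)\<close>. Functions are real-valued,
  defined on all of \<open>'a\<close> and vanish outside \<open>\<Omega>\<close>; elements of L^2 are Borel representatives,
  so they are only determined up to null sets.
\<close>

subsection \<open>Domains and the unit sphere\<close>

text \<open>
  Around each boundary point \<open>\<Omega>\<close> is, in suitable Cartesian coordinates with vertical direction \<open>e\<close>,
  the strict epigraph of a Lipschitz function on the hyperplane orthogonal to \<open>e\<close>.
\<close>
definition lipschitz_boundary :: "'a::euclidean_space set \<Rightarrow> bool" where
  "lipschitz_boundary \<Omega> \<longleftrightarrow>
     (\<forall>p \<in> frontier \<Omega>. \<exists>e r L \<gamma>. norm e = 1 \<and> 0 < r \<and> L-lipschitz_on {y. y \<bullet> e = 0} \<gamma> \<and>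
        \<Omega> \<inter> ball p r = {x \<in> ball p r. \<gamma> (x - (x \<bullet> e) *\<^sub>R e) < x \<bullet> e})"

text \<open>
  Surface measure of a subset \<open>A\<close> of the unit sphere: \<open>N\<close> times the volume of the solid cone over
  \<open>A\<close>, which is the normalisation for which integration in polar coordinates holds.
\<close>
definition sphere_measure :: "'a::euclidean_space set \<Rightarrow> real" where
  "sphere_measure A =
     real DIM('a) * measure lebesgue {r *\<^sub>R x |r x. 0 < r \<and> r \<le> 1 \<and> x \<in> A}"

lemma sphere_measure_unit_sphere:
  "sphere_measure (sphere (0::'a::euclidean_space) 1) = real DIM('a) * unit_ball_vol (real DIM('a))"
proof -
  have "{r *\<^sub>R x |r x. 0 < r \<and> r \<le> 1 \<and> x \<in> sphere (0::'a) 1} = cball 0 1 - {0}" (is "?C = _")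
  proof (intro set_eqI iffI)
    fix y :: 'a assume "y \<in> cball 0 1 - {0}"
    then have "y = norm y *\<^sub>R (y /\<^sub>R norm y)" "0 < norm y" "norm y \<le> 1"
      "y /\<^sub>R norm y \<in> sphere 0 1" by auto
    then show "y \<in> ?C" by blast
  qed auto
  moreover have "measure lebesgue (cball 0 1 - {0::'a}) = measure lebesgue (cball (0::'a) 1)"
    by (rule measure_Diff_null_set) auto
  ultimately show ?thesis
    by (simp add: sphere_measure_def content_cball)
qed

definition T_const :: "'a::euclidean_space itself \<Rightarrow> real" where
  "T_const _ = sphere_measure (sphere (0::'a) 1) / (2 * pi) ^ DIM('a)"

subsection \<open>Test functions\<close>

definition partial_deriv :: "'a::euclidean_space \<Rightarrow> ('a \<Rightarrow> real) \<Rightarrow> 'a \<Rightarrow> real" where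
  "partial_deriv b f x = frechet_derivative f (at x) b"

definition smooth :: "('a::euclidean_space \<Rightarrow> real) \<Rightarrow> bool" where
  "smooth f \<longleftrightarrow> (\<forall>bs. set bs \<subseteq> Basis \<longrightarrow> (\<forall>x. foldr partial_deriv bs f differentiable (at x)))"

definition test_functions :: "'a::euclidean_space set \<Rightarrow> ('a \<Rightarrow> real) set" where
  "test_functions \<Omega> =
     {f. smooth f \<and> compact (closure {x. f x \<noteq> 0}) \<and> closure {x. f x \<noteq> 0} \<subseteq> \<Omega>}"

subsection \<open>Fourier transform and the form domain\<close>

text \<open>
  Only applied to square-integrable functions vanishing outside a bounded set, which are integrable.
\<close>
definition fourier :: "('a::euclidean_space \<Rightarrow> real) \<Rightarrow> 'a \<Rightarrow> complex" where
  "fourier u \<xi> =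
     (LINT x|lborel. exp (- \<i> * complex_of_real (\<xi> \<bullet> x)) * complex_of_real (u x))"

text \<open>The square of the norm, possibly infinite.\<close>
definition log_norm_sq :: "nat \<Rightarrow> ('a::euclidean_space \<Rightarrow> real) \<Rightarrow> ennreal" where
  "log_norm_sq m u =
     (\<integral>\<^sup>+ \<xi>. ennreal ((ln (exp 1 + norm \<xi>)) ^ m * (cmod (fourier u \<xi>))\<^sup>2) \<partial>lborel)"

definition L2_zero_ext :: "'a::euclidean_space set \<Rightarrow> ('a \<Rightarrow> real) set" where
  "L2_zero_ext \<Omega> =
     {u \<in> borel_measurable borel. (\<forall>x. x \<notin> \<Omega> \<longrightarrow> u x = 0) \<and> integrable lborel (\<lambda>x. (u x)\<^sup>2)}"

text \<open>
  The closure of the test functions is taken inside L^2; this loses nothing, since by Plancherel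
  the norm dominates a multiple of the L^2 norm.
\<close>
definition log_sobolev :: "nat \<Rightarrow> 'a::euclidean_space set \<Rightarrow> ('a \<Rightarrow> real) set" where
  "log_sobolev m \<Omega> =
     {u \<in> L2_zero_ext \<Omega>. \<exists>\<phi>. (\<forall>n. \<phi> n \<in> test_functions \<Omega>) \<and>
        (\<lambda>n::nat. log_norm_sq m (\<lambda>x. u x - \<phi> n x)) \<longlonglongrightarrow> 0}"

definition log_form ::
    "nat \<Rightarrow> ('a::euclidean_space \<Rightarrow> real) \<Rightarrow> ('a \<Rightarrow> real) \<Rightarrow> complex" where
  "log_form m u v = complex_of_real (1 / (2 * pi) ^ DIM('a)) *
     (LINT \<xi>|lborel. complex_of_real ((2 * ln (norm \<xi>)) ^ m) * fourier u \<xi> * cnj (fourier v \<xi>))"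

subsection \<open>Dirichlet eigenvalues\<close>

definition eigenspace :: "nat \<Rightarrow> 'a::euclidean_space set \<Rightarrow> real \<Rightarrow> ('a \<Rightarrow> real) set" where
  "eigenspace m \<Omega> \<mu> =
     {\<phi> \<in> log_sobolev m \<Omega>. \<forall>v \<in> log_sobolev m \<Omega>.
        log_form m \<phi> v = complex_of_real (\<mu> * (LINT x:\<Omega>|lborel. \<phi> x * v x))}"

text \<open>
  \<open>E\<close> has a basis of \<open>d\<close> elements after identifying functions that agree almost everywhere.
\<close>
definition has_dim_ae :: "('a::euclidean_space \<Rightarrow> real) set \<Rightarrow> nat \<Rightarrow> bool" where
  "has_dim_ae E d \<longleftrightarrow>
     (\<exists>b. (\<forall>i<d. b i \<in> E) \<and>
        (\<forall>c. (AE x in lborel. (\<Sum>i<d. c i * b i x) = 0) \<longrightarrow> (\<forall>i<d. c i = 0)) \<and>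
        (\<forall>u\<in>E. \<exists>c. AE x in lborel. u x = (\<Sum>i<d. c i * b i x)))"

text \<open>
  \<open>lam\<close> lists the eigenvalues in nondecreasing order, each \<open>\<mu>\<close> as often as its multiplicity, i.e.
  the dimension of its eigenspace (zero exactly when \<open>\<mu>\<close> is not an eigenvalue).
\<close>
definition eigenvalue_enumeration :: "nat \<Rightarrow> 'a::euclidean_space set \<Rightarrow> (nat \<Rightarrow> real) \<Rightarrow> bool" where
  "eigenvalue_enumeration m \<Omega> lam \<longleftrightarrow>
     incseq lam \<and> filterlim lam at_top sequentially \<and>
     (\<forall>\<mu>. has_dim_ae (eigenspace m \<Omega> \<mu>) (card {k. lam k = \<mu>}))"

text \<open>
  Indices start at \<open>0\<close>: \<open>dirichlet_eigenvalue m \<Omega> k\<close> is the \<open>(k+1)\<close>-st eigenvalue.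
\<close>
definition dirichlet_eigenvalue :: "nat \<Rightarrow> 'a::euclidean_space set \<Rightarrow> nat \<Rightarrow> real" where
  "dirichlet_eigenvalue m \<Omega> = (THE lam. eigenvalue_enumeration m \<Omega> lam)"

end

theory Submission
  imports Defs "HOL-Library.Function_Algebras" "HOL-Probability.Probability"
    "HOL-Real_Asymp.Real_Asymp" "HOL-Complex_Analysis.Great_Picard"
begin

text \<open>
  Everything reduces to the Riesz means \<open>\<Sum>k. (\<lambda> - \<lambda>\<^sub>k)\<^sub>+\<close>, studied at \<open>\<lambda> = s\<^sup>m\<close>. Minimising the
  Rayleigh quotient successively gives an orthonormal eigenbasis: by the parallelogram law and the
  compactness of the form domain in \<open>L\<^sup>2\<close>, minimising sequences have convergent subsequences. The
  upper bound is that of Berezin, Li and Yau: for each eigenfunction, Jensen's inequality moves the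
  positive part inside the Fourier integral, and Bessel's inequality for the plane waves
  restricted to \<open>\<Omega>\<close> bounds the sum over \<open>k\<close>. For the lower bound the trial functions
  \<open>w(x) cos (\<xi> \<bullet> x)\<close> and \<open>w(x) sin (\<xi> \<bullet> x)\<close> are used, where the cutoffs \<open>w\<close> increase to the
  indicator of \<open>\<Omega>\<close>; since the logarithm varies slowly, replacing the symbol at \<open>\<xi> + \<zeta>\<close> by its
  value at \<open>\<xi>\<close> costs a term of lower order. Both bounds are the phase space integral of
  \<open>(s\<^sup>m - (2 log |\<xi>|)\<^sup>m)\<^sub>+\<close>. Finally the counting function lies between difference quotients of the
  Riesz mean, with respect to \<open>\<lambda>\<close>, from \<open>s\<close> to \<open>s \<plusminus> \<tau>\<close>; as the Riesz mean is asymptotic to a power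
  times an exponential, nothing is lost when \<open>\<tau>\<close> tends to zero.
\<close>

subsection \<open>Spectral decomposition of compact forms\<close>

text \<open>\<open>dirichlet_eigenvalue\<close> is a definite description, so an enumeration must be
  produced whose multiplicities are the dimensions of all eigenspaces, and it must be shown to be
  unique. The symbol is singular at the origin and, for odd \<open>m\<close>, unbounded below there.
  It is controlled because a function in \<open>L\<^sup>2\<close> supported in a bounded set has a
  bounded Fourier transform: the unit ball of frequencies then contributes at most a multiple of the
  squared \<open>L\<^sup>2\<close> norm. The constant: with \<xi> = e^(s/2) \<eta>, the difference
  s^m - (s + 2 log |\<eta>|)^m behaves like -2 m s^(m-1) log |\<eta>|, and -log |\<eta>| has
  integral v / N over the unit ball, whose volume is v. Since T_N = N v / (2 pi)^N, the Riesz mean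
  gets the constant 2 m T_N |\<Omega>| / N^2, and the Jacobian supplies e^(N s / 2). The errors: the
  Riesz mean has order s^(m-1) e^(N s / 2). The singularity at the origin costs the lower bound a
  multiple of e^(N s / 2), of smaller order because m is at least 2. The shift of frequencies costs
  a factor e^(-s/4), obtained by keeping only frequencies beyond e^(s/4).\<close>

instantiation "fun" :: (type, real_vector) real_vector
begin
definition scaleR_fun :: "real \<Rightarrow> ('a \<Rightarrow> 'b) \<Rightarrow> 'a \<Rightarrow> 'b" where
  "scaleR_fun c f = (\<lambda>x. c *\<^sub>R f x)"
instance
  by standard (auto simp: scaleR_fun_def plus_fun_def fun_eq_iff scaleR_add_right scaleR_add_left)
end

lemma scaleR_apply_fun [simp]: "(c *\<^sub>R f) x = c *\<^sub>R f x"
  by (simp add: scaleR_fun_def)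

lemma sum_apply_fun [simp]: "(sum f I) x = (\<Sum>i\<in>I. f i x)"
  by (induction I rule: infinite_finite_induct) auto

text \<open>Only semidefiniteness is assumed: the elements of the form domain are functions and not
  classes, so a function vanishing almost everywhere has norm zero without being
  \<open>0\<close>.\<close>

locale semi_inner =
  fixes V :: "'v::real_vector set" and B :: "'v \<Rightarrow> 'v \<Rightarrow> real"
  assumes subV: "subspace V"
    and B_add: "\<lbrakk>u \<in> V; v \<in> V; w \<in> V\<rbrakk> \<Longrightarrow> B (u + v) w = B u w + B v w"
    and B_scale: "\<lbrakk>u \<in> V; w \<in> V\<rbrakk> \<Longrightarrow> B (c *\<^sub>R u) w = c * B u w"
    and B_sym: "\<lbrakk>u \<in> V; v \<in> V\<rbrakk> \<Longrightarrow> B u v = B v u"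
    and B_nonneg: "u \<in> V \<Longrightarrow> 0 \<le> B u u"
begin

lemma add_V: "\<lbrakk>u \<in> V; v \<in> V\<rbrakk> \<Longrightarrow> u + v \<in> V"
  and scale_V: "u \<in> V \<Longrightarrow> c *\<^sub>R u \<in> V"
  and diff_V: "\<lbrakk>u \<in> V; v \<in> V\<rbrakk> \<Longrightarrow> u - v \<in> V"
  and zero_V: "0 \<in> V"
  and sum_V: "(\<And>i. i \<in> I \<Longrightarrow> f i \<in> V) \<Longrightarrow> sum f I \<in> V"
  using subV by (auto simp: subspace_add subspace_scale subspace_diff subspace_0 subspace_sum)

lemma B_add_right: "\<lbrakk>u \<in> V; v \<in> V; w \<in> V\<rbrakk> \<Longrightarrow> B w (u + v) = B w u + B w v"
  using B_add B_sym add_V by metis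

lemma B_scale_right: "\<lbrakk>u \<in> V; w \<in> V\<rbrakk> \<Longrightarrow> B w (c *\<^sub>R u) = c * B w u"
  using B_scale B_sym scale_V by metis

lemma B_diff: "\<lbrakk>u \<in> V; v \<in> V; w \<in> V\<rbrakk> \<Longrightarrow> B (u - v) w = B u w - B v w"
  using B_add[of "u - v" v w] diff_V[of u v] by simp

lemma B_diff_right: "\<lbrakk>u \<in> V; v \<in> V; w \<in> V\<rbrakk> \<Longrightarrow> B w (u - v) = B w u - B w v"
  using B_diff B_sym diff_V by metis

lemma B_zero: "u \<in> V \<Longrightarrow> B 0 u = 0"
  using B_scale[of 0 u 0] zero_V by simp

lemma B_sum:
  assumes "\<And>i. i \<in> I \<Longrightarrow> f i \<in> V" "w \<in> V"
  shows "B (\<Sum>i\<in>I. c i *\<^sub>R f i) w = (\<Sum>i\<in>I. c i * B (f i) w)"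
  using assms
proof (induction I rule: infinite_finite_induct)
  case (insert x F)
  then show ?case
    by (simp add: B_add B_scale scale_V sum_V)
qed (auto simp: B_zero)

lemma B_sum_right:
  assumes "\<And>i. i \<in> I \<Longrightarrow> f i \<in> V" "w \<in> V"
  shows "B w (\<Sum>i\<in>I. c i *\<^sub>R f i) = (\<Sum>i\<in>I. c i * B w (f i))"
proof -
  have "B w (\<Sum>i\<in>I. c i *\<^sub>R f i) = B (\<Sum>i\<in>I. c i *\<^sub>R f i) w"
    using assms by (intro B_sym sum_V scale_V) auto
  also have "\<dots> = (\<Sum>i\<in>I. c i * B w (f i))"
    using assms by (subst B_sum) (auto intro!: sum.cong simp: B_sym)
  finally show ?thesis .
qed

lemmas B_simps = B_add B_add_right B_scale B_scale_right B_diff B_diff_right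
  add_V scale_V diff_V zero_V

text \<open>This is the first-order condition at a minimum. For nonzero \<open>a\<close>, the choice
  \<open>t = - a / d\<close> with \<open>d > \<bar>b\<bar>\<close> would let the linear term win,
  with a value of at most \<open>- a\<^sup>2 / d\<close>.\<close>

lemma quadratic_nonneg_linear_zero:
  fixes a b :: real
  assumes "\<And>t. 0 \<le> 2 * t * a + t\<^sup>2 * b"
  shows "a = 0"
proof (rule ccontr)
  assume a: "a \<noteq> 0"
  define d where "d = \<bar>b\<bar> + 1"
  define t where "t = - a / d"
  have d: "d > 0" by (simp add: d_def)
  have "2 * t * a + t\<^sup>2 * b \<le> 2 * t * a + t\<^sup>2 * d"
    by (intro add_left_mono mult_left_mono) (auto simp: d_def)
  also have "\<dots> = - a\<^sup>2 / d"
    using d by (simp add: t_def power2_eq_square field_simps)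
  also have "\<dots> < 0"
    using a d by simp
  finally show False
    using assms[of t] by simp
qed

lemma B_residual_orth:
  assumes "finite I" "\<And>i. i \<in> I \<Longrightarrow> f i \<in> V"
    "\<And>i j. \<lbrakk>i \<in> I; j \<in> I\<rbrakk> \<Longrightarrow> B (f i) (f j) = (if i = j then 1 else 0)" "u \<in> V" "i \<in> I"
  shows "B (f i) (u - (\<Sum>j\<in>I. B (f j) u *\<^sub>R f j)) = 0"
proof -
  have "(\<Sum>j\<in>I. B (f j) u *\<^sub>R f j) \<in> V"
    using assms by (intro sum_V scale_V)
  then have "B (f i) (u - (\<Sum>j\<in>I. B (f j) u *\<^sub>R f j)) = B (f i) u - (\<Sum>j\<in>I. B (f j) u * B (f i) (f j))"
    using assms by (simp add: B_diff_right B_sum_right)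
  also have "(\<Sum>j\<in>I. B (f j) u * B (f i) (f j)) = (\<Sum>j\<in>I. if i = j then B (f j) u else 0)"
    using assms by (intro sum.cong) auto
  also have "\<dots> = B (f i) u"
    using assms by simp
  finally show ?thesis by simp
qed

lemma B_residual_norm:
  assumes "finite I" "\<And>i. i \<in> I \<Longrightarrow> f i \<in> V"
    "\<And>i j. \<lbrakk>i \<in> I; j \<in> I\<rbrakk> \<Longrightarrow> B (f i) (f j) = (if i = j then 1 else 0)" "u \<in> V"
  defines "g \<equiv> u - (\<Sum>j\<in>I. B (f j) u *\<^sub>R f j)"
  shows "B g g = B u u - (\<Sum>j\<in>I. (B (f j) u)\<^sup>2)"
proof -
  have S: "(\<Sum>j\<in>I. B (f j) u *\<^sub>R f j) \<in> V"
    using assms by (intro sum_V scale_V)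
  then have gV: "g \<in> V"
    using assms by (simp add: diff_V)
  have "B g g = B u g - (\<Sum>j\<in>I. B (f j) u * B (f j) g)"
    unfolding g_def[of] using assms S gV[unfolded g_def]
    by (subst B_diff) (auto simp: B_sum)
  also have "(\<Sum>j\<in>I. B (f j) u * B (f j) g) = 0"
    unfolding g_def using B_residual_orth[OF assms(1-4)] by (intro sum.neutral) auto
  also have "B u g = B u u - (\<Sum>j\<in>I. B (f j) u * B u (f j))"
    unfolding g_def using assms S by (simp add: B_diff_right B_sum_right)
  also have "(\<Sum>j\<in>I. B (f j) u * B u (f j)) = (\<Sum>j\<in>I. (B (f j) u)\<^sup>2)"
    using assms B_sym by (intro sum.cong) (auto simp: power2_eq_square)
  finally show ?thesis by simp
qed

lemma bessel:
  assumes "finite I" "\<And>i. i \<in> I \<Longrightarrow> f i \<in> V"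
    "\<And>i j. \<lbrakk>i \<in> I; j \<in> I\<rbrakk> \<Longrightarrow> B (f i) (f j) = (if i = j then 1 else 0)" "u \<in> V"
  shows "(\<Sum>j\<in>I. (B (f j) u)\<^sup>2) \<le> B u u"
proof -
  have "0 \<le> B (u - (\<Sum>j\<in>I. B (f j) u *\<^sub>R f j)) (u - (\<Sum>j\<in>I. B (f j) u *\<^sub>R f j))"
    using assms by (intro B_nonneg diff_V sum_V scale_V)
  then show ?thesis
    using B_residual_norm[OF assms] by simp
qed

end

text \<open>\<open>A\<close> stands for the form shifted by a multiple of \<open>B\<close>, so that
  it dominates \<open>B\<close>. \<open>complete\<close> is the closedness of the form.
  \<open>compact\<close> asks only for a \<open>B\<close>-Cauchy subsequence; the limit is supplied
  by \<open>complete\<close>. \<open>infinite_dim\<close> keeps the successive minimisation from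
  stopping.\<close>

locale compact_form =
  B: semi_inner V B + A: semi_inner V A for V :: "'v::real_vector set" and B A +
  assumes A_ge_B: "u \<in> V \<Longrightarrow> B u u \<le> A u u"
    and complete: "\<And>u. \<lbrakk>\<And>n::nat. u n \<in> V;
        \<And>e. e > 0 \<Longrightarrow> \<exists>N. \<forall>i\<ge>N. \<forall>j\<ge>N. A (u i - u j) (u i - u j) < e\<rbrakk>
      \<Longrightarrow> \<exists>w\<in>V. (\<lambda>n. A (u n - w) (u n - w)) \<longlonglongrightarrow> 0"
    and compact: "\<And>u C. \<lbrakk>\<And>n::nat. u n \<in> V; \<And>n. A (u n) (u n) \<le> C\<rbrakk>
      \<Longrightarrow> \<exists>r. strict_mono (r::nat\<Rightarrow>nat) \<and>
        (\<forall>e>0. \<exists>N. \<forall>i\<ge>N. \<forall>j\<ge>N. B (u (r i) - u (r j)) (u (r i) - u (r j)) < e)"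
    and infinite_dim: "\<And>n. \<exists>f. (\<forall>i<n. f i \<in> V) \<and>
        (\<forall>i<n. \<forall>j<n. B (f i) (f j) = (if i = (j::nat) then 1 else 0))"
begin

text \<open>Convergence in \<open>A\<close> implies convergence in \<open>B\<close>, which is
  dominated by it, so one argument for a generic form \<open>D\<close> serves both.\<close>

lemma A_limit:
  assumes "\<And>n::nat. u n \<in> V" "w \<in> V" "v \<in> V" "(\<lambda>n. A (u n - w) (u n - w)) \<longlonglongrightarrow> 0"
  shows "(\<lambda>n. A (u n) v) \<longlonglongrightarrow> A w v" "(\<lambda>n. B (u n) v) \<longlonglongrightarrow> B w v"
    "(\<lambda>n. A (u n) (u n)) \<longlonglongrightarrow> A w w" "(\<lambda>n. B (u n) (u n)) \<longlonglongrightarrow> B w w"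
proof -
  have cs: "(\<lambda>n. D (u n) v) \<longlonglongrightarrow> D w v"
    if D: "semi_inner V D" and lim: "(\<lambda>n. D (u n - w) (u n - w)) \<longlonglongrightarrow> 0" and v: "v \<in> V" for D v
  proof -
    interpret D: semi_inner V D by (rule D)
    \<comment> \<open>Cauchy-Schwarz in additive form, with a weight \<open>t\<close> that can be
      chosen small against \<open>D v v\<close>.\<close>
    have key: "\<bar>D (u n) v - D w v\<bar> \<le> t * D v v + D (u n - w) (u n - w) / t" if "t > 0" for t n
    proof -
      have x: "u n - w \<in> V" using assms by (simp add: D.diff_V)
      have "0 \<le> D ((1/t) *\<^sub>R (u n - w) + v) ((1/t) *\<^sub>R (u n - w) + v)"
        "0 \<le> D ((1/t) *\<^sub>R (u n - w) - v) ((1/t) *\<^sub>R (u n - w) - v)"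
        using x v by (auto intro!: D.B_nonneg D.diff_V[OF D.scale_V] D.add_V[OF D.scale_V])
      then have *: "0 \<le> (1/t)^2 * D (u n - w) (u n - w) + 2 * ((1/t) * D (u n - w) v) + D v v"
         "0 \<le> (1/t)^2 * D (u n - w) (u n - w) - 2 * ((1/t) * D (u n - w) v) + D v v"
        using x v D.B_sym[OF x v] by (simp_all only: D.B_simps power2_eq_square) (simp_all add: algebra_simps)
      have "\<bar>2 * ((1/t) * D (u n - w) v)\<bar> \<le> (1/t)^2 * D (u n - w) (u n - w) + D v v"
        using * by linarith
      then have "t * \<bar>2 * ((1/t) * D (u n - w) v)\<bar> \<le> t * ((1/t)^2 * D (u n - w) (u n - w) + D v v)"
        using that by (intro mult_left_mono) auto
      then have "2 * \<bar>D (u n - w) v\<bar> \<le> D (u n - w) (u n - w) / t + t * D v v"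
        using that by (simp add: abs_mult power2_eq_square algebra_simps)
      then show ?thesis
        using D.B_diff[OF assms(1) assms(2) v, of n] by linarith
    qed
    show ?thesis
    proof (rule LIMSEQ_I)
      fix e :: real assume e: "e > 0"
      define t where "t = e / (2 * (D v v + 1))"
      have "0 \<le> D v v" using v by (simp add: D.B_nonneg)
      then have t: "t > 0" "t * D v v < e / 2"
        using e by (auto simp: t_def divide_simps algebra_simps)
      have "eventually (\<lambda>n. D (u n - w) (u n - w) < t * e / 2) sequentially"
        using lim t e by (intro order_tendstoD(2)) auto
      then obtain n0 where n0: "\<And>n. n \<ge> n0 \<Longrightarrow> D (u n - w) (u n - w) < t * e / 2"
        by (auto simp: eventually_sequentially)
      show "\<exists>no. \<forall>n\<ge>no. norm (D (u n) v - D w v) < e"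
      proof (intro exI allI impI)
        fix n assume "n \<ge> n0"
        then have "D (u n - w) (u n - w) / t < e / 2"
          using n0[of n] t by (simp add: divide_simps mult.commute)
        then show "norm (D (u n) v - D w v) < e"
          using key[OF t(1), of n] t(2) unfolding real_norm_def by linarith
      qed
    qed
  qed
  have sq: "(\<lambda>n. D (u n) (u n)) \<longlonglongrightarrow> D w w"
    if D: "semi_inner V D" and lim: "(\<lambda>n. D (u n - w) (u n - w)) \<longlonglongrightarrow> 0" for D
  proof -
    interpret D: semi_inner V D by (rule D)
    have "(\<lambda>n. D (u n - w) (u n - w) + 2 * D (u n) w - D w w) \<longlonglongrightarrow> 0 + 2 * D w w - D w w"
      using cs[OF D lim assms(2)] lim by (intro tendsto_intros)
    moreover have "D (u n - w) (u n - w) + 2 * D (u n) w - D w w = D (u n) (u n)" for n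
      using D.B_sym[OF assms(2) assms(1)[of n]] D.B_diff[OF assms(1)[of n] assms(2) D.diff_V[OF assms(1)[of n] assms(2)]]
        D.B_diff_right[OF assms(1)[of n] assms(2) assms(1)[of n]] D.B_diff_right[OF assms(1)[of n] assms(2) assms(2)]
      by linarith
    ultimately show ?thesis by simp
  qed
  have limB: "(\<lambda>n. B (u n - w) (u n - w)) \<longlonglongrightarrow> 0"
    using assms by (intro tendsto_sandwich[OF _ _ tendsto_const assms(4)])
      (auto intro!: always_eventually B.B_nonneg A_ge_B B.diff_V)
  show "(\<lambda>n. A (u n) v) \<longlonglongrightarrow> A w v" "(\<lambda>n. B (u n) v) \<longlonglongrightarrow> B w v"
    using cs[OF A.semi_inner_axioms assms(4)] cs[OF B.semi_inner_axioms limB] assms by auto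
  show "(\<lambda>n. A (u n) (u n)) \<longlonglongrightarrow> A w w" "(\<lambda>n. B (u n) (u n)) \<longlonglongrightarrow> B w w"
    using sq[OF A.semi_inner_axioms assms(4)] sq[OF B.semi_inner_axioms limB] by auto
qed

section \<open>Eigenvectors by successive minimisation\<close>

definition orth :: "'v set \<Rightarrow> 'v set" where
  "orth S = {v \<in> V. \<forall>s\<in>S. B s v = 0}"

text \<open>Minimality is put in homogeneous form, so that vectors with \<open>B v v = 0\<close> are
  no exception and no normalisation of \<open>v\<close> intervenes.\<close>

definition minimizer :: "'v set \<Rightarrow> 'v \<Rightarrow> bool" where
  "minimizer S u \<longleftrightarrow> u \<in> orth S \<and> B u u = 1 \<and> (\<forall>v\<in>orth S. A u u * B v v \<le> A v v)"

lemma orth_subspace: "S \<subseteq> V \<Longrightarrow> subspace (orth S)"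
  using B.B_scale_right[of 0 _ 0]
  unfolding subspace_def orth_def by (auto simp: B.B_simps subset_iff)

lemma minimizer_exists:
  assumes S: "S \<subseteq> V" and v0: "v0 \<in> orth S" "B v0 v0 > 0"
  shows "\<exists>u. minimizer S u"
proof -
  have sub: "subspace (orth S)" using orth_subspace[OF S] .
  have oV: "orth S \<subseteq> V" by (auto simp: orth_def)
  define U where "U = {A u u | u. u \<in> orth S \<and> B u u = 1}"
  define c where "c = Inf U"
  have bdd: "bdd_below U"
    unfolding U_def using A.B_nonneg oV by (intro bdd_belowI[of _ 0]) auto
  define v1 where "v1 = (1 / sqrt (B v0 v0)) *\<^sub>R v0"
  have v1: "v1 \<in> orth S" "B v1 v1 = 1"
    using v0 sub oV unfolding v1_def
    by (auto simp: subspace_scale B.B_simps subset_iff)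
  then have U_ne: "U \<noteq> {}"
    unfolding U_def by auto
  have c_le: "c * B v v \<le> A v v" if v: "v \<in> orth S" for v
  proof (cases "B v v = 0")
    case True
    then show ?thesis using v oV A.B_nonneg by auto
  next
    case False
    with v oV have pos: "B v v > 0" using B.B_nonneg[of v] by auto
    have vV: "v \<in> V" using v oV by auto
    define v' where "v' = (1 / sqrt (B v v)) *\<^sub>R v"
    have "v' \<in> orth S" "B v' v' = 1"
      using v pos sub vV unfolding v'_def
      by (auto simp: subspace_scale B.B_simps)
    then have "c \<le> A v' v'"
      unfolding c_def U_def by (intro cInf_lower bdd[unfolded U_def]) auto
    also have "A v' v' = A v v / B v v"
      using pos vV unfolding v'_def by (simp add: A.B_simps)
    finally show ?thesis using pos by (simp add: divide_simps)
  qed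
  have "\<exists>u. u \<in> orth S \<and> B u u = 1 \<and> A u u < c + 1 / real (Suc n)" for n
    using cInf_lessD[OF U_ne, of "c + 1 / real (Suc n)"] by (auto simp: c_def U_def)
  then obtain u where u: "\<And>n. u n \<in> orth S" "\<And>n. B (u n) (u n) = 1"
      "\<And>n::nat. A (u n) (u n) < c + 1 / real (Suc n)"
    by metis
  have uV: "u n \<in> V" for n using u(1) oV by auto
  have "A (u n) (u n) \<le> c + 1" for n
    using u(3)[of n] by (rule order_trans[OF less_imp_le]) simp
  from compact[OF uV this] obtain r where "strict_mono (r::nat\<Rightarrow>nat) \<and>
    (\<forall>e>0. \<exists>N. \<forall>i\<ge>N. \<forall>j\<ge>N. B (u (r i) - u (r j)) (u (r i) - u (r j)) < e)"
    by (rule exE)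
  then have r: "strict_mono r"
    and cau: "\<And>e. e > 0 \<Longrightarrow> \<exists>N. \<forall>i\<ge>N. \<forall>j\<ge>N. B (u (r i) - u (r j)) (u (r i) - u (r j)) < e"
    by simp_all
  have c0: "c \<ge> 0"
    unfolding c_def using U_ne A.B_nonneg oV by (intro cInf_greatest) (auto simp: U_def)
  have Acau: "\<exists>N. \<forall>i\<ge>N. \<forall>j\<ge>N. A (u (r i) - u (r j)) (u (r i) - u (r j)) < e" if e: "e > 0" for e
  proof -
    \<comment> \<open>The error has two halves. Energies within \<open>e / 8\<close> of the infimum
      give \<open>e / 2\<close> through the parallelogram identity; the threshold chosen here bounds
      \<open>c\<close> times the \<open>B\<close>-distance by the other half. The \<open>+ 1\<close>
      covers \<open>c = 0\<close>.\<close>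
    obtain N1 where N1: "\<And>i j. \<lbrakk>i \<ge> N1; j \<ge> N1\<rbrakk> \<Longrightarrow>
        B (u (r i) - u (r j)) (u (r i) - u (r j)) < e / (2 * (c + 1))"
      using cau[of "e / (2 * (c + 1))"] e c0 by auto
    obtain N2 :: nat where N2: "1 / real (Suc N2) < e / 8"
      using reals_Archimedean[of "e / 8"] e by (auto simp: inverse_eq_divide)
    show ?thesis
    proof (intro exI[of _ "max N1 N2"] allI impI)
      fix i j assume ij: "i \<ge> max N1 N2" "j \<ge> max N1 N2"
      have bnd: "A (u (r k)) (u (r k)) < c + e / 8" if "k \<ge> N2" for k
      proof -
        have "N2 \<le> r k" using that seq_suble[OF r, of k] by simp
        then have "1 / real (Suc (r k)) \<le> 1 / real (Suc N2)"
          by (intro divide_left_mono) auto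
        then show ?thesis using u(3)[of "r k"] N2 by linarith
      qed
      let ?x = "u (r i)" and ?y = "u (r j)"
      have xy: "?x \<in> V" "?y \<in> V" using uV by auto
      have par: "D (?x - ?y) (?x - ?y) = 2 * D ?x ?x + 2 * D ?y ?y - D (?x + ?y) (?x + ?y)"
        if "semi_inner V D" for D
      proof -
        interpret D: semi_inner V D by (rule that)
        show ?thesis using xy by (simp add: D.B_simps)
      qed
      have "c * B (?x + ?y) (?x + ?y) \<le> A (?x + ?y) (?x + ?y)"
        using u(1) sub by (intro c_le subspace_add)
      then have "A (?x - ?y) (?x - ?y) \<le> 2 * A ?x ?x + 2 * A ?y ?y - c * B (?x + ?y) (?x + ?y)"
        using par[OF A.semi_inner_axioms] by simp
      also have "B (?x + ?y) (?x + ?y) = 4 - B (?x - ?y) (?x - ?y)"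
        using par[OF B.semi_inner_axioms] u(2) by simp
      also have "2 * A ?x ?x + 2 * A ?y ?y - c * (4 - B (?x - ?y) (?x - ?y))
          < e / 2 + c * B (?x - ?y) (?x - ?y)"
        using bnd[of i] bnd[of j] ij by (simp add: algebra_simps)
      also have "c * B (?x - ?y) (?x - ?y) \<le> (c + 1) * B (?x - ?y) (?x - ?y)"
        using xy B.B_nonneg[of "?x - ?y"] by (simp add: B.diff_V algebra_simps)
      also have "\<dots> < (c + 1) * (e / (2 * (c + 1)))"
        using N1 ij c0 by (intro mult_strict_left_mono) auto
      also have "\<dots> = e / 2" using c0 by (simp add: field_simps)
      finally show "A (?x - ?y) (?x - ?y) < e" by simp
    qed
  qed
  obtain w where w: "w \<in> V" "(\<lambda>n. A (u (r n) - w) (u (r n) - w)) \<longlonglongrightarrow> 0"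
    using complete[of "\<lambda>n. u (r n)"] uV Acau by blast
  have lims: "(\<lambda>n. B (u (r n)) v) \<longlonglongrightarrow> B w v" if "v \<in> V" for v
    using A_limit(2)[OF _ w(1) that w(2)] uV by auto
  have w_orth: "w \<in> orth S"
  proof -
    have "B s w = 0" if s: "s \<in> S" for s
    proof -
      have "B (u (r n)) s = 0" for n
        using u(1)[of "r n"] s S B.B_sym[of s "u (r n)"] uV by (auto simp: orth_def)
      then have "B w s = 0"
        using lims[of s] s S by (auto simp: LIMSEQ_const_iff)
      then show ?thesis using B.B_sym[of s w] s S w by auto
    qed
    then show ?thesis using w by (auto simp: orth_def)
  qed
  have Bw: "B w w = 1"
    using A_limit(4)[OF uV w(1,1,2)] u(2) by (simp add: LIMSEQ_const_iff)
  have "A w w \<le> c"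
  proof (rule LIMSEQ_le[OF A_limit(3)[OF uV w(1,1,2)]])
    have "(\<lambda>n. c + 1 / real (Suc n)) \<longlonglongrightarrow> c + 0"
      using LIMSEQ_inverse_real_of_nat by (intro tendsto_intros) (simp add: inverse_eq_divide)
    then show "(\<lambda>n. c + 1 / real (Suc (r n))) \<longlonglongrightarrow> c"
      using LIMSEQ_subseq_LIMSEQ[OF _ r] by (auto simp: o_def)
    show "\<exists>N. \<forall>n\<ge>N. A (u (r n)) (u (r n)) \<le> c + 1 / real (Suc (r n))"
      using u(3) less_imp_le by blast
  qed
  then have "A w w = c"
    using c_le[OF w_orth] Bw by simp
  then show ?thesis
    unfolding minimizer_def using w_orth Bw c_le by auto
qed

text \<open>A dimension count by Bessel's inequality. If every vector orthogonal to the
  \<open>f i\<close> had norm zero, each of \<open>n + 1\<close> orthonormal vectors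
  \<open>g i\<close> would have squared coefficients of sum 1. Summing over the \<open>g i\<close>
  first and using Bessel for each \<open>f j\<close> bounds the total \<open>n + 1\<close> by
  \<open>n\<close>.\<close>

lemma orth_nontrivial:
  assumes "\<And>i. i < n \<Longrightarrow> f i \<in> V"
    "\<And>i j. \<lbrakk>i < n; j < n\<rbrakk> \<Longrightarrow> B (f i) (f j) = (if i = (j::nat) then 1 else 0)"
  shows "\<exists>v\<in>orth (f ` {..<n}). B v v > 0"
proof (rule ccontr)
  assume no: "\<not> ?thesis"
  obtain g where g: "\<And>i. i < Suc n \<Longrightarrow> g i \<in> V"
    "\<And>i j. \<lbrakk>i < Suc n; j < Suc n\<rbrakk> \<Longrightarrow> B (g i) (g j) = (if i = j then 1 else 0)"
    using infinite_dim[of "Suc n"] by blast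
  have "(\<Sum>j<n. (B (f j) (g i))\<^sup>2) = 1" if i: "i < Suc n" for i
  proof -
    define v where "v = g i - (\<Sum>j\<in>{..<n}. B (f j) (g i) *\<^sub>R f j)"
    have vV: "v \<in> V" unfolding v_def using g(1)[OF i] assms(1)
      by (intro B.diff_V B.sum_V B.scale_V) auto
    then have "v \<in> orth (f ` {..<n})"
      unfolding orth_def v_def
      using B.B_residual_orth[of "{..<n}" f "g i"] assms g(1)[OF i] by auto
    then have "B v v = 0"
      using no B.B_nonneg[OF vV] by force
    moreover have "B v v = B (g i) (g i) - (\<Sum>j<n. (B (f j) (g i))\<^sup>2)"
      unfolding v_def using assms g(1)[OF i] by (intro B.B_residual_norm) auto
    ultimately show ?thesis using g(2)[OF i i] by simp
  qed
  then have "real (Suc n) = (\<Sum>i<Suc n. \<Sum>j<n. (B (f j) (g i))\<^sup>2)"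
    by simp
  also have "\<dots> = (\<Sum>j<n. \<Sum>i<Suc n. (B (f j) (g i))\<^sup>2)"
    by (rule sum.swap)
  also have "\<dots> \<le> (\<Sum>j<n. 1)"
  proof (rule sum_mono)
    fix j assume j: "j \<in> {..<n}"
    have "(\<Sum>i<Suc n. (B (f j) (g i))\<^sup>2) = (\<Sum>i<Suc n. (B (g i) (f j))\<^sup>2)"
      using assms(1) g(1) j by (intro sum.cong refl) (simp add: B.B_sym)
    also have "\<dots> \<le> B (f j) (f j)"
      using g assms(1) j by (intro B.bessel) auto
    also have "\<dots> = 1" using assms(2) j by simp
    finally show "(\<Sum>i<Suc n. (B (f j) (g i))\<^sup>2) \<le> 1" .
  qed
  finally show False by simp
qed

text \<open>The next vector depends on the set of all its predecessors. Recursion on that set makes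
  the definition primitive recursive, and \<open>eigvec\<close> reads off the vector added at each
  stage.\<close>

primrec eigvecs :: "nat \<Rightarrow> 'v set" where
  "eigvecs 0 = {}"
| "eigvecs (Suc n) = insert (SOME u. minimizer (eigvecs n) u) (eigvecs n)"

definition eigvec :: "nat \<Rightarrow> 'v" where
  "eigvec n = (SOME u. minimizer (eigvecs n) u)"

definition eigval :: "nat \<Rightarrow> real" where
  "eigval n = A (eigvec n) (eigvec n)"

lemma eigvecs_eq: "eigvecs n = eigvec ` {..<n}"
  by (induction n) (auto simp: eigvec_def lessThan_Suc)

lemma eigvec_minimizer: "minimizer (eigvec ` {..<n}) (eigvec n)"
proof (induction n rule: less_induct)
  case (less n)
  have V: "eigvec i \<in> V" if "i < n" for i
    using less[OF that] by (auto simp: minimizer_def orth_def)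
  have lt: "B (eigvec i) (eigvec j) = 0" if "i < j" "j < n" for i j
    using less[OF that(2)] that(1) by (auto simp: minimizer_def orth_def)
  have "B (eigvec i) (eigvec j) = (if i = j then 1 else 0)" if "i < n" "j < n" for i j
  proof (cases i j rule: linorder_cases)
    case equal
    then show ?thesis using less that by (auto simp: minimizer_def)
  next
    case greater
    then show ?thesis using lt[of j i] that B.B_sym[of "eigvec i" "eigvec j"] V by auto
  qed (use lt that in auto)
  from orth_nontrivial[of n eigvec, OF V this]
  obtain v where "v \<in> orth (eigvec ` {..<n})" "B v v > 0" by auto
  then have "\<exists>u. minimizer (eigvecs n) u"
    using V unfolding eigvecs_eq by (intro minimizer_exists) auto
  then have "minimizer (eigvecs n) (eigvec n)"
    unfolding eigvec_def by (rule someI_ex)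
  then show ?case by (simp add: eigvecs_eq)
qed

lemma eigvec_V: "eigvec n \<in> V"
  using eigvec_minimizer[of n] by (auto simp: minimizer_def orth_def)

lemma eigvec_orthonormal: "B (eigvec i) (eigvec j) = (if i = j then 1 else 0)"
proof -
  have lt: "B (eigvec i) (eigvec j) = 0" if "i < j" for i j
    using eigvec_minimizer[of j] that by (auto simp: minimizer_def orth_def)
  show ?thesis
  proof (cases i j rule: linorder_cases)
    case equal
    then show ?thesis using eigvec_minimizer[of j] by (auto simp: minimizer_def)
  next
    case greater
    then show ?thesis using lt[of j i] B.B_sym[of "eigvec i" "eigvec j"] eigvec_V by auto
  qed (use lt in auto)
qed

lemma eigval_le: "v \<in> orth (eigvec ` {..<n}) \<Longrightarrow> eigval n * B v v \<le> A v v"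
  using eigvec_minimizer[of n] by (auto simp: minimizer_def eigval_def)

lemma eigval_mono: "i \<le> j \<Longrightarrow> eigval i \<le> eigval j"
proof -
  assume "i \<le> j"
  then have "eigvec j \<in> orth (eigvec ` {..<i})"
    using eigvec_V eigvec_orthonormal by (auto simp: orth_def)
  then show ?thesis
    using eigval_le[of "eigvec j" i] eigvec_orthonormal[of j j] by (simp add: eigval_def)
qed

lemma residual_orth:
  assumes "v \<in> V"
  shows "v - (\<Sum>j<n. B (eigvec j) v *\<^sub>R eigvec j) \<in> orth (eigvec ` {..<n})"
  unfolding orth_def using assms eigvec_V eigvec_orthonormal
  by (auto intro!: B.diff_V B.sum_V B.scale_V B.B_residual_orth)

text \<open>For \<open>v\<close> orthogonal to the earlier eigenvectors this is the first variation
  of the minimum. On the span of the earlier eigenvectors both sides vanish, by orthogonality and by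
  the induction hypothesis combined with symmetry.\<close>

lemma eigvec_eq:
  assumes "v \<in> V"
  shows "A (eigvec n) v = eigval n * B (eigvec n) v"
  using assms
proof (induction n arbitrary: v rule: less_induct)
  case (less n)
  define v' where "v' = v - (\<Sum>j<n. B (eigvec j) v *\<^sub>R eigvec j)"
  have v': "v' \<in> orth (eigvec ` {..<n})"
    unfolding v'_def by (rule residual_orth) fact
  have o: "subspace (orth (eigvec ` {..<n}))"
    using eigvec_V by (intro orth_subspace) auto
  have en: "eigvec n \<in> orth (eigvec ` {..<n})"
    using eigvec_minimizer[of n] by (simp add: minimizer_def)
  have V: "v' \<in> V" "eigvec n \<in> V" using v' eigvec_V by (auto simp: orth_def)
  have "A (eigvec n) v' - eigval n * B (eigvec n) v' = 0"
  proof (rule B.quadratic_nonneg_linear_zero)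
    fix t :: real
    let ?x = "t *\<^sub>R v' + eigvec n"
    have "?x \<in> orth (eigvec ` {..<n})"
      using o v' en by (intro subspace_add subspace_scale)
    then have "eigval n * B ?x ?x \<le> A ?x ?x" by (rule eigval_le)
    then have "0 \<le> t\<^sup>2 * A v' v' + 2 * t * A (eigvec n) v' + eigval n
        - eigval n * (t\<^sup>2 * B v' v' + 2 * t * B (eigvec n) v' + 1)"
      using V eigvec_orthonormal[of n n] A.B_sym[of v' "eigvec n"] B.B_sym[of v' "eigvec n"]
      by (simp add: A.B_simps B.B_simps power2_eq_square eigval_def[symmetric] algebra_simps)
    then show "0 \<le> 2 * t * (A (eigvec n) v' - eigval n * B (eigvec n) v')
        + t\<^sup>2 * (A v' v' - eigval n * B v' v')"
      by (simp add: algebra_simps)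
  qed
  moreover have "v \<in> V" by fact
  have "v = v' + (\<Sum>j<n. B (eigvec j) v *\<^sub>R eigvec j)" by (simp add: v'_def)
  moreover have D: "D (eigvec n) (v' + (\<Sum>j<n. B (eigvec j) v *\<^sub>R eigvec j)) = D (eigvec n) v'"
    if "semi_inner V D" "\<And>j. j < n \<Longrightarrow> D (eigvec n) (eigvec j) = 0" for D
  proof -
    interpret D: semi_inner V D by (rule that)
    show ?thesis
      using V eigvec_V that(2) by (subst D.B_add_right) (auto simp: D.B_sum_right intro!: D.sum_V D.scale_V)
  qed
  have Bz: "B (eigvec n) (eigvec j) = 0" if "j < n" for j
    using eigvec_orthonormal[of n j] that by simp
  have Az: "A (eigvec n) (eigvec j) = 0" if "j < n" for j
    using less.IH[OF that V(2)] A.B_sym[OF eigvec_V eigvec_V, of n j]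
      eigvec_orthonormal[of j n] that by simp
  have "A (eigvec n) v = A (eigvec n) v'" "B (eigvec n) v = B (eigvec n) v'"
    using D[OF A.semi_inner_axioms Az] D[OF B.semi_inner_axioms Bz] by (simp_all add: v'_def)
  ultimately show ?case by simp
qed

text \<open>Orthonormal vectors have squared distance 2 from each other, so an orthonormal sequence
  of bounded energy has no \<open>B\<close>-Cauchy subsequence.\<close>

lemma eigval_unbounded: "filterlim eigval at_top sequentially"
proof -
  have "\<exists>n. eigval n > C" for C
  proof (rule ccontr)
    assume "\<not> ?thesis"
    then have "A (eigvec n) (eigvec n) \<le> C" for n
      by (auto simp: eigval_def not_less)
    from compact[OF eigvec_V this] obtain r where "strict_mono (r::nat\<Rightarrow>nat) \<and>
      (\<forall>e>0. \<exists>N. \<forall>i\<ge>N. \<forall>j\<ge>N.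
        B (eigvec (r i) - eigvec (r j)) (eigvec (r i) - eigvec (r j)) < e)"
      by (rule exE)
    then have r: "strict_mono r" and cau: "\<And>e. e > 0 \<Longrightarrow> \<exists>N. \<forall>i\<ge>N. \<forall>j\<ge>N.
        B (eigvec (r i) - eigvec (r j)) (eigvec (r i) - eigvec (r j)) < e"
      by simp_all
    obtain N where N: "\<And>i j. \<lbrakk>i \<ge> N; j \<ge> N\<rbrakk> \<Longrightarrow>
        B (eigvec (r i) - eigvec (r j)) (eigvec (r i) - eigvec (r j)) < 1"
      using cau[of 1] by auto
    have "r N \<noteq> r (Suc N)" using r strict_mono_eq by (metis n_not_Suc_n)
    then have "B (eigvec (r N) - eigvec (r (Suc N))) (eigvec (r N) - eigvec (r (Suc N))) = 2"
      using eigvec_V eigvec_orthonormal by (simp add: B.B_simps)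
    then show False using N[of N "Suc N"] by simp
  qed
  then show ?thesis
    unfolding filterlim_at_top eventually_sequentially
    by (meson eigval_mono less_imp_le order_trans)
qed

text \<open>The variational principle behind the lower bound. Split \<open>f\<close> into its
  projection to the first \<open>n\<close> eigenvectors and a residual \<open>g\<close>. Neither
  form has cross terms, and \<open>g\<close> contributes at most zero because \<open>A g g\<close>
  is at least \<open>eigval n\<close> times \<open>B g g\<close>. Since \<open>n\<close> is finite,
  no convergence of eigenfunction expansions enters.\<close>

lemma residual_form_le:
  assumes f: "f \<in> V" and n: "\<And>k. k \<ge> n \<Longrightarrow> t \<le> eigval k"
  shows "t * B f f - A f f \<le> (\<Sum>k<n. max 0 (t - eigval k) * (B (eigvec k) f)\<^sup>2)"
proof -
  define s where "s = (\<Sum>j<n. B (eigvec j) f *\<^sub>R eigvec j)"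
  define g where "g = f - s"
  have g: "g \<in> orth (eigvec ` {..<n})"
    unfolding g_def s_def by (rule residual_orth) fact
  have V: "s \<in> V" "g \<in> V"
    using g eigvec_V by (auto simp: orth_def s_def intro!: B.sum_V B.scale_V)
  have Bg: "B g g = B f f - (\<Sum>j<n. (B (eigvec j) f)\<^sup>2)"
    unfolding g_def s_def using f eigvec_V eigvec_orthonormal by (intro B.B_residual_norm) auto
  have Asv: "A s v = (\<Sum>j<n. eigval j * B (eigvec j) f * B (eigvec j) v)" if "v \<in> V" for v
    unfolding s_def using eigvec_V that by (subst A.B_sum) (auto simp: eigvec_eq algebra_simps)
  have Asg: "A s g = 0"
    using Asv[OF V(2)] g by (auto simp: orth_def)
  have "A f f = A s f + A g f"
    unfolding g_def using f V(1) by (simp add: A.B_simps)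
  also have "A g f = A g g"
    using Asg V A.B_sym[of s g] f unfolding g_def by (simp add: A.B_simps)
  finally have Af: "A f f = (\<Sum>j<n. eigval j * (B (eigvec j) f)\<^sup>2) + A g g"
    using Asv[OF f] by (simp add: power2_eq_square mult.assoc)
  have "t * B g g \<le> eigval n * B g g"
    using n[of n] V B.B_nonneg by (intro mult_right_mono) auto
  also have "\<dots> \<le> A g g" using g by (rule eigval_le)
  finally have "t * B f f - A f f \<le> (\<Sum>k<n. (t - eigval k) * (B (eigvec k) f)\<^sup>2)"
    using Af Bg by (simp add: algebra_simps sum_subtractf sum_distrib_left)
  also have "\<dots> \<le> (\<Sum>k<n. max 0 (t - eigval k) * (B (eigvec k) f)\<^sup>2)"
    by (intro sum_mono mult_right_mono) auto
  finally show ?thesis .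
qed

text \<open>The minimisation misses no eigenvector. Eigenvectors for different eigenvalues are
  orthogonal, so the residual \<open>g\<close> is orthogonal to every \<open>eigvec k\<close>. Then
  \<open>eigval k * B g g \<le> A g g\<close> for all \<open>k\<close>, and the unboundedness of the
  eigenvalues forces \<open>B g g = 0\<close>.\<close>

lemma eigenvector_expansion:
  assumes u: "u \<in> V" and eig: "\<And>v. v \<in> V \<Longrightarrow> A u v = \<mu> * B u v"
  defines "K \<equiv> {k. eigval k = \<mu>}"
  defines "g \<equiv> u - (\<Sum>k\<in>K. B (eigvec k) u *\<^sub>R eigvec k)"
  shows "finite K" "B g g = 0"
proof -
  obtain n where n: "\<And>k. k \<ge> n \<Longrightarrow> eigval k > \<mu>"
    using eigval_unbounded unfolding filterlim_at_top_dense eventually_sequentially by blast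
  then have "K \<subseteq> {..<n}" unfolding K_def by (force simp: not_less[symmetric])
  then show K: "finite K" using finite_subset by blast
  have z: "B (eigvec k) u = 0" if "k \<notin> K" for k
  proof -
    have "eigval k * B (eigvec k) u = A u (eigvec k)"
      using eigvec_eq[OF u, of k] A.B_sym[OF u eigvec_V[of k]] by simp
    also have "\<dots> = \<mu> * B (eigvec k) u"
      using eig[OF eigvec_V[of k]] B.B_sym[OF u eigvec_V[of k]] by simp
    finally show ?thesis using that by (auto simp: K_def)
  qed
  have gV: "g \<in> V"
    unfolding g_def using u eigvec_V by (intro B.diff_V B.sum_V B.scale_V)
  have "B (eigvec k) g = 0" for k
  proof (cases "k \<in> K")
    case True
    then show ?thesis unfolding g_def
      using K u eigvec_V eigvec_orthonormal by (intro B.B_residual_orth) auto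
  next
    case False
    have "(\<Sum>j\<in>K. B (eigvec j) u * B (eigvec k) (eigvec j)) = 0"
      using False eigvec_orthonormal by (intro sum.neutral) auto
    then show ?thesis unfolding g_def
      using z[OF False] u eigvec_V
      by (subst B.B_diff_right) (auto simp: B.B_sum_right intro!: B.sum_V B.scale_V)
  qed
  then have "g \<in> orth (eigvec ` {..<k})" for k
    using gV by (auto simp: orth_def)
  then have le: "eigval k * B g g \<le> A g g" for k
    by (rule eigval_le)
  show "B g g = 0"
  proof (rule ccontr)
    assume "B g g \<noteq> 0"
    then have pos: "B g g > 0" using B.B_nonneg[OF gV] by simp
    obtain k where "eigval k > A g g / B g g"
      using eigval_unbounded unfolding filterlim_at_top_dense eventually_sequentially by blast
    then show False using le[of k] pos by (simp add: divide_simps)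
  qed
qed

end

subsection \<open>Uniqueness of the enumerated eigenvalues\<close>

text \<open>Inserting one expansion into the other expands \<open>b i\<close> in the
  \<open>b k\<close>. By independence the coefficients are Kronecker deltas; the diagonal ones are
  all that a comparison of traces takes.\<close>

lemma ae_basis_change_diag:
  fixes b b' :: "nat \<Rightarrow> 'a::euclidean_space \<Rightarrow> real"
  assumes indep: "\<And>c. (AE x in lborel. (\<Sum>i<d. c i * b i x) = 0) \<Longrightarrow> (\<forall>i<d. c i = 0)"
    and M: "\<And>i. i < d \<Longrightarrow> AE x in lborel. b i x = (\<Sum>j<e. M i j * b' j x)"
    and N: "\<And>j. j < e \<Longrightarrow> AE x in lborel. b' j x = (\<Sum>i<d. N j i * b i x)"
    and i: "i < d"
  shows "(\<Sum>j<e. M i j * N j i) = 1"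
proof -
  have "AE x in lborel. \<forall>j\<in>{..<e}. b' j x = (\<Sum>i<d. N j i * b i x)"
    by (rule AE_finite_allI) (use N in auto)
  with M[OF i] have "AE x in lborel. (\<Sum>k<d. ((\<Sum>j<e. M i j * N j k) - (if k = i then 1 else 0)) * b k x) = 0"
  proof eventually_elim
    case (elim x)
    have "b i x = (\<Sum>j<e. M i j * (\<Sum>k<d. N j k * b k x))"
      using elim by simp
    also have "\<dots> = (\<Sum>j<e. \<Sum>k<d. M i j * N j k * b k x)"
      by (simp add: sum_distrib_left mult.assoc)
    also have "\<dots> = (\<Sum>k<d. \<Sum>j<e. M i j * N j k * b k x)"
      by (rule sum.swap)
    also have "\<dots> = (\<Sum>k<d. (\<Sum>j<e. M i j * N j k) * b k x)"
      by (simp add: sum_distrib_right)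
    finally have *: "b i x = (\<Sum>k<d. (\<Sum>j<e. M i j * N j k) * b k x)" .
    have "(\<Sum>k<d. (if k = i then 1 else 0) * b k x) = (\<Sum>k<d. if k = i then b k x else 0)"
      by (intro sum.cong) auto
    also have "\<dots> = b i x" using i by simp
    finally have "(\<Sum>k<d. (if k = i then 1 else 0) * b k x) = b i x" .
    with * show ?case
      unfolding left_diff_distrib sum_subtractf by linarith
  qed
  from indep[OF this] i show ?thesis by force
qed

text \<open>With mutually inverse base changes \<open>M\<close> and \<open>N\<close>, \<open>d = tr (M N) = tr (N M) = e\<close>.\<close>
lemma has_dim_ae_unique:
  fixes E :: "('a::euclidean_space \<Rightarrow> real) set"
  assumes "has_dim_ae E d" "has_dim_ae E e"
  shows "d = e"
proof -
  obtain b where b: "\<And>i. i < d \<Longrightarrow> b i \<in> E"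
    "\<And>c. (AE x in lborel. (\<Sum>i<d. c i * b i x) = 0) \<Longrightarrow> (\<forall>i<d. c i = 0)"
    "\<And>u. u \<in> E \<Longrightarrow> \<exists>c. AE x in lborel. u x = (\<Sum>i<d. c i * b i x)"
    using assms(1) unfolding has_dim_ae_def by blast
  obtain b' where b': "\<And>i. i < e \<Longrightarrow> b' i \<in> E"
    "\<And>c. (AE x in lborel. (\<Sum>i<e. c i * b' i x) = 0) \<Longrightarrow> (\<forall>i<e. c i = 0)"
    "\<And>u. u \<in> E \<Longrightarrow> \<exists>c. AE x in lborel. u x = (\<Sum>i<e. c i * b' i x)"
    using assms(2) unfolding has_dim_ae_def by blast
  have "\<forall>i. \<exists>c. i < d \<longrightarrow> (AE x in lborel. b i x = (\<Sum>j<e. c j * b' j x))"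
    using b(1) b'(3) by blast
  then obtain M where M: "\<And>i. i < d \<Longrightarrow> AE x in lborel. b i x = (\<Sum>j<e. M i j * b' j x)"
    by metis
  have "\<forall>j. \<exists>c. j < e \<longrightarrow> (AE x in lborel. b' j x = (\<Sum>i<d. c i * b i x))"
    using b'(1) b(3) by blast
  then obtain N where N: "\<And>j. j < e \<Longrightarrow> AE x in lborel. b' j x = (\<Sum>i<d. N j i * b i x)"
    by metis
  have "real d = (\<Sum>i<d. \<Sum>j<e. M i j * N j i)"
    using ae_basis_change_diag[OF b(2) M N] by simp
  also have "\<dots> = (\<Sum>j<e. \<Sum>i<d. N j i * M i j)"
    by (subst sum.swap) (simp add: mult.commute)
  also have "\<dots> = real e"
    using ae_basis_change_diag[OF b'(2) N M] by simp
  finally show ?thesis by simp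
qed

lemma finite_level_set:
  fixes f :: "nat \<Rightarrow> real"
  assumes "filterlim f at_top sequentially"
  shows "finite {k. f k \<le> t}"
proof -
  obtain n where "\<And>k. k \<ge> n \<Longrightarrow> f k > t"
    using assms unfolding filterlim_at_top_dense eventually_sequentially by blast
  then have "{k. f k \<le> t} \<subseteq> {..<n}" by (force simp: not_less[symmetric])
  then show ?thesis using finite_subset by blast
qed

text \<open>Let \<open>k\<close> be the first index of disagreement, say with
  \<open>f k < g k\<close>. By monotonicity \<open>g\<close> takes the value \<open>f k\<close> only
  at indices below \<open>k\<close>, where it agrees with \<open>f\<close>; but \<open>f\<close>
  takes it at \<open>k\<close> as well, so the cardinalities differ.\<close>

lemma incseq_eq_of_card_level_sets:
  fixes f g :: "nat \<Rightarrow> real"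
  assumes f: "incseq f" "filterlim f at_top sequentially"
    and g: "incseq g" "filterlim g at_top sequentially"
    and card: "\<And>t. card {k. f k = t} = card {k. g k = t}"
  shows "f = g"
proof -
  have less_False: False
    if f: "incseq f" "filterlim f at_top sequentially" and g: "incseq g"
      and card: "\<And>t. card {k. f k = t} = card {k. g k = t}"
      and eq: "\<And>j. j < k \<Longrightarrow> f j = g j" and lt: "f k < g k" for f g :: "nat \<Rightarrow> real" and k
  proof -
    have "{j. g j = f k} \<subseteq> {j. f j = f k} - {k}"
    proof
      fix j assume j: "j \<in> {j. g j = f k}"
      then have "j < k"
        using incseqD[OF g, of k j] lt by (auto simp: not_less[symmetric])
      then show "j \<in> {j. f j = f k} - {k}" using eq j by auto
    qed
    moreover have fin: "finite {j. f j = f k}"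
      by (rule finite_subset[OF _ finite_level_set[OF f(2), of "f k"]]) auto
    ultimately have "card {j. g j = f k} \<le> card ({j. f j = f k} - {k})"
      by (intro card_mono) auto
    also have "\<dots> < card {j. f j = f k}"
      using fin by (intro psubset_card_mono) auto
    finally show False using card by simp
  qed
  have "f k = g k" for k
  proof (induction k rule: less_induct)
    case (less k)
    have eq: "\<And>j. j < k \<Longrightarrow> f j = g j" "\<And>j. j < k \<Longrightarrow> g j = f j"
      using less.IH by auto
    show ?case
      using less_False[OF f g(1) card eq(1)] less_False[OF g f(1) card[symmetric] eq(2)]
      by (meson linorder_neqE_linordered_idom)
  qed
  then show ?thesis by auto
qed

lemma eigenvalue_enumeration_unique:
  assumes "eigenvalue_enumeration m \<Omega> f" "eigenvalue_enumeration m \<Omega> g"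
  shows "f = g"
  using assms has_dim_ae_unique unfolding eigenvalue_enumeration_def
  by (intro incseq_eq_of_card_level_sets) blast+

lemma dirichlet_eigenvalue_eqI:
  "eigenvalue_enumeration m \<Omega> f \<Longrightarrow> dirichlet_eigenvalue m \<Omega> = f"
  unfolding dirichlet_eigenvalue_def by (rule the_equality) (auto intro: eigenvalue_enumeration_unique)

subsection \<open>Plancherel's theorem for functions of bounded support\<close>

lemma lborel_integral_affine_euclidean:
  fixes f :: "'a::euclidean_space \<Rightarrow> 'b::{banach, second_countable_topology}"
  assumes [measurable]: "f \<in> borel_measurable borel" and c: "c \<noteq> 0"
  shows "(LINT x|lborel. f x) = \<bar>c\<bar> ^ DIM('a) *\<^sub>R (LINT x|lborel. f (t + c *\<^sub>R x))"
proof -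
  have "(LINT x|lborel. f x) =
      (LINT x|density (distr lborel borel (\<lambda>x. t + c *\<^sub>R x)) (\<lambda>_. ennreal (\<bar>c\<bar> ^ DIM('a))). f x)"
    using lborel_affine[OF c, of t] by (simp add: ennreal_power)
  also have "\<dots> = (LINT x|distr lborel borel (\<lambda>x. t + c *\<^sub>R x). \<bar>c\<bar> ^ DIM('a) *\<^sub>R f x)"
    by (subst integral_density) auto
  also have "\<dots> = (LINT x|lborel. \<bar>c\<bar> ^ DIM('a) *\<^sub>R f (t + c *\<^sub>R x))"
    by (subst integral_distr) auto
  finally show ?thesis by simp
qed

lemma lborel_integrable_affine_euclidean:
  fixes f :: "'a::euclidean_space \<Rightarrow> 'b::{banach, second_countable_topology}"
  assumes f: "integrable lborel f" and c: "c \<noteq> 0"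
  shows "integrable lborel (\<lambda>x. f (t + c *\<^sub>R x))"
proof -
  have [measurable]: "f \<in> borel_measurable borel" using f by auto
  have "integrable (density (distr lborel borel (\<lambda>x. t + c *\<^sub>R x)) (\<lambda>_. ennreal (\<bar>c\<bar> ^ DIM('a)))) f"
    using lborel_affine[OF c, of t] f by (simp add: ennreal_power)
  then have "integrable (distr lborel borel (\<lambda>x. t + c *\<^sub>R x)) (\<lambda>x. \<bar>c\<bar> ^ DIM('a) *\<^sub>R f x)"
    by (subst (asm) integrable_density) auto
  then have "integrable lborel (\<lambda>x. \<bar>c\<bar> ^ DIM('a) *\<^sub>R f (t + c *\<^sub>R x))"
    by (subst (asm) integrable_distr_eq) auto
  from integrable_scaleR_right[OF this, of "inverse (\<bar>c\<bar> ^ DIM('a))"]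
  show ?thesis using c by simp
qed

text \<open>This is the characteristic function of the standard normal distribution, freed from its
  normalisation.\<close>

lemma
  fixes t :: real
  shows integrable_gauss_iexp:
      "integrable lborel (\<lambda>s::real. complex_of_real (exp (- s\<^sup>2 / 2)) * iexp (t * s))" (is ?A)
    and integral_gauss_iexp:
      "(LINT s|lborel. complex_of_real (exp (- s\<^sup>2 / 2)) * iexp (t * s)) =
        complex_of_real (sqrt (2 * pi) * exp (- t\<^sup>2 / 2))" (is ?B)
proof -
  have eq: "complex_of_real (exp (- s\<^sup>2 / 2)) * iexp (t * s) =
      complex_of_real (sqrt (2 * pi)) * (std_normal_density s *\<^sub>R iexp (t * s))" for s :: real
    by (simp add: std_normal_density_def scaleR_conv_of_real)
  have "integrable lborel (\<lambda>s. std_normal_density s *\<^sub>R iexp (t * s))"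
    by (rule Bochner_Integration.integrable_bound[where f=std_normal_density])
       (auto simp: normal_density_nonneg integrable_normal_density)
  then show ?A unfolding eq by (rule integrable_mult_right)
  have "char std_normal_distribution t = (LINT s|lborel. std_normal_density s *\<^sub>R iexp (t * s))"
    unfolding char_def by (subst integral_density) (auto simp: normal_density_nonneg)
  then have "(LINT s|lborel. std_normal_density s *\<^sub>R iexp (t * s)) = complex_of_real (exp (- t\<^sup>2 / 2))"
    by (simp add: char_std_normal_distribution)
  then show ?B unfolding eq by (simp only: integral_mult_right_zero of_real_mult)
qed

lemma norm_sq_eq_sum_Basis: "(norm (x::'a::euclidean_space))\<^sup>2 = (\<Sum>b\<in>Basis. (x \<bullet> b)\<^sup>2)"
  unfolding power2_norm_eq_inner by (subst euclidean_inner) (simp add: power2_eq_square)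

text \<open>The Gaussian and the plane wave both factor over the coordinates, so the integral is a
  product of one-dimensional ones.\<close>

lemma
  fixes z :: "'a::euclidean_space"
  shows integrable_gauss_iexp_euclidean:
      "integrable lborel (\<lambda>x::'a. complex_of_real (exp (- (norm x)\<^sup>2 / 2)) * iexp (x \<bullet> z))" (is ?A)
    and integral_gauss_iexp_euclidean:
      "(LINT x::'a|lborel. complex_of_real (exp (- (norm x)\<^sup>2 / 2)) * iexp (x \<bullet> z)) =
        complex_of_real (sqrt (2 * pi) ^ DIM('a) * exp (- (norm z)\<^sup>2 / 2))" (is ?B)
proof -
  interpret product_sigma_finite "\<lambda>_::'a. lborel :: real measure" ..
  define h where "h = (\<lambda>(b::'a) (s::real). complex_of_real (exp (- s\<^sup>2 / 2)) * iexp ((z \<bullet> b) * s))"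
  have eq: "complex_of_real (exp (- (norm x)\<^sup>2 / 2)) * iexp (x \<bullet> z) = (\<Prod>b\<in>Basis. h b (x \<bullet> b))"
    for x :: 'a
  proof -
    have "(\<Prod>b\<in>Basis. h b (x \<bullet> b)) =
        exp (\<Sum>b\<in>Basis. complex_of_real (- (x \<bullet> b)\<^sup>2 / 2) + \<i> * complex_of_real ((z \<bullet> b) * (x \<bullet> b)))"
      unfolding h_def exp_sum[OF finite_Basis] by (simp only: exp_add exp_of_real)
    also have "(\<Sum>b\<in>Basis. complex_of_real (- (x \<bullet> b)\<^sup>2 / 2) + \<i> * complex_of_real ((z \<bullet> b) * (x \<bullet> b)))
        = complex_of_real (- (norm x)\<^sup>2 / 2) + \<i> * complex_of_real (x \<bullet> z)"
      unfolding norm_sq_eq_sum_Basis euclidean_inner[of x z]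
      by (simp add: sum.distrib sum_negf sum_subtractf sum_divide_distrib sum_distrib_left mult.commute)
    finally show ?thesis by (simp only: exp_add exp_of_real)
  qed
  have T: "(\<lambda>f. \<Sum>b\<in>Basis. f b *\<^sub>R b) \<in> (\<Pi>\<^sub>M b\<in>(Basis::'a set). lborel) \<rightarrow>\<^sub>M borel"
    by measurable
  have coord: "(\<Sum>b\<in>Basis. f b *\<^sub>R b) \<bullet> c = f c" if "c \<in> Basis" for f :: "'a \<Rightarrow> real" and c
    using that by simp
  have hm: "(\<lambda>x::'a. \<Prod>b\<in>Basis. h b (x \<bullet> b)) \<in> borel_measurable borel"
    unfolding h_def by measurable
  have pc: "(\<Prod>c\<in>Basis. h c ((\<Sum>b\<in>Basis. f b *\<^sub>R b) \<bullet> c)) = (\<Prod>c\<in>Basis. h c (f c))" for f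
    by (intro prod.cong refl) (simp add: coord)
  have hint: "integrable lborel (h b)" for b
    unfolding h_def by (rule integrable_gauss_iexp)
  have "integrable (\<Pi>\<^sub>M b\<in>(Basis::'a set). lborel) (\<lambda>f. \<Prod>b\<in>Basis. h b (f b))"
    using hint by (intro product_integrable_prod) auto
  then have "integrable (distr (\<Pi>\<^sub>M b\<in>(Basis::'a set). lborel) borel (\<lambda>f. \<Sum>b\<in>Basis. f b *\<^sub>R b))
      (\<lambda>x. \<Prod>b\<in>Basis. h b (x \<bullet> b))"
    by (subst integrable_distr_eq[OF T hm]) (simp add: pc)
  then show ?A unfolding eq by (subst lborel_eq)
  have "(LINT x|lborel. (\<Prod>b\<in>Basis. h b (x \<bullet> b))) =
      (LINT x|distr (\<Pi>\<^sub>M b\<in>(Basis::'a set). lborel) borel (\<lambda>f. \<Sum>b\<in>Basis. f b *\<^sub>R b). (\<Prod>b\<in>Basis. h b (x \<bullet> b)))"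
    by (subst lborel_eq) simp
  also have "\<dots> = (LINT f|(\<Pi>\<^sub>M b\<in>(Basis::'a set). lborel). (\<Prod>b\<in>Basis. h b (f b)))"
    by (subst integral_distr[OF T hm]) (simp add: pc)
  also have "\<dots> = (\<Prod>b\<in>Basis. LINT s|lborel. h b s)"
    using hint by (intro product_integral_prod) auto
  also have "\<dots> = (\<Prod>b\<in>Basis. complex_of_real (sqrt (2 * pi) * exp (- (z \<bullet> b)\<^sup>2 / 2)))"
    unfolding h_def integral_gauss_iexp by simp
  also have "\<dots> = complex_of_real (sqrt (2 * pi) ^ DIM('a) * exp (\<Sum>b\<in>Basis. - (z \<bullet> b)\<^sup>2 / 2))"
    by (simp add: prod.distrib exp_sum)
  also have "(\<Sum>b\<in>Basis. - (z \<bullet> b)\<^sup>2 / 2) = - (norm z)\<^sup>2 / 2"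
    unfolding norm_sq_eq_sum_Basis by (simp add: sum_negf sum_divide_distrib)
  finally show ?B unfolding eq .
qed

lemma
  fixes z :: "'a::euclidean_space"
  assumes s: "s > 0"
  shows integrable_gauss_cos:
      "integrable lborel (\<lambda>x::'a. exp (- s\<^sup>2 * (norm x)\<^sup>2 / 2) * cos (x \<bullet> z))" (is ?A)
    and integral_gauss_cos:
      "(LINT x::'a|lborel. exp (- s\<^sup>2 * (norm x)\<^sup>2 / 2) * cos (x \<bullet> z)) =
        (sqrt (2 * pi) / s) ^ DIM('a) * exp (- (norm z)\<^sup>2 / (2 * s\<^sup>2))" (is ?B)
proof -
  have I: "integrable lborel (\<lambda>x::'a. exp (- (norm x)\<^sup>2 / 2) * cos (x \<bullet> w))" for w :: 'a
    using integrable_Re[OF integrable_gauss_iexp_euclidean[of w]] by (simp add: Re_exp)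
  have B1: "(LINT x::'a|lborel. exp (- (norm x)\<^sup>2 / 2) * cos (x \<bullet> w)) =
      sqrt (2 * pi) ^ DIM('a) * exp (- (norm w)\<^sup>2 / 2)" for w :: 'a
    using arg_cong[OF integral_gauss_iexp_euclidean[of w], of Re]
    by (subst (asm) integral_Re[symmetric, OF integrable_gauss_iexp_euclidean]) (simp add: Re_exp)
  have eq: "(\<lambda>x::'a. exp (- s\<^sup>2 * (norm x)\<^sup>2 / 2) * cos (x \<bullet> z)) =
      (\<lambda>x. exp (- (norm (0 + s *\<^sub>R x))\<^sup>2 / 2) * cos ((0 + s *\<^sub>R x) \<bullet> (z /\<^sub>R s)))"
  proof -
    have a: "(0 + s *\<^sub>R x) \<bullet> (z /\<^sub>R s) = x \<bullet> z" for x
      using s by simp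
    show ?thesis unfolding a by (simp add: power_mult_distrib)
  qed
  show ?A unfolding eq
    by (rule lborel_integrable_affine_euclidean[OF I]) (use s in auto)
  have "s ^ DIM('a) * (LINT x::'a|lborel. exp (- s\<^sup>2 * (norm x)\<^sup>2 / 2) * cos (x \<bullet> z)) =
      sqrt (2 * pi) ^ DIM('a) * exp (- (norm (z /\<^sub>R s))\<^sup>2 / 2)"
    unfolding eq B1[symmetric]
    by (subst lborel_integral_affine_euclidean[of _ s 0]) (use s in auto)
  moreover have "(norm (z /\<^sub>R s))\<^sup>2 / 2 = (norm z)\<^sup>2 / (2 * s\<^sup>2)"
    using s by (simp add: power_mult_distrib divide_simps)
  ultimately show ?B
    using s by (simp add: power_divide field_simps)
qed

section \<open>Plancherel's identity with a Gaussian factor\<close>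

lemma integrable_lborel_prod_mult:
  fixes f :: "'a::euclidean_space \<Rightarrow> real" and g :: "'b::euclidean_space \<Rightarrow> real"
  assumes f: "integrable lborel f" and g: "integrable lborel g"
  shows "integrable (lborel \<Otimes>\<^sub>M lborel) (\<lambda>p. f (fst p) * g (snd p))"
proof (rule lborel_pair.Fubini_integrable)
  have [measurable]: "f \<in> borel_measurable borel" "g \<in> borel_measurable borel"
    using f g by auto
  show "(\<lambda>p. f (fst p) * g (snd p)) \<in> borel_measurable (lborel \<Otimes>\<^sub>M lborel)"
    by measurable
  show "integrable lborel (\<lambda>x. LINT y|lborel. norm (f (fst (x, y)) * g (snd (x, y))))"
    using f g by (simp add: abs_mult)
  show "AE x in lborel. integrable lborel (\<lambda>y. f (fst (x, y)) * g (snd (x, y)))"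
    using g by simp
qed

lemma fourier_Re_Im:
  assumes u: "integrable lborel u"
  shows "Re (fourier u \<xi>) = (LINT x|lborel. cos (\<xi> \<bullet> x) * u x)"
    and "Im (fourier u \<xi>) = - (LINT x|lborel. sin (\<xi> \<bullet> x) * u x)"
    and "integrable lborel (\<lambda>x. cos (\<xi> \<bullet> x) * u x)"
    and "integrable lborel (\<lambda>x. sin (\<xi> \<bullet> x) * u x)"
    and "integrable lborel (\<lambda>x. exp (- \<i> * complex_of_real (\<xi> \<bullet> x)) * complex_of_real (u x))"
proof -
  have [measurable]: "u \<in> borel_measurable borel" using u by auto
  show I: "integrable lborel (\<lambda>x. exp (- \<i> * complex_of_real (\<xi> \<bullet> x)) * complex_of_real (u x))"
    by (rule Bochner_Integration.integrable_bound[OF u]) (auto simp: norm_mult)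
  show "Re (fourier u \<xi>) = (LINT x|lborel. cos (\<xi> \<bullet> x) * u x)"
    unfolding fourier_def by (subst integral_Re[OF I, symmetric]) (simp add: Re_exp)
  show "Im (fourier u \<xi>) = - (LINT x|lborel. sin (\<xi> \<bullet> x) * u x)"
    unfolding fourier_def by (subst integral_Im[OF I, symmetric]) (simp add: Im_exp)
  show "integrable lborel (\<lambda>x. cos (\<xi> \<bullet> x) * u x)" "integrable lborel (\<lambda>x. sin (\<xi> \<bullet> x) * u x)"
    by (rule Bochner_Integration.integrable_bound[OF u], auto simp: abs_mult mult_left_le_one_le)+
qed

lemma measurable_fourier [measurable]:
  assumes [measurable]: "u \<in> borel_measurable borel"
  shows "fourier u \<in> borel_measurable borel"
  unfolding fourier_def[abs_def] by measurable

lemma cmod_fourier_le: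
  assumes u: "integrable lborel u"
  shows "cmod (fourier u \<xi>) \<le> (LINT x|lborel. \<bar>u x\<bar>)"
proof -
  have "cmod (fourier u \<xi>) \<le>
      (LINT x|lborel. cmod (exp (- \<i> * complex_of_real (\<xi> \<bullet> x)) * complex_of_real (u x)))"
    unfolding fourier_def by (rule integral_norm_bound)
  also have "\<dots> = (LINT x|lborel. \<bar>u x\<bar>)"
    by (simp add: norm_mult)
  finally show ?thesis .
qed

lemma fourier_lincomb:
  assumes u: "integrable lborel u" and v: "integrable lborel v"
  shows "fourier (\<lambda>x. a * u x + b * v x) \<xi> = a * fourier u \<xi> + b * fourier v \<xi>"
proof -
  note I = fourier_Re_Im(5)[OF u, of \<xi>] fourier_Re_Im(5)[OF v, of \<xi>]
  have "fourier (\<lambda>x. a * u x + b * v x) \<xi> =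
     (LINT x|lborel. complex_of_real a * (exp (- \<i> * complex_of_real (\<xi> \<bullet> x)) * complex_of_real (u x))
       + complex_of_real b * (exp (- \<i> * complex_of_real (\<xi> \<bullet> x)) * complex_of_real (v x)))"
    unfolding fourier_def by (simp add: algebra_simps)
  also have "\<dots> = a * fourier u \<xi> + b * fourier v \<xi>"
    unfolding fourier_def using I by simp
  finally show ?thesis .
qed

lemma fourier_diff:
  "integrable lborel u \<Longrightarrow> integrable lborel v \<Longrightarrow> fourier (\<lambda>x. u x - v x) \<xi> = fourier u \<xi> - fourier v \<xi>"
  using fourier_lincomb[of u v 1 "-1"] by simp

lemma fourier_minus_arg: "integrable lborel u \<Longrightarrow> fourier u (- \<xi>) = cnj (fourier u \<xi>)"
  by (simp add: complex_eq_iff fourier_Re_Im)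

text \<open>The Fourier transform of \<open>exp (- s\<^sup>2 * (norm x)\<^sup>2 / 2)\<close>. Its
  mass is (2 pi)^N for every \<open>s\<close>, so for small \<open>s\<close> it is (2 pi)^N times an
  approximate identity.\<close>

definition gauss_kernel :: "real \<Rightarrow> 'a::euclidean_space \<Rightarrow> real" where
  "gauss_kernel s z = (sqrt (2 * pi) / s) ^ DIM('a) * exp (- (norm z)\<^sup>2 / (2 * s\<^sup>2))"

lemma gauss_kernel_nonneg: "s > 0 \<Longrightarrow> 0 \<le> gauss_kernel s z"
  by (simp add: gauss_kernel_def)

lemma gauss_kernel_le: "s > 0 \<Longrightarrow> gauss_kernel s (z::'a::euclidean_space) \<le> (sqrt (2 * pi) / s) ^ DIM('a)"
  by (auto simp: gauss_kernel_def intro!: mult_left_le)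

lemma measurable_gauss_kernel [measurable]: "gauss_kernel s \<in> borel_measurable borel"
  unfolding gauss_kernel_def[abs_def] by measurable

lemma gauss_kernel_sym: "gauss_kernel s (x - y) = gauss_kernel s (y - x)"
  by (simp add: gauss_kernel_def norm_minus_commute)

lemma
  fixes x :: "'a::euclidean_space"
  assumes s: "s > 0" and [measurable]: "v \<in> borel_measurable borel" and v: "\<And>x. \<bar>v x\<bar> \<le> M"
  shows integral_gauss_kernel:
      "(LINT y|lborel. gauss_kernel s (x - y) * v y) =
        sqrt (2 * pi) ^ DIM('a) * (LINT z|lborel. exp (- (norm z)\<^sup>2 / 2) * v (x + s *\<^sub>R z))" (is ?A)
    and integrable_gauss_kernel: "integrable lborel (\<lambda>y. gauss_kernel s (x - y) * v y)" (is ?B)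
proof -
  have "(LINT y|lborel. gauss_kernel s (x - y) * v y) =
      s ^ DIM('a) * (LINT z|lborel. gauss_kernel s (x - (x + s *\<^sub>R z)) * v (x + s *\<^sub>R z))"
    by (subst lborel_integral_affine_euclidean[of _ s x]) (use s in auto)
  also have "(LINT z|lborel. gauss_kernel s (x - (x + s *\<^sub>R z)) * v (x + s *\<^sub>R z)) =
     (LINT z|lborel. (sqrt (2 * pi) / s) ^ DIM('a) * (exp (- (norm z)\<^sup>2 / 2) * v (x + s *\<^sub>R z)))"
    using s by (intro Bochner_Integration.integral_cong refl) (simp add: gauss_kernel_def power_mult_distrib)
  finally show ?A using s by (simp add: power_divide)
  have g: "integrable lborel (\<lambda>z::'a. exp (- (norm z)\<^sup>2 / 2))"
    using integrable_gauss_cos[of 1 0] by simp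
  have "integrable lborel (\<lambda>y::'a. exp (- (norm (- x /\<^sub>R s + (1/s) *\<^sub>R y))\<^sup>2 / 2))"
    by (rule lborel_integrable_affine_euclidean[OF g]) (use s in auto)
  moreover have "norm (- x /\<^sub>R s + (1/s) *\<^sub>R y) = norm (x - y) / s" for y
  proof -
    have "- x /\<^sub>R s + (1/s) *\<^sub>R y = (1/s) *\<^sub>R (y - x)"
      using s by (simp add: algebra_simps divide_inverse)
    then show ?thesis using s by (simp add: norm_minus_commute)
  qed
  ultimately have "integrable lborel (\<lambda>y. gauss_kernel s (x - y))"
    unfolding gauss_kernel_def using s by (simp add: power_divide mult.commute)
  then have "integrable lborel (\<lambda>y. M * gauss_kernel s (x - y))" by simp
  then show ?B
  proof (rule Bochner_Integration.integrable_bound)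
    have "norm (gauss_kernel s (x - y) * v y) \<le> norm (M * gauss_kernel s (x - y))" for y
      using v[of y] gauss_kernel_nonneg[OF s, of "x - y"] by (auto simp: abs_mult mult.commute intro!: mult_right_mono)
    then show "AE y in lborel. norm (gauss_kernel s (x - y) * v y) \<le> norm (M * gauss_kernel s (x - y))"
      by simp
  qed simp
qed

lemma integral_gauss_kernel_one:
  fixes x :: "'a::euclidean_space"
  assumes s: "s > 0"
  shows "(LINT y|lborel. gauss_kernel s (x - y)) = (2 * pi) ^ DIM('a)"
proof -
  have "(LINT z::'a|lborel. exp (- (norm z)\<^sup>2 / 2)) = sqrt (2 * pi) ^ DIM('a)"
    using integral_gauss_cos[of 1 "0::'a"] by simp
  then have "(LINT y|lborel. gauss_kernel s (x - y)) = sqrt (2 * pi) ^ DIM('a) * sqrt (2 * pi) ^ DIM('a)"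
    using integral_gauss_kernel[OF s, of "\<lambda>_. 1" 1 x] by simp
  also have "\<dots> = (sqrt (2 * pi) * sqrt (2 * pi)) ^ DIM('a)"
    by (rule power_mult_distrib[symmetric])
  also have "\<dots> = (2 * pi) ^ DIM('a)" by simp
  finally show ?thesis .
qed

lemma integrable_fourier_gauss:
  fixes u :: "'a::euclidean_space \<Rightarrow> real"
  assumes u: "integrable lborel u" and s: "s > 0"
  shows "integrable lborel (\<lambda>\<xi>::'a. exp (- s\<^sup>2 * (norm \<xi>)\<^sup>2 / 2) * (cmod (fourier u \<xi>))\<^sup>2)"
proof -
  have [measurable]: "u \<in> borel_measurable borel" using u by auto
  have "integrable lborel (\<lambda>\<xi>::'a. (LINT x|lborel. \<bar>u x\<bar>)\<^sup>2 * exp (- s\<^sup>2 * (norm \<xi>)\<^sup>2 / 2))"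
    using integrable_gauss_cos[OF s, of "0::'a"] by simp
  then show ?thesis
  proof (rule Bochner_Integration.integrable_bound)
    show "AE \<xi> in lborel. norm (exp (- s\<^sup>2 * (norm (\<xi>::'a))\<^sup>2 / 2) * (cmod (fourier u \<xi>))\<^sup>2)
        \<le> norm ((LINT x|lborel. \<bar>u x\<bar>)\<^sup>2 * exp (- s\<^sup>2 * (norm \<xi>)\<^sup>2 / 2))"
      using cmod_fourier_le[OF u] by (intro AE_I2) (simp add: mult.commute power_mono)
  qed measurable
qed

text \<open>The Gaussian factor makes the triple integral absolutely convergent. By Fubini the
  integral over \<xi> may then be taken first, and it produces the kernel.\<close>

lemma fourier_gauss_eq:
  fixes u :: "'a::euclidean_space \<Rightarrow> real"
  assumes u: "integrable lborel u" and s: "s > 0"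
  shows "(LINT \<xi>|lborel. exp (- s\<^sup>2 * (norm \<xi>)\<^sup>2 / 2) * (cmod (fourier u \<xi>))\<^sup>2) =
      (LINT p|(lborel \<Otimes>\<^sub>M lborel). gauss_kernel s (fst p - snd p) * (u (fst p) * u (snd p)))" (is "?L = ?R")
proof -
  have [measurable]: "u \<in> borel_measurable borel" using u by auto
  have uu: "integrable lborel (\<lambda>p. u (fst p) * u (snd p))"
    using integrable_lborel_prod_mult[OF u u] by (simp add: lborel_prod)
  \<comment> \<open>Expanding \<open>cos (\<xi> \<bullet> (x - y))\<close> by the addition theorem
    separates the variables and leaves the squares of the real and the imaginary part.\<close>
  have sq: "(cmod (fourier u \<xi>))\<^sup>2 = (LINT p|lborel. cos (\<xi> \<bullet> (fst p - snd p)) * (u (fst p) * u (snd p)))" for \<xi>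
  proof -
    have I: "integrable (lborel \<Otimes>\<^sub>M lborel) (\<lambda>p. cos (\<xi> \<bullet> fst p) * u (fst p) * (cos (\<xi> \<bullet> snd p) * u (snd p)))"
      "integrable (lborel \<Otimes>\<^sub>M lborel) (\<lambda>p. sin (\<xi> \<bullet> fst p) * u (fst p) * (sin (\<xi> \<bullet> snd p) * u (snd p)))"
      using fourier_Re_Im(3,4)[OF u, of \<xi>] by (auto intro!: integrable_lborel_prod_mult[of "\<lambda>x. cos (\<xi> \<bullet> x) * u x" "\<lambda>x. cos (\<xi> \<bullet> x) * u x"]
          integrable_lborel_prod_mult[of "\<lambda>x. sin (\<xi> \<bullet> x) * u x" "\<lambda>x. sin (\<xi> \<bullet> x) * u x"])
    have "(LINT p|lborel. cos (\<xi> \<bullet> (fst p - snd p)) * (u (fst p) * u (snd p))) =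
      (LINT p|(lborel \<Otimes>\<^sub>M lborel). cos (\<xi> \<bullet> fst p) * u (fst p) * (cos (\<xi> \<bullet> snd p) * u (snd p))
        + sin (\<xi> \<bullet> fst p) * u (fst p) * (sin (\<xi> \<bullet> snd p) * u (snd p)))"
      unfolding lborel_prod by (intro Bochner_Integration.integral_cong refl) (simp add: inner_diff_right cos_diff algebra_simps)
    also have "\<dots> = (LINT p|(lborel \<Otimes>\<^sub>M lborel). cos (\<xi> \<bullet> fst p) * u (fst p) * (cos (\<xi> \<bullet> snd p) * u (snd p)))
        + (LINT p|(lborel \<Otimes>\<^sub>M lborel). sin (\<xi> \<bullet> fst p) * u (fst p) * (sin (\<xi> \<bullet> snd p) * u (snd p)))"
      using I by (rule Bochner_Integration.integral_add)
    also have "\<dots> = (Re (fourier u \<xi>))\<^sup>2 + (Im (fourier u \<xi>))\<^sup>2"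
      using lborel_pair.integral_fst'[OF I(1)] lborel_pair.integral_fst'[OF I(2)]
      by (simp add: fourier_Re_Im[OF u] power2_eq_square)
    finally show ?thesis by (simp add: cmod_power2)
  qed
  define g where "g = (\<lambda>\<xi>::'a. exp (- s\<^sup>2 * (norm \<xi>)\<^sup>2 / 2))"
  have g: "integrable lborel g"
    using integrable_gauss_cos[OF s, of 0] by (simp add: g_def)
  have [measurable]: "g \<in> borel_measurable borel" by (simp add: g_def)
  let ?F = "\<lambda>(\<xi>, p). g \<xi> * (cos (\<xi> \<bullet> (fst p - snd p)) * (u (fst p) * u (snd p)))"
  have "?F \<in> borel_measurable (lborel \<Otimes>\<^sub>M (lborel \<Otimes>\<^sub>M lborel))"
    by measurable
  then have Fm: "?F \<in> borel_measurable (lborel \<Otimes>\<^sub>M lborel)"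
    by (simp add: lborel_prod)
  have I: "integrable (lborel \<Otimes>\<^sub>M lborel) ?F"
    by (rule Bochner_Integration.integrable_bound[OF integrable_lborel_prod_mult[OF g uu] Fm])
       (auto simp: abs_mult split_beta' intro!: mult_left_mono mult_left_le_one_le)
  have "?L = (LINT \<xi>|lborel. LINT p|lborel. ?F (\<xi>, p))"
    by (simp add: sq g_def)
  also have "\<dots> = (LINT p|lborel. LINT \<xi>|lborel. ?F (\<xi>, p))"
    using lborel_pair.Fubini_integral[of "\<lambda>\<xi> p. ?F (\<xi>, p)"] I by (simp add: split_beta')
  also have "\<dots> = (LINT p|lborel. gauss_kernel s (fst p - snd p) * (u (fst p) * u (snd p)))"
  proof (intro Bochner_Integration.integral_cong refl)
    fix p :: "'a \<times> 'a"
    have "(LINT \<xi>|lborel. ?F (\<xi>, p)) =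
        (LINT \<xi>|lborel. (u (fst p) * u (snd p)) * (g \<xi> * cos (\<xi> \<bullet> (fst p - snd p))))"
      by (simp add: algebra_simps)
    then show "(LINT \<xi>|lborel. ?F (\<xi>, p)) = gauss_kernel s (fst p - snd p) * (u (fst p) * u (snd p))"
      using integral_gauss_cos[OF s, of "fst p - snd p"] by (simp add: g_def gauss_kernel_def)
  qed
  finally show ?thesis by (simp add: lborel_prod)
qed

text \<open>Schur's test: bound the product of the two values of \<open>u\<close> by half the sum of
  their squares, and use that the kernel has the same mass in either variable.\<close>

lemma fourier_gauss_le:
  fixes u :: "'a::euclidean_space \<Rightarrow> real"
  assumes u: "integrable lborel u" and u2: "integrable lborel (\<lambda>x. (u x)\<^sup>2)" and s: "s > 0"
  shows "(LINT \<xi>|lborel. exp (- s\<^sup>2 * (norm \<xi>)\<^sup>2 / 2) * (cmod (fourier u \<xi>))\<^sup>2)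
    \<le> (2 * pi) ^ DIM('a) * (LINT x|lborel. (u x)\<^sup>2)"
proof -
  have [measurable]: "u \<in> borel_measurable borel" using u by auto
  let ?K = "\<lambda>p. gauss_kernel s (fst p - snd p :: 'a)"
  have k: "integrable lborel (\<lambda>y. gauss_kernel s (x - y))" for x :: 'a
    using integrable_gauss_kernel[OF s, of "\<lambda>_. 1" 1] by simp
  have I1: "integrable (lborel \<Otimes>\<^sub>M lborel) (\<lambda>p. ?K p * (u (fst p))\<^sup>2)"
  proof (rule lborel_pair.Fubini_integrable)
    show "integrable lborel (\<lambda>x. LINT y|lborel. norm (?K (x, y) * (u (fst (x, y)))\<^sup>2))"
      using u2 by (simp add: abs_mult abs_of_nonneg[OF gauss_kernel_nonneg[OF s]] integral_gauss_kernel_one[OF s])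
    show "AE x in lborel. integrable lborel (\<lambda>y. ?K (x, y) * (u (fst (x, y)))\<^sup>2)"
      using k by simp
  qed measurable
  have e1: "(LINT p|(lborel \<Otimes>\<^sub>M lborel). ?K p * (u (fst p))\<^sup>2) = (2 * pi) ^ DIM('a) * (LINT x|lborel. (u x)\<^sup>2)"
    using lborel_pair.integral_fst'[OF I1] by (simp add: integral_gauss_kernel_one[OF s])
  have I2: "integrable (lborel \<Otimes>\<^sub>M lborel) (\<lambda>p. ?K p * (u (snd p))\<^sup>2)"
    using lborel_pair.integrable_product_swap[OF I1]
    by (simp add: split_beta' gauss_kernel_sym[of s "snd _"])
  have e2: "(LINT p|(lborel \<Otimes>\<^sub>M lborel). ?K p * (u (snd p))\<^sup>2) = (2 * pi) ^ DIM('a) * (LINT x|lborel. (u x)\<^sup>2)"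
    using lborel_pair.integral_product_swap[of "\<lambda>p. ?K p * (u (fst p))\<^sup>2"] e1
    by (simp add: split_beta' gauss_kernel_sym[of s "snd _"])
  have "(LINT p|(lborel \<Otimes>\<^sub>M lborel). ?K p * (u (fst p) * u (snd p)))
     \<le> (LINT p|(lborel \<Otimes>\<^sub>M lborel). (?K p * (u (fst p))\<^sup>2 + ?K p * (u (snd p))\<^sup>2) / 2)"
  proof (rule integral_mono)
    fix p :: "'a \<times> 'a"
    have "u (fst p) * u (snd p) \<le> ((u (fst p))\<^sup>2 + (u (snd p))\<^sup>2) / 2"
      using zero_le_power2[of "u (fst p) - u (snd p)"] by (simp add: power2_diff)
    from mult_left_mono[OF this gauss_kernel_nonneg[OF s, of "fst p - snd p"]]
    show "?K p * (u (fst p) * u (snd p)) \<le> (?K p * (u (fst p))\<^sup>2 + ?K p * (u (snd p))\<^sup>2) / 2"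
      by (simp add: algebra_simps)
    show "integrable (lborel \<Otimes>\<^sub>M lborel) (\<lambda>p. ?K p * (u (fst p) * u (snd p)))"
    proof (rule Bochner_Integration.integrable_bound[OF integrable_mult_right[OF integrable_lborel_prod_mult[OF u u]]])
      show "AE p in lborel \<Otimes>\<^sub>M lborel. norm (?K p * (u (fst p) * u (snd p))) \<le>
         norm ((sqrt (2 * pi) / s) ^ DIM('a) * (u (fst p) * u (snd p)))"
        using gauss_kernel_le[OF s, where 'a='a] gauss_kernel_nonneg[OF s, where 'a='a] s
        by (intro AE_I2) (auto simp: abs_mult intro!: mult_right_mono)
    qed measurable
  qed (use I1 I2 in simp)
  also have "\<dots> = (2 * pi) ^ DIM('a) * (LINT x|lborel. (u x)\<^sup>2)"
    using I1 I2 e1 e2 by simp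
  finally show ?thesis using fourier_gauss_eq[OF u s] by simp
qed

text \<open>The Gaussian weights increase to 1, so monotone convergence yields the integrability of
  the limit together with its integral.\<close>

lemma fourier_gauss_limit:
  fixes u :: "'a::euclidean_space \<Rightarrow> real"
  assumes u: "integrable lborel u" and x: "\<And>n. (LINT \<xi>|lborel. exp (- (1 / real (Suc n))\<^sup>2 * (norm \<xi>)\<^sup>2 / 2) * (cmod (fourier u \<xi>))\<^sup>2) \<le> C"
  shows "integrable lborel (\<lambda>\<xi>. (cmod (fourier u \<xi>))\<^sup>2)"
    and "(\<lambda>n. LINT \<xi>|lborel. exp (- (1 / real (Suc n))\<^sup>2 * (norm \<xi>)\<^sup>2 / 2) * (cmod (fourier u \<xi>))\<^sup>2)
      \<longlonglongrightarrow> (LINT \<xi>|lborel. (cmod (fourier u \<xi>))\<^sup>2)"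
proof -
  have [measurable]: "u \<in> borel_measurable borel" using u by auto
  let ?f = "\<lambda>n \<xi>. exp (- (1 / real (Suc n))\<^sup>2 * (norm (\<xi>::'a))\<^sup>2 / 2) * (cmod (fourier u \<xi>))\<^sup>2"
  have I: "integrable lborel (?f n)" for n
    by (rule integrable_fourier_gauss[OF u]) simp
  have mono: "mono (\<lambda>n. ?f n \<xi>)" for \<xi>
  proof (rule monoI)
    fix i j :: nat assume "i \<le> j"
    then have "(1 / real (Suc j))\<^sup>2 \<le> (1 / real (Suc i))\<^sup>2"
      by (intro power_mono divide_left_mono) auto
    then show "?f i \<xi> \<le> ?f j \<xi>"
      by (auto intro!: mult_right_mono)
  qed
  have "(\<lambda>n. LINT \<xi>|lborel. ?f n \<xi>) \<longlonglongrightarrow> (SUP n. LINT \<xi>|lborel. ?f n \<xi>)"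
    by (intro LIMSEQ_incseq_SUP bdd_aboveI2[OF x] monoI integral_mono I) (use monoD[OF mono] in blast)
  moreover have "(\<lambda>n. ?f n \<xi>) \<longlonglongrightarrow> (cmod (fourier u \<xi>))\<^sup>2" for \<xi>
  proof -
    have "(\<lambda>n. 1 / real (Suc n)) \<longlonglongrightarrow> 0"
      using LIMSEQ_inverse_real_of_nat by (simp add: inverse_eq_divide)
    then have "(\<lambda>n. ?f n \<xi>) \<longlonglongrightarrow> exp (- 0\<^sup>2 * (norm \<xi>)\<^sup>2 / 2) * (cmod (fourier u \<xi>))\<^sup>2"
      by (intro tendsto_intros) auto
    then show ?thesis by simp
  qed
  ultimately have lim: "(\<lambda>n. LINT \<xi>|lborel. ?f n \<xi>) \<longlonglongrightarrow> (SUP n. LINT \<xi>|lborel. ?f n \<xi>)"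
    "\<And>\<xi>. (\<lambda>n. ?f n \<xi>) \<longlonglongrightarrow> (cmod (fourier u \<xi>))\<^sup>2" by auto
  have m: "(\<lambda>\<xi>. (cmod (fourier u \<xi>))\<^sup>2) \<in> borel_measurable lborel"
    by measurable
  note conv = I AE_I2[OF mono] AE_I2[OF lim(2)] lim(1) m
  show "integrable lborel (\<lambda>\<xi>. (cmod (fourier u \<xi>))\<^sup>2)"
    by (rule integrable_monotone_convergence[OF conv])
  show "(\<lambda>n. LINT \<xi>|lborel. ?f n \<xi>) \<longlonglongrightarrow> (LINT \<xi>|lborel. (cmod (fourier u \<xi>))\<^sup>2)"
    using lim(1) integral_monotone_convergence[OF conv] by simp
qed

lemma plancherel_le:
  fixes u :: "'a::euclidean_space \<Rightarrow> real"
  assumes u: "integrable lborel u" and u2: "integrable lborel (\<lambda>x. (u x)\<^sup>2)"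
  shows integrable_fourier_sq: "integrable lborel (\<lambda>\<xi>. (cmod (fourier u \<xi>))\<^sup>2)"
    and "(LINT \<xi>|lborel. (cmod (fourier u \<xi>))\<^sup>2) \<le> (2 * pi) ^ DIM('a) * (LINT x|lborel. (u x)\<^sup>2)"
proof -
  have *: "(LINT \<xi>|lborel. exp (- (1 / real (Suc n))\<^sup>2 * (norm \<xi>)\<^sup>2 / 2) * (cmod (fourier u \<xi>))\<^sup>2)
      \<le> (2 * pi) ^ DIM('a) * (LINT x|lborel. (u x)\<^sup>2)" for n
    by (rule fourier_gauss_le[OF u u2]) simp
  show "integrable lborel (\<lambda>\<xi>. (cmod (fourier u \<xi>))\<^sup>2)"
    by (rule fourier_gauss_limit(1)[OF u *])
  show "(LINT \<xi>|lborel. (cmod (fourier u \<xi>))\<^sup>2) \<le> (2 * pi) ^ DIM('a) * (LINT x|lborel. (u x)\<^sup>2)"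
    using * by (intro LIMSEQ_le_const2[OF fourier_gauss_limit(2)[OF u *]]) auto
qed

text \<open>For bounded continuous \<open>v\<close> the convolution with the kernel converges
  pointwise to (2 pi)^N \<open>v\<close> and stays bounded, so dominated convergence identifies the
  limit of the double integral. Monotone convergence identifies the limit of the same quantity on
  the Fourier side.\<close>

lemma plancherel_continuous:
  fixes v :: "'a::euclidean_space \<Rightarrow> real"
  assumes v: "continuous_on UNIV v" and M: "\<And>x. \<bar>v x\<bar> \<le> M"
    and v1: "integrable lborel v" and v2: "integrable lborel (\<lambda>x. (v x)\<^sup>2)"
  shows "(LINT \<xi>|lborel. (cmod (fourier v \<xi>))\<^sup>2) = (2 * pi) ^ DIM('a) * (LINT x|lborel. (v x)\<^sup>2)"
proof -
  have [measurable]: "v \<in> borel_measurable borel" using v1 by auto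
  let ?s = "\<lambda>n. 1 / real (Suc n)"
  let ?J = "\<lambda>n x. LINT y|lborel. gauss_kernel (?s n) (x - y) * v y"
  have s: "?s n > 0" for n by simp
  have s0: "?s \<longlonglongrightarrow> 0"
    using LIMSEQ_inverse_real_of_nat by (simp add: inverse_eq_divide)
  have g: "integrable lborel (\<lambda>z::'a. exp (- (norm z)\<^sup>2 / 2))"
    "(LINT z::'a|lborel. exp (- (norm z)\<^sup>2 / 2)) = sqrt (2 * pi) ^ DIM('a)"
    using integrable_gauss_cos[of 1 0] integral_gauss_cos[of 1 "0::'a"] by simp_all
  have Jeq: "?J n x = sqrt (2 * pi) ^ DIM('a) * (LINT z|lborel. exp (- (norm z)\<^sup>2 / 2) * v (x + ?s n *\<^sub>R z))" for n x
    by (rule integral_gauss_kernel[OF s _ M]) measurable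
  have Jlim: "(\<lambda>n. ?J n x) \<longlonglongrightarrow> (2 * pi) ^ DIM('a) * v x" for x
  proof -
    have "(\<lambda>n. LINT z|lborel. exp (- (norm z)\<^sup>2 / 2) * v (x + ?s n *\<^sub>R z)) \<longlonglongrightarrow>
        (LINT z|lborel. exp (- (norm (z::'a))\<^sup>2 / 2) * v x)"
    proof (rule integral_dominated_convergence)
      show "integrable lborel (\<lambda>z::'a. exp (- (norm z)\<^sup>2 / 2) * M)" using g by simp
      show "AE z in lborel. norm (exp (- (norm z)\<^sup>2 / 2) * v (x + ?s n *\<^sub>R z)) \<le> exp (- (norm z)\<^sup>2 / 2) * M" for n
        using M by (intro AE_I2) (simp add: abs_mult)
      have "(\<lambda>n. x + ?s n *\<^sub>R z) \<longlonglongrightarrow> x + 0 *\<^sub>R z" for z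
        by (intro tendsto_intros s0)
      then have "(\<lambda>n. v (x + ?s n *\<^sub>R z)) \<longlonglongrightarrow> v (x + 0 *\<^sub>R z)" for z
        by (rule continuous_on_tendsto_compose[OF v]) auto
      then show "AE z in lborel. (\<lambda>n. exp (- (norm z)\<^sup>2 / 2) * v (x + ?s n *\<^sub>R z)) \<longlonglongrightarrow> exp (- (norm z)\<^sup>2 / 2) * v x"
        by (intro AE_I2 tendsto_intros) simp
    qed measurable
    then have "(\<lambda>n. ?J n x) \<longlonglongrightarrow> sqrt (2 * pi) ^ DIM('a) * (LINT z|lborel. exp (- (norm (z::'a))\<^sup>2 / 2) * v x)"
      unfolding Jeq by (intro tendsto_intros)
    also have "sqrt (2 * pi) ^ DIM('a) * (LINT z|lborel. exp (- (norm (z::'a))\<^sup>2 / 2) * v x) =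
        (sqrt (2 * pi) * sqrt (2 * pi)) ^ DIM('a) * v x"
      unfolding power_mult_distrib[of "sqrt (2 * pi)" "sqrt (2 * pi)"] using g by simp
    finally show ?thesis by simp
  qed
  have Jb: "\<bar>?J n x\<bar> \<le> (2 * pi) ^ DIM('a) * M" for n x
  proof -
    have k: "integrable lborel (\<lambda>y. gauss_kernel (?s n) (x - y))"
      using integrable_gauss_kernel[OF s, of "\<lambda>_. 1" 1] by simp
    have kv: "integrable lborel (\<lambda>y. gauss_kernel (?s n) (x - y) * v y)"
      by (rule integrable_gauss_kernel[OF s _ M]) measurable
    have "\<bar>?J n x\<bar> \<le> (LINT y|lborel. \<bar>gauss_kernel (?s n) (x - y) * v y\<bar>)"
      by (rule integral_abs_bound)
    also have "\<dots> \<le> (LINT y|lborel. gauss_kernel (?s n) (x - y) * M)"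
      by (intro integral_mono integrable_abs[OF kv] integrable_mult_left k)
         (simp add: abs_mult abs_of_nonneg[OF gauss_kernel_nonneg[OF s]] mult_left_mono[OF M gauss_kernel_nonneg[OF s]] del: of_nat_Suc)
    also have "\<dots> = (2 * pi) ^ DIM('a) * M"
      using integral_gauss_kernel_one[OF s, of n x] by simp
    finally show ?thesis .
  qed
  have eq: "(LINT \<xi>|lborel. exp (- (?s n)\<^sup>2 * (norm \<xi>)\<^sup>2 / 2) * (cmod (fourier v \<xi>))\<^sup>2) = (LINT x|lborel. v x * ?J n x)" for n
  proof -
    have I: "integrable (lborel \<Otimes>\<^sub>M lborel) (\<lambda>p. gauss_kernel (?s n) (fst p - snd p) * (v (fst p) * v (snd p)))"
    proof (rule Bochner_Integration.integrable_bound[OF integrable_mult_right[OF integrable_lborel_prod_mult[OF v1 v1]]])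
      show "AE p in lborel \<Otimes>\<^sub>M lborel. norm (gauss_kernel (?s n) (fst p - snd p) * (v (fst p) * v (snd p))) \<le>
         norm ((sqrt (2 * pi) / ?s n) ^ DIM('a) * (v (fst p) * v (snd p)))"
        using gauss_kernel_le[OF s, where 'a='a] gauss_kernel_nonneg[OF s, where 'a='a]
        by (intro AE_I2) (auto simp: abs_mult intro!: mult_right_mono)
    qed measurable
    have "(LINT \<xi>|lborel. exp (- (?s n)\<^sup>2 * (norm \<xi>)\<^sup>2 / 2) * (cmod (fourier v \<xi>))\<^sup>2) =
      (LINT x|lborel. LINT y|lborel. v x * (gauss_kernel (?s n) (x - y) * v y))"
      unfolding fourier_gauss_eq[OF v1 s] lborel_pair.integral_fst'[OF I, symmetric]
      by (intro Bochner_Integration.integral_cong refl) simp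
    then show ?thesis by simp
  qed
  have "(\<lambda>n. LINT x|lborel. v x * ?J n x) \<longlonglongrightarrow> (LINT x|lborel. v x * ((2 * pi) ^ DIM('a) * v x))"
  proof (rule integral_dominated_convergence)
    show "integrable lborel (\<lambda>x. \<bar>v x\<bar> * ((2 * pi) ^ DIM('a) * M))" using v1 by simp
    show "AE x in lborel. (\<lambda>n. v x * ?J n x) \<longlonglongrightarrow> v x * ((2 * pi) ^ DIM('a) * v x)"
      using Jlim by (intro AE_I2 tendsto_intros)
    show "AE x in lborel. norm (v x * ?J n x) \<le> \<bar>v x\<bar> * ((2 * pi) ^ DIM('a) * M)" for n
      using Jb by (intro AE_I2) (auto simp: abs_mult intro!: mult_left_mono)
  qed measurable
  moreover have "(\<lambda>n. LINT \<xi>|lborel. exp (- (?s n)\<^sup>2 * (norm \<xi>)\<^sup>2 / 2) * (cmod (fourier v \<xi>))\<^sup>2)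
      \<longlonglongrightarrow> (LINT \<xi>|lborel. (cmod (fourier v \<xi>))\<^sup>2)"
    by (rule fourier_gauss_limit(2)[OF v1 fourier_gauss_le[OF v1 v2 s]])
  ultimately have "(LINT \<xi>|lborel. (cmod (fourier v \<xi>))\<^sup>2) = (LINT x|lborel. v x * ((2 * pi) ^ DIM('a) * v x))"
    unfolding eq using LIMSEQ_unique by blast
  also have "(\<lambda>x. v x * ((2 * pi) ^ DIM('a) * v x)) = (\<lambda>x. (2 * pi) ^ DIM('a) * (v x)\<^sup>2)"
    by (simp add: power2_eq_square fun_eq_iff)
  finally show ?thesis by simp
qed

lemma sq_add_le:
  fixes a b d :: real
  assumes "d > 0"
  shows "(a + b)\<^sup>2 \<le> (1 + d) * a\<^sup>2 + (1 + 1 / d) * b\<^sup>2"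
proof -
  have "0 \<le> (d * a - b)\<^sup>2 / d" using assms by simp
  also have "\<dots> = d * a\<^sup>2 - 2 * a * b + b\<^sup>2 / d"
    using assms by (simp add: power2_eq_square field_simps)
  finally show ?thesis by (simp add: power2_sum algebra_simps)
qed

text \<open>Only one inequality is new. The transform of \<open>v n - u\<close> is small in
  \<open>L\<^sup>2\<close> by \<open>plancherel_le\<close>; the weighted estimate
  \<open>sq_add_le\<close>, with its weight \<open>d\<close> tending to zero at the end, takes the
  place of Minkowski's inequality.\<close>

lemma plancherel_limit:
  fixes u :: "'a::euclidean_space \<Rightarrow> real"
  assumes u: "integrable lborel u" "integrable lborel (\<lambda>x. (u x)\<^sup>2)"
    and v: "\<And>n. integrable lborel (v n)" "\<And>n. integrable lborel (\<lambda>x. (v n x)\<^sup>2)"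
    and pl: "\<And>n. (LINT \<xi>|lborel. (cmod (fourier (v n) \<xi>))\<^sup>2) = (2 * pi) ^ DIM('a) * (LINT x|lborel. (v n x)\<^sup>2)"
    and lim: "(\<lambda>n. LINT x|lborel. (v n x - u x)\<^sup>2) \<longlonglongrightarrow> 0"
      "(\<lambda>n. LINT x|lborel. (v n x)\<^sup>2) \<longlonglongrightarrow> (LINT x|lborel. (u x)\<^sup>2)"
  shows "(LINT \<xi>|lborel. (cmod (fourier u \<xi>))\<^sup>2) = (2 * pi) ^ DIM('a) * (LINT x|lborel. (u x)\<^sup>2)"
proof (rule antisym)
  show "(LINT \<xi>|lborel. (cmod (fourier u \<xi>))\<^sup>2) \<le> (2 * pi) ^ DIM('a) * (LINT x|lborel. (u x)\<^sup>2)"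
    by (rule plancherel_le[OF u])
  let ?c = "(2 * pi) ^ DIM('a)"
  have key: "?c * (LINT x|lborel. (u x)\<^sup>2) \<le> (1 + d) * (LINT \<xi>|lborel. (cmod (fourier u \<xi>))\<^sup>2)" if d: "d > 0" for d
  proof (rule LIMSEQ_le)
    show "(\<lambda>n. ?c * (LINT x|lborel. (v n x)\<^sup>2)) \<longlonglongrightarrow> ?c * (LINT x|lborel. (u x)\<^sup>2)"
      using lim by (intro tendsto_intros)
    have "(\<lambda>n. (1 + d) * (LINT \<xi>|lborel. (cmod (fourier u \<xi>))\<^sup>2) + (1 + 1 / d) * (?c * (LINT x|lborel. (v n x - u x)\<^sup>2)))
      \<longlonglongrightarrow> (1 + d) * (LINT \<xi>|lborel. (cmod (fourier u \<xi>))\<^sup>2) + (1 + 1 / d) * (?c * 0)"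
      using lim by (intro tendsto_intros)
    then show "(\<lambda>n. (1 + d) * (LINT \<xi>|lborel. (cmod (fourier u \<xi>))\<^sup>2) + (1 + 1 / d) * (?c * (LINT x|lborel. (v n x - u x)\<^sup>2)))
      \<longlonglongrightarrow> (1 + d) * (LINT \<xi>|lborel. (cmod (fourier u \<xi>))\<^sup>2)" by simp
    show "\<exists>N. \<forall>n\<ge>N. ?c * (LINT x|lborel. (v n x)\<^sup>2) \<le>
        (1 + d) * (LINT \<xi>|lborel. (cmod (fourier u \<xi>))\<^sup>2) + (1 + 1 / d) * (?c * (LINT x|lborel. (v n x - u x)\<^sup>2))"
    proof (intro exI allI impI)
      fix n :: nat
      have [measurable]: "u \<in> borel_measurable borel" "v n \<in> borel_measurable borel"
        using u(1) v(1)[of n] by auto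
      have w: "integrable lborel (\<lambda>x. v n x - u x)" using u v by auto
      have w2: "integrable lborel (\<lambda>x. (v n x - u x)\<^sup>2)"
      proof (rule Bochner_Integration.integrable_bound)
        show "integrable lborel (\<lambda>x. 2 * (v n x)\<^sup>2 + 2 * (u x)\<^sup>2)" using u v by auto
        have "(a - b)\<^sup>2 \<le> 2 * a\<^sup>2 + 2 * b\<^sup>2" for a b :: real
          using zero_le_power2[of "a + b"] unfolding power2_sum power2_diff by linarith
        then show "AE x in lborel. norm ((v n x - u x)\<^sup>2) \<le> norm (2 * (v n x)\<^sup>2 + 2 * (u x)\<^sup>2)"
          by simp
      qed measurable
      have pt: "(cmod (fourier (v n) \<xi>))\<^sup>2 \<le> (1 + d) * (cmod (fourier u \<xi>))\<^sup>2 + (1 + 1 / d) * (cmod (fourier (\<lambda>x. v n x - u x) \<xi>))\<^sup>2" for \<xi>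
      proof -
        have "fourier (v n) \<xi> = fourier u \<xi> + fourier (\<lambda>x. v n x - u x) \<xi>"
          using fourier_diff[OF v(1) u(1)] by simp
        then have "cmod (fourier (v n) \<xi>) \<le> cmod (fourier u \<xi>) + cmod (fourier (\<lambda>x. v n x - u x) \<xi>)"
          using norm_triangle_ineq by metis
        then have "(cmod (fourier (v n) \<xi>))\<^sup>2 \<le> (cmod (fourier u \<xi>) + cmod (fourier (\<lambda>x. v n x - u x) \<xi>))\<^sup>2"
          by (intro power_mono) auto
        also note sq_add_le[OF d]
        finally show ?thesis .
      qed
      have "?c * (LINT x|lborel. (v n x)\<^sup>2) = (LINT \<xi>|lborel. (cmod (fourier (v n) \<xi>))\<^sup>2)"
        using pl by simp
      also have "\<dots> \<le> (LINT \<xi>|lborel. (1 + d) * (cmod (fourier u \<xi>))\<^sup>2 + (1 + 1 / d) * (cmod (fourier (\<lambda>x. v n x - u x) \<xi>))\<^sup>2)"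
        using integrable_fourier_sq[OF v] integrable_fourier_sq[OF u] integrable_fourier_sq[OF w w2] pt
        by (intro integral_mono) auto
      also have "\<dots> = (1 + d) * (LINT \<xi>|lborel. (cmod (fourier u \<xi>))\<^sup>2) + (1 + 1 / d) * (LINT \<xi>|lborel. (cmod (fourier (\<lambda>x. v n x - u x) \<xi>))\<^sup>2)"
        using integrable_fourier_sq[OF u] integrable_fourier_sq[OF w w2] by simp
      also have "\<dots> \<le> (1 + d) * (LINT \<xi>|lborel. (cmod (fourier u \<xi>))\<^sup>2) + (1 + 1 / d) * (?c * (LINT x|lborel. (v n x - u x)\<^sup>2))"
        using plancherel_le(2)[OF w w2] d by (intro add_left_mono mult_left_mono) auto
      finally show "?c * (LINT x|lborel. (v n x)\<^sup>2) \<le>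
        (1 + d) * (LINT \<xi>|lborel. (cmod (fourier u \<xi>))\<^sup>2) + (1 + 1 / d) * (?c * (LINT x|lborel. (v n x - u x)\<^sup>2))" .
    qed
  qed
  show "?c * (LINT x|lborel. (u x)\<^sup>2) \<le> (LINT \<xi>|lborel. (cmod (fourier u \<xi>))\<^sup>2)"
  proof (rule tendsto_lowerbound)
    show "((\<lambda>d. (1 + d) * (LINT \<xi>|lborel. (cmod (fourier u \<xi>))\<^sup>2)) \<longlongrightarrow> (LINT \<xi>|lborel. (cmod (fourier u \<xi>))\<^sup>2)) (at_right 0)"
      by (auto intro!: tendsto_eq_intros)
    show "\<forall>\<^sub>F d in at_right 0. ?c * (LINT x|lborel. (u x)\<^sup>2) \<le> (1 + d) * (LINT \<xi>|lborel. (cmod (fourier u \<xi>))\<^sup>2)"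
      using key by (auto simp: eventually_at_right_less eventually_at_filter)
  qed simp
qed

lemma emeasure_lborel_cball_less_top: "emeasure lborel (cball (c::'a::euclidean_space) R) < top"
  using emeasure_bounded_finite[OF bounded_cball, of c R] by (simp add: infinity_ennreal_def)

lemma integrable_bounded_support:
  fixes f :: "'a::euclidean_space \<Rightarrow> real"
  assumes [measurable]: "f \<in> borel_measurable borel"
    and "\<And>x. \<bar>f x\<bar> \<le> M" "\<And>x. norm x > R \<Longrightarrow> f x = 0"
  shows "integrable lborel f"
proof (rule Bochner_Integration.integrable_bound)
  show "integrable lborel (\<lambda>x::'a. M * indicator (cball 0 R) x)"
    by (intro integrable_mult_right integrable_real_indicator) (auto intro!: emeasure_lborel_cball_less_top)
  have "\<bar>f x\<bar> \<le> \<bar>M * indicator (cball 0 R) x\<bar>" for x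
    using assms(2)[of x] assms(3)[of x] by (cases "norm x > R") (auto simp: indicator_def)
  then show "AE x in lborel. norm (f x) \<le> norm (M * indicator (cball 0 R) x :: real)"
    by simp
qed simp

text \<open>Measurability gives continuous functions converging to \<open>u\<close> almost
  everywhere. Clipping them at height \<open>M\<close> and multiplying by a cutoff that vanishes
  beyond radius \<open>R + 1\<close> provides a common integrable majorant, and does not change the
  limit.\<close>

lemma plancherel_bounded:
  fixes u :: "'a::euclidean_space \<Rightarrow> real"
  assumes [measurable]: "u \<in> borel_measurable borel"
    and M: "\<And>x. \<bar>u x\<bar> \<le> M" and R: "\<And>x. norm x > R \<Longrightarrow> u x = 0"
  shows "(LINT \<xi>|lborel. (cmod (fourier u \<xi>))\<^sup>2) = (2 * pi) ^ DIM('a) * (LINT x|lborel. (u x)\<^sup>2)"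
proof -
  have M0: "M \<ge> 0" using M[of 0] by simp
  have "u \<in> borel_measurable lebesgue" by (intro measurable_completion) simp
  then have "u measurable_on UNIV"
    by (rule lebesgue_measurable_imp_measurable_on_real) simp
  then obtain N g where N: "negligible N" and g: "\<And>n. continuous_on UNIV (g n)"
    and lim: "\<And>x. x \<notin> N \<Longrightarrow> (\<lambda>n. g n x) \<longlonglongrightarrow> u x"
    by (auto simp: measurable_on_def)
  define v where "v = (\<lambda>n x. max 0 (min 1 (R + 1 - norm x)) * max (- M) (min M (g n x)))"
  have vc: "continuous_on UNIV (v n)" for n
    unfolding v_def by (intro continuous_intros g)
  have [measurable]: "v n \<in> borel_measurable borel" for n
    using vc by (rule borel_measurable_continuous_onI)
  have vM: "\<bar>v n x\<bar> \<le> M" for n x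
  proof -
    have "\<bar>v n x\<bar> \<le> 1 * \<bar>max (- M) (min M (g n x))\<bar>"
      unfolding v_def abs_mult by (intro mult_right_mono) auto
    then show ?thesis using M0 by auto
  qed
  have vR: "v n x = 0" if "norm x > R + 1" for n x
    using that by (simp add: v_def)
  have uR: "u x = 0" if "norm x > R + 1" for x
    using that R[of x] by simp
  have limv: "(\<lambda>n. v n x) \<longlonglongrightarrow> u x" if "x \<notin> N" for x
  proof -
    have "(\<lambda>n. v n x) \<longlonglongrightarrow> max 0 (min 1 (R + 1 - norm x)) * max (- M) (min M (u x))"
      unfolding v_def by (intro tendsto_intros lim that)
    moreover have "max (- M) (min M (u x)) = u x" using M[of x] by auto
    moreover have "max 0 (min 1 (R + 1 - norm x)) * u x = u x"
      using R[of x] by (cases "norm x > R") auto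
    ultimately show ?thesis by simp
  qed
  have "N \<in> null_sets lebesgue" using N by (simp add: negligible_iff_null_sets)
  then have "AE x in lebesgue. x \<notin> N" by (rule AE_not_in)
  then have "AE x in lebesgue. (\<lambda>n. v n x) \<longlonglongrightarrow> u x"
    using limv by auto
  then have aelim: "AE x in lborel. (\<lambda>n. v n x) \<longlonglongrightarrow> u x"
    by (simp add: AE_completion_iff)
  have sqb: "\<bar>a\<^sup>2\<bar> \<le> M\<^sup>2" if "\<bar>a\<bar> \<le> M" for a
    using that power_mono[of "\<bar>a\<bar>" M 2] by simp
  have dom: "integrable lborel (\<lambda>x::'a. (2 * M)\<^sup>2 * indicator (cball 0 (R + 1)) x)"
    by (rule integrable_bounded_support[of _ "(2 * M)\<^sup>2" "R + 1"]) (auto simp: indicator_def)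
  show ?thesis
  proof (rule plancherel_limit)
    show "integrable lborel u"
      using M R by (intro integrable_bounded_support[of _ M R]) auto
    show "integrable lborel (\<lambda>x. (u x)\<^sup>2)"
      using sqb[OF M] R by (intro integrable_bounded_support[of _ "M\<^sup>2" R]) auto
    show v1: "integrable lborel (v n)" for n
      using vM vR by (intro integrable_bounded_support[of _ M "R + 1"]) auto
    show v2: "integrable lborel (\<lambda>x. (v n x)\<^sup>2)" for n
      using sqb[OF vM] vR by (intro integrable_bounded_support[of _ "M\<^sup>2" "R + 1"]) auto
    show "(LINT \<xi>|lborel. (cmod (fourier (v n) \<xi>))\<^sup>2) = (2 * pi) ^ DIM('a) * (LINT x|lborel. (v n x)\<^sup>2)" for n
      by (rule plancherel_continuous[OF vc vM v1 v2])
    have b: "(a - b)\<^sup>2 \<le> (2 * M)\<^sup>2" if "\<bar>a\<bar> \<le> M" "\<bar>b\<bar> \<le> M" for a b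
      using that power_mono[of "\<bar>a - b\<bar>" "2 * M" 2] by (simp add: abs_le_iff)
    have "(\<lambda>n. LINT x|lborel. (v n x - u x)\<^sup>2) \<longlonglongrightarrow> (LINT (x::'a)|lborel. (0::real))"
    proof (rule integral_dominated_convergence[OF _ _ dom])
      show "AE x in lborel. (\<lambda>n. (v n x - u x)\<^sup>2) \<longlonglongrightarrow> 0"
        using aelim by eventually_elim (auto intro!: tendsto_eq_intros)
      show "AE x in lborel. norm ((v n x - u x)\<^sup>2) \<le> (2 * M)\<^sup>2 * indicator (cball 0 (R + 1)) x" for n
        using b[OF vM M] vR uR by (intro AE_I2) (auto simp: indicator_def)
    qed measurable
    then show "(\<lambda>n. LINT x|lborel. (v n x - u x)\<^sup>2) \<longlonglongrightarrow> 0" by simp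
    show "(\<lambda>n. LINT x|lborel. (v n x)\<^sup>2) \<longlonglongrightarrow> (LINT x|lborel. (u x)\<^sup>2)"
    proof (rule integral_dominated_convergence[OF _ _ dom])
      show "AE x in lborel. (\<lambda>n. (v n x)\<^sup>2) \<longlonglongrightarrow> (u x)\<^sup>2"
        using aelim by eventually_elim (auto intro!: tendsto_eq_intros)
      show "AE x in lborel. norm ((v n x)\<^sup>2) \<le> (2 * M)\<^sup>2 * indicator (cball 0 (R + 1)) x" for n
        using b[OF vM, of 0] vR M0 by (intro AE_I2) (auto simp: indicator_def)
    qed measurable
  qed
qed

lemma integrable_of_sq_integrable:
  fixes u :: "'a::euclidean_space \<Rightarrow> real"
  assumes [measurable]: "u \<in> borel_measurable borel"
    and u2: "integrable lborel (\<lambda>x. (u x)\<^sup>2)" and R: "\<And>x. norm x > R \<Longrightarrow> u x = 0"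
  shows "integrable lborel u"
proof (rule Bochner_Integration.integrable_bound)
  show "integrable lborel (\<lambda>x::'a. indicator (cball 0 R) x + (u x)\<^sup>2)"
    using u2 by (intro Bochner_Integration.integrable_add integrable_real_indicator) (auto intro!: emeasure_lborel_cball_less_top)
  have "\<bar>a\<bar> \<le> 1 + a\<^sup>2" for a :: real
    using zero_le_power2[of "\<bar>a\<bar> - 1"] zero_le_power2[of a] unfolding power2_diff by simp
  then have "\<bar>u x\<bar> \<le> \<bar>indicator (cball 0 R) x + (u x)\<^sup>2\<bar>" for x
    using R[of x] by (cases "norm x > R") (auto simp: indicator_def)
  then show "AE x in lborel. norm (u x) \<le> norm (indicator (cball 0 R) x + (u x)\<^sup>2)"
    by simp
qed measurable

text \<open>Truncation at height \<open>n\<close> reduces to bounded functions. Both the truncations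
  and their errors are at most \<bar>u\<bar> in modulus, so the square of \<open>u\<close>
  dominates.\<close>

theorem plancherel:
  fixes u :: "'a::euclidean_space \<Rightarrow> real"
  assumes [measurable]: "u \<in> borel_measurable borel"
    and u2: "integrable lborel (\<lambda>x. (u x)\<^sup>2)" and R: "\<And>x. norm x > R \<Longrightarrow> u x = 0"
  shows "(LINT \<xi>|lborel. (cmod (fourier u \<xi>))\<^sup>2) = (2 * pi) ^ DIM('a) * (LINT x|lborel. (u x)\<^sup>2)"
proof -
  define v where "v = (\<lambda>n x. max (- real n) (min (real n) (u x)))"
  have [measurable]: "v n \<in> borel_measurable borel" for n
    unfolding v_def by measurable
  have vn: "\<bar>v n x\<bar> \<le> real n" and vu: "\<bar>v n x\<bar> \<le> \<bar>u x\<bar>" "\<bar>v n x - u x\<bar> \<le> \<bar>u x\<bar>" for n x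
    by (auto simp: v_def)
  have sq: "(v n x)\<^sup>2 \<le> (u x)\<^sup>2" "(v n x - u x)\<^sup>2 \<le> (u x)\<^sup>2" for n x
    using vu[of n x] by (metis abs_ge_zero power2_abs power_mono)+
  have vR: "v n x = 0" if "norm x > R" for n x
    using R[OF that] by (simp add: v_def)
  have lim: "(\<lambda>n. v n x) \<longlonglongrightarrow> u x" for x
  proof (rule tendsto_eventually)
    obtain n0 :: nat where "\<bar>u x\<bar> \<le> real n0" using real_arch_simple by blast
    then show "\<forall>\<^sub>F n in sequentially. v n x = u x"
      by (intro eventually_sequentiallyI[of n0]) (auto simp: v_def)
  qed
  show ?thesis
  proof (rule plancherel_limit[where v = v])
    show "integrable lborel u"
      by (rule integrable_of_sq_integrable[OF _ u2 R]) auto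
    show v2: "integrable lborel (\<lambda>x. (v n x)\<^sup>2)" for n
      by (rule Bochner_Integration.integrable_bound[OF u2]) (auto simp: sq)
    show "integrable lborel (v n)" for n
      by (rule integrable_of_sq_integrable[OF _ v2 vR]) auto
    show "(LINT \<xi>|lborel. (cmod (fourier (v n) \<xi>))\<^sup>2) = (2 * pi) ^ DIM('a) * (LINT x|lborel. (v n x)\<^sup>2)" for n
      by (rule plancherel_bounded[OF _ vn vR]) auto
    have "(\<lambda>n. LINT x|lborel. (v n x - u x)\<^sup>2) \<longlonglongrightarrow> (LINT (x::'a)|lborel. (0::real))"
    proof (rule integral_dominated_convergence[OF _ _ u2])
      show "AE x in lborel. (\<lambda>n. (v n x - u x)\<^sup>2) \<longlonglongrightarrow> 0"
        using lim by (intro AE_I2) (auto intro!: tendsto_eq_intros)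
    qed (auto simp: sq)
    then show "(\<lambda>n. LINT x|lborel. (v n x - u x)\<^sup>2) \<longlonglongrightarrow> 0" by simp
    show "(\<lambda>n. LINT x|lborel. (v n x)\<^sup>2) \<longlonglongrightarrow> (LINT x|lborel. (u x)\<^sup>2)"
    proof (rule integral_dominated_convergence[OF _ _ u2])
      show "AE x in lborel. (\<lambda>n. (v n x)\<^sup>2) \<longlonglongrightarrow> (u x)\<^sup>2"
        using lim by (intro AE_I2) (auto intro!: tendsto_eq_intros)
    qed (auto simp: sq)
  qed (rule u2)
qed

subsection \<open>Smooth cutoff functions\<close>

lemma power_le_fact_exp:
  fixes x :: real
  assumes "0 \<le> x"
  shows "x ^ n \<le> fact n * exp x"
proof -
  have "(\<Sum>k\<in>{n}. x ^ k /\<^sub>R fact k) \<le> (\<Sum>k. x ^ k /\<^sub>R fact k)"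
    using assms exp_converges[of x] by (intro sum_le_suminf) (auto simp: sums_iff)
  also have "\<dots> = exp x" using exp_converges[of x] by (simp add: sums_iff)
  finally show ?thesis by (simp add: divide_simps mult.commute)
qed

text \<open>The flat function \<open>exp (- 1 / t)\<close>, extended by zero, divided by a power of
  \<open>t\<close>, because such powers arise when it is differentiated.\<close>

definition bump_atom :: "nat \<Rightarrow> real \<Rightarrow> real" where
  "bump_atom k t = (if t > 0 then exp (- 1 / t) / t ^ k else 0)"

text \<open>Flatness at zero to every order, since \<open>exp (1 / t)\<close> exceeds each term of
  its power series. With \<open>j = 2\<close> the difference quotients at zero tend to zero.\<close>

lemma bump_atom_le: "\<bar>bump_atom k t\<bar> \<le> fact (k + j) * \<bar>t\<bar> ^ j"
proof (cases "t > 0")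
  case True
  have "(1 / t) ^ (k + j) \<le> fact (k + j) * exp (1 / t)"
    using True by (intro power_le_fact_exp) auto
  then have "1 / t ^ k \<le> fact (k + j) * exp (1 / t) * t ^ j"
    using True by (simp add: power_add power_one_over field_simps)
  then show ?thesis
    using True by (simp add: bump_atom_def exp_minus field_simps)
qed (simp add: bump_atom_def)

lemma bump_atom_has_derivative:
  "(bump_atom k has_real_derivative (- real k * bump_atom (Suc k) t + bump_atom (k + 2) t)) (at t)"
proof (cases t "0::real" rule: linorder_cases)
  case less
  have "((\<lambda>_. 0) has_real_derivative 0) (at t)" by simp
  then have "(bump_atom k has_real_derivative 0) (at t)"
    by (rule has_field_derivative_transform_within_open[where S="{..<0}"])
       (use less in \<open>auto simp: bump_atom_def\<close>)
  then show ?thesis using less by (simp add: bump_atom_def)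
next
  case greater
  have "((\<lambda>s. exp (- 1 / s) / s ^ k) has_real_derivative
      (- real k * bump_atom (Suc k) t + bump_atom (k + 2) t)) (at t)"
  proof -
    have e: "((\<lambda>s. exp (- 1 / s)) has_real_derivative exp (- 1 / t) / t\<^sup>2) (at t)"
      using greater by (auto intro!: derivative_eq_intros simp: power2_eq_square)
    have p: "((\<lambda>s. s ^ k) has_real_derivative real k * t ^ (k - Suc 0)) (at t)"
      by (rule DERIV_pow)
    have "((\<lambda>s. exp (- 1 / s) / s ^ k) has_real_derivative
        (exp (- 1 / t) / t\<^sup>2 * t ^ k - exp (- 1 / t) * (real k * t ^ (k - Suc 0))) / (t ^ k * t ^ k)) (at t)"
      using greater by (intro DERIV_divide e p) auto
    moreover have "(exp (- 1 / t) / t\<^sup>2 * t ^ k - exp (- 1 / t) * (real k * t ^ (k - Suc 0))) / (t ^ k * t ^ k)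
        = - real k * bump_atom (Suc k) t + bump_atom (k + 2) t"
      using greater by (cases k) (auto simp: bump_atom_def power2_eq_square field_simps)
    ultimately show ?thesis by simp
  qed
  then show ?thesis
    by (rule has_field_derivative_transform_within_open[where S="{0<..}"])
       (use greater in \<open>auto simp: bump_atom_def\<close>)
next
  case equal
  have "((\<lambda>h. (bump_atom k (0 + h) - bump_atom k 0) / h) \<longlongrightarrow> 0) (at 0)"
  proof (rule Lim_null_comparison)
    show "((\<lambda>h. fact (k + 2) * \<bar>h\<bar>) \<longlongrightarrow> 0) (at (0::real))"
      by (auto intro!: tendsto_eq_intros)
    show "\<forall>\<^sub>F h in at 0. norm ((bump_atom k (0 + h) - bump_atom k 0) / h) \<le> fact (k + 2) * \<bar>h\<bar>"
      unfolding eventually_at_filter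
    proof (intro always_eventually allI impI)
      fix h :: real assume "h \<noteq> 0"
      then show "norm ((bump_atom k (0 + h) - bump_atom k 0) / h) \<le> fact (k + 2) * \<bar>h\<bar>"
        using bump_atom_le[of k h 2] by (simp add: bump_atom_def[of k 0] abs_divide divide_simps power2_eq_square mult.assoc)
    qed
  qed
  then have "(bump_atom k has_real_derivative 0) (at 0)"
    by (simp add: DERIV_def)
  then show ?thesis using equal by (simp add: bump_atom_def)
qed

text \<open>An algebra containing the cutoffs and the trial functions. It is closed under partial derivatives, the
  derivative of \<open>bump_atom k\<close> being \<open>bump_atom (k + 2) - k * bump_atom (k + 1)\<close>; hence its members
  are smooth.\<close>
inductive_set smooth_alg :: "('a::euclidean_space \<Rightarrow> real) set" where
  const: "(\<lambda>x. c) \<in> smooth_alg"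
| bump: "(\<lambda>x. bump_atom k (x \<bullet> v + c)) \<in> smooth_alg"
| cos: "(\<lambda>x. cos (\<xi> \<bullet> x)) \<in> smooth_alg"
| sin: "(\<lambda>x. sin (\<xi> \<bullet> x)) \<in> smooth_alg"
| add: "f \<in> smooth_alg \<Longrightarrow> g \<in> smooth_alg \<Longrightarrow> (\<lambda>x. f x + g x) \<in> smooth_alg"
| mult: "f \<in> smooth_alg \<Longrightarrow> g \<in> smooth_alg \<Longrightarrow> (\<lambda>x. f x * g x) \<in> smooth_alg"

lemma smooth_alg_derivative:
  assumes "f \<in> smooth_alg"
  shows "\<exists>F. (\<forall>x. (f has_derivative (\<lambda>h. F h x)) (at x)) \<and> (\<forall>h. F h \<in> smooth_alg)"
  using assms
proof induction
  case (const c)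
  then show ?case by (intro exI[of _ "\<lambda>h x. 0"]) (auto intro: smooth_alg.const)
next
  case (bump k v c)
  let ?F = "\<lambda>h x. (h \<bullet> v) * (- real k * bump_atom (Suc k) (x \<bullet> v + c) + bump_atom (k + 2) (x \<bullet> v + c))"
  have "((\<lambda>x. bump_atom k (x \<bullet> v + c)) has_derivative (\<lambda>h. ?F h x)) (at x)" for x
  proof -
    have "((\<lambda>x. x \<bullet> v + c) has_derivative (\<lambda>h. h \<bullet> v)) (at x)"
      by (auto intro!: derivative_eq_intros)
    from DERIV_compose_FDERIV[OF bump_atom_has_derivative this]
    show ?thesis by simp
  qed
  moreover have "?F h \<in> smooth_alg" for h
    by (intro smooth_alg.intros)
  ultimately show ?case by (intro exI[of _ ?F]) auto
next
  case (cos \<xi>)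
  let ?F = "\<lambda>h x. - (\<xi> \<bullet> h) * sin (\<xi> \<bullet> x)"
  have "((\<lambda>x. cos (\<xi> \<bullet> x)) has_derivative (\<lambda>h. ?F h x)) (at x)" for x
    by (auto intro!: derivative_eq_intros)
  moreover have "?F h \<in> smooth_alg" for h
    by (intro smooth_alg.intros)
  ultimately show ?case by (intro exI[of _ ?F]) auto
next
  case (sin \<xi>)
  let ?F = "\<lambda>h x. (\<xi> \<bullet> h) * cos (\<xi> \<bullet> x)"
  have "((\<lambda>x. sin (\<xi> \<bullet> x)) has_derivative (\<lambda>h. ?F h x)) (at x)" for x
    by (auto intro!: derivative_eq_intros)
  moreover have "?F h \<in> smooth_alg" for h
    by (intro smooth_alg.intros)
  ultimately show ?case by (intro exI[of _ ?F]) auto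
next
  case (add f g)
  then obtain F G where F: "\<And>x. (f has_derivative (\<lambda>h. F h x)) (at x)" "\<And>h. F h \<in> smooth_alg"
    and G: "\<And>x. (g has_derivative (\<lambda>h. G h x)) (at x)" "\<And>h. G h \<in> smooth_alg"
    by blast
  have "(\<lambda>x. F h x + G h x) \<in> smooth_alg" for h
    by (intro smooth_alg.intros F G)
  then show ?case
    by (intro exI[of _ "\<lambda>h x. F h x + G h x"]) (auto intro!: has_derivative_add F G)
next
  case (mult f g)
  then obtain F G where F: "\<And>x. (f has_derivative (\<lambda>h. F h x)) (at x)" "\<And>h. F h \<in> smooth_alg"
    and G: "\<And>x. (g has_derivative (\<lambda>h. G h x)) (at x)" "\<And>h. G h \<in> smooth_alg"
    by blast
  have "(\<lambda>x. f x * G h x + F h x * g x) \<in> smooth_alg" for h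
    by (intro smooth_alg.intros F G mult)
  then show ?case
    by (intro exI[of _ "\<lambda>h x. f x * G h x + F h x * g x"]) (auto intro!: has_derivative_mult F G)
qed

lemma smooth_alg_partial_deriv:
  assumes "f \<in> smooth_alg"
  shows "partial_deriv b f \<in> smooth_alg" and "f differentiable (at x)"
proof -
  obtain F where F: "\<And>x. (f has_derivative (\<lambda>h. F h x)) (at x)" "\<And>h. F h \<in> smooth_alg"
    using smooth_alg_derivative[OF assms] by blast
  have "partial_deriv b f = F b"
    unfolding partial_deriv_def fun_eq_iff using frechet_derivative_at[OF F(1)] by metis
  then show "partial_deriv b f \<in> smooth_alg" using F by simp
  show "f differentiable (at x)" using F(1) by (auto simp: differentiable_def)
qed

lemma smooth_alg_smooth:
  assumes "f \<in> smooth_alg"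
  shows "smooth f"
proof -
  have "foldr partial_deriv bs f \<in> smooth_alg" for bs
    by (induction bs) (auto simp: assms smooth_alg_partial_deriv)
  then show ?thesis
    unfolding smooth_def using smooth_alg_partial_deriv by blast
qed

lemma smooth_alg_prod:
  assumes "\<And>i. i \<in> I \<Longrightarrow> f i \<in> smooth_alg"
  shows "(\<lambda>x. \<Prod>i\<in>I. f i x) \<in> smooth_alg"
  using assms
  by (induction I rule: infinite_finite_induct) (auto intro: smooth_alg.intros)

lemma smooth_alg_power: "f \<in> smooth_alg \<Longrightarrow> (\<lambda>x. f x ^ n) \<in> smooth_alg"
  by (induction n) (auto intro: smooth_alg.intros)

lemma smooth_alg_one_minus: "f \<in> smooth_alg \<Longrightarrow> (\<lambda>x. 1 - f x) \<in> smooth_alg"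
  using smooth_alg.add[OF smooth_alg.const[of 1] smooth_alg.mult[OF smooth_alg.const[of "-1"]], of f] by simp

definition box_bump :: "'a::euclidean_space \<Rightarrow> 'a \<Rightarrow> 'a \<Rightarrow> real" where
  "box_bump a b x = (\<Prod>i\<in>Basis. bump_atom 0 (x \<bullet> i - a \<bullet> i) * bump_atom 0 (b \<bullet> i - x \<bullet> i))"

lemma bump_atom_0: "0 \<le> bump_atom 0 t" "bump_atom 0 t < 1" "bump_atom 0 t > 0 \<longleftrightarrow> t > 0"
  by (auto simp: bump_atom_def)

lemma box_bump_smooth_alg: "box_bump a b \<in> smooth_alg"
proof -
  have "(\<lambda>x. bump_atom 0 (x \<bullet> i - a \<bullet> i)) \<in> smooth_alg" "(\<lambda>x. bump_atom 0 (b \<bullet> i - x \<bullet> i)) \<in> smooth_alg" for i :: 'a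
    using smooth_alg.bump[of 0 i "- (a \<bullet> i)"] smooth_alg.bump[of 0 "- i" "b \<bullet> i"] by simp_all
  then show ?thesis
    unfolding box_bump_def[abs_def] by (intro smooth_alg_prod smooth_alg.mult)
qed

lemma box_bump_bounds: "0 \<le> box_bump a b x" "box_bump a b x < 1"
proof -
  show "0 \<le> box_bump a b x"
    unfolding box_bump_def by (intro prod_nonneg mult_nonneg_nonneg ballI bump_atom_0)
  obtain i :: 'a where i: "i \<in> Basis" using nonempty_Basis by blast
  have le1: "0 \<le> bump_atom 0 (x \<bullet> i - a \<bullet> i) * bump_atom 0 (b \<bullet> i - x \<bullet> i)"
    "bump_atom 0 (x \<bullet> i - a \<bullet> i) * bump_atom 0 (b \<bullet> i - x \<bullet> i) < 1" for i
  proof -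
    show "0 \<le> bump_atom 0 (x \<bullet> i - a \<bullet> i) * bump_atom 0 (b \<bullet> i - x \<bullet> i)"
      by (intro mult_nonneg_nonneg bump_atom_0)
    have "bump_atom 0 (x \<bullet> i - a \<bullet> i) * bump_atom 0 (b \<bullet> i - x \<bullet> i) \<le> bump_atom 0 (x \<bullet> i - a \<bullet> i) * 1"
      using bump_atom_0(1,2) less_imp_le by (intro mult_left_mono) blast+
    then show "bump_atom 0 (x \<bullet> i - a \<bullet> i) * bump_atom 0 (b \<bullet> i - x \<bullet> i) < 1"
      using bump_atom_0(2)[of "x \<bullet> i - a \<bullet> i"] by linarith
  qed
  have "box_bump a b x = (bump_atom 0 (x \<bullet> i - a \<bullet> i) * bump_atom 0 (b \<bullet> i - x \<bullet> i)) *
      (\<Prod>i\<in>Basis - {i}. bump_atom 0 (x \<bullet> i - a \<bullet> i) * bump_atom 0 (b \<bullet> i - x \<bullet> i))"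
    unfolding box_bump_def using i by (simp add: prod.remove)
  also have "\<dots> \<le> (bump_atom 0 (x \<bullet> i - a \<bullet> i) * bump_atom 0 (b \<bullet> i - x \<bullet> i)) * 1"
    using le1 less_imp_le by (intro mult_left_mono prod_le_1) blast+
  also have "\<dots> < 1" using le1 by simp
  finally show "box_bump a b x < 1" .
qed

lemma box_bump_pos_iff: "box_bump a b x > 0 \<longleftrightarrow> x \<in> box a b"
proof -
  have "box_bump a b x > 0 \<longleftrightarrow> box_bump a b x \<noteq> 0"
    using box_bump_bounds(1)[of a b x] by auto
  also have "\<dots> \<longleftrightarrow> (\<forall>i\<in>Basis. bump_atom 0 (x \<bullet> i - a \<bullet> i) > 0 \<and> bump_atom 0 (b \<bullet> i - x \<bullet> i) > 0)"
    unfolding box_bump_def by (auto simp: less_le bump_atom_0(1))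
  also have "\<dots> \<longleftrightarrow> x \<in> box a b"
    unfolding bump_atom_0(3) by (auto simp: mem_box)
  finally show ?thesis .
qed

lemma test_functions_smooth_alg:
  assumes "f \<in> smooth_alg" "compact K" "K \<subseteq> \<Omega>" "\<And>x. f x \<noteq> 0 \<Longrightarrow> x \<in> K"
  shows "f \<in> test_functions \<Omega>"
proof -
  have "closure {x. f x \<noteq> 0} \<subseteq> K"
    using assms by (intro closure_minimal compact_imp_closed) auto
  moreover from this have "compact (closure {x. f x \<noteq> 0})"
    using assms(2) by (meson bounded_subset closed_closure compact_eq_bounded_closed)
  ultimately show ?thesis
    unfolding test_functions_def using assms(3) smooth_alg_smooth[OF assms(1)] by auto
qed

lemma test_functions_mult_smooth_alg:
  assumes "w \<in> smooth_alg" "w \<in> test_functions \<Omega>" "g \<in> smooth_alg"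
  shows "(\<lambda>x. w x * g x) \<in> test_functions \<Omega>"
proof (rule test_functions_smooth_alg)
  show "(\<lambda>x. w x * g x) \<in> smooth_alg" using assms by (intro smooth_alg.mult)
  show "compact (closure {x. w x \<noteq> 0})" "closure {x. w x \<noteq> 0} \<subseteq> \<Omega>"
    using assms(2) by (auto simp: test_functions_def)
  show "x \<in> closure {x. w x \<noteq> 0}" if "w x * g x \<noteq> 0" for x
    using that closure_subset[of "{x. w x \<noteq> 0}"] by auto
qed

text \<open>Countably many open boxes whose closures lie in \<Omega> cover \<Omega>. The
  \<open>n\<close>-th cutoff uses the first \<open>n\<close> of them, so its support lies in a
  finite union of compact boxes.\<close>

lemma exists_cutoffs:
  fixes \<Omega> :: "'a::euclidean_space set"
  assumes \<Omega>: "open \<Omega>" "\<Omega> \<noteq> {}"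
  obtains w :: "nat \<Rightarrow> 'a \<Rightarrow> real" where
    "\<And>n. w n \<in> smooth_alg" "\<And>n. w n \<in> test_functions \<Omega>" "\<And>n x. 0 \<le> w n x" "\<And>n x. w n x \<le> 1"
    "\<And>x. x \<in> \<Omega> \<Longrightarrow> (\<lambda>n. w n x) \<longlonglongrightarrow> 1"
proof -
  define F where "F = {box a b | a b. cbox a b \<subseteq> \<Omega>}"
  have "\<And>S. S \<in> F \<Longrightarrow> open S" by (auto simp: F_def)
  then obtain F' where F': "F' \<subseteq> F" "countable F'" "\<Union>F' = \<Union>F" by (rule Lindelof) blast+
  have cover: "\<Union>F = \<Omega>"
  proof
    show "\<Union>F \<subseteq> \<Omega>" unfolding F_def using box_subset_cbox by blast
    show "\<Omega> \<subseteq> \<Union>F"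
    proof
      fix x assume "x \<in> \<Omega>"
      then obtain a b where "cbox a b \<subseteq> \<Omega>" "x \<in> box a b"
        using open_contains_cbox[OF \<Omega>(1)] by metis
      then show "x \<in> \<Union>F" unfolding F_def by blast
    qed
  qed
  have "F' \<noteq> {}" using cover F' \<Omega> by auto
  then have rng: "range (from_nat_into F') = F'"
    using F'(2) by (simp add: range_from_nat_into)
  have "\<forall>j. \<exists>a b. cbox a b \<subseteq> \<Omega> \<and> from_nat_into F' j = box a b"
  proof
    fix j
    have "from_nat_into F' j \<in> F" using rng F'(1) by blast
    then show "\<exists>a b. cbox a b \<subseteq> \<Omega> \<and> from_nat_into F' j = box a b" unfolding F_def by auto
  qed
  then obtain a b where ab: "\<And>j. cbox (a j) (b j) \<subseteq> \<Omega>" "\<And>j::nat. from_nat_into F' j = box (a j) (b j)"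
    by metis
  \<comment> \<open>The product is below 1 exactly where one of the first \<open>n\<close> bumps is
    positive, and there its \<open>n\<close>-th power tends to zero. The formula uses only sums and
    products, hence stays in \<open>smooth_alg\<close>, and its values lie in [0, 1].\<close>
  define w where "w = (\<lambda>n x. 1 - (\<Prod>j<n. 1 - box_bump (a j) (b j) x) ^ n)"
  have le1: "box_bump a b x \<le> 1" for a b x :: 'a
    using box_bump_bounds(2) less_imp_le by blast
  have pr: "0 \<le> (\<Prod>j<n. 1 - box_bump (a j) (b j) x)" "(\<Prod>j<n. 1 - box_bump (a j) (b j) x) \<le> 1" for n x
    using box_bump_bounds(1) le1 by (auto intro!: prod_nonneg prod_le_1)
  show ?thesis
  proof (rule that[of w])
    show alg: "w n \<in> smooth_alg" for n
      unfolding w_def by (intro smooth_alg_one_minus smooth_alg_power smooth_alg_prod box_bump_smooth_alg)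
    show "w n \<in> test_functions \<Omega>" for n
    proof (rule test_functions_smooth_alg[OF alg])
      show "compact (\<Union>j<n. cbox (a j) (b j))" by (intro compact_UN) auto
      show "(\<Union>j<n. cbox (a j) (b j)) \<subseteq> \<Omega>" using ab by blast
      fix x assume "w n x \<noteq> 0"
      then have "\<exists>j<n. box_bump (a j) (b j) x \<noteq> 0"
        unfolding w_def by (rule contrapos_np) simp
      then obtain j where j: "j < n" "box_bump (a j) (b j) x \<noteq> 0"
        by auto
      then have "box_bump (a j) (b j) x > 0"
        using box_bump_bounds(1)[of "a j" "b j" x] by simp
      then have "x \<in> cbox (a j) (b j)"
        unfolding box_bump_pos_iff by (rule subsetD[OF box_subset_cbox])
      then show "x \<in> (\<Union>j<n. cbox (a j) (b j))" using j by auto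
    qed
    show "0 \<le> w n x" "w n x \<le> 1" for n x
      using pr by (auto simp: w_def power_le_one)
    show "(\<lambda>n. w n x) \<longlonglongrightarrow> 1" if "x \<in> \<Omega>" for x
    proof -
      have "x \<in> \<Union>(range (from_nat_into F'))" using that cover F' rng by simp
      then obtain j where "x \<in> box (a j) (b j)" using ab(2) by auto
      then have j: "box_bump (a j) (b j) x > 0" by (simp add: box_bump_pos_iff)
      define q where "q = 1 - box_bump (a j) (b j) x"
      have q: "0 \<le> q" "q < 1" using j box_bump_bounds(2)[of "a j" "b j" x] by (auto simp: q_def)
      have "(\<lambda>n. (\<Prod>j<n. 1 - box_bump (a j) (b j) x) ^ n) \<longlonglongrightarrow> 0"
      proof (rule tendsto_sandwich[OF _ _ tendsto_const LIMSEQ_realpow_zero[OF q]])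
        show "\<forall>\<^sub>F n in sequentially. 0 \<le> (\<Prod>j<n. 1 - box_bump (a j) (b j) x) ^ n"
          using pr by simp
        show "\<forall>\<^sub>F n in sequentially. (\<Prod>j<n. 1 - box_bump (a j) (b j) x) ^ n \<le> q ^ n"
        proof (rule eventually_sequentiallyI[of "Suc j"])
          fix n assume n: "n \<ge> Suc j"
          have "(\<Prod>j<n. 1 - box_bump (a j) (b j) x) = q * (\<Prod>j\<in>{..<n} - {j}. 1 - box_bump (a j) (b j) x)"
            unfolding q_def using n by (subst prod.remove[of _ j]) auto
          also have "\<dots> \<le> q * 1"
            using q box_bump_bounds(1) le1 by (intro mult_left_mono prod_le_1) auto
          finally show "(\<Prod>j<n. 1 - box_bump (a j) (b j) x) ^ n \<le> q ^ n"
            using pr by (intro power_mono) auto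
        qed
      qed
      from tendsto_diff[OF tendsto_const[of 1] this] show ?thesis by (simp add: w_def)
    qed
  qed
qed

subsection \<open>Decay of Fourier transforms of test functions\<close>

lemma test_function_continuous:
  assumes "f \<in> test_functions \<Omega>"
  shows "continuous_on UNIV f"
proof -
  have "foldr partial_deriv [] f differentiable (at x)" for x
  proof -
    have "smooth f" using assms by (simp add: test_functions_def)
    then show ?thesis unfolding smooth_def by (metis empty_set empty_subsetI)
  qed
  then show ?thesis
    by (intro continuous_at_imp_continuous_on ballI differentiable_imp_continuous_within) simp
qed

lemma bounded_continuous_compact_support:
  fixes f :: "'a::euclidean_space \<Rightarrow> real"
  assumes "continuous_on UNIV f" "compact K" "\<And>x. x \<notin> K \<Longrightarrow> f x = 0"
  obtains C where "C \<ge> 0" "\<And>x. \<bar>f x\<bar> \<le> C"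
proof -
  have "bounded (f ` K)"
    using compact_continuous_image[OF continuous_on_subset[OF assms(1) subset_UNIV] assms(2)]
    by (rule compact_imp_bounded)
  then obtain C where C: "\<And>x. x \<in> K \<Longrightarrow> \<bar>f x\<bar> \<le> C" by (auto simp: bounded_iff)
  have "\<bar>f x\<bar> \<le> max C 0" for x
    using C[of x] assms(3)[of x] by (cases "x \<in> K") auto
  then show ?thesis using that[of "max C 0"] by auto
qed

lemma test_function_bounds:
  fixes f :: "'a::euclidean_space \<Rightarrow> real"
  assumes f: "f \<in> test_functions \<Omega>"
  obtains M where "\<And>x. \<bar>f x\<bar> \<le> M"
proof -
  have K: "compact (closure {x. f x \<noteq> 0})" using f by (auto simp: test_functions_def)
  have "f x = 0" if "x \<notin> closure {x. f x \<noteq> 0}" for x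
    using that closure_subset[of "{x. f x \<noteq> 0}"] by auto
  from bounded_continuous_compact_support[OF test_function_continuous[OF f] K this] that
  show ?thesis by metis
qed

text \<open>\<open>smooth\<close> makes the partial derivative differentiable, hence continuous. It
  vanishes off the compact support, so it is bounded, and the mean value inequality along the
  direction \<open>b\<close> applies.\<close>

lemma test_function_directional_lipschitz:
  fixes f :: "'a::euclidean_space \<Rightarrow> real"
  assumes f: "f \<in> test_functions \<Omega>" and b: "b \<in> Basis"
  obtains C where "C \<ge> 0" "\<And>x t. \<bar>f (x + t *\<^sub>R b) - f x\<bar> \<le> C * \<bar>t\<bar>"
proof -
  define K where "K = closure {x. f x \<noteq> 0}"
  have K: "compact K" using f by (auto simp: test_functions_def K_def)
  have sm: "foldr partial_deriv bs f differentiable (at x)" if "set bs \<subseteq> Basis" for bs x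
  proof -
    have "smooth f" using f by (simp add: test_functions_def)
    then show ?thesis using that unfolding smooth_def by simp
  qed
  have df: "(f has_derivative frechet_derivative f (at x)) (at x)" for x
    using sm[of "[]" x] by (simp add: frechet_derivative_works)
  have "continuous_on UNIV (partial_deriv b f)"
    using sm[of "[b]"] b by (intro continuous_at_imp_continuous_on ballI differentiable_imp_continuous_within) simp
  moreover have "partial_deriv b f x = 0" if x: "x \<notin> K" for x
  proof -
    have "((\<lambda>_. 0) has_derivative (\<lambda>h. 0)) (at x)" by simp
    then have "(f has_derivative (\<lambda>h. 0)) (at x)"
    proof (rule has_derivative_transform_within_open)
      show "open (- K)" using K by (simp add: compact_imp_closed open_Compl)
      show "x \<in> - K" using x by simp
      show "0 = f y" if "y \<in> - K" for y
        using that closure_subset[of "{x. f x \<noteq> 0}"] by (auto simp: K_def)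
    qed
    then show ?thesis
      unfolding partial_deriv_def using frechet_derivative_at by metis
  qed
  ultimately obtain C where C: "C \<ge> 0" "\<And>x. \<bar>partial_deriv b f x\<bar> \<le> C"
    using bounded_continuous_compact_support[OF _ K] by metis
  have "\<bar>f (x + t *\<^sub>R b) - f x\<bar> \<le> C * \<bar>t\<bar>" for x t
  proof -
    have D: "((\<lambda>s. f (x + s *\<^sub>R b)) has_real_derivative partial_deriv b f (x + s *\<^sub>R b)) (at s)" for s
    proof -
      have "((\<lambda>s. x + s *\<^sub>R b) has_derivative (\<lambda>h. h *\<^sub>R b)) (at s)"
        by (auto intro!: derivative_eq_intros)
      from has_derivative_compose[OF this df]
      have "((\<lambda>s. f (x + s *\<^sub>R b)) has_derivative (\<lambda>h. frechet_derivative f (at (x + s *\<^sub>R b)) (h *\<^sub>R b))) (at s)" .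
      moreover have "frechet_derivative f (at y) (h *\<^sub>R b) = partial_deriv b f y * h" for y h
        using linear_scale[OF has_derivative_linear[OF df[of y]], of h b] by (simp add: partial_deriv_def)
      ultimately show ?thesis by (simp add: has_field_derivative_def)
    qed
    have "norm (f (x + t *\<^sub>R b) - f (x + 0 *\<^sub>R b)) \<le> C * norm (t - 0)"
      by (rule field_differentiable_bound[OF convex_UNIV D]) (use C in auto)
    then show ?thesis by simp
  qed
  with C(1) that show ?thesis by blast
qed

lemma fourier_translate:
  fixes u :: "'a::euclidean_space \<Rightarrow> real"
  assumes u: "integrable lborel u"
  shows "fourier (\<lambda>x. u (x + a)) \<xi> = exp (\<i> * complex_of_real (\<xi> \<bullet> a)) * fourier u \<xi>"
proof -
  have [measurable]: "u \<in> borel_measurable borel" using u by auto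
  have "fourier u \<xi> = (LINT x|lborel. exp (- \<i> * complex_of_real (\<xi> \<bullet> (a + x))) * complex_of_real (u (a + x)))"
    unfolding fourier_def by (subst lborel_integral_affine_euclidean[of _ 1 a]) auto
  also have "\<dots> = (LINT x|lborel. exp (- \<i> * complex_of_real (\<xi> \<bullet> a)) *
      (exp (- \<i> * complex_of_real (\<xi> \<bullet> x)) * complex_of_real (u (x + a))))"
    by (intro Bochner_Integration.integral_cong refl) (simp add: inner_add_right algebra_simps exp_add[symmetric] exp_diff)
  also have "\<dots> = exp (- \<i> * complex_of_real (\<xi> \<bullet> a)) * fourier (\<lambda>x. u (x + a)) \<xi>"
    unfolding fourier_def by simp
  finally show ?thesis by (simp add: exp_minus field_simps)
qed

lemma tendsto_exp_difference_quotient: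
  fixes c :: real
  shows "(\<lambda>n. (exp (\<i> * complex_of_real (c * (1 / real (Suc n)))) - 1) / complex_of_real (1 / real (Suc n))) \<longlonglongrightarrow> \<i> * complex_of_real c"
proof -
  have "((\<lambda>z. exp (\<i> * complex_of_real c * z)) has_field_derivative \<i> * complex_of_real c) (at 0)"
    by (auto intro!: derivative_eq_intros)
  then have "((\<lambda>h. (exp (\<i> * complex_of_real c * h) - 1) / h) \<longlongrightarrow> \<i> * complex_of_real c) (at 0)"
    by (simp add: DERIV_def)
  moreover have "filterlim (\<lambda>n. complex_of_real (1 / real (Suc n))) (at 0) sequentially"
  proof -
    have "(\<lambda>n. complex_of_real (1 / real (Suc n))) \<longlonglongrightarrow> of_real 0"
      using LIMSEQ_inverse_real_of_nat by (intro tendsto_of_real) (simp add: inverse_eq_divide)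
    then show ?thesis
      by (intro filterlim_atI) (auto simp del: of_nat_Suc)
  qed
  ultimately have "(\<lambda>n. (exp (\<i> * complex_of_real c * complex_of_real (1 / real (Suc n))) - 1) / complex_of_real (1 / real (Suc n)))
    \<longlonglongrightarrow> \<i> * complex_of_real c"
    by (rule filterlim_compose)
  then show ?thesis by (simp add: mult.assoc)
qed

text \<open>The Fourier transform of the difference quotients is bounded in \<open>L\<^sup>2\<close>; Fatou does the rest.\<close>
lemma nn_integral_fourier_directional:
  fixes f :: "'a::euclidean_space \<Rightarrow> real"
  assumes [measurable]: "f \<in> borel_measurable borel" and b: "norm b \<le> 1"
    and M: "\<And>x. \<bar>f x\<bar> \<le> M" and R: "\<And>x. norm x > R \<Longrightarrow> f x = 0"
    and C: "\<And>x t. \<bar>f (x + t *\<^sub>R b) - f x\<bar> \<le> C * \<bar>t\<bar>"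
  shows "(\<integral>\<^sup>+\<xi>. ennreal ((\<xi> \<bullet> b)\<^sup>2 * (cmod (fourier f \<xi>))\<^sup>2) \<partial>lborel) < \<infinity>"
proof -
  let ?t = "\<lambda>n. 1 / real (Suc n)"
  define D where "D = (\<lambda>n x. (f (x + ?t n *\<^sub>R b) - f x) / ?t n)"
  have f1: "integrable lborel f" by (rule integrable_bounded_support[OF _ M R]) auto
  have f2: "integrable lborel (\<lambda>x. f (x + a))" for a
    using lborel_integrable_affine_euclidean[OF f1, of 1 a] by (simp add: add.commute)
  have Dm[measurable]: "D n \<in> borel_measurable borel" for n unfolding D_def by measurable
  have DC: "\<bar>D n x\<bar> \<le> C" for n x
    using C[of x "?t n"] by (simp add: D_def abs_mult divide_simps del: of_nat_Suc)
  have DR: "D n x = 0" if "norm x > R + 1" for n x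
  proof -
    have "norm x \<le> norm (x + ?t n *\<^sub>R b) + norm (?t n *\<^sub>R b)"
      using norm_triangle_ineq4[of "x + ?t n *\<^sub>R b" "?t n *\<^sub>R b"] by simp
    moreover have "norm (?t n *\<^sub>R b) \<le> 1 * 1"
      using b unfolding norm_scaleR by (intro mult_mono) auto
    ultimately have "norm (x + ?t n *\<^sub>R b) > R" "norm x > R" using that by linarith+
    then show ?thesis using R by (simp add: D_def)
  qed
  have sqb: "(D n x)\<^sup>2 \<le> C\<^sup>2" for n x
    using DC[of n x] by (metis abs_ge_zero power2_abs power_mono)
  have D2: "integrable lborel (\<lambda>x. (D n x)\<^sup>2)" for n
    using sqb DR by (intro integrable_bounded_support[of _ "C\<^sup>2" "R + 1"]) auto
  have D1: "integrable lborel (D n)" for n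
    using DC DR by (intro integrable_bounded_support[of _ C "R + 1"]) auto
  have FD: "fourier (D n) \<xi> = (exp (\<i> * complex_of_real ((\<xi> \<bullet> b) * ?t n)) - 1) / complex_of_real (?t n) * fourier f \<xi>" for n \<xi>
  proof -
    have "fourier (D n) \<xi> = fourier (\<lambda>x. (1 / ?t n) * f (x + ?t n *\<^sub>R b) + (- (1 / ?t n)) * f x) \<xi>"
      unfolding D_def by (intro arg_cong2[of _ _ _ _ fourier] refl ext) (simp add: divide_simps del: of_nat_Suc, simp add: algebra_simps)
    also have "\<dots> = (1 / ?t n) * (exp (\<i> * complex_of_real (\<xi> \<bullet> (?t n *\<^sub>R b))) * fourier f \<xi>) + (- (1 / ?t n)) * fourier f \<xi>"
      using fourier_lincomb[OF f2 f1] fourier_translate[OF f1] by simp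
    finally show ?thesis
      by (simp add: mult.commute algebra_simps del: of_nat_Suc)
  qed
  have lim: "(\<lambda>n. (cmod (fourier (D n) \<xi>))\<^sup>2) \<longlonglongrightarrow> (\<xi> \<bullet> b)\<^sup>2 * (cmod (fourier f \<xi>))\<^sup>2" for \<xi>
  proof -
    have "(\<lambda>n. (cmod (fourier (D n) \<xi>))\<^sup>2) \<longlonglongrightarrow> (cmod (\<i> * complex_of_real (\<xi> \<bullet> b) * fourier f \<xi>))\<^sup>2"
      unfolding FD by (intro tendsto_intros tendsto_exp_difference_quotient)
    then show ?thesis by (simp add: norm_mult power_mult_distrib)
  qed
  \<comment> \<open>By the Plancherel bound this majorises the transform of any function of modulus
    at most \<open>C\<close> supported in the ball of radius \<open>R + 1\<close>. All difference
    quotients are of this kind, because their steps are at most 1.\<close>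
  define K where "K = (2 * pi) ^ DIM('a) * (LINT x|lborel. C\<^sup>2 * indicator (cball (0::'a) (R + 1)) x)"
  have le: "(\<integral>\<^sup>+\<xi>. ennreal ((cmod (fourier (D n) \<xi>))\<^sup>2) \<partial>lborel) \<le> ennreal K" for n
  proof -
    have "(LINT x|lborel. (D n x)\<^sup>2) \<le> (LINT x|lborel. C\<^sup>2 * indicator (cball (0::'a) (R + 1)) x)"
    proof (rule integral_mono[OF D2])
      show "integrable lborel (\<lambda>x::'a. C\<^sup>2 * indicator (cball 0 (R + 1)) x)"
        by (intro integrable_mult_right integrable_real_indicator) (auto intro!: emeasure_lborel_cball_less_top)
      show "(D n x)\<^sup>2 \<le> C\<^sup>2 * indicator (cball 0 (R + 1)) x" for x
        using sqb[of n x] DR[of x n] by (auto simp: indicator_def)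
    qed
    then have "(LINT \<xi>|lborel. (cmod (fourier (D n) \<xi>))\<^sup>2) \<le> K"
      unfolding K_def using plancherel_le(2)[OF D1[of n] D2[of n]] by (smt (verit) mult_left_mono zero_le_power pi_ge_zero)
    then show ?thesis
      using integrable_fourier_sq[OF D1 D2] by (subst nn_integral_eq_integral) (auto intro: ennreal_leI)
  qed
  have "(\<integral>\<^sup>+\<xi>. ennreal ((\<xi> \<bullet> b)\<^sup>2 * (cmod (fourier f \<xi>))\<^sup>2) \<partial>lborel) =
      (\<integral>\<^sup>+\<xi>. liminf (\<lambda>n. ennreal ((cmod (fourier (D n) \<xi>))\<^sup>2)) \<partial>lborel)"
    using lim by (intro nn_integral_cong) (metis lim_imp_Liminf tendsto_ennrealI trivial_limit_sequentially)
  also have "\<dots> \<le> liminf (\<lambda>n. \<integral>\<^sup>+\<xi>. ennreal ((cmod (fourier (D n) \<xi>))\<^sup>2) \<partial>lborel)"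
    by (rule nn_integral_liminf) measurable
  also have "\<dots> \<le> ennreal K"
    by (rule order_trans[OF Liminf_le_Limsup Limsup_bounded]) (auto simp: le)
  finally show ?thesis
    by (simp add: le_less_trans)
qed

lemma test_function_support_bound:
  fixes f :: "'a::euclidean_space \<Rightarrow> real"
  assumes "f \<in> test_functions \<Omega>"
  obtains R where "\<And>x. norm x > R \<Longrightarrow> f x = 0"
proof -
  have "bounded (closure {x. f x \<noteq> 0})"
    using assms by (auto simp: test_functions_def compact_imp_bounded)
  then obtain R where R: "\<And>x. x \<in> closure {x. f x \<noteq> 0} \<Longrightarrow> norm x \<le> R"
    by (auto simp: bounded_iff)
  then show ?thesis
    using that[of R] closure_subset[of "{x. f x \<noteq> 0}"] by force
qed

lemma test_function_integrable:
  fixes f :: "'a::euclidean_space \<Rightarrow> real"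
  assumes f: "f \<in> test_functions \<Omega>"
  shows "f \<in> borel_measurable borel" "integrable lborel f" "integrable lborel (\<lambda>x. (f x)\<^sup>2)"
proof -
  show [measurable]: "f \<in> borel_measurable borel"
    using test_function_continuous[OF f] by (rule borel_measurable_continuous_onI)
  obtain M where M: "\<And>x. \<bar>f x\<bar> \<le> M" using test_function_bounds[OF f] by blast
  obtain R where R: "\<And>x. norm x > R \<Longrightarrow> f x = 0" using test_function_support_bound[OF f] by blast
  show "integrable lborel f" by (rule integrable_bounded_support[OF _ M R]) auto
  have "(f x)\<^sup>2 \<le> M\<^sup>2" for x
    using M[of x] by (metis abs_ge_zero power2_abs power_mono)
  then show "integrable lborel (\<lambda>x. (f x)\<^sup>2)"
    using R by (intro integrable_bounded_support[of _ "M\<^sup>2" R]) auto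
qed

text \<open>One derivative in \<open>L\<^sup>2\<close> is enough here: the logarithmic weights grow
  more slowly than any power, and the error in shifting the symbol is weighted by the same quadratic
  factor.\<close>

lemma test_function_fourier_decay:
  fixes f :: "'a::euclidean_space \<Rightarrow> real"
  assumes f: "f \<in> test_functions \<Omega>"
  shows "integrable lborel (\<lambda>\<xi>. (1 + (norm \<xi>)\<^sup>2) * (cmod (fourier f \<xi>))\<^sup>2)"
proof (rule integrableI_bounded)
  note [measurable] = test_function_integrable(1)[OF f]
  show "(\<lambda>\<xi>. (1 + (norm \<xi>)\<^sup>2) * (cmod (fourier f \<xi>))\<^sup>2) \<in> borel_measurable lborel"
    by measurable
  obtain M where M: "\<And>x. \<bar>f x\<bar> \<le> M" using test_function_bounds[OF f] by blast
  obtain R where R: "\<And>x. norm x > R \<Longrightarrow> f x = 0" using test_function_support_bound[OF f] by blast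
  have b: "(\<integral>\<^sup>+\<xi>. ennreal ((\<xi> \<bullet> b)\<^sup>2 * (cmod (fourier f \<xi>))\<^sup>2) \<partial>lborel) < \<infinity>" if bB: "b \<in> Basis" for b
  proof -
    obtain C where "C \<ge> 0" "\<And>x t. \<bar>f (x + t *\<^sub>R b) - f x\<bar> \<le> C * \<bar>t\<bar>"
      using test_function_directional_lipschitz[OF f bB] by metis
    from nn_integral_fourier_directional[OF _ _ M R this(2)] bB show ?thesis by auto
  qed
  have "(\<integral>\<^sup>+\<xi>. ennreal (norm ((1 + (norm \<xi>)\<^sup>2) * (cmod (fourier f \<xi>))\<^sup>2)) \<partial>lborel) =
     (\<integral>\<^sup>+\<xi>. (\<Sum>b\<in>Basis. ennreal ((\<xi> \<bullet> b)\<^sup>2 * (cmod (fourier f \<xi>))\<^sup>2)) + ennreal ((cmod (fourier f \<xi>))\<^sup>2) \<partial>lborel)"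
  proof (intro nn_integral_cong)
    fix \<xi> :: 'a
    have "norm ((1 + (norm \<xi>)\<^sup>2) * (cmod (fourier f \<xi>))\<^sup>2) =
        (\<Sum>b\<in>Basis. (\<xi> \<bullet> b)\<^sup>2 * (cmod (fourier f \<xi>))\<^sup>2) + (cmod (fourier f \<xi>))\<^sup>2"
      by (simp add: norm_sq_eq_sum_Basis abs_mult sum_nonneg sum_distrib_right distrib_right)
    then show "ennreal (norm ((1 + (norm \<xi>)\<^sup>2) * (cmod (fourier f \<xi>))\<^sup>2)) =
       (\<Sum>b\<in>Basis. ennreal ((\<xi> \<bullet> b)\<^sup>2 * (cmod (fourier f \<xi>))\<^sup>2)) + ennreal ((cmod (fourier f \<xi>))\<^sup>2)"
      by (simp add: sum_nonneg)
  qed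
  also have "\<dots> = (\<Sum>b\<in>Basis. \<integral>\<^sup>+\<xi>. ennreal ((\<xi> \<bullet> b)\<^sup>2 * (cmod (fourier f \<xi>))\<^sup>2) \<partial>lborel) +
      (\<integral>\<^sup>+\<xi>. ennreal ((cmod (fourier f \<xi>))\<^sup>2) \<partial>lborel)"
    by (subst nn_integral_add) (auto simp: nn_integral_sum simp del: sum_ennreal)
  also have "\<dots> < \<infinity>"
    using b integrable_fourier_sq[OF test_function_integrable(2,3)[OF f]]
    by (simp add: nn_integral_eq_integral)
  finally show "(\<integral>\<^sup>+\<xi>. ennreal (norm ((1 + (norm \<xi>)\<^sup>2) * (cmod (fourier f \<xi>))\<^sup>2)) \<partial>lborel) < \<infinity>" .
qed

subsection \<open>Phase space integrals of the logarithmic symbol\<close>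

text \<open>Radial functions are integrated through their layers: after an exchange of the
  integrals, only volumes of balls of radius \<open>s\<close> remain.\<close>

lemma nn_integral_radial_layers:
  fixes k :: "real \<Rightarrow> real"
  assumes [measurable]: "k \<in> borel_measurable borel"
  shows "(\<integral>\<^sup>+(\<xi>::'a::euclidean_space). (\<integral>\<^sup>+s. ennreal (k s) * indicator {norm \<xi>..1} s \<partial>lborel) \<partial>lborel) =
    (\<integral>\<^sup>+s. ennreal (k s) * ennreal (unit_ball_vol (real DIM('a)) * s ^ DIM('a)) * indicator {0..1} s \<partial>lborel)"
proof -
  have "(\<integral>\<^sup>+(\<xi>::'a). (\<integral>\<^sup>+s. ennreal (k s) * indicator {norm \<xi>..1} s \<partial>lborel) \<partial>lborel) =
      (\<integral>\<^sup>+(\<xi>::'a). (\<integral>\<^sup>+s. ennreal (k s) * (if norm \<xi> \<le> s \<and> s \<le> 1 then 1 else 0) \<partial>lborel) \<partial>lborel)"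
    by (intro nn_integral_cong) (auto simp: indicator_def)
  also have "\<dots> = (\<integral>\<^sup>+s. (\<integral>\<^sup>+(\<xi>::'a). ennreal (k s) * (if norm \<xi> \<le> s \<and> s \<le> 1 then 1 else 0) \<partial>lborel) \<partial>lborel)"
    by (rule lborel_pair.Fubini'[symmetric]) measurable
  also have "\<dots> = (\<integral>\<^sup>+s. ennreal (k s) * ennreal (unit_ball_vol (real DIM('a)) * s ^ DIM('a)) * indicator {0..1} s \<partial>lborel)"
  proof (intro nn_integral_cong)
    fix s :: real
    show "(\<integral>\<^sup>+(\<xi>::'a). ennreal (k s) * (if norm \<xi> \<le> s \<and> s \<le> 1 then 1 else 0) \<partial>lborel) =
      ennreal (k s) * ennreal (unit_ball_vol (real DIM('a)) * s ^ DIM('a)) * indicator {0..1} s"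
    proof (cases "0 \<le> s \<and> s \<le> 1")
      case True
      have "(\<integral>\<^sup>+(\<xi>::'a). ennreal (k s) * (if norm \<xi> \<le> s \<and> s \<le> 1 then 1 else 0) \<partial>lborel) =
          (\<integral>\<^sup>+(\<xi>::'a). ennreal (k s) * indicator (cball 0 s) \<xi> \<partial>lborel)"
        using True by (intro nn_integral_cong) (auto simp: indicator_def)
      also have "\<dots> = ennreal (k s) * emeasure lborel (cball (0::'a) s)"
        by (rule nn_integral_cmult_indicator) simp
      finally show ?thesis using True by (simp add: emeasure_cball)
    next
      case False
      have "(if norm \<xi> \<le> s \<and> s \<le> 1 then 1 else 0) = (0::ennreal)" for \<xi> :: 'a
        using False by (smt (verit) norm_ge_zero)
      then show ?thesis using False by (auto simp: indicator_def)
    qed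
  qed
  finally show ?thesis .
qed

lemma AE_lborel_nonzero: "AE x in lborel. x \<noteq> (0::'a::euclidean_space)"
  using AE_not_in[OF finite_imp_null_set_lborel[of "{0::'a}"]] by simp

lemma sets_cball_borel [measurable]: "cball c r \<in> sets (borel :: 'a::metric_space measure)"
  by (rule borel_closed) (rule closed_cball)

text \<open>\<open>- ln r\<close> is the integral of \<open>1 / s\<close> from \<open>r\<close> to
  1, so the layers give the volume of the unit ball times the integral of
  \<open>s ^ (N - 1)\<close>. The value is the constant that survives in the asymptotics.\<close>

lemma nn_integral_neg_ln_norm:
  "(\<integral>\<^sup>+(\<xi>::'a::euclidean_space). ennreal (- ln (norm \<xi>)) * indicator (cball 0 1) \<xi> \<partial>lborel) =
    ennreal (unit_ball_vol (real DIM('a)) / real DIM('a))"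
proof -
  let ?N = "DIM('a)" and ?v = "unit_ball_vol (real DIM('a))"
  have N: "?N > 0" by simp
  have inner: "(\<integral>\<^sup>+s. ennreal (1 / s) * indicator {norm \<xi>..1} s \<partial>lborel) =
      ennreal (- ln (norm \<xi>)) * indicator (cball 0 1) \<xi>" if "\<xi> \<noteq> 0" for \<xi> :: 'a
  proof (cases "norm \<xi> \<le> 1")
    case True
    have "(\<integral>\<^sup>+s. ennreal (1 / s) * indicator {norm \<xi>..1} s \<partial>lborel) = ennreal (ln 1 - ln (norm \<xi>))"
    proof (rule nn_integral_FTC_Icc[where F = ln])
      fix x assume x: "x \<in> {norm \<xi>..1}"
      moreover have "norm \<xi> > 0" using that by simp
      ultimately have "x > 0" by (simp only: atLeastAtMost_iff) linarith
      then show "(ln has_real_derivative 1 / x) (at x)" "0 \<le> 1 / x"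
        by (auto intro!: derivative_eq_intros)
    qed (use True in auto)
    then show ?thesis using True by simp
  qed simp
  have "(\<integral>\<^sup>+(\<xi>::'a). ennreal (- ln (norm \<xi>)) * indicator (cball 0 1) \<xi> \<partial>lborel) =
      (\<integral>\<^sup>+(\<xi>::'a). (\<integral>\<^sup>+s. ennreal (1 / s) * indicator {norm \<xi>..1} s \<partial>lborel) \<partial>lborel)"
    using AE_lborel_nonzero by (intro nn_integral_cong_AE) (auto simp: inner elim!: eventually_mono)
  also have "\<dots> = (\<integral>\<^sup>+s. ennreal (1 / s) * ennreal (?v * s ^ ?N) * indicator {0..1} s \<partial>lborel)"
    by (rule nn_integral_radial_layers) measurable
  also have "\<dots> = (\<integral>\<^sup>+s. ennreal (?v * s ^ (?N - 1)) * indicator {0..1} s \<partial>lborel)"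
  proof (rule nn_integral_cong_AE)
    have "ennreal (1 / s) * ennreal (?v * s ^ ?N) * indicator {0..1} s = ennreal (?v * s ^ (?N - 1)) * indicator {0..1} s"
      if "s \<noteq> 0" for s :: real
    proof (cases "0 < s \<and> s \<le> 1")
      case True
      have "s ^ ?N = s * s ^ (?N - 1)" using N by (metis power_eq_if less_not_refl)
      then show ?thesis using True by (simp add: ennreal_mult[symmetric])
    qed (use that in \<open>auto simp: indicator_def\<close>)
    then show "AE s in lborel. ennreal (1 / s) * ennreal (?v * s ^ ?N) * indicator {0..1} s =
        ennreal (?v * s ^ (?N - 1)) * indicator {0..1} s"
      using AE_lborel_nonzero by (auto elim!: eventually_mono)
  qed
  also have "\<dots> = ennreal (?v * 1 ^ ?N / ?N - ?v * 0 ^ ?N / ?N)"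
  proof (rule nn_integral_FTC_Icc[where F = "\<lambda>x. ?v * x ^ ?N / ?N"])
    fix x :: real assume "x \<in> {0..1}"
    then show "0 \<le> ?v * x ^ (?N - 1)" by simp
    show "((\<lambda>x. ?v * x ^ ?N / ?N) has_real_derivative ?v * x ^ (?N - 1)) (at x)"
      using N by (auto intro!: derivative_eq_intros)
  qed auto
  finally show ?thesis using N by (simp add: zero_power)
qed

text \<open>The layers of \<open>1 / sqrt r - 1\<close> have density
  \<open>1 / (2 * s * sqrt s)\<close>. The exponent 1/2 is below every dimension, and this
  singularity dominates all powers of the logarithm.\<close>

lemma nn_integral_inverse_sqrt_norm:
  "(\<integral>\<^sup>+(\<xi>::'a::euclidean_space). ennreal (1 / sqrt (norm \<xi>)) * indicator (cball 0 1) \<xi> \<partial>lborel) < \<infinity>"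
proof -
  let ?N = "DIM('a)" and ?v = "unit_ball_vol (real DIM('a))"
  have N: "?N > 0" by simp
  have inner: "(\<integral>\<^sup>+s. ennreal (1 / (2 * s * sqrt s)) * indicator {norm \<xi>..1} s \<partial>lborel) =
      ennreal (1 / sqrt (norm \<xi>) - 1)" if "\<xi> \<noteq> 0" "norm \<xi> \<le> 1" for \<xi> :: 'a
  proof -
    have "(\<integral>\<^sup>+s. ennreal (1 / (2 * s * sqrt s)) * indicator {norm \<xi>..1} s \<partial>lborel) = ennreal (- 1 / sqrt 1 - (- 1 / sqrt (norm \<xi>)))"
    proof (rule nn_integral_FTC_Icc[where F = "\<lambda>x. - 1 / sqrt x"])
      fix x assume x: "x \<in> {norm \<xi>..1}"
      moreover have "norm \<xi> > 0" using that by simp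
      ultimately have "x > 0" by (simp only: atLeastAtMost_iff) linarith
      then show "((\<lambda>x. - 1 / sqrt x) has_real_derivative 1 / (2 * x * sqrt x)) (at x)" "0 \<le> 1 / (2 * x * sqrt x)"
        by (auto intro!: derivative_eq_intros simp: field_simps)
    qed (use that in auto)
    then show ?thesis by simp
  qed
  have "(\<integral>\<^sup>+(\<xi>::'a). ennreal (1 / sqrt (norm \<xi>)) * indicator (cball 0 1) \<xi> \<partial>lborel) \<le>
      (\<integral>\<^sup>+(\<xi>::'a). indicator (cball 0 1) \<xi> + (\<integral>\<^sup>+s. ennreal (1 / (2 * s * sqrt s)) * indicator {norm \<xi>..1} s \<partial>lborel) \<partial>lborel)"
  proof (rule nn_integral_mono_AE)
    have "ennreal (1 / sqrt (norm \<xi>)) * indicator (cball 0 1) \<xi> \<le>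
       indicator (cball 0 1) \<xi> + (\<integral>\<^sup>+s. ennreal (1 / (2 * s * sqrt s)) * indicator {norm \<xi>..1} s \<partial>lborel)" if "\<xi> \<noteq> 0" for \<xi> :: 'a
    proof (cases "norm \<xi> \<le> 1")
      case True
      have "1 \<le> 1 / sqrt (norm \<xi>)" using True that by simp
      then have "1 + ennreal (1 / sqrt (norm \<xi>) - 1) = ennreal (1 / sqrt (norm \<xi>))"
        unfolding ennreal_1[symmetric] by (subst ennreal_plus[symmetric]) auto
      then show ?thesis using True inner[OF that True] by simp
    qed simp
    then show "AE \<xi> in lborel. ennreal (1 / sqrt (norm (\<xi>::'a))) * indicator (cball 0 1) \<xi> \<le>
       indicator (cball 0 1) \<xi> + (\<integral>\<^sup>+s. ennreal (1 / (2 * s * sqrt s)) * indicator {norm \<xi>..1} s \<partial>lborel)"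
      using AE_lborel_nonzero by (auto elim!: eventually_mono)
  qed
  also have "\<dots> = emeasure lborel (cball (0::'a) 1) +
      (\<integral>\<^sup>+(\<xi>::'a). (\<integral>\<^sup>+s. ennreal (1 / (2 * s * sqrt s)) * indicator {norm \<xi>..1} s \<partial>lborel) \<partial>lborel)"
  proof (subst nn_integral_add)
    have "(\<lambda>\<xi>::'a. \<integral>\<^sup>+s. ennreal (1 / (2 * s * sqrt s)) * (if norm \<xi> \<le> s \<and> s \<le> 1 then 1 else 0) \<partial>lborel) \<in> borel_measurable lborel"
      by measurable
    also have "(\<lambda>\<xi>::'a. \<integral>\<^sup>+s. ennreal (1 / (2 * s * sqrt s)) * (if norm \<xi> \<le> s \<and> s \<le> 1 then 1 else 0) \<partial>lborel) =
        (\<lambda>\<xi>. \<integral>\<^sup>+s. ennreal (1 / (2 * s * sqrt s)) * indicator {norm \<xi>..1} s \<partial>lborel)"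
      by (intro ext nn_integral_cong) (auto simp: indicator_def)
    finally show "(\<lambda>\<xi>::'a. \<integral>\<^sup>+s. ennreal (1 / (2 * s * sqrt s)) * indicator {norm \<xi>..1} s \<partial>lborel) \<in> borel_measurable lborel" .
  qed auto
  also have "(\<integral>\<^sup>+(\<xi>::'a). (\<integral>\<^sup>+s. ennreal (1 / (2 * s * sqrt s)) * indicator {norm \<xi>..1} s \<partial>lborel) \<partial>lborel) =
      (\<integral>\<^sup>+s. ennreal (1 / (2 * s * sqrt s)) * ennreal (?v * s ^ ?N) * indicator {0..1} s \<partial>lborel)"
    by (rule nn_integral_radial_layers) measurable
  also have "\<dots> \<le> (\<integral>\<^sup>+s. ennreal (?v / (2 * sqrt s)) * indicator {0..1} s \<partial>lborel)"
  proof (rule nn_integral_mono)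
    fix s :: real
    show "ennreal (1 / (2 * s * sqrt s)) * ennreal (?v * s ^ ?N) * indicator {0..1} s \<le> ennreal (?v / (2 * sqrt s)) * indicator {0..1} s"
    proof (cases "0 < s \<and> s \<le> 1")
      case True
      have "s ^ ?N = s * s ^ (?N - 1)" using N by (metis power_eq_if less_not_refl)
      then have "1 / (2 * s * sqrt s) * (?v * s ^ ?N) = ?v / (2 * sqrt s) * s ^ (?N - 1)"
        using True by simp
      also have "\<dots> \<le> ?v / (2 * sqrt s) * 1"
        using True by (intro mult_left_mono power_le_one) auto
      finally show ?thesis using True by (simp add: ennreal_mult[symmetric] ennreal_leI)
    qed (auto simp: indicator_def)
  qed
  also have "\<dots> = ennreal (?v * sqrt 1 - ?v * sqrt 0)"
  proof (rule nn_integral_has_integral_lebesgue')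
    show "((\<lambda>s. ?v / (2 * sqrt s)) has_integral ?v * sqrt 1 - ?v * sqrt 0) {0..1}"
    proof (rule fundamental_theorem_of_calculus_interior)
      show "continuous_on {0..1} (\<lambda>s. ?v * sqrt s)" by (intro continuous_intros)
      fix x :: real assume "x \<in> {0<..<1}"
      then have "((\<lambda>s. ?v * sqrt s) has_real_derivative ?v / (2 * sqrt x)) (at x)"
        by (auto intro!: derivative_eq_intros simp: field_simps)
      then show "((\<lambda>s. ?v * sqrt s) has_vector_derivative ?v / (2 * sqrt x)) (at x)"
        by (simp add: has_real_derivative_iff_has_vector_derivative)
    qed simp
  qed auto
  finally have "(\<integral>\<^sup>+(\<xi>::'a). ennreal (1 / sqrt (norm \<xi>)) * indicator (cball 0 1) \<xi> \<partial>lborel) \<le>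
      emeasure lborel (cball (0::'a) 1) + ennreal (?v * sqrt 1 - ?v * sqrt 0)"
    by (simp add: add_left_mono)
  also have "\<dots> < \<infinity>"
    using emeasure_lborel_cball_less_top[of "0::'a" 1] by (simp add: less_top)
  finally show ?thesis .
qed

lemma integrable_log_power_cball:
  "integrable lborel (\<lambda>\<xi>::'a::euclidean_space. (1 - 2 * ln (norm \<xi>)) ^ j * indicator (cball 0 1) \<xi>)"
proof (rule integrableI_bounded)
  \<comment> \<open>\<open>power_le_fact_exp\<close> at a quarter of
    \<open>1 - 2 * ln (norm \<xi>)\<close>: the exponential of that quarter is
    \<open>exp (1 / 4)\<close> times \<open>1 / sqrt (norm \<xi>)\<close>.\<close>
  define C where "C = 4 ^ j * fact j * exp (1 / 4 :: real)"
  have C: "C \<ge> 0" by (simp add: C_def)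
  have "norm ((1 - 2 * ln (norm \<xi>)) ^ j * indicator (cball 0 1) \<xi>) \<le> C * (1 / sqrt (norm \<xi>)) * indicator (cball 0 1) \<xi>"
    if "\<xi> \<noteq> 0" for \<xi> :: 'a
  proof (cases "norm \<xi> \<le> 1")
    case True
    have "ln (norm \<xi>) \<le> 0" using True that by simp
    then have l: "1 - 2 * ln (norm \<xi>) \<ge> 0" by simp
    have "(1 - 2 * ln (norm \<xi>)) ^ j = 4 ^ j * ((1 - 2 * ln (norm \<xi>)) / 4) ^ j"
      by (simp add: power_divide)
    also have "\<dots> \<le> 4 ^ j * (fact j * exp ((1 - 2 * ln (norm \<xi>)) / 4))"
      using l by (intro mult_left_mono power_le_fact_exp) auto
    also have "exp ((1 - 2 * ln (norm \<xi>)) / 4) = exp (1 / 4) * (1 / sqrt (norm \<xi>))"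
    proof -
      have "(1 - 2 * ln (norm \<xi>)) / 4 = 1 / 4 - ln (norm \<xi>) / 2" by simp
      also have "ln (norm \<xi>) / 2 = ln (sqrt (norm \<xi>))"
        using that by (simp add: ln_sqrt)
      finally have "exp ((1 - 2 * ln (norm \<xi>)) / 4) = exp (1 / 4 - ln (sqrt (norm \<xi>)))" by (rule arg_cong)
      then show ?thesis using that by (simp only: exp_diff exp_ln real_sqrt_gt_zero zero_less_norm_iff) simp
    qed
    finally show ?thesis using True l by (simp add: C_def)
  qed simp
  then have "(\<integral>\<^sup>+(\<xi>::'a). ennreal (norm ((1 - 2 * ln (norm \<xi>)) ^ j * indicator (cball 0 1) \<xi>)) \<partial>lborel) \<le>
      (\<integral>\<^sup>+(\<xi>::'a). ennreal C * (ennreal (1 / sqrt (norm \<xi>)) * indicator (cball 0 1) \<xi>) \<partial>lborel)"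
    using AE_lborel_nonzero C
    by (intro nn_integral_mono_AE)
       (auto elim!: eventually_mono simp: ennreal_mult[symmetric] ennreal_indicator[symmetric] mult.assoc intro!: ennreal_leI)
  also have "\<dots> = ennreal C * (\<integral>\<^sup>+(\<xi>::'a). (ennreal (1 / sqrt (norm \<xi>)) * indicator (cball 0 1) \<xi>) \<partial>lborel)"
    by (rule nn_integral_cmult) measurable
  also have "\<dots> < \<infinity>"
    using nn_integral_inverse_sqrt_norm[where 'a='a] by (simp add: ennreal_mult_less_top)
  finally show "(\<integral>\<^sup>+(\<xi>::'a). ennreal (norm ((1 - 2 * ln (norm \<xi>)) ^ j * indicator (cball 0 1) \<xi>)) \<partial>lborel) < \<infinity>" .
qed measurable

lemma
  shows integrable_neg_ln_norm: "integrable lborel (\<lambda>\<xi>::'a::euclidean_space. - ln (norm \<xi>) * indicator (cball 0 1) \<xi>)"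
    and integral_neg_ln_norm: "(LINT \<xi>::'a|lborel. - ln (norm \<xi>) * indicator (cball 0 1) \<xi>) =
      unit_ball_vol (real DIM('a)) / real DIM('a)"
proof -
  have nn: "0 \<le> - ln (norm \<xi>) * indicator (cball 0 1) \<xi>" for \<xi> :: 'a
    by (cases "\<xi> = 0") (auto simp: indicator_def)
  have eq: "(\<integral>\<^sup>+(\<xi>::'a). ennreal (- ln (norm \<xi>) * indicator (cball 0 1) \<xi>) \<partial>lborel) =
      ennreal (unit_ball_vol (real DIM('a)) / real DIM('a))"
    unfolding nn_integral_neg_ln_norm[symmetric]
    by (intro nn_integral_cong) (simp add: indicator_def)
  show "integrable lborel (\<lambda>\<xi>::'a. - ln (norm \<xi>) * indicator (cball 0 1) \<xi>)"
  proof (rule integrableI_nonneg)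
    show "(\<integral>\<^sup>+\<xi>. ennreal (- ln (norm \<xi>) * indicator (cball 0 1) \<xi>) \<partial>(lborel :: 'a measure)) < \<infinity>"
      unfolding eq by simp
  qed (use nn in \<open>measurable, auto\<close>)
  show "(LINT \<xi>::'a|lborel. - ln (norm \<xi>) * indicator (cball 0 1) \<xi>) = unit_ball_vol (real DIM('a)) / real DIM('a)"
    by (subst integral_eq_nn_integral) (use eq nn in \<open>measurable, auto\<close>)
qed

section \<open>The rescaled symbol and its integrals\<close>

lemma abs_power_diff_le:
  fixes a b K :: real
  assumes "\<bar>a\<bar> \<le> K" "\<bar>b\<bar> \<le> K"
  shows "\<bar>a ^ m - b ^ m\<bar> \<le> real m * \<bar>a - b\<bar> * K ^ (m - 1)"
proof -
  have "\<bar>\<Sum>i<m. b ^ (m - Suc i) * a ^ i\<bar> \<le> (\<Sum>i<m. K ^ (m - 1))"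
  proof (rule order_trans[OF sum_abs sum_mono])
    fix i assume i: "i \<in> {..<m}"
    have "\<bar>b ^ (m - Suc i) * a ^ i\<bar> = \<bar>b\<bar> ^ (m - Suc i) * \<bar>a\<bar> ^ i"
      by (simp add: abs_mult power_abs)
    also have "\<dots> \<le> K ^ (m - Suc i) * K ^ i"
      using assms by (intro mult_mono power_mono) auto
    also have "\<dots> = K ^ (m - 1)"
      using i by (simp add: power_add[symmetric])
    finally show "\<bar>b ^ (m - Suc i) * a ^ i\<bar> \<le> K ^ (m - 1)" .
  qed
  then have "\<bar>a - b\<bar> * \<bar>\<Sum>i<m. b ^ (m - Suc i) * a ^ i\<bar> \<le> \<bar>a - b\<bar> * (real m * K ^ (m - 1))"
    by (intro mult_left_mono) auto
  then show ?thesis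
    by (simp add: power_diff_sumr2[of a m b] abs_mult mult_ac)
qed

text \<open>Under the dilation by \<open>exp (s / 2)\<close>, the difference of \<open>s ^ m\<close>
  and the symbol becomes \<open>s ^ (m - 1)\<close> times this function. The normalisation leaves
  the finite limit \<open>- 2 * real m * ln (norm \<eta>)\<close> as \<open>s\<close> grows.\<close>

definition log_gap :: "nat \<Rightarrow> real \<Rightarrow> 'a::euclidean_space \<Rightarrow> real" where
  "log_gap m s \<eta> = (s ^ m - (s + 2 * ln (norm \<eta>)) ^ m) / s ^ (m - 1)"

lemma measurable_log_gap [measurable]: "log_gap m s \<in> borel_measurable borel"
  unfolding log_gap_def[abs_def] by measurable

text \<open>A majorant independent of \<open>s\<close>, as dominated convergence requires. With
  \<open>l = - 2 * ln (norm \<eta>)\<close>, the factor \<open>s + l\<close> is at most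
  \<open>s * (1 + l)\<close> because \<open>s\<close> is at least 1, and the powers of
  \<open>s\<close> cancel.\<close>

lemma log_gap_bound:
  assumes s: "s \<ge> 1" and \<eta>: "norm \<eta> \<le> 1"
  shows "\<bar>log_gap m s \<eta>\<bar> \<le> real m * (1 - 2 * ln (norm \<eta>)) ^ m"
proof (cases "m = 0")
  case False
  define l where "l = - 2 * ln (norm \<eta>)"
  \<comment> \<open>The convention \<open>ln 0 = 0\<close> takes care of the origin.\<close>
  have l: "l \<ge> 0" using \<eta> by (cases "\<eta> = 0") (auto simp: l_def)
  have "\<bar>s ^ m - (s - l) ^ m\<bar> \<le> real m * \<bar>s - (s - l)\<bar> * (s + l) ^ (m - 1)"
    using s l by (intro abs_power_diff_le) auto
  also have "\<dots> \<le> real m * (1 + l) * (s * (1 + l)) ^ (m - 1)"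
    using s l by (intro mult_mono power_mono) (auto simp: algebra_simps mult_le_cancel_left1 mult_le_cancel_right1)
  also have "\<dots> = s ^ (m - 1) * (real m * ((1 + l) * (1 + l) ^ (m - 1)))"
    by (simp add: power_mult_distrib)
  also have "(1 + l) * (1 + l) ^ (m - 1) = (1 + l) ^ m"
    using False by (metis power_eq_if)
  finally have "\<bar>s ^ m - (s - l) ^ m\<bar> / s ^ (m - 1) \<le> real m * (1 + l) ^ m"
    using s by (simp add: divide_simps mult.commute)
  then show ?thesis using s by (simp add: log_gap_def l_def)
qed (simp add: log_gap_def)

text \<open>The difference of powers has the factor \<open>l\<close>; each of the \<open>m\<close>
  summands left over, divided by \<open>s ^ (m - 1)\<close>, tends to 1. The number \<open>l\<close>
  may have either sign.\<close>

lemma power_gap_tendsto: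
  fixes l :: real
  shows "((\<lambda>s. (s ^ m - (s - l) ^ m) / s ^ (m - 1)) \<longlongrightarrow> real m * l) at_top"
proof -
  have 1: "((\<lambda>s. (s - l) / s) \<longlongrightarrow> 1) at_top"
    by real_asymp
  have "((\<lambda>s. l * (\<Sum>i<m. ((s - l) / s) ^ (m - Suc i))) \<longlongrightarrow> l * (\<Sum>i<m. 1 ^ (m - Suc i))) at_top"
    by (intro tendsto_intros 1)
  moreover have "\<forall>\<^sub>F s in at_top. l * (\<Sum>i<m. ((s - l) / s) ^ (m - Suc i)) = (s ^ m - (s - l) ^ m) / s ^ (m - 1)"
    using eventually_gt_at_top[of 0]
  proof eventually_elim
    case (elim s)
    have "s ^ m - (s - l) ^ m = l * (\<Sum>i<m. (s - l) ^ (m - Suc i) * s ^ i)"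
      by (simp add: power_diff_sumr2[of s m "s - l"])
    moreover have "(\<Sum>i<m. (s - l) ^ (m - Suc i) * s ^ i) / s ^ (m - 1) = (\<Sum>i<m. ((s - l) / s) ^ (m - Suc i))"
      unfolding sum_divide_distrib
    proof (intro sum.cong refl)
      fix i assume i: "i \<in> {..<m}"
      have "s ^ (m - 1) = s ^ (m - Suc i) * s ^ i"
        using i by (simp add: power_add[symmetric])
      then show "(s - l) ^ (m - Suc i) * s ^ i / s ^ (m - 1) = ((s - l) / s) ^ (m - Suc i)"
        using elim by (simp add: power_divide)
    qed
    ultimately show ?case by (simp only: times_divide_eq_right[symmetric])
  qed
  ultimately have "((\<lambda>s. (s ^ m - (s - l) ^ m) / s ^ (m - 1)) \<longlongrightarrow> l * (\<Sum>i<m. 1 ^ (m - Suc i))) at_top"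
    using tendsto_cong by fast
  then show ?thesis by (simp add: mult_ac)
qed

lemma log_gap_tendsto:
  "((\<lambda>s. log_gap m s \<eta>) \<longlongrightarrow> - 2 * real m * ln (norm \<eta>)) at_top"
  using power_gap_tendsto[of m "- 2 * ln (norm \<eta>)"] by (simp add: log_gap_def mult_ac)

lemma integrable_log_gap_dominated:
  assumes [measurable]: "f \<in> borel_measurable borel"
    and "s \<ge> 1" "\<And>\<eta>. \<bar>f \<eta>\<bar> \<le> \<bar>log_gap m s \<eta>\<bar> * indicator (cball 0 1) \<eta>"
  shows "integrable lborel (f :: 'a::euclidean_space \<Rightarrow> real)"
proof (rule Bochner_Integration.integrable_bound)
  show "integrable lborel (\<lambda>\<eta>::'a. real m * ((1 - 2 * ln (norm \<eta>)) ^ m * indicator (cball 0 1) \<eta>))"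
    by (intro integrable_mult_right integrable_log_power_cball)
  have "\<bar>f \<eta>\<bar> \<le> real m * ((1 - 2 * ln (norm \<eta>)) ^ m * indicator (cball 0 1) \<eta>)" for \<eta>
    using assms(3)[of \<eta>] log_gap_bound[OF assms(2), of \<eta> m] by (auto simp: indicator_def split: if_splits)
  then show "AE \<eta> in lborel. norm (f \<eta>) \<le> norm (real m * ((1 - 2 * ln (norm \<eta>)) ^ m * indicator (cball 0 1) \<eta>))"
    by (intro AE_I2) (metis abs_ge_self order_trans real_norm_def)
qed simp

text \<open>One limit for both bounds: the upper one integrates the positive part of the gap, the
  lower one the gap itself away from the origin. The limits agree because
  \<open>- ln (norm \<eta>)\<close> is positive inside the unit ball.\<close>

lemma log_gap_integral_tendsto:
  fixes f :: "real \<Rightarrow> 'a::euclidean_space \<Rightarrow> real"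
  assumes [measurable]: "\<And>s. f s \<in> borel_measurable borel"
    and b: "\<And>s \<eta>. s \<ge> 1 \<Longrightarrow> \<bar>f s \<eta>\<bar> \<le> \<bar>log_gap m s \<eta>\<bar> * indicator (cball 0 1) \<eta>"
    and l: "\<And>\<eta>. \<eta> \<noteq> 0 \<Longrightarrow> norm \<eta> < 1 \<Longrightarrow> \<forall>\<^sub>F s in at_top. f s \<eta> = log_gap m s \<eta> \<or> f s \<eta> = max 0 (log_gap m s \<eta>)"
  shows "((\<lambda>s. LINT \<eta>|lborel. f s \<eta>) \<longlongrightarrow> 2 * real m * unit_ball_vol (real DIM('a)) / real DIM('a)) at_top"
proof -
  have "((\<lambda>s. LINT \<eta>|lborel. f s \<eta>) \<longlongrightarrow> (LINT \<eta>::'a|lborel. 2 * real m * (- ln (norm \<eta>) * indicator (cball 0 1) \<eta>))) at_top"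
  proof (rule integral_dominated_convergence_at_top)
    show "integrable lborel (\<lambda>\<eta>::'a. real m * ((1 - 2 * ln (norm \<eta>)) ^ m * indicator (cball 0 1) \<eta>))"
      by (intro integrable_mult_right integrable_log_power_cball)
    show "\<forall>\<^sub>F s in at_top. AE \<eta> in lborel. norm (f s \<eta>) \<le> real m * ((1 - 2 * ln (norm \<eta>)) ^ m * indicator (cball 0 1) \<eta>)"
      using eventually_ge_at_top[of 1]
    proof eventually_elim
      case (elim s)
      have "\<bar>f s \<eta>\<bar> \<le> real m * ((1 - 2 * ln (norm \<eta>)) ^ m * indicator (cball 0 1) \<eta>)" for \<eta>
        using b[OF elim, of \<eta>] log_gap_bound[OF elim, of \<eta> m] by (auto simp: indicator_def split: if_splits)
      then show ?case by simp
    qed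
    have lim: "((\<lambda>s. f s \<eta>) \<longlongrightarrow> 2 * real m * (- ln (norm \<eta>) * indicator (cball 0 1) \<eta>)) at_top"
      if \<eta>: "\<eta> \<noteq> 0" "norm \<eta> \<noteq> 1" for \<eta>
    proof (cases "norm \<eta> < 1")
      case True
      let ?L = "- 2 * real m * ln (norm \<eta>)"
      have L: "?L \<ge> 0" using True \<eta> by (simp add: mult_nonneg_nonpos)
      have g: "((\<lambda>s. log_gap m s \<eta>) \<longlongrightarrow> ?L) at_top" by (rule log_gap_tendsto)
      have g': "((\<lambda>s. max 0 (log_gap m s \<eta>)) \<longlongrightarrow> ?L) at_top"
        using tendsto_max[OF tendsto_const[of 0] g] L by (simp add: max_absorb2)
      have "((\<lambda>s. f s \<eta>) \<longlongrightarrow> ?L) at_top"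
      proof (rule tendstoI)
        fix e :: real assume "e > 0"
        from tendstoD[OF g this] tendstoD[OF g' this] l[OF \<eta>(1) True]
        show "\<forall>\<^sub>F s in at_top. dist (f s \<eta>) ?L < e"
          by eventually_elim auto
      qed
      then show ?thesis using True by simp
    next
      case False
      then have "\<eta> \<notin> cball 0 1" using \<eta> by auto
      moreover have "\<forall>\<^sub>F s in at_top. f s \<eta> = 0"
        using eventually_ge_at_top[of 1]
        by eventually_elim (use b[of _ \<eta>] \<open>\<eta> \<notin> cball 0 1\<close> in fastforce)
      ultimately show ?thesis by (simp add: tendsto_eventually)
    qed
    have "AE \<eta> in lborel. \<eta> \<notin> sphere (0::'a) 1"
      using negligible_sphere[of "0::'a" 1]
      by (intro AE_not_in) (auto simp: null_sets_completion_iff negligible_iff_null_sets)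
    with AE_lborel_nonzero
    show "AE \<eta> in lborel. ((\<lambda>s. f s \<eta>) \<longlongrightarrow> 2 * real m * (- ln (norm \<eta>) * indicator (cball 0 1) \<eta>)) at_top"
      by eventually_elim (use lim in auto)
  qed measurable
  also have "(LINT \<eta>::'a|lborel. 2 * real m * (- ln (norm \<eta>) * indicator (cball 0 1) \<eta>)) =
      2 * real m * (unit_ball_vol (real DIM('a)) / real DIM('a))"
    by (subst integral_mult_right_zero) (simp only: integral_neg_ln_norm)
  finally show ?thesis by simp
qed

definition log_symbol :: "nat \<Rightarrow> 'a::euclidean_space \<Rightarrow> real" where
  "log_symbol m \<xi> = (2 * ln (norm \<xi>)) ^ m"

lemma measurable_log_symbol [measurable]: "log_symbol m \<in> borel_measurable borel"
  unfolding log_symbol_def[abs_def] by measurable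

lemma log_symbol_scaled:
  assumes "\<eta> \<noteq> 0" "s > 0"
  shows "s ^ m - log_symbol m (exp (s / 2) *\<^sub>R \<eta>) = s ^ (m - 1) * log_gap m s \<eta>"
proof -
  have "2 * ln (norm (exp (s / 2) *\<^sub>R \<eta>)) = s + 2 * ln (norm \<eta>)"
    using assms by (simp add: ln_mult)
  then show ?thesis using assms by (simp add: log_symbol_def log_gap_def)
qed

text \<open>The exponential in the theorem is the Jacobian of the dilation by
  \<open>exp (s / 2)\<close>, the radius at which the symbol reaches \<open>s ^ m\<close>.\<close>

lemma log_symbol_integral_scaled:
  fixes F :: "'a::euclidean_space \<Rightarrow> real"
  assumes [measurable]: "F \<in> borel_measurable borel" "G \<in> borel_measurable borel"
    and eq: "\<And>\<eta>. \<eta> \<noteq> 0 \<Longrightarrow> F (exp (s / 2) *\<^sub>R \<eta>) = c * G \<eta>"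
    and G: "integrable lborel G"
  shows "integrable lborel F" "(LINT \<xi>|lborel. F \<xi>) = exp (real DIM('a) / 2 * s) * c * (LINT \<eta>|lborel. G \<eta>)"
proof -
  have ae: "AE \<eta> in lborel. F (exp (s / 2) *\<^sub>R \<eta>) = c * G \<eta>"
    using AE_lborel_nonzero eq by (auto elim!: eventually_mono)
  have "integrable lborel (\<lambda>\<eta>. c * G \<eta>)" using G by simp
  then have "integrable lborel (\<lambda>\<eta>. F (exp (s / 2) *\<^sub>R \<eta>))"
    by (subst integrable_cong_AE[OF _ _ ae]) auto
  from lborel_integrable_affine_euclidean[OF this, of "exp (- s / 2)" 0]
  show "integrable lborel F"
    by (simp add: exp_add[symmetric])
  have "(LINT \<xi>|lborel. F \<xi>) = exp (s / 2) ^ DIM('a) * (LINT \<eta>|lborel. F (exp (s / 2) *\<^sub>R \<eta>))"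
    by (subst lborel_integral_affine_euclidean[of _ "exp (s / 2)" 0]) auto
  also have "(LINT \<eta>|lborel. F (exp (s / 2) *\<^sub>R \<eta>)) = c * (LINT \<eta>|lborel. G \<eta>)"
    using integral_cong_AE[OF _ _ ae] by simp
  also have "exp (s / 2) ^ DIM('a) = exp (real DIM('a) / 2 * s)"
    by (simp add: exp_of_nat_mult[symmetric])
  finally show "(LINT \<xi>|lborel. F \<xi>) = exp (real DIM('a) / 2 * s) * c * (LINT \<eta>|lborel. G \<eta>)"
    by simp
qed

lemma berezin_upper_integral:
  assumes m: "m \<ge> 1"
  obtains U :: "real \<Rightarrow> real" where
    "\<And>s. s \<ge> 1 \<Longrightarrow> integrable lborel (\<lambda>\<xi>::'a::euclidean_space. max 0 (s ^ m - log_symbol m \<xi>))"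
    "\<And>s. s \<ge> 1 \<Longrightarrow> (LINT \<xi>::'a|lborel. max 0 (s ^ m - log_symbol m \<xi>)) =
      exp (real DIM('a) / 2 * s) * s ^ (m - 1) * U s"
    "(U \<longlongrightarrow> 2 * real m * unit_ball_vol (real DIM('a)) / real DIM('a)) at_top"
proof -
  define f where "f = (\<lambda>s (\<eta>::'a). max 0 (log_gap m s \<eta>) * indicator (cball 0 1) \<eta>)"
  have [measurable]: "f s \<in> borel_measurable borel" for s
    unfolding f_def by measurable
  have fb: "\<bar>f s \<eta>\<bar> \<le> \<bar>log_gap m s \<eta>\<bar> * indicator (cball 0 1) \<eta>" for s \<eta>
    by (auto simp: f_def indicator_def)
  have eq: "max 0 (s ^ m - log_symbol m (exp (s / 2) *\<^sub>R \<eta>)) = s ^ (m - 1) * f s \<eta>" if "\<eta> \<noteq> 0" "s \<ge> 1" for s and \<eta> :: 'a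
  proof -
    have "s ^ m - log_symbol m (exp (s / 2) *\<^sub>R \<eta>) = s ^ (m - 1) * log_gap m s \<eta>"
      using that by (intro log_symbol_scaled) auto
    moreover have "max 0 (s ^ (m - 1) * log_gap m s \<eta>) = s ^ (m - 1) * max 0 (log_gap m s \<eta>)"
      using that by (simp add: max_mult_distrib_left)
    \<comment> \<open>Beyond the unit sphere \<open>s + 2 * ln (norm \<eta>)\<close> is at least
      \<open>s\<close>, so the positive part lives on the unit ball alone.\<close>
    moreover have "log_gap m s \<eta> \<le> 0" if "norm \<eta> > 1"
      using that \<open>s \<ge> 1\<close> power_mono[of s "s + 2 * ln (norm \<eta>)" m]
      by (simp add: log_gap_def divide_le_0_iff)
    ultimately show ?thesis
      by (cases "norm \<eta> \<le> 1") (auto simp: f_def indicator_def)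
  qed
  have int: "integrable lborel (f s)" if "s \<ge> 1" for s
    by (rule integrable_log_gap_dominated[OF _ that fb]) auto
  show ?thesis
  proof (rule that[of "\<lambda>s. LINT \<eta>|lborel. f s \<eta>"])
    fix s :: real assume s: "s \<ge> 1"
    show "integrable lborel (\<lambda>\<xi>::'a. max 0 (s ^ m - log_symbol m \<xi>))"
      by (rule log_symbol_integral_scaled(1)[where c = "s ^ (m - 1)" and G = "f s"])
         (use eq s int in auto)
    show "(LINT \<xi>::'a|lborel. max 0 (s ^ m - log_symbol m \<xi>)) =
      exp (real DIM('a) / 2 * s) * s ^ (m - 1) * (LINT \<eta>|lborel. f s \<eta>)"
      by (rule log_symbol_integral_scaled(2)) (use eq s int in auto)
  next
    show "((\<lambda>s. LINT \<eta>|lborel. f s \<eta>) \<longlongrightarrow> 2 * real m * unit_ball_vol (real DIM('a)) / real DIM('a)) at_top"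
      by (rule log_gap_integral_tendsto[OF _ fb]) (auto simp: f_def)
  qed
qed

text \<open>The inner radius is a compromise. It is so large that a shift by \<zeta> changes the
  logarithm by at most \<bar>\<zeta>\<bar> \<open>exp (- s / 4)\<close>, yet it rescales to
  \<open>exp (- s / 4)\<close>, so the omitted ball is negligible. At the outer radius the symbol
  equals \<open>s ^ m\<close>.\<close>

definition log_annulus :: "real \<Rightarrow> 'a::euclidean_space set" where
  "log_annulus s = {\<xi>. exp (s / 4) < norm \<xi> \<and> norm \<xi> \<le> exp (s / 2)}"

lemma log_annulus_measurable [measurable]: "log_annulus s \<in> sets borel"
  unfolding log_annulus_def by measurable

lemma berezin_lower_integral:
  obtains U :: "real \<Rightarrow> real" where
    "\<And>s. s \<ge> 1 \<Longrightarrow> integrable lborel (\<lambda>\<xi>::'a::euclidean_space. (s ^ m - log_symbol m \<xi>) * indicator (log_annulus s) \<xi>)"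
    "\<And>s. s \<ge> 1 \<Longrightarrow> (LINT \<xi>::'a|lborel. (s ^ m - log_symbol m \<xi>) * indicator (log_annulus s) \<xi>) =
      exp (real DIM('a) / 2 * s) * s ^ (m - 1) * U s"
    "(U \<longlongrightarrow> 2 * real m * unit_ball_vol (real DIM('a)) / real DIM('a)) at_top"
proof -
  define f where "f = (\<lambda>s (\<eta>::'a). log_gap m s \<eta> * indicator {\<eta>. exp (- s / 4) < norm \<eta> \<and> norm \<eta> \<le> 1} \<eta>)"
  have [measurable]: "f s \<in> borel_measurable borel" for s
    unfolding f_def by measurable
  have fb: "\<bar>f s \<eta>\<bar> \<le> \<bar>log_gap m s \<eta>\<bar> * indicator (cball 0 1) \<eta>" for s \<eta>
    by (auto simp: f_def indicator_def)
  have eq: "(s ^ m - log_symbol m (exp (s / 2) *\<^sub>R \<eta>)) * indicator (log_annulus s) (exp (s / 2) *\<^sub>R \<eta>) = s ^ (m - 1) * f s \<eta>"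
    if "\<eta> \<noteq> 0" "s \<ge> 1" for s and \<eta> :: 'a
  proof -
    have "exp (s / 4) < exp (s / 2) * norm \<eta> \<longleftrightarrow> exp (- s / 4) < norm \<eta>"
    proof -
      have "exp (- s / 4) = exp (s / 4) / exp (s / 2)" by (simp add: exp_diff[symmetric])
      show ?thesis unfolding \<open>exp (- s / 4) = exp (s / 4) / exp (s / 2)\<close>
        by (simp add: divide_less_eq mult.commute)
    qed
    then show ?thesis
      using log_symbol_scaled[of \<eta> s m] that by (auto simp: f_def log_annulus_def indicator_def)
  qed
  have int: "integrable lborel (f s)" if "s \<ge> 1" for s
    by (rule integrable_log_gap_dominated[OF _ that fb]) auto
  show ?thesis
  proof (rule that[of "\<lambda>s. LINT \<eta>|lborel. f s \<eta>"])
    fix s :: real assume s: "s \<ge> 1"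
    show "integrable lborel (\<lambda>\<xi>::'a. (s ^ m - log_symbol m \<xi>) * indicator (log_annulus s) \<xi>)"
      by (rule log_symbol_integral_scaled(1)[where c = "s ^ (m - 1)" and G = "f s"])
         (use eq s int in auto)
    show "(LINT \<xi>::'a|lborel. (s ^ m - log_symbol m \<xi>) * indicator (log_annulus s) \<xi>) =
      exp (real DIM('a) / 2 * s) * s ^ (m - 1) * (LINT \<eta>|lborel. f s \<eta>)"
      by (rule log_symbol_integral_scaled(2)) (use eq s int in auto)
  next
    show "((\<lambda>s. LINT \<eta>|lborel. f s \<eta>) \<longlongrightarrow> 2 * real m * unit_ball_vol (real DIM('a)) / real DIM('a)) at_top"
    proof (rule log_gap_integral_tendsto[OF _ fb])
      fix \<eta> :: 'a assume \<eta>: "\<eta> \<noteq> 0" "norm \<eta> < 1"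
      have "((\<lambda>s. exp (- s / 4)) \<longlongrightarrow> (0::real)) at_top" by real_asymp
      then have "\<forall>\<^sub>F s in at_top. exp (- s / 4) < norm \<eta>"
        using \<eta> by (intro order_tendstoD(2)) auto
      then show "\<forall>\<^sub>F s in at_top. f s \<eta> = log_gap m s \<eta> \<or> f s \<eta> = max 0 (log_gap m s \<eta>)"
        by eventually_elim (use \<eta> in \<open>auto simp: f_def\<close>)
    qed measurable
  qed
qed

section \<open>The weight of the norm compared with the symbol\<close>

definition ip :: "('a::euclidean_space \<Rightarrow> real) \<Rightarrow> ('a \<Rightarrow> real) \<Rightarrow> real" where
  "ip u v = (LINT x|lborel. u x * v x)"

definition log_weight :: "nat \<Rightarrow> 'a::euclidean_space \<Rightarrow> real" where
  "log_weight m \<xi> = (ln (exp 1 + norm \<xi>)) ^ m"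

lemma measurable_log_weight [measurable]: "log_weight m \<in> borel_measurable borel"
  unfolding log_weight_def[abs_def] by measurable

lemma one_le_ln_exp_plus:
  fixes r :: real
  assumes "0 \<le> r"
  shows "1 \<le> ln (exp 1 + r)"
proof -
  have "exp 1 + r > 0" using assms by (intro add_pos_nonneg) auto
  then show ?thesis using assms by (simp add: ln_ge_iff)
qed

lemma log_weight_ge_1: "1 \<le> log_weight m \<xi>"
  unfolding log_weight_def by (intro one_le_power one_le_ln_exp_plus) simp

lemma log_weight_le_quadratic: "log_weight m \<xi> \<le> 4 * fact m * (1 + (norm \<xi>)\<^sup>2)"
proof -
  have pos: "exp 1 + norm \<xi> > 0" by (intro add_pos_nonneg) auto
  have "log_weight m \<xi> \<le> fact m * exp (ln (exp 1 + norm \<xi>))"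
    unfolding log_weight_def using one_le_ln_exp_plus[of "norm \<xi>"] by (intro power_le_fact_exp) auto
  also have "\<dots> = fact m * (exp 1 + norm \<xi>)" using pos by simp
  also have "exp 1 + norm \<xi> \<le> 4 * (1 + (norm \<xi>)\<^sup>2)"
  proof -
    have "2 * norm \<xi> \<le> 1 + (norm \<xi>)\<^sup>2"
      using zero_le_power2[of "norm \<xi> - 1"] unfolding power2_diff by simp
    then have "exp 1 + norm \<xi> \<le> 3 + (1 + (norm \<xi>)\<^sup>2)"
      using exp_le norm_ge_zero[of \<xi>] by (intro add_mono) linarith+
    also have "\<dots> \<le> 4 * (1 + (norm \<xi>)\<^sup>2)" by simp
    finally show ?thesis .
  qed
  finally show ?thesis by (simp add: mult_ac)
qed

lemma power_add_le_max:
  fixes a b :: real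
  assumes "0 \<le> a" "0 \<le> b"
  shows "(a + b) ^ m \<le> 2 ^ m * (a ^ m + b ^ m)"
proof -
  have "(a + b) ^ m \<le> (2 * max a b) ^ m" using assms by (intro power_mono) auto
  also have "\<dots> = 2 ^ m * max a b ^ m" by (rule power_mult_distrib)
  also have "\<dots> \<le> 2 ^ m * (a ^ m + b ^ m)"
    using assms by (intro mult_left_mono) (auto simp: max_def)
  finally show ?thesis .
qed

text \<open>For \<open>r > 1\<close> the sum \<open>exp 1 + r\<close> is at most
  \<open>exp 2 * r\<close>, so its logarithm is at most \<open>2 + ln r\<close>. This is the source
  of the coercivity of the form.\<close>

lemma log_weight_le_symbol:
  assumes "norm \<xi> > 1"
  shows "log_weight m \<xi> \<le> 2 ^ m * (2 ^ m + log_symbol m \<xi>)"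
proof -
  have "exp 1 + norm \<xi> \<le> exp 2 * norm \<xi>"
  proof -
    have "exp 1 + norm \<xi> \<le> exp 1 * norm \<xi> + exp 1 * norm \<xi>"
      using assms by (intro add_mono) (auto simp: mult_le_cancel_left1 mult_le_cancel_right1)
    also have "\<dots> = exp 1 * 2 * norm \<xi>" by simp
    also have "\<dots> \<le> exp 1 * exp 1 * norm \<xi>"
      using exp_ge_add_one_self[of "1::real"] assms by (intro mult_right_mono mult_left_mono) auto
    also have "exp 1 * exp 1 = exp (2::real)" by (simp add: exp_add[symmetric])
    finally show ?thesis .
  qed
  then have "ln (exp 1 + norm \<xi>) \<le> ln (exp 2 * norm \<xi>)"
    using assms by (intro ln_mono) (auto intro: add_pos_nonneg)
  also have "\<dots> = 2 + ln (norm \<xi>)" using assms by (subst ln_mult) auto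
  also have "\<dots> \<le> 2 + 2 * ln (norm \<xi>)" using assms by simp
  finally have "log_weight m \<xi> \<le> (2 + 2 * ln (norm \<xi>)) ^ m"
    unfolding log_weight_def using one_le_ln_exp_plus[of "norm \<xi>"] by (intro power_mono) auto
  also have "\<dots> \<le> 2 ^ m * (2 ^ m + (2 * ln (norm \<xi>)) ^ m)"
    using assms by (intro power_add_le_max) auto
  finally show ?thesis by (simp add: log_symbol_def)
qed

lemma log_symbol_le_weight:
  assumes "norm \<xi> > 1"
  shows "0 \<le> log_symbol m \<xi>" "log_symbol m \<xi> \<le> 2 ^ m * log_weight m \<xi>"
proof -
  show "0 \<le> log_symbol m \<xi>" using assms by (simp add: log_symbol_def)
  have "ln (norm \<xi>) \<le> ln (exp 1 + norm \<xi>)" using assms by (intro ln_mono) auto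
  then show "log_symbol m \<xi> \<le> 2 ^ m * log_weight m \<xi>"
    unfolding log_symbol_def log_weight_def power_mult_distrib[symmetric] using assms by (intro power_mono) auto
qed

lemma integrable_log_symbol_cball:
  "integrable lborel (\<lambda>\<xi>::'a::euclidean_space. \<bar>log_symbol m \<xi>\<bar> * indicator (cball 0 1) \<xi>)"
proof (rule Bochner_Integration.integrable_bound[OF integrable_log_power_cball[of m]])
  have "\<bar>log_symbol m \<xi>\<bar> * indicator (cball 0 1) \<xi> \<le> (1 - 2 * ln (norm \<xi>)) ^ m * indicator (cball 0 1) \<xi>" for \<xi> :: 'a
  proof (cases "norm \<xi> \<le> 1")
    case True
    then have "ln (norm \<xi>) \<le> 0" by (cases "\<xi> = 0") auto
    then have "\<bar>2 * ln (norm \<xi>)\<bar> ^ m \<le> (1 - 2 * ln (norm \<xi>)) ^ m"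
      by (intro power_mono) auto
    then show ?thesis using True by (simp add: log_symbol_def power_abs[symmetric] del: power_mult_distrib)
  qed simp
  then show "AE \<xi> in lborel. norm (\<bar>log_symbol m (\<xi>::'a)\<bar> * indicator (cball 0 1) \<xi>) \<le>
      norm ((1 - 2 * ln (norm \<xi>)) ^ m * indicator (cball 0 1) \<xi>)"
    by (intro AE_I2) (smt (verit) abs_ge_zero indicator_pos_le mult_nonneg_nonneg real_norm_def)
qed measurable

subsection \<open>Linear combinations of test functions\<close>

lemma foldr_partial_deriv_lincomb:
  assumes "smooth f" "smooth g" "set bs \<subseteq> Basis"
  shows "foldr partial_deriv bs (\<lambda>x. a * f x + b * g x) =
    (\<lambda>x. a * foldr partial_deriv bs f x + b * foldr partial_deriv bs g x)"
  using assms(3)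
proof (induction bs)
  case (Cons c bs)
  let ?F = "foldr partial_deriv bs f" and ?G = "foldr partial_deriv bs g"
  have "(?F has_derivative frechet_derivative ?F (at x)) (at x)" "(?G has_derivative frechet_derivative ?G (at x)) (at x)" for x
    using Cons.prems assms(1,2) unfolding smooth_def by (auto simp: frechet_derivative_works[symmetric])
  then have "((\<lambda>x. a * ?F x + b * ?G x) has_derivative
      (\<lambda>h. a * frechet_derivative ?F (at x) h + b * frechet_derivative ?G (at x) h)) (at x)" for x
    by (intro has_derivative_add has_derivative_mult_right)
  from frechet_derivative_at[OF this, symmetric] show ?case
    using Cons by (simp add: partial_deriv_def[abs_def])
qed simp

lemma smooth_lincomb:
  assumes "smooth f" "smooth g"
  shows "smooth (\<lambda>x. a * f x + b * g x)"
  unfolding smooth_def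
proof (intro allI impI)
  fix bs :: "'a list" and x :: 'a assume bs: "set bs \<subseteq> Basis"
  show "foldr partial_deriv bs (\<lambda>x. a * f x + b * g x) differentiable at x"
    unfolding foldr_partial_deriv_lincomb[OF assms bs]
    using assms bs unfolding smooth_def by (intro derivative_intros) auto
qed

lemma test_functions_lincomb:
  assumes "f \<in> test_functions \<Omega>" "g \<in> test_functions \<Omega>"
  shows "(\<lambda>x. a * f x + b * g x) \<in> test_functions \<Omega>"
proof -
  let ?K = "closure {x. f x \<noteq> 0} \<union> closure {x. g x \<noteq> 0}"
  have K: "compact ?K" "?K \<subseteq> \<Omega>" using assms by (auto simp: test_functions_def)
  have sub: "closure {x. a * f x + b * g x \<noteq> 0} \<subseteq> ?K"
  proof (rule closure_minimal)
    show "{x. a * f x + b * g x \<noteq> 0} \<subseteq> ?K"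
    proof
      fix x assume "x \<in> {x. a * f x + b * g x \<noteq> 0}"
      then have "x \<in> {x. f x \<noteq> 0} \<or> x \<in> {x. g x \<noteq> 0}" by auto
      then show "x \<in> ?K"
        using subsetD[OF closure_subset, of x "{x. f x \<noteq> 0}"] subsetD[OF closure_subset, of x "{x. g x \<noteq> 0}"] by (elim disjE) simp_all
    qed
    show "closed ?K" by auto
  qed
  then have "compact (closure {x. a * f x + b * g x \<noteq> 0})"
    using K(1) by (meson bounded_subset closed_closure compact_eq_bounded_closed)
  then show ?thesis
    using sub K assms smooth_lincomb[of f g a b] by (auto simp: test_functions_def)
qed

subsection \<open>The form domain\<close>

lemma log_norm_sq_eq: "log_norm_sq m u = (\<integral>\<^sup>+\<xi>. ennreal (log_weight m \<xi> * (cmod (fourier u \<xi>))\<^sup>2) \<partial>lborel)"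
  by (simp add: log_norm_sq_def log_weight_def)

lemma log_norm_sq_lincomb:
  assumes u: "integrable lborel u" and v: "integrable lborel v"
  shows "log_norm_sq m (\<lambda>x. a * u x + b * v x) \<le> ennreal (2 * a\<^sup>2) * log_norm_sq m u + ennreal (2 * b\<^sup>2) * log_norm_sq m v"
proof -
  have [measurable]: "u \<in> borel_measurable borel" "v \<in> borel_measurable borel" using u v by auto
  have "log_norm_sq m (\<lambda>x. a * u x + b * v x) \<le>
      (\<integral>\<^sup>+\<xi>. ennreal (2 * a\<^sup>2) * ennreal (log_weight m \<xi> * (cmod (fourier u \<xi>))\<^sup>2) + ennreal (2 * b\<^sup>2) * ennreal (log_weight m \<xi> * (cmod (fourier v \<xi>))\<^sup>2) \<partial>lborel)"
    unfolding log_norm_sq_eq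
  proof (rule nn_integral_mono)
    fix \<xi> :: 'a
    have w: "0 \<le> log_weight m \<xi>" using log_weight_ge_1[of m \<xi>] by simp
    have "cmod (fourier (\<lambda>x. a * u x + b * v x) \<xi>) \<le> \<bar>a\<bar> * cmod (fourier u \<xi>) + \<bar>b\<bar> * cmod (fourier v \<xi>)"
      unfolding fourier_lincomb[OF u v] by (rule norm_triangle_le) (simp add: norm_mult)
    then have "(cmod (fourier (\<lambda>x. a * u x + b * v x) \<xi>))\<^sup>2 \<le> (\<bar>a\<bar> * cmod (fourier u \<xi>) + \<bar>b\<bar> * cmod (fourier v \<xi>))\<^sup>2"
      by (intro power_mono) auto
    also have "\<dots> \<le> 2 * a\<^sup>2 * (cmod (fourier u \<xi>))\<^sup>2 + 2 * b\<^sup>2 * (cmod (fourier v \<xi>))\<^sup>2"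
      using sq_add_le[of 1 "\<bar>a\<bar> * cmod (fourier u \<xi>)" "\<bar>b\<bar> * cmod (fourier v \<xi>)"] by (simp add: power_mult_distrib)
    finally have "log_weight m \<xi> * (cmod (fourier (\<lambda>x. a * u x + b * v x) \<xi>))\<^sup>2 \<le>
        log_weight m \<xi> * (2 * a\<^sup>2 * (cmod (fourier u \<xi>))\<^sup>2 + 2 * b\<^sup>2 * (cmod (fourier v \<xi>))\<^sup>2)"
      using w by (intro mult_left_mono)
    also have "\<dots> = 2 * a\<^sup>2 * (log_weight m \<xi> * (cmod (fourier u \<xi>))\<^sup>2) + 2 * b\<^sup>2 * (log_weight m \<xi> * (cmod (fourier v \<xi>))\<^sup>2)"
      by (simp add: algebra_simps)
    finally have "ennreal (log_weight m \<xi> * (cmod (fourier (\<lambda>x. a * u x + b * v x) \<xi>))\<^sup>2) \<le>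
       ennreal (2 * a\<^sup>2 * (log_weight m \<xi> * (cmod (fourier u \<xi>))\<^sup>2) + 2 * b\<^sup>2 * (log_weight m \<xi> * (cmod (fourier v \<xi>))\<^sup>2))"
      by (rule ennreal_leI)
    also have "\<dots> = ennreal (2 * a\<^sup>2) * ennreal (log_weight m \<xi> * (cmod (fourier u \<xi>))\<^sup>2) + ennreal (2 * b\<^sup>2) * ennreal (log_weight m \<xi> * (cmod (fourier v \<xi>))\<^sup>2)"
      using w by (subst ennreal_plus) (auto simp: ennreal_mult[symmetric])
    finally show "ennreal (log_weight m \<xi> * (cmod (fourier (\<lambda>x. a * u x + b * v x) \<xi>))\<^sup>2) \<le>
       ennreal (2 * a\<^sup>2) * ennreal (log_weight m \<xi> * (cmod (fourier u \<xi>))\<^sup>2) + ennreal (2 * b\<^sup>2) * ennreal (log_weight m \<xi> * (cmod (fourier v \<xi>))\<^sup>2)" .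
  qed
  also have "\<dots> = ennreal (2 * a\<^sup>2) * log_norm_sq m u + ennreal (2 * b\<^sup>2) * log_norm_sq m v"
    unfolding log_norm_sq_eq by (subst nn_integral_add) (auto simp: nn_integral_cmult)
  finally show ?thesis .
qed

lemma test_function_log_norm_sq:
  fixes f :: "'a::euclidean_space \<Rightarrow> real"
  assumes "f \<in> test_functions \<Omega>"
  shows "log_norm_sq m f < \<infinity>"
proof -
  note [measurable] = test_function_integrable(1)[OF assms]
  have "log_norm_sq m f \<le> (\<integral>\<^sup>+\<xi>. ennreal (4 * fact m * ((1 + (norm \<xi>)\<^sup>2) * (cmod (fourier f \<xi>))\<^sup>2)) \<partial>lborel)"
    unfolding log_norm_sq_eq
    using mult_right_mono[OF log_weight_le_quadratic zero_le_power2]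
    by (intro nn_integral_mono ennreal_leI) (simp add: mult.assoc)
  also have "\<dots> < \<infinity>"
    using integrable_mult_right[OF test_function_fourier_decay[OF assms], of "4 * fact m"]
    by (subst nn_integral_eq_integral) auto
  finally show ?thesis .
qed

lemma measurable_cnj [measurable]: "cnj \<in> borel_measurable borel"
  by (intro borel_measurable_continuous_onI continuous_intros)

text \<open>Boundedness embeds \<open>L2\<close> into the integrable functions, which makes the
  transforms bounded and equicontinuous. Nonemptiness provides infinitely many orthonormal
  functions, and \<open>m_pos\<close> makes the weight tend to infinity, whence compactness.\<close>

locale log_domain =
  fixes \<Omega> :: "'a::euclidean_space set" and m :: nat
  assumes open_\<Omega>: "open \<Omega>" and bounded_\<Omega>: "bounded \<Omega>" and nonempty_\<Omega>: "\<Omega> \<noteq> {}" and m_pos: "1 \<le> m"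
begin

abbreviation L2 :: "('a \<Rightarrow> real) set" where "L2 \<equiv> L2_zero_ext \<Omega>"
abbreviation H :: "('a \<Rightarrow> real) set" where "H \<equiv> log_sobolev m \<Omega>"

definition rad :: real where "rad = (SOME R. 0 < R \<and> (\<forall>x\<in>\<Omega>. norm x \<le> R))"

lemma rad: "0 < rad" "x \<in> \<Omega> \<Longrightarrow> norm x \<le> rad"
proof -
  have "\<exists>R. 0 < R \<and> (\<forall>x\<in>\<Omega>. norm x \<le> R)"
    using bounded_\<Omega> by (simp add: bounded_pos)
  then have "0 < rad \<and> (\<forall>x\<in>\<Omega>. norm x \<le> rad)"
    unfolding rad_def by (rule someI_ex)
  then show "0 < rad" "x \<in> \<Omega> \<Longrightarrow> norm x \<le> rad" by auto
qed

lemma sets_\<Omega> [measurable]: "\<Omega> \<in> sets borel"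
  using open_\<Omega> by simp

lemma L2_D:
  assumes "u \<in> L2"
  shows L2_measurable: "u \<in> borel_measurable borel"
    and L2_zero: "x \<notin> \<Omega> \<Longrightarrow> u x = 0"
    and L2_zero_rad: "norm x > rad \<Longrightarrow> u x = 0"
    and L2_sq_integrable: "integrable lborel (\<lambda>x. (u x)\<^sup>2)"
    and L2_integrable: "integrable lborel u"
proof -
  show 1: "u \<in> borel_measurable borel" "x \<notin> \<Omega> \<Longrightarrow> u x = 0" "integrable lborel (\<lambda>x. (u x)\<^sup>2)" for x
    using assms by (auto simp: L2_zero_ext_def)
  show 2: "norm x > rad \<Longrightarrow> u x = 0" for x
    using 1(2)[of x] rad(2)[of x] by force
  show "integrable lborel u"
    by (rule integrable_of_sq_integrable[OF 1(1,3) 2])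
qed

lemma L2_mult_integrable:
  assumes "u \<in> L2" "v \<in> L2"
  shows "integrable lborel (\<lambda>x. u x * v x)"
proof (rule Bochner_Integration.integrable_bound)
  note [measurable] = assms[THEN L2_measurable]
  show "integrable lborel (\<lambda>x. (u x)\<^sup>2 + (v x)\<^sup>2)"
    using assms L2_sq_integrable by auto
  have "\<bar>a * b\<bar> \<le> a\<^sup>2 + b\<^sup>2" for a b :: real
    using zero_le_power2[of "\<bar>a\<bar> - \<bar>b\<bar>"] mult_nonneg_nonneg[OF abs_ge_zero[of a] abs_ge_zero[of b]]
    unfolding power2_diff abs_mult power2_abs by linarith
  then show "AE x in lborel. norm (u x * v x) \<le> norm ((u x)\<^sup>2 + (v x)\<^sup>2)" by simp
  show "(\<lambda>x. u x * v x) \<in> borel_measurable lborel" by measurable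
qed

lemma L2_lincomb:
  assumes "u \<in> L2" "v \<in> L2"
  shows "(\<lambda>x. a * u x + b * v x) \<in> L2"
proof -
  note [measurable] = assms[THEN L2_measurable]
  have "(\<lambda>x. (a * u x + b * v x)\<^sup>2) = (\<lambda>x. a\<^sup>2 * (u x)\<^sup>2 + 2 * a * b * (u x * v x) + b\<^sup>2 * (v x)\<^sup>2)"
    by (simp add: power2_eq_square algebra_simps fun_eq_iff)
  moreover have "integrable lborel (\<lambda>x. a\<^sup>2 * (u x)\<^sup>2 + 2 * a * b * (u x * v x) + b\<^sup>2 * (v x)\<^sup>2)"
    by (intro Bochner_Integration.integrable_add integrable_mult_right L2_sq_integrable L2_mult_integrable assms)
  moreover have "(\<lambda>x. a * u x + b * v x) \<in> borel_measurable borel" by measurable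
  moreover have "a * u x + b * v x = 0" if "x \<notin> \<Omega>" for x
    using L2_zero[OF assms(1) that] L2_zero[OF assms(2) that] by simp
  ultimately show ?thesis
    unfolding L2_zero_ext_def by simp
qed

lemma L2_diff: "u \<in> L2 \<Longrightarrow> v \<in> L2 \<Longrightarrow> u - v \<in> L2"
  using L2_lincomb[of u v 1 "-1"] by (simp add: fun_diff_def)

lemma ip_self: "ip u u = (LINT x|lborel. (u x)\<^sup>2)"
  by (simp add: ip_def power2_eq_square)

lemma L2_plancherel:
  assumes "u \<in> L2"
  shows "integrable lborel (\<lambda>\<xi>. (cmod (fourier u \<xi>))\<^sup>2)"
    and "(LINT \<xi>|lborel. (cmod (fourier u \<xi>))\<^sup>2) = (2 * pi) ^ DIM('a) * ip u u"
  using integrable_fourier_sq[OF L2_integrable L2_sq_integrable] plancherel[OF L2_measurable L2_sq_integrable L2_zero_rad] assms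
  by (auto simp: ip_self)

text \<open>The added 1 makes positivity immediate, for the sake of divisions.\<close>

definition volK :: real where "volK = measure lborel \<Omega> + 1"

lemma volK_pos: "volK > 0"
  by (simp add: volK_def add_nonneg_pos)

lemma emeasure_\<Omega>: "emeasure lborel \<Omega> < \<infinity>"
  using bounded_\<Omega> by (rule emeasure_bounded_finite)

text \<open>Cauchy-Schwarz against the indicator of \<Omega>, read off from the nonnegative integral
  of the square of \<bar>u\<bar> minus \<open>t\<close> times the indicator. The chosen
  \<open>t\<close> minimises the resulting quadratic with \<open>volK\<close> as its leading
  coefficient.\<close>

lemma L2_L1_bound:
  assumes "u \<in> L2"
  shows "(LINT x|lborel. \<bar>u x\<bar>)\<^sup>2 \<le> volK * ip u u"
proof -
  note [measurable] = assms[THEN L2_measurable]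
  define t where "t = (LINT x|lborel. \<bar>u x\<bar>) / volK"
  have i\<Omega>: "integrable lborel (indicator \<Omega> :: 'a \<Rightarrow> real)"
    using emeasure_\<Omega> by (intro integrable_real_indicator) auto
  have eq: "(\<bar>u x\<bar> - t * indicator \<Omega> x)\<^sup>2 = (u x)\<^sup>2 - 2 * t * \<bar>u x\<bar> + t\<^sup>2 * indicator \<Omega> x" for x
    using L2_zero[OF assms, of x] by (auto simp: indicator_def power2_eq_square algebra_simps)
  have "0 \<le> (LINT x|lborel. (\<bar>u x\<bar> - t * indicator \<Omega> x)\<^sup>2)" by simp
  also have "\<dots> = ip u u - 2 * t * (LINT x|lborel. \<bar>u x\<bar>) + t\<^sup>2 * measure lborel \<Omega>"
    unfolding eq ip_self using L2_sq_integrable[OF assms] L2_integrable[OF assms] i\<Omega> by simp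
  also have "\<dots> \<le> ip u u - 2 * t * (LINT x|lborel. \<bar>u x\<bar>) + t\<^sup>2 * volK"
    by (intro add_left_mono mult_left_mono) (auto simp: volK_def)
  also have "\<dots> = ip u u - (LINT x|lborel. \<bar>u x\<bar>)\<^sup>2 / volK"
    using volK_pos by (simp add: t_def power2_eq_square field_simps)
  finally show ?thesis using volK_pos by (simp add: field_simps)
qed

text \<open>This uniform bound tames the singularity of the symbol at the origin: it can be taken
  out of integrals over the unit ball of frequencies.\<close>

lemma L2_fourier_bound:
  assumes "u \<in> L2"
  shows "(cmod (fourier u \<xi>))\<^sup>2 \<le> volK * ip u u"
proof -
  have "(cmod (fourier u \<xi>))\<^sup>2 \<le> (LINT x|lborel. \<bar>u x\<bar>)\<^sup>2"
    using cmod_fourier_le[OF L2_integrable[OF assms]] by (intro power_mono) auto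
  also note L2_L1_bound[OF assms]
  finally show ?thesis .
qed

lemma cmod_iexp_diff_le: "cmod (exp (- \<i> * complex_of_real a) - exp (- \<i> * complex_of_real b)) \<le> \<bar>a - b\<bar>"
proof -
  have "exp (- \<i> * complex_of_real a) - exp (- \<i> * complex_of_real b) =
      exp (- \<i> * complex_of_real b) * (exp (\<i> * complex_of_real (b - a)) - 1)"
    by (simp add: algebra_simps exp_add[symmetric] exp_diff[symmetric])
  then have "cmod (exp (- \<i> * complex_of_real a) - exp (- \<i> * complex_of_real b)) = cmod (exp (\<i> * complex_of_real (b - a)) - 1)"
    by (simp add: norm_mult)
  also have "\<dots> = 2 * \<bar>sin ((b - a) / 2)\<bar>" by (rule dist_exp_i_1)
  also have "\<dots> \<le> 2 * \<bar>(b - a) / 2\<bar>" by (intro mult_left_mono abs_sin_x_le_abs_x) auto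
  finally show ?thesis by simp
qed

text \<open>A plane wave on the ball of radius \<open>rad\<close> is Lipschitz in its frequency with
  constant \<open>rad\<close>. Families bounded in \<open>L\<^sup>2\<close> therefore have
  equicontinuous transforms.\<close>

lemma L2_fourier_lipschitz:
  assumes "u \<in> L2"
  shows "cmod (fourier u \<xi> - fourier u \<eta>) \<le> rad * norm (\<xi> - \<eta>) * (LINT x|lborel. \<bar>u x\<bar>)"
proof -
  note u = L2_integrable[OF assms]
  note I = fourier_Re_Im(5)[OF u]
  have "fourier u \<xi> - fourier u \<eta> =
    (LINT x|lborel. (exp (- \<i> * complex_of_real (\<xi> \<bullet> x)) - exp (- \<i> * complex_of_real (\<eta> \<bullet> x))) * complex_of_real (u x))"
    unfolding fourier_def using I by (subst Bochner_Integration.integral_diff[symmetric]) (auto simp: left_diff_distrib)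
  also have "cmod \<dots> \<le> (LINT x|lborel. rad * norm (\<xi> - \<eta>) * \<bar>u x\<bar>)"
  proof (rule Bochner_Integration.integral_norm_bound_integral)
    show "integrable lborel (\<lambda>x. (exp (- \<i> * complex_of_real (\<xi> \<bullet> x)) - exp (- \<i> * complex_of_real (\<eta> \<bullet> x))) * complex_of_real (u x))"
      using Bochner_Integration.integrable_diff[OF I[of \<xi>] I[of \<eta>]] by (simp add: left_diff_distrib)
    show "integrable lborel (\<lambda>x. rad * norm (\<xi> - \<eta>) * \<bar>u x\<bar>)" using u by simp
    fix x
    show "cmod ((exp (- \<i> * complex_of_real (\<xi> \<bullet> x)) - exp (- \<i> * complex_of_real (\<eta> \<bullet> x))) * complex_of_real (u x)) \<le> rad * norm (\<xi> - \<eta>) * \<bar>u x\<bar>"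
    proof (cases "x \<in> \<Omega>")
      case True
      have "\<bar>\<xi> \<bullet> x - \<eta> \<bullet> x\<bar> \<le> norm (\<xi> - \<eta>) * norm x"
        unfolding inner_diff_left[symmetric] by (rule Cauchy_Schwarz_ineq2)
      also have "\<dots> \<le> norm (\<xi> - \<eta>) * rad" using rad(2)[OF True] by (intro mult_left_mono) auto
      finally have "cmod (exp (- \<i> * complex_of_real (\<xi> \<bullet> x)) - exp (- \<i> * complex_of_real (\<eta> \<bullet> x))) \<le> rad * norm (\<xi> - \<eta>)"
        using cmod_iexp_diff_le[of "\<xi> \<bullet> x" "\<eta> \<bullet> x"] by (simp add: mult.commute)
      then show ?thesis unfolding norm_mult by (auto intro: mult_right_mono)
    qed (use L2_zero[OF assms] in simp)
  qed
  finally show ?thesis by simp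
qed

lemma test_functions_L2: "f \<in> test_functions \<Omega> \<Longrightarrow> f \<in> L2"
proof -
  assume f: "f \<in> test_functions \<Omega>"
  have "f x = 0" if "x \<notin> \<Omega>" for x
    using f that closure_subset[of "{x. f x \<noteq> 0}"] by (auto simp: test_functions_def)
  then show ?thesis
    using test_function_integrable[OF f] by (auto simp: L2_zero_ext_def)
qed

lemma H_L2: "u \<in> H \<Longrightarrow> u \<in> L2"
  by (simp add: log_sobolev_def)

lemma H_finite:
  assumes "u \<in> H"
  shows "log_norm_sq m u < \<infinity>"
proof -
  obtain \<phi> where \<phi>: "\<And>n. \<phi> n \<in> test_functions \<Omega>" "(\<lambda>n::nat. log_norm_sq m (\<lambda>x. u x - \<phi> n x)) \<longlonglongrightarrow> 0"
    using assms by (auto simp: log_sobolev_def)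
  have "\<forall>\<^sub>F n in sequentially. log_norm_sq m (\<lambda>x. u x - \<phi> n x) < 1"
    using \<phi>(2) by (rule order_tendstoD) simp
  then obtain n where n: "log_norm_sq m (\<lambda>x. u x - \<phi> n x) < 1"
    by (auto simp: eventually_sequentially)
  have I: "integrable lborel (\<lambda>x. u x - \<phi> n x)" "integrable lborel (\<phi> n)"
    using L2_integrable[OF H_L2[OF assms]] test_function_integrable[OF \<phi>(1)] by auto
  have "log_norm_sq m u \<le> ennreal 2 * log_norm_sq m (\<lambda>x. u x - \<phi> n x) + ennreal 2 * log_norm_sq m (\<phi> n)"
    using log_norm_sq_lincomb[OF I, of m 1 1] by simp
  also have "\<dots> < \<infinity>"
    using test_function_log_norm_sq[OF \<phi>(1), of m n] less_trans[OF n ennreal_one_less_top]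
    by (simp add: ennreal_mult_less_top)
  finally show ?thesis .
qed

lemma test_functions_H: "f \<in> test_functions \<Omega> \<Longrightarrow> f \<in> H"
proof -
  assume f: "f \<in> test_functions \<Omega>"
  have "log_norm_sq m (\<lambda>x. f x - f x) = 0"
    by (simp add: log_norm_sq_eq fourier_def)
  then have "(\<lambda>n::nat. log_norm_sq m (\<lambda>x. f x - f x)) \<longlonglongrightarrow> 0" by simp
  then show ?thesis
    unfolding log_sobolev_def using test_functions_L2[OF f] f by (intro CollectI conjI exI[of _ "\<lambda>_. f"]) auto
qed

lemma H_lincomb:
  assumes u: "u \<in> H" and v: "v \<in> H"
  shows "(\<lambda>x. a * u x + b * v x) \<in> H"
proof -
  obtain \<phi> where \<phi>: "\<And>n. \<phi> n \<in> test_functions \<Omega>" "(\<lambda>n::nat. log_norm_sq m (\<lambda>x. u x - \<phi> n x)) \<longlonglongrightarrow> 0"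
    using u by (auto simp: log_sobolev_def)
  obtain \<psi> where \<psi>: "\<And>n. \<psi> n \<in> test_functions \<Omega>" "(\<lambda>n::nat. log_norm_sq m (\<lambda>x. v x - \<psi> n x)) \<longlonglongrightarrow> 0"
    using v by (auto simp: log_sobolev_def)
  have I: "integrable lborel (\<lambda>x. u x - \<phi> n x)" "integrable lborel (\<lambda>x. v x - \<psi> n x)" for n
    using L2_integrable[OF H_L2[OF u]] L2_integrable[OF H_L2[OF v]] test_function_integrable[OF \<phi>(1)] test_function_integrable[OF \<psi>(1)] by auto
  have "(\<lambda>n. log_norm_sq m (\<lambda>x. (a * u x + b * v x) - (a * \<phi> n x + b * \<psi> n x))) \<longlonglongrightarrow> 0"
  proof (rule tendsto_sandwich[OF _ _ tendsto_const])
    have "(\<lambda>n. ennreal (2 * a\<^sup>2) * log_norm_sq m (\<lambda>x. u x - \<phi> n x) + ennreal (2 * b\<^sup>2) * log_norm_sq m (\<lambda>x. v x - \<psi> n x))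
       \<longlonglongrightarrow> ennreal (2 * a\<^sup>2) * 0 + ennreal (2 * b\<^sup>2) * 0"
      by (intro tendsto_add ennreal_tendsto_cmult \<phi> \<psi>) auto
    then show "(\<lambda>n. ennreal (2 * a\<^sup>2) * log_norm_sq m (\<lambda>x. u x - \<phi> n x) + ennreal (2 * b\<^sup>2) * log_norm_sq m (\<lambda>x. v x - \<psi> n x)) \<longlonglongrightarrow> 0"
      by simp
    have "(\<lambda>x. (a * u x + b * v x) - (a * \<phi> n x + b * \<psi> n x)) = (\<lambda>x. a * (u x - \<phi> n x) + b * (v x - \<psi> n x))" for n
      by (simp add: fun_eq_iff algebra_simps)
    then show "\<forall>\<^sub>F n in sequentially. log_norm_sq m (\<lambda>x. (a * u x + b * v x) - (a * \<phi> n x + b * \<psi> n x)) \<le>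
       ennreal (2 * a\<^sup>2) * log_norm_sq m (\<lambda>x. u x - \<phi> n x) + ennreal (2 * b\<^sup>2) * log_norm_sq m (\<lambda>x. v x - \<psi> n x)"
      using log_norm_sq_lincomb[OF I, of m a _ b] by simp
  qed auto
  then show ?thesis
    unfolding log_sobolev_def using L2_lincomb[OF H_L2[OF u] H_L2[OF v]] test_functions_lincomb[OF \<phi>(1) \<psi>(1)]
    by (intro CollectI conjI exI[of _ "\<lambda>n x. a * \<phi> n x + b * \<psi> n x"]) auto
qed

lemma H_subspace: "subspace H"
proof -
  have w: "(\<lambda>_. 0) \<in> test_functions \<Omega>"
    by (rule test_functions_smooth_alg[OF smooth_alg.const, of "{}"]) auto
  show ?thesis
    unfolding subspace_def
  proof (intro conjI ballI allI)
    show "0 \<in> H"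
      using H_lincomb[OF test_functions_H[OF w] test_functions_H[OF w], of 0 0] by (simp add: zero_fun_def)
    show "u + v \<in> H" if "u \<in> H" "v \<in> H" for u v
      using H_lincomb[OF that, of 1 1] by (simp add: plus_fun_def)
    show "c *\<^sub>R u \<in> H" if "u \<in> H" for u c
      using H_lincomb[OF that that, of c 0] by (simp add: scaleR_fun_def)
  qed
qed

lemma H_diff: "u \<in> H \<Longrightarrow> v \<in> H \<Longrightarrow> u - v \<in> H"
  using H_subspace by (rule subspace_diff)

section \<open>The real form and its equivalence with the norm\<close>

definition wn :: "('a \<Rightarrow> real) \<Rightarrow> real" where
  "wn u = (LINT \<xi>|lborel. log_weight m \<xi> * (cmod (fourier u \<xi>))\<^sup>2)"

lemma H_weight_integrable:
  assumes "u \<in> H"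
  shows "integrable lborel (\<lambda>\<xi>. log_weight m \<xi> * (cmod (fourier u \<xi>))\<^sup>2)" and "log_norm_sq m u = ennreal (wn u)"
proof -
  note [measurable] = L2_measurable[OF H_L2[OF assms]]
  have nn: "0 \<le> log_weight m \<xi> * (cmod (fourier u \<xi>))\<^sup>2" for \<xi>
    using log_weight_ge_1[of m \<xi>] by simp
  show 1: "integrable lborel (\<lambda>\<xi>. log_weight m \<xi> * (cmod (fourier u \<xi>))\<^sup>2)"
    using H_finite[OF assms] nn by (intro integrableI_nonneg) (auto simp: log_norm_sq_eq)
  show "log_norm_sq m u = ennreal (wn u)"
    unfolding log_norm_sq_eq wn_def using nn by (intro nn_integral_eq_integral[OF 1]) auto
qed

lemma wn_nonneg: "0 \<le> wn u"
proof -
  have "0 \<le> log_weight m \<xi> * (cmod (fourier u \<xi>))\<^sup>2" for \<xi>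
    using log_weight_ge_1[of m \<xi>] by simp
  then show ?thesis unfolding wn_def by (rule Bochner_Integration.integral_nonneg)
qed

lemma ip_le_wn:
  assumes "u \<in> H"
  shows "(2 * pi) ^ DIM('a) * ip u u \<le> wn u"
  unfolding L2_plancherel(2)[OF H_L2[OF assms], symmetric] wn_def
proof (intro integral_mono L2_plancherel(1)[OF H_L2[OF assms]] H_weight_integrable(1)[OF assms])
  show "(cmod (fourier u \<xi>))\<^sup>2 \<le> log_weight m \<xi> * (cmod (fourier u \<xi>))\<^sup>2" for \<xi>
    using mult_right_mono[OF log_weight_ge_1[of m \<xi>], of "(cmod (fourier u \<xi>))\<^sup>2"] by simp
qed

text \<open>The real part loses nothing: on \<open>H\<close> the form is real by
  \<open>log_form_real\<close>.\<close>

definition qf :: "('a \<Rightarrow> real) \<Rightarrow> ('a \<Rightarrow> real) \<Rightarrow> real" where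
  "qf u v = Re (log_form m u v)"

definition symK :: real where
  "symK = (LINT \<xi>::'a|lborel. \<bar>log_symbol m \<xi>\<bar> * indicator (cball 0 1) \<xi>)"

lemma symK_nonneg: "0 \<le> symK"
  unfolding symK_def by (intro Bochner_Integration.integral_nonneg) simp

lemma L2_symbol_cball:
  assumes "u \<in> L2"
  shows "integrable lborel (\<lambda>\<xi>. \<bar>log_symbol m \<xi>\<bar> * indicator (cball 0 1) \<xi> * (cmod (fourier u \<xi>))\<^sup>2)"
    and "(LINT \<xi>|lborel. \<bar>log_symbol m \<xi>\<bar> * indicator (cball 0 1) \<xi> * (cmod (fourier u \<xi>))\<^sup>2) \<le> symK * (volK * ip u u)"
proof -
  note [measurable] = L2_measurable[OF assms]
  have le: "\<bar>log_symbol m \<xi>\<bar> * indicator (cball 0 1) \<xi> * (cmod (fourier u \<xi>))\<^sup>2 \<le>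
      \<bar>log_symbol m \<xi>\<bar> * indicator (cball 0 1) \<xi> * (volK * ip u u)" for \<xi>
    using L2_fourier_bound[OF assms] by (intro mult_left_mono) auto
  have I: "integrable lborel (\<lambda>\<xi>::'a. \<bar>log_symbol m \<xi>\<bar> * indicator (cball 0 1) \<xi> * (volK * ip u u))"
    by (intro integrable_mult_left integrable_log_symbol_cball)
  show 1: "integrable lborel (\<lambda>\<xi>. \<bar>log_symbol m \<xi>\<bar> * indicator (cball 0 1) \<xi> * (cmod (fourier u \<xi>))\<^sup>2)"
  proof (rule Bochner_Integration.integrable_bound[OF I])
    show "AE \<xi> in lborel. norm (\<bar>log_symbol m \<xi>\<bar> * indicator (cball 0 1) \<xi> * (cmod (fourier u \<xi>))\<^sup>2) \<le>
        norm (\<bar>log_symbol m \<xi>\<bar> * indicator (cball 0 1) \<xi> * (volK * ip u u))"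
    proof (intro AE_I2)
      fix \<xi> :: 'a
      have "norm (\<bar>log_symbol m \<xi>\<bar> * indicator (cball 0 1) \<xi> * (cmod (fourier u \<xi>))\<^sup>2) = \<bar>log_symbol m \<xi>\<bar> * indicator (cball 0 1) \<xi> * (cmod (fourier u \<xi>))\<^sup>2"
        by (simp add: abs_mult)
      also note le[of \<xi>]
      also note abs_ge_self
      finally show "norm (\<bar>log_symbol m \<xi>\<bar> * indicator (cball 0 1) \<xi> * (cmod (fourier u \<xi>))\<^sup>2) \<le>
        norm (\<bar>log_symbol m \<xi>\<bar> * indicator (cball 0 1) \<xi> * (volK * ip u u))" by simp
    qed
  qed measurable
  have "(LINT \<xi>|lborel. \<bar>log_symbol m \<xi>\<bar> * indicator (cball 0 1) \<xi> * (cmod (fourier u \<xi>))\<^sup>2)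
    \<le> (LINT \<xi>::'a|lborel. \<bar>log_symbol m \<xi>\<bar> * indicator (cball 0 1) \<xi> * (volK * ip u u))"
    by (rule integral_mono[OF 1 I le])
  also have "\<dots> = symK * (volK * ip u u)" by (simp add: symK_def)
  finally show "(LINT \<xi>|lborel. \<bar>log_symbol m \<xi>\<bar> * indicator (cball 0 1) \<xi> * (cmod (fourier u \<xi>))\<^sup>2) \<le> symK * (volK * ip u u)" .
qed

lemma abs_log_symbol_le:
  "\<bar>log_symbol m \<xi>\<bar> \<le> \<bar>log_symbol m \<xi>\<bar> * indicator (cball 0 1) \<xi> + 2 ^ m * log_weight m \<xi>"
proof (cases "norm \<xi> \<le> 1")
  case True
  then show ?thesis using log_weight_ge_1[of m \<xi>] by simp
next
  case False
  then show ?thesis using log_symbol_le_weight[of \<xi> m] by simp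
qed

lemma H_symbol_integrable_abs:
  assumes "u \<in> H"
  shows "integrable lborel (\<lambda>\<xi>. \<bar>log_symbol m \<xi>\<bar> * (cmod (fourier u \<xi>))\<^sup>2)"
    and "(LINT \<xi>|lborel. \<bar>log_symbol m \<xi>\<bar> * (cmod (fourier u \<xi>))\<^sup>2) \<le> symK * (volK * ip u u) + 2 ^ m * wn u"
proof -
  have uL: "u \<in> L2" by (rule H_L2[OF assms])
  note [measurable] = L2_measurable[OF uL]
  let ?g = "\<lambda>\<xi>. \<bar>log_symbol m \<xi>\<bar> * indicator (cball 0 1) \<xi> * (cmod (fourier u \<xi>))\<^sup>2 + 2 ^ m * (log_weight m \<xi> * (cmod (fourier u \<xi>))\<^sup>2)"
  have I: "integrable lborel ?g"
    by (intro Bochner_Integration.integrable_add integrable_mult_right L2_symbol_cball H_weight_integrable uL assms)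
  have le: "\<bar>log_symbol m \<xi>\<bar> * (cmod (fourier u \<xi>))\<^sup>2 \<le> ?g \<xi>" for \<xi>
    using mult_right_mono[OF abs_log_symbol_le[of \<xi>], of "(cmod (fourier u \<xi>))\<^sup>2"] by (simp add: algebra_simps)
  show 1: "integrable lborel (\<lambda>\<xi>. \<bar>log_symbol m \<xi>\<bar> * (cmod (fourier u \<xi>))\<^sup>2)"
  proof (rule Bochner_Integration.integrable_bound[OF I])
    show "AE \<xi> in lborel. norm (\<bar>log_symbol m \<xi>\<bar> * (cmod (fourier u \<xi>))\<^sup>2) \<le> norm (?g \<xi>)"
    proof (intro AE_I2)
      fix \<xi> :: 'a
      have "norm (\<bar>log_symbol m \<xi>\<bar> * (cmod (fourier u \<xi>))\<^sup>2) = \<bar>log_symbol m \<xi>\<bar> * (cmod (fourier u \<xi>))\<^sup>2"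
        by (simp add: abs_mult)
      also note le[of \<xi>]
      also note abs_ge_self
      finally show "norm (\<bar>log_symbol m \<xi>\<bar> * (cmod (fourier u \<xi>))\<^sup>2) \<le> norm (?g \<xi>)" by simp
    qed
  qed measurable
  have "(LINT \<xi>|lborel. \<bar>log_symbol m \<xi>\<bar> * (cmod (fourier u \<xi>))\<^sup>2) \<le> integral\<^sup>L lborel ?g"
    by (rule integral_mono[OF 1 I le])
  also have "\<dots> = (LINT \<xi>|lborel. \<bar>log_symbol m \<xi>\<bar> * indicator (cball 0 1) \<xi> * (cmod (fourier u \<xi>))\<^sup>2) + 2 ^ m * wn u"
    unfolding wn_def using L2_symbol_cball(1)[OF uL] H_weight_integrable(1)[OF assms] by simp
  also have "\<dots> \<le> symK * (volK * ip u u) + 2 ^ m * wn u"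
    using L2_symbol_cball(2)[OF uL] by simp
  finally show "(LINT \<xi>|lborel. \<bar>log_symbol m \<xi>\<bar> * (cmod (fourier u \<xi>))\<^sup>2) \<le> symK * (volK * ip u u) + 2 ^ m * wn u" .
qed

lemma form_integrable:
  assumes "u \<in> H" "v \<in> H"
  shows "integrable lborel (\<lambda>\<xi>. complex_of_real ((2 * ln (norm \<xi>)) ^ m) * fourier u \<xi> * cnj (fourier v \<xi>))"
proof (rule Bochner_Integration.integrable_bound)
  note [measurable] = L2_measurable[OF H_L2[OF assms(1)]] L2_measurable[OF H_L2[OF assms(2)]]
  show "(\<lambda>\<xi>. complex_of_real ((2 * ln (norm \<xi>)) ^ m) * fourier u \<xi> * cnj (fourier v \<xi>)) \<in> borel_measurable lborel"
    by measurable
  show "integrable lborel (\<lambda>\<xi>. \<bar>log_symbol m \<xi>\<bar> * (cmod (fourier u \<xi>))\<^sup>2 + \<bar>log_symbol m \<xi>\<bar> * (cmod (fourier v \<xi>))\<^sup>2)"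
    using assms H_symbol_integrable_abs(1) by (intro Bochner_Integration.integrable_add)
  show "AE \<xi> in lborel. cmod (complex_of_real ((2 * ln (norm \<xi>)) ^ m) * fourier u \<xi> * cnj (fourier v \<xi>)) \<le>
      norm (\<bar>log_symbol m \<xi>\<bar> * (cmod (fourier u \<xi>))\<^sup>2 + \<bar>log_symbol m \<xi>\<bar> * (cmod (fourier v \<xi>))\<^sup>2)"
  proof (intro AE_I2)
    fix \<xi> :: 'a
    have ab: "a * b \<le> a\<^sup>2 + b\<^sup>2" if "0 \<le> a" "0 \<le> b" for a b :: real
      using zero_le_power2[of "a - b"] mult_nonneg_nonneg[OF that] unfolding power2_diff by linarith
    have "cmod (complex_of_real ((2 * ln (norm \<xi>)) ^ m) * fourier u \<xi> * cnj (fourier v \<xi>)) =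
        \<bar>log_symbol m \<xi>\<bar> * (cmod (fourier u \<xi>) * cmod (fourier v \<xi>))"
      unfolding norm_mult complex_mod_cnj norm_of_real by (simp add: log_symbol_def mult.assoc)
    also have "\<dots> \<le> \<bar>log_symbol m \<xi>\<bar> * ((cmod (fourier u \<xi>))\<^sup>2 + (cmod (fourier v \<xi>))\<^sup>2)"
      by (intro mult_left_mono ab) auto
    also have "\<dots> = norm (\<bar>log_symbol m \<xi>\<bar> * (cmod (fourier u \<xi>))\<^sup>2 + \<bar>log_symbol m \<xi>\<bar> * (cmod (fourier v \<xi>))\<^sup>2)"
      by (simp add: distrib_left)
    finally show "cmod (complex_of_real ((2 * ln (norm \<xi>)) ^ m) * fourier u \<xi> * cnj (fourier v \<xi>)) \<le>
      norm (\<bar>log_symbol m \<xi>\<bar> * (cmod (fourier u \<xi>))\<^sup>2 + \<bar>log_symbol m \<xi>\<bar> * (cmod (fourier v \<xi>))\<^sup>2)" .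
  qed
qed

lemma log_form_cnj: "cnj (log_form m u v) = log_form m v u"
proof -
  have "cnj (LINT \<xi>|lborel. complex_of_real ((2 * ln (norm \<xi>)) ^ m) * fourier u \<xi> * cnj (fourier v \<xi>)) =
     (LINT \<xi>|lborel. complex_of_real ((2 * ln (norm \<xi>)) ^ m) * fourier v \<xi> * cnj (fourier u \<xi>))"
    by (subst Bochner_Integration.integral_cnj[symmetric], intro Bochner_Integration.integral_cong refl) (simp add: mult_ac)
  then show ?thesis by (simp add: log_form_def)
qed

text \<open>Real functions satisfy \<open>fourier u (- \<xi>) = cnj (fourier u \<xi>)\<close> and
  the symbol is even, so the substitution of - \<xi> for \<xi> turns the integral into its
  conjugate.\<close>

lemma log_form_real:
  assumes "u \<in> H" "v \<in> H"
  shows "log_form m u v = complex_of_real (qf u v)"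
proof -
  note [measurable] = L2_measurable[OF H_L2[OF assms(1)]] L2_measurable[OF H_L2[OF assms(2)]]
  have "(LINT \<xi>|lborel. complex_of_real ((2 * ln (norm \<xi>)) ^ m) * fourier u \<xi> * cnj (fourier v \<xi>)) =
     (LINT \<xi>|lborel. complex_of_real ((2 * ln (norm (- \<xi>))) ^ m) * fourier u (- \<xi>) * cnj (fourier v (- \<xi>)))"
    by (subst lborel_integral_affine_euclidean[of _ "- 1" 0]) auto
  also have "\<dots> = (LINT \<xi>|lborel. cnj (complex_of_real ((2 * ln (norm \<xi>)) ^ m) * fourier u \<xi> * cnj (fourier v \<xi>)))"
    using assms[THEN H_L2, THEN L2_integrable] by (simp add: fourier_minus_arg)
  also have "\<dots> = cnj (LINT \<xi>|lborel. complex_of_real ((2 * ln (norm \<xi>)) ^ m) * fourier u \<xi> * cnj (fourier v \<xi>))"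
    by (rule Bochner_Integration.integral_cnj)
  finally have "log_form m u v = cnj (log_form m u v)"
    by (simp add: log_form_def)
  then have "Im (log_form m u v) = 0"
    by (metis complex_cnj_cancel_iff cnj.simps(2) neg_equal_zero)
  then show ?thesis by (simp add: qf_def complex_eq_iff)
qed

lemma qf_sym: "qf u v = qf v u"
  unfolding qf_def log_form_cnj[of v u, symmetric] by simp

lemma qf_lincomb:
  assumes "u \<in> H" "v \<in> H" "w \<in> H"
  shows "qf (\<lambda>x. a * u x + b * v x) w = a * qf u w + b * qf v w"
proof -
  note I = form_integrable[OF assms(1,3)] form_integrable[OF assms(2,3)]
  have "(LINT \<xi>|lborel. complex_of_real ((2 * ln (norm \<xi>)) ^ m) * fourier (\<lambda>x. a * u x + b * v x) \<xi> * cnj (fourier w \<xi>)) =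
    (LINT \<xi>|lborel. a * (complex_of_real ((2 * ln (norm \<xi>)) ^ m) * fourier u \<xi> * cnj (fourier w \<xi>)) +
      b * (complex_of_real ((2 * ln (norm \<xi>)) ^ m) * fourier v \<xi> * cnj (fourier w \<xi>)))"
    using assms(1,2)[THEN H_L2, THEN L2_integrable]
    by (intro Bochner_Integration.integral_cong refl) (simp add: fourier_lincomb algebra_simps)
  also have "\<dots> = a * (LINT \<xi>|lborel. complex_of_real ((2 * ln (norm \<xi>)) ^ m) * fourier u \<xi> * cnj (fourier w \<xi>)) +
      b * (LINT \<xi>|lborel. complex_of_real ((2 * ln (norm \<xi>)) ^ m) * fourier v \<xi> * cnj (fourier w \<xi>))"
    using I by simp
  finally have "log_form m (\<lambda>x. a * u x + b * v x) w = a * log_form m u w + b * log_form m v w"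
    unfolding log_form_def by (simp add: algebra_simps)
  then show ?thesis by (simp add: qf_def)
qed

lemma ip_lincomb:
  assumes "u \<in> L2" "v \<in> L2" "w \<in> L2"
  shows "ip (\<lambda>x. a * u x + b * v x) w = a * ip u w + b * ip v w"
proof -
  have "(\<lambda>x. (a * u x + b * v x) * w x) = (\<lambda>x. a * (u x * w x) + b * (v x * w x))"
    by (simp add: fun_eq_iff algebra_simps)
  then show ?thesis
    unfolding ip_def using L2_mult_integrable[OF assms(1,3)] L2_mult_integrable[OF assms(2,3)] by simp
qed

lemma ip_sym: "ip u v = ip v u"
  by (simp add: ip_def mult.commute)

lemma ip_nonneg: "0 \<le> ip u u"
  unfolding ip_self by (rule Bochner_Integration.integral_nonneg) simp

lemma qf_self:
  assumes "u \<in> H"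
  shows "(2 * pi) ^ DIM('a) * qf u u = (LINT \<xi>|lborel. log_symbol m \<xi> * (cmod (fourier u \<xi>))\<^sup>2)"
    and "integrable lborel (\<lambda>\<xi>. log_symbol m \<xi> * (cmod (fourier u \<xi>))\<^sup>2)"
proof -
  have eq: "complex_of_real ((2 * ln (norm \<xi>)) ^ m) * fourier u \<xi> * cnj (fourier u \<xi>) =
      complex_of_real (log_symbol m \<xi> * (cmod (fourier u \<xi>))\<^sup>2)" for \<xi>
    unfolding of_real_mult complex_norm_square log_symbol_def by (simp only: mult.assoc)
  define c where "c = 1 / (2 * pi) ^ DIM('a)"
  have "log_form m u u = complex_of_real (1 / (2 * pi) ^ DIM('a) * (LINT \<xi>|lborel. log_symbol m \<xi> * (cmod (fourier u \<xi>))\<^sup>2))"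
    unfolding log_form_def eq integral_complex_of_real c_def[symmetric] by (rule of_real_mult[symmetric])
  then have "qf u u = 1 / (2 * pi) ^ DIM('a) * (LINT \<xi>|lborel. log_symbol m \<xi> * (cmod (fourier u \<xi>))\<^sup>2)"
    unfolding qf_def by (simp only: Re_complex_of_real)
  then show "(2 * pi) ^ DIM('a) * qf u u = (LINT \<xi>|lborel. log_symbol m \<xi> * (cmod (fourier u \<xi>))\<^sup>2)"
    by simp
  show "integrable lborel (\<lambda>\<xi>. log_symbol m \<xi> * (cmod (fourier u \<xi>))\<^sup>2)"
    using integrable_Re[OF form_integrable[OF assms assms]] unfolding eq by simp
qed

text \<open>Outside the unit ball the weight and the symbol bound each other up to constants.
  Inside, the symbol may be very negative, but its integral against the squared transform is at most
  a multiple of \<open>ip u u\<close>, so a shift by \<open>S\<close> repairs coercivity.\<close>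

lemma qf_equiv_wn:
  obtains S E D where "0 \<le> E" "0 \<le> D" "\<And>u. u \<in> H \<Longrightarrow> ip u u \<le> qf u u + S * ip u u"
    "\<And>u. u \<in> H \<Longrightarrow> wn u \<le> E * (qf u u + S * ip u u)"
    "\<And>u. u \<in> H \<Longrightarrow> qf u u + S * ip u u \<le> D * wn u"
proof -
  let ?c = "(2 * pi) ^ DIM('a)"
  define M where "M = (ln (exp 1 + 1)) ^ m + (2::real) ^ m * 2 ^ m"
  define C where "C = (M * ?c + 2 ^ m * symK * volK) / (2 ^ m * ?c)"
  have c: "?c > 0" by simp
  have M: "M \<ge> 0" unfolding M_def using one_le_ln_exp_plus[of 1] by simp
  have C0: "C \<ge> 0" unfolding C_def using M c symK_nonneg volK_pos by simp
  \<comment> \<open>In the unit ball the modulus cancels a negative symbol, and the first summand of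
    \<open>M\<close> bounds the weight. Outside, the second summand is the constant from
    \<open>log_weight_le_symbol\<close>.\<close>
  have lw: "log_weight m \<xi> \<le> M + 2 ^ m * (log_symbol m \<xi> + \<bar>log_symbol m \<xi>\<bar> * indicator (cball 0 1) \<xi>)" for \<xi> :: 'a
  proof (cases "norm \<xi> \<le> 1")
    case True
    have "log_weight m \<xi> \<le> (ln (exp 1 + 1)) ^ m"
      unfolding log_weight_def using True one_le_ln_exp_plus[of "norm \<xi>"]
      by (intro power_mono ln_mono) (auto intro: add_pos_nonneg)
    also have "\<dots> \<le> M" by (simp add: M_def)
    also have "\<dots> \<le> M + 2 ^ m * (log_symbol m \<xi> + \<bar>log_symbol m \<xi>\<bar> * indicator (cball 0 1) \<xi>)"
      using True by simp
    finally show ?thesis .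
  next
    case False
    then have "log_weight m \<xi> \<le> 2 ^ m * 2 ^ m + 2 ^ m * log_symbol m \<xi>"
      using log_weight_le_symbol[of \<xi> m] by (simp add: distrib_left)
    also have "2 ^ m * 2 ^ m \<le> M" unfolding M_def using one_le_ln_exp_plus[of 1] by simp
    finally show ?thesis using False by simp
  qed
  have w: "wn u \<le> 2 ^ m * ?c * (qf u u + C * ip u u)" if u: "u \<in> H" for u
  proof -
    have uL: "u \<in> L2" by (rule H_L2[OF u])
    note I = L2_plancherel(1)[OF uL] qf_self(2)[OF u] L2_symbol_cball(1)[OF uL]
    have "wn u \<le> (LINT \<xi>|lborel. M * (cmod (fourier u \<xi>))\<^sup>2 + 2 ^ m * (log_symbol m \<xi> * (cmod (fourier u \<xi>))\<^sup>2
        + \<bar>log_symbol m \<xi>\<bar> * indicator (cball 0 1) \<xi> * (cmod (fourier u \<xi>))\<^sup>2))"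
      unfolding wn_def
    proof (intro integral_mono H_weight_integrable(1)[OF u] Bochner_Integration.integrable_add integrable_mult_right I)
      fix \<xi> :: 'a
      show "log_weight m \<xi> * (cmod (fourier u \<xi>))\<^sup>2 \<le> M * (cmod (fourier u \<xi>))\<^sup>2 + 2 ^ m * (log_symbol m \<xi> * (cmod (fourier u \<xi>))\<^sup>2
        + \<bar>log_symbol m \<xi>\<bar> * indicator (cball 0 1) \<xi> * (cmod (fourier u \<xi>))\<^sup>2)"
        using mult_right_mono[OF lw[of \<xi>], of "(cmod (fourier u \<xi>))\<^sup>2"] by (simp add: algebra_simps)
    qed
    also have "\<dots> = M * (?c * ip u u) + 2 ^ m * (?c * qf u u + (LINT \<xi>|lborel. \<bar>log_symbol m \<xi>\<bar> * indicator (cball 0 1) \<xi> * (cmod (fourier u \<xi>))\<^sup>2))"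
      unfolding qf_self(1)[OF u] L2_plancherel(2)[OF uL, symmetric] using I by simp
    also have "\<dots> \<le> M * (?c * ip u u) + 2 ^ m * (?c * qf u u + symK * (volK * ip u u))"
      using L2_symbol_cball(2)[OF uL] by simp
    also have "\<dots> = 2 ^ m * ?c * (qf u u + C * ip u u)"
      using c by (simp add: C_def field_simps)
    finally show ?thesis .
  qed
  show ?thesis
  \<comment> \<open>The shift exceeds the coercivity constant \<open>C\<close> by 1, so that the
    shifted form dominates \<open>ip\<close> itself. The second constant gathers the estimates of
    \<open>qf u u\<close> and of \<open>(C + 1) * ip u u\<close>, with \<open>ip\<close> bounded by
    \<open>wn\<close> through \<open>ip_le_wn\<close>.\<close>
  proof (rule that[of "2 ^ m * ?c" "(symK * volK + 2 ^ m * ?c + C * ?c + ?c) / (?c * ?c)" "C + 1"])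
    show "0 \<le> 2 ^ m * ?c" by simp
    show "0 \<le> (symK * volK + 2 ^ m * ?c + C * ?c + ?c) / (?c * ?c)"
      using symK_nonneg volK_pos C0 c by (intro add_nonneg_nonneg divide_nonneg_nonneg mult_nonneg_nonneg) auto
    fix u assume u: "u \<in> H"
    have "0 \<le> 2 ^ m * ?c * (qf u u + C * ip u u)" using w[OF u] wn_nonneg[of u] by linarith
    moreover have "2 ^ m * ?c > 0" using c by (intro mult_pos_pos) auto
    ultimately have 0: "0 \<le> qf u u + C * ip u u" by (simp only: zero_le_mult_iff) linarith
    then show "ip u u \<le> qf u u + (C + 1) * ip u u" by (simp add: distrib_right)
    have "wn u \<le> 2 ^ m * ?c * (qf u u + C * ip u u)" by (rule w[OF u])
    also have "\<dots> \<le> 2 ^ m * ?c * (qf u u + (C + 1) * ip u u)"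
      using c ip_nonneg[of u] by (intro mult_left_mono) (auto simp: distrib_right)
    finally show "wn u \<le> 2 ^ m * ?c * (qf u u + (C + 1) * ip u u)" .
    have ipw: "ip u u \<le> wn u / ?c" using ip_le_wn[OF u] c by (simp add: pos_le_divide_eq mult.commute)
    have "?c * qf u u \<le> (LINT \<xi>|lborel. \<bar>log_symbol m \<xi>\<bar> * (cmod (fourier u \<xi>))\<^sup>2)"
      unfolding qf_self(1)[OF u]
      by (intro integral_mono qf_self(2)[OF u] H_symbol_integrable_abs(1)[OF u] mult_right_mono) auto
    also have "\<dots> \<le> symK * (volK * ip u u) + 2 ^ m * wn u" by (rule H_symbol_integrable_abs(2)[OF u])
    also have "\<dots> \<le> symK * (volK * (wn u / ?c)) + 2 ^ m * wn u"
      using ipw symK_nonneg volK_pos by (intro add_right_mono mult_left_mono) auto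
    finally have "qf u u \<le> (symK * (volK * (wn u / ?c)) + 2 ^ m * wn u) / ?c"
      using c by (simp add: pos_le_divide_eq mult.commute)
    moreover have "(C + 1) * ip u u \<le> (C + 1) * (wn u / ?c)"
      using ipw C0 by (intro mult_left_mono) auto
    ultimately have "qf u u + (C + 1) * ip u u \<le> (symK * (volK * (wn u / ?c)) + 2 ^ m * wn u) / ?c + (C + 1) * (wn u / ?c)"
      by linarith
    also have "\<dots> = ((symK * volK + 2 ^ m * ?c + C * ?c + ?c) / (?c * ?c)) * wn u"
      using c by (simp add: field_simps)
    finally show "qf u u + (C + 1) * ip u u \<le> ((symK * volK + 2 ^ m * ?c + C * ?c + ?c) / (?c * ?c)) * wn u" .
  qed
qed

section \<open>Compactness and completeness of the form domain\<close>

lemma H_integrable: "u \<in> H \<Longrightarrow> integrable lborel u"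
  by (rule L2_integrable[OF H_L2])

text \<open>The Arzela-Ascoli argument: the transforms are uniformly bounded and uniformly
  Lipschitz, a diagonal subsequence converges on a countable dense set, and equicontinuity carries
  convergence to every frequency.\<close>

lemma H_pointwise_subsequence:
  fixes u :: "nat \<Rightarrow> 'a \<Rightarrow> real"
  assumes u: "\<And>n. u n \<in> H" and C: "\<And>n. ip (u n) (u n) \<le> C"
  obtains r where "strict_mono (r::nat\<Rightarrow>nat)" "\<And>\<xi>. convergent (\<lambda>n. fourier (u (r n)) \<xi>)"
proof -
  define M where "M = sqrt (volK * C)"
  have L1: "(LINT x|lborel. \<bar>u n x\<bar>) \<le> M" for n
  proof -
    have "(LINT x|lborel. \<bar>u n x\<bar>)\<^sup>2 \<le> volK * C"
      by (rule order_trans[OF L2_L1_bound[OF H_L2[OF u]] mult_left_mono[OF C less_imp_le[OF volK_pos]]])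
    then show ?thesis unfolding M_def by (rule real_le_rsqrt)
  qed
  have M0: "0 \<le> M"
    by (rule order_trans[OF Bochner_Integration.integral_nonneg L1[of 0]]) simp
  have b: "norm (fourier (u n) \<xi>) \<le> M" for n \<xi>
    by (rule order_trans[OF cmod_fourier_le[OF H_integrable[OF u]] L1])
  have lip: "norm (fourier (u n) \<xi> - fourier (u n) \<eta>) \<le> rad * M * norm (\<xi> - \<eta>)" for n \<xi> \<eta>
  proof -
    have "norm (fourier (u n) \<xi> - fourier (u n) \<eta>) \<le> rad * norm (\<xi> - \<eta>) * (LINT x|lborel. \<bar>u n x\<bar>)"
      by (rule L2_fourier_lipschitz[OF H_L2[OF u]])
    also have "\<dots> \<le> rad * norm (\<xi> - \<eta>) * M"
      using rad(1) L1 by (intro mult_left_mono) auto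
    finally show ?thesis by (simp add: mult_ac)
  qed
  obtain D :: "'a set" where D: "countable D" "\<And>X. open X \<Longrightarrow> X \<noteq> {} \<Longrightarrow> \<exists>d\<in>D. d \<in> X"
    by (rule countable_dense_setE) blast
  obtain r where r: "strict_mono (r::nat\<Rightarrow>nat)" and rl: "\<And>\<xi>. \<xi> \<in> D \<Longrightarrow> \<exists>l. (\<lambda>n. fourier (u (r n)) \<xi>) \<longlonglongrightarrow> l"
    using function_convergent_subsequence[OF D(1), of "\<lambda>n. fourier (u n)" M] b by metis
  have "Cauchy (\<lambda>n. fourier (u (r n)) \<xi>)" for \<xi>
  proof (rule metric_CauchyI)
    fix e :: real assume e: "e > 0"
    \<comment> \<open>At this distance the Lipschitz bound costs at most \<open>e / 4\<close> at
      each end, leaving room for the difference at the dense point. The \<open>+ 1\<close> keeps the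
      divisor positive.\<close>
    define d where "d = e / (4 * (rad * M + 1))"
    have p: "rad * M + 1 > 0" using rad(1) M0 by (simp add: add_nonneg_pos)
    have d: "d > 0" using e p by (simp add: d_def)
    obtain \<eta> where \<eta>: "\<eta> \<in> D" "\<eta> \<in> ball \<xi> d"
      using D(2)[of "ball \<xi> d"] d by auto
    have close: "norm (fourier (u n) \<xi> - fourier (u n) \<eta>) \<le> e / 4" for n
    proof -
      have "norm (fourier (u n) \<xi> - fourier (u n) \<eta>) \<le> rad * M * norm (\<xi> - \<eta>)" by (rule lip)
      also have "\<dots> \<le> (rad * M + 1) * d"
        using \<eta>(2) rad(1) M0 p d by (intro mult_mono) (auto simp: dist_norm)
      also have "\<dots> = e / 4"
      proof -
        have "q * (e / (4 * q)) = e / 4" if "q > 0" for q :: real using that by simp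
        from this[OF p] show ?thesis unfolding d_def .
      qed
      finally show ?thesis .
    qed
    have "Cauchy (\<lambda>n. fourier (u (r n)) \<eta>)"
      using rl[OF \<eta>(1)] by (auto intro: LIMSEQ_imp_Cauchy)
    then obtain N where N: "\<And>i j. i \<ge> N \<Longrightarrow> j \<ge> N \<Longrightarrow> dist (fourier (u (r i)) \<eta>) (fourier (u (r j)) \<eta>) < e / 4"
      using metric_CauchyD[of "\<lambda>n. fourier (u (r n)) \<eta>" "e / 4"] e by auto
    show "\<exists>M. \<forall>i\<ge>M. \<forall>j\<ge>M. dist (fourier (u (r i)) \<xi>) (fourier (u (r j)) \<xi>) < e"
    proof (intro exI[of _ N] allI impI)
      fix i j assume ij: "i \<ge> N" "j \<ge> N"
      have "dist (fourier (u (r i)) \<xi>) (fourier (u (r j)) \<xi>) \<le>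
        dist (fourier (u (r i)) \<xi>) (fourier (u (r i)) \<eta>) + dist (fourier (u (r i)) \<eta>) (fourier (u (r j)) \<eta>)
        + dist (fourier (u (r j)) \<eta>) (fourier (u (r j)) \<xi>)"
        by (meson add_mono dist_triangle order_refl order_trans)
      also have "\<dots> < e / 4 + e / 4 + e / 4 + e / 4"
        using close[of "r i"] close[of "r j"] N[OF ij] e by (simp add: dist_norm norm_minus_commute)
      finally show "dist (fourier (u (r i)) \<xi>) (fourier (u (r j)) \<xi>) < e" by simp
    qed
  qed
  then show ?thesis using that[OF r] by (auto simp: Cauchy_convergent_iff)
qed

text \<open>On balls the Fourier transforms converge by dominated convergence; the tails are controlled
  by the weight, which tends to infinity.\<close>
lemma H_compact:
  fixes u :: "nat \<Rightarrow> 'a \<Rightarrow> real"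
  assumes u: "\<And>n. u n \<in> H" and C: "\<And>n. ip (u n) (u n) \<le> C" and W: "\<And>n. wn (u n) \<le> W"
  shows "\<exists>r. strict_mono (r::nat\<Rightarrow>nat) \<and>
    (\<forall>e>0. \<exists>N. \<forall>i\<ge>N. \<forall>j\<ge>N. ip (u (r i) - u (r j)) (u (r i) - u (r j)) < e)"
proof -
  obtain r where r: "strict_mono (r::nat\<Rightarrow>nat)" and conv: "\<And>\<xi>. convergent (\<lambda>n. fourier (u (r n)) \<xi>)"
    by (rule H_pointwise_subsequence[of u, OF u C]) blast
  let ?c = "(2 * pi) ^ DIM('a)"
  define f where "f = (\<lambda>n. fourier (u (r n)))"
  define g where "g = (\<lambda>\<xi>. lim (\<lambda>n. f n \<xi>))"
  have [measurable]: "f n \<in> borel_measurable borel" for n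
    unfolding f_def using L2_measurable[OF H_L2[OF u]] by (intro measurable_fourier)
  have [measurable]: "g \<in> borel_measurable borel"
    unfolding g_def by (rule borel_measurable_lim_metric) measurable
  have lim: "(\<lambda>n. f n \<xi>) \<longlonglongrightarrow> g \<xi>" for \<xi>
    using conv[of \<xi>] unfolding g_def f_def by (simp add: convergent_LIMSEQ_iff)
  define M2 where "M2 = volK * C"
  have fb: "(cmod (f n \<xi>))\<^sup>2 \<le> M2" for n \<xi>
    unfolding f_def M2_def
    by (rule order_trans[OF L2_fourier_bound[OF H_L2[OF u]] mult_left_mono[OF C less_imp_le[OF volK_pos]]])
  have gb: "(cmod (g \<xi>))\<^sup>2 \<le> M2" for \<xi>
    using fb by (intro LIMSEQ_le_const2[of "\<lambda>n. (cmod (f n \<xi>))\<^sup>2"]) (auto intro!: tendsto_intros lim)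
  have sq: "(cmod (a - b))\<^sup>2 \<le> 2 * (cmod a)\<^sup>2 + 2 * (cmod b)\<^sup>2" for a b
  proof -
    have "(cmod (a - b))\<^sup>2 \<le> (cmod a + cmod b)\<^sup>2" by (intro power_mono norm_triangle_ineq4) auto
    also have "\<dots> \<le> 2 * (cmod a)\<^sup>2 + 2 * (cmod b)\<^sup>2" using sq_add_le[of 1 "cmod a" "cmod b"] by simp
    finally show ?thesis .
  qed
  have fgb: "(cmod (f n \<xi> - g \<xi>))\<^sup>2 \<le> 4 * M2" for n \<xi>
    using sq[of "f n \<xi>" "g \<xi>"] fb[of n \<xi>] gb[of \<xi>] by linarith
  have ball: "integrable lborel (\<lambda>\<xi>. indicator (cball 0 P) \<xi> * (cmod (f n \<xi> - g \<xi>))\<^sup>2)" for P n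
  proof (rule integrable_bounded_support[of _ "4 * M2" P])
    show "\<bar>indicator (cball 0 P) \<xi> * (cmod (f n \<xi> - g \<xi>))\<^sup>2\<bar> \<le> 4 * M2" for \<xi>
      using fgb[of n \<xi>] order_trans[OF zero_le_power2 fgb[of n \<xi>]] by (auto simp: indicator_def)
  qed auto
  have balllim: "(\<lambda>n. LINT \<xi>|lborel. indicator (cball 0 P) \<xi> * (cmod (f n \<xi> - g \<xi>))\<^sup>2) \<longlonglongrightarrow> 0" for P
  proof -
    have "(\<lambda>n. LINT \<xi>|lborel. indicator (cball 0 P) \<xi> * (cmod (f n \<xi> - g \<xi>))\<^sup>2) \<longlonglongrightarrow> (LINT (\<xi>::'a)|lborel. (0::real))"
    proof (rule integral_dominated_convergence)
      show "integrable lborel (\<lambda>\<xi>::'a. indicator (cball 0 P) \<xi> * (4 * M2))"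
        by (intro integrable_mult_left integrable_real_indicator) (auto intro!: emeasure_lborel_cball_less_top)
      show "AE \<xi> in lborel. norm (indicator (cball 0 P) \<xi> * (cmod (f n \<xi> - g \<xi>))\<^sup>2) \<le> indicator (cball 0 P) \<xi> * (4 * M2)" for n
        using fgb by (intro AE_I2) (simp add: abs_mult mult_left_mono)
      have "(\<lambda>n. indicator (cball 0 P) \<xi> * (cmod (f n \<xi> - g \<xi>))\<^sup>2) \<longlonglongrightarrow> indicator (cball 0 P) \<xi> * (cmod (g \<xi> - g \<xi>))\<^sup>2" for \<xi>
        by (intro tendsto_intros lim)
      then show "AE \<xi> in lborel. (\<lambda>n. indicator (cball 0 P) \<xi> * (cmod (f n \<xi> - g \<xi>))\<^sup>2) \<longlonglongrightarrow> 0" by simp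
    qed auto
    then show ?thesis by simp
  qed
  have key: "?c * ip (u (r i) - u (r j)) (u (r i) - u (r j)) \<le>
      2 * (LINT \<xi>|lborel. indicator (cball 0 P) \<xi> * (cmod (f i \<xi> - g \<xi>))\<^sup>2)
      + 2 * (LINT \<xi>|lborel. indicator (cball 0 P) \<xi> * (cmod (f j \<xi> - g \<xi>))\<^sup>2)
      + 4 * W / ln (exp 1 + P)" if P: "P \<ge> 0" for P i j
  proof -
    let ?l = "ln (exp 1 + P)"
    have l1: "1 \<le> ?l" using one_le_ln_exp_plus[OF P] .
    let ?G = "\<lambda>n \<xi>. indicator (cball 0 P) \<xi> * (cmod (f n \<xi> - g \<xi>))\<^sup>2"
    let ?w = "\<lambda>n \<xi>. log_weight m \<xi> * (cmod (f n \<xi>))\<^sup>2"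
    have dL: "u (r i) - u (r j) \<in> L2" by (intro H_L2 H_diff u)
    have wn_f: "wn (u (r n)) = integral\<^sup>L lborel (?w n)" for n by (simp add: wn_def f_def)
    have Iw: "integrable lborel (?w n)" for n unfolding f_def by (rule H_weight_integrable(1)[OF u])
    have "?c * ip (u (r i) - u (r j)) (u (r i) - u (r j)) = (LINT \<xi>|lborel. (cmod (fourier (u (r i) - u (r j)) \<xi>))\<^sup>2)"
      by (rule L2_plancherel(2)[OF dL, symmetric])
    also have "\<dots> \<le> (LINT \<xi>|lborel. 2 * ?G i \<xi> + 2 * ?G j \<xi> + (2 / ?l) * (?w i \<xi> + ?w j \<xi>))"
    proof (intro integral_mono L2_plancherel(1)[OF dL] Bochner_Integration.integrable_add integrable_mult_right ball Iw)
      fix \<xi> :: 'a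
      have F: "fourier (u (r i) - u (r j)) \<xi> = f i \<xi> - f j \<xi>"
        unfolding f_def fun_diff_def by (rule fourier_diff[OF H_integrable[OF u] H_integrable[OF u]])
      have nn: "0 \<le> ?w n \<xi>" for n using log_weight_ge_1[of m \<xi>] by simp
      show "(cmod (fourier (u (r i) - u (r j)) \<xi>))\<^sup>2 \<le> 2 * ?G i \<xi> + 2 * ?G j \<xi> + (2 / ?l) * (?w i \<xi> + ?w j \<xi>)"
      proof (cases "norm \<xi> \<le> P")
        case True
        have "(cmod (f i \<xi> - f j \<xi>))\<^sup>2 \<le> 2 * (cmod (f i \<xi> - g \<xi>))\<^sup>2 + 2 * (cmod (f j \<xi> - g \<xi>))\<^sup>2"
          using sq[of "f i \<xi> - g \<xi>" "f j \<xi> - g \<xi>"] by simp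
        also have "\<dots> \<le> 2 * ?G i \<xi> + 2 * ?G j \<xi> + (2 / ?l) * (?w i \<xi> + ?w j \<xi>)"
          using True nn l1 by (simp add: add_nonneg_nonneg)
        finally show ?thesis unfolding F .
      next
        case False
        have "?l \<le> ln (exp 1 + norm \<xi>)" using False P by (intro ln_mono) (auto intro: add_pos_nonneg)
        also have "\<dots> \<le> log_weight m \<xi>"
          unfolding log_weight_def using m_pos one_le_ln_exp_plus[of "norm \<xi>"] by (intro self_le_power) auto
        finally have lw: "1 \<le> (1 / ?l) * log_weight m \<xi>" using l1 by (simp add: field_simps)
        have "(cmod (f i \<xi> - f j \<xi>))\<^sup>2 \<le> 1 * (2 * (cmod (f i \<xi>))\<^sup>2 + 2 * (cmod (f j \<xi>))\<^sup>2)"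
          using sq[of "f i \<xi>" "f j \<xi>"] by simp
        also have "\<dots> \<le> ((1 / ?l) * log_weight m \<xi>) * (2 * (cmod (f i \<xi>))\<^sup>2 + 2 * (cmod (f j \<xi>))\<^sup>2)"
          by (intro mult_right_mono lw) auto
        also have "\<dots> = (2 / ?l) * (?w i \<xi> + ?w j \<xi>)" by (simp add: algebra_simps add_divide_distrib)
        finally show ?thesis unfolding F using False by simp
      qed
    qed
    also have "\<dots> = 2 * (LINT \<xi>|lborel. ?G i \<xi>) + 2 * (LINT \<xi>|lborel. ?G j \<xi>) + (2 / ?l) * (wn (u (r i)) + wn (u (r j)))"
      unfolding wn_f using ball Iw by simp
    also have "\<dots> \<le> 2 * (LINT \<xi>|lborel. ?G i \<xi>) + 2 * (LINT \<xi>|lborel. ?G j \<xi>) + (2 / ?l) * (W + W)"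
      using l1 W by (intro add_left_mono mult_left_mono add_mono) auto
    finally show ?thesis by simp
  qed
  have "\<exists>N. \<forall>i\<ge>N. \<forall>j\<ge>N. ip (u (r i) - u (r j)) (u (r i) - u (r j)) < e" if e: "e > 0" for e
  proof -
    have c: "?c > 0" by simp
    \<comment> \<open>Then \<open>ln (exp 1 + P)\<close> is at least
      \<open>16 * W / (?c * e)\<close>, which puts the tail term of \<open>key\<close> below a
      quarter of \<open>?c * e\<close>.\<close>
    define P where "P = exp (16 * W / (?c * e))"
    have P: "P \<ge> 0" by (simp add: P_def)
    have ce: "?c * e > 0" using c e by simp
    have "4 * W / ln (exp 1 + P) \<le> ?c * e / 4"
    proof -
      have "ln P \<le> ln (exp 1 + P)" by (intro ln_mono) (auto simp: P_def add_pos_pos)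
      then have "16 * W / (?c * e) \<le> ln (exp 1 + P)" by (simp add: P_def)
      then have "16 * W \<le> ln (exp 1 + P) * (?c * e)" using ce by (simp only: pos_divide_le_eq)
      then show ?thesis using one_le_ln_exp_plus[OF P] by (simp only: pos_divide_le_eq) (simp add: pos_divide_le_eq mult_ac)
    qed
    note W4 = this
    obtain N where N: "\<And>n. n \<ge> N \<Longrightarrow> (LINT \<xi>|lborel. indicator (cball 0 P) \<xi> * (cmod (f n \<xi> - g \<xi>))\<^sup>2) < ?c * e / 8"
      using order_tendstoD(2)[OF balllim[of P], of "?c * e / 8"] ce by (auto simp: eventually_sequentially)
    have arith: "x < E" if "x \<le> 2 * a + 2 * b + w" "w \<le> E / 4" "a < E / 8" "b < E / 8" "0 < E" for x a b w E :: real
      using that by linarith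
    have "?c * ip (u (r i) - u (r j)) (u (r i) - u (r j)) < ?c * e" if "i \<ge> N" "j \<ge> N" for i j
      by (rule arith[OF key[OF P, of i j] W4 N[OF that(1)] N[OF that(2)] ce])
    then show ?thesis using c by (intro exI[of _ N]) (simp only: mult_less_cancel_left_pos, blast)
  qed
  with r show ?thesis by blast
qed

text \<open>Being Cauchy in \<open>ip\<close> means being Cauchy in \<open>L\<^sup>1\<close>, so a
  subsequence converges almost everywhere. Fatou's lemma passes the Cauchy estimates to the limit,
  once for \<open>ip\<close> and once for the weighted norm. The limit belongs to \<open>H\<close>
  because the \<open>n\<close>-th function has a test function within squared distance
  \<open>1 / (n + 1)\<close>.\<close>

lemma H_complete:
  fixes u :: "nat \<Rightarrow> 'a \<Rightarrow> real"
  assumes u: "\<And>n. u n \<in> H"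
    and cip: "\<And>e. e > 0 \<Longrightarrow> \<exists>N. \<forall>i\<ge>N. \<forall>j\<ge>N. ip (u i - u j) (u i - u j) < e"
    and cwn: "\<And>e. e > 0 \<Longrightarrow> \<exists>N. \<forall>i\<ge>N. \<forall>j\<ge>N. wn (u i - u j) < e"
  shows "\<exists>v\<in>H. (\<lambda>n. wn (u n - v)) \<longlonglongrightarrow> 0"
proof -
  note um[measurable] = L2_measurable[OF H_L2[OF u]]
  have "\<exists>N. \<forall>i\<ge>N. \<forall>j\<ge>N. (LINT x|lborel. norm (u i x - u j x)) < e" if e: "e > 0" for e
  proof -
    obtain N where N: "\<And>i j. i \<ge> N \<Longrightarrow> j \<ge> N \<Longrightarrow> ip (u i - u j) (u i - u j) < e\<^sup>2 / volK"
      using cip[of "e\<^sup>2 / volK"] e volK_pos by auto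
    have "(LINT x|lborel. norm (u i x - u j x)) < e" if "i \<ge> N" "j \<ge> N" for i j
    proof -
      have "(LINT x|lborel. \<bar>(u i - u j) x\<bar>)\<^sup>2 \<le> volK * ip (u i - u j) (u i - u j)"
        by (intro L2_L1_bound H_L2 H_diff u)
      also have "\<dots> < e\<^sup>2" using N[OF that] volK_pos by (simp add: pos_less_divide_eq mult.commute)
      finally show ?thesis using e by (simp add: power_less_imp_less_base)
    qed
    then show ?thesis by blast
  qed
  then obtain r where r: "strict_mono (r::nat\<Rightarrow>nat)" and ae: "AE x in lborel. Cauchy (\<lambda>i. u (r i) x)"
    using cauchy_L1_AE_cauchy_subseq[of lborel u] H_integrable[OF u] by metis
  \<comment> \<open>The value 0 where the subsequence is not Cauchy keeps \<open>v\<close> Borel.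
    Outside \<Omega> the subsequence is constantly zero, and so is \<open>v\<close>.\<close>
  define v where "v = (\<lambda>x. if Cauchy (\<lambda>i. u (r i) x) then lim (\<lambda>i. u (r i) x) else 0)"
  have [measurable]: "v \<in> borel_measurable borel"
    unfolding v_def by measurable
  have v0: "v x = 0" if "x \<notin> \<Omega>" for x
    using L2_zero[OF H_L2[OF u] that] by (simp add: v_def limI)
  have lim: "AE x in lborel. (\<lambda>i. u (r i) x) \<longlonglongrightarrow> v x"
    using ae by eventually_elim (auto simp: v_def Cauchy_convergent_iff convergent_LIMSEQ_iff)
  have rN: "r i \<ge> N" if "i \<ge> N" for i N using seq_suble[OF r, of i] that by simp
  have fat: "(\<integral>\<^sup>+x. ennreal ((u n x - v x)\<^sup>2) \<partial>lborel) \<le> ennreal e"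
    if e: "e > 0" and N: "\<And>i. i \<ge> N \<Longrightarrow> ip (u n - u i) (u n - u i) < e" for n N e
  proof -
    have "(\<integral>\<^sup>+x. ennreal ((u n x - v x)\<^sup>2) \<partial>lborel) = (\<integral>\<^sup>+x. liminf (\<lambda>i. ennreal ((u n x - u (r i) x)\<^sup>2)) \<partial>lborel)"
    proof (rule nn_integral_cong_AE)
      show "AE x in lborel. ennreal ((u n x - v x)\<^sup>2) = liminf (\<lambda>i. ennreal ((u n x - u (r i) x)\<^sup>2))"
        using lim
      proof eventually_elim
        case (elim x)
        have "(\<lambda>i. ennreal ((u n x - u (r i) x)\<^sup>2)) \<longlonglongrightarrow> ennreal ((u n x - v x)\<^sup>2)"
          by (intro tendsto_ennrealI tendsto_intros elim)
        from lim_imp_Liminf[OF _ this] show ?case by simp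
      qed
    qed
    also have "\<dots> \<le> liminf (\<lambda>i. \<integral>\<^sup>+x. ennreal ((u n x - u (r i) x)\<^sup>2) \<partial>lborel)"
      by (rule nn_integral_liminf) measurable
    also have "\<dots> \<le> ennreal e"
    proof (rule order_trans[OF Liminf_le_Limsup Limsup_bounded])
      have eq: "(\<integral>\<^sup>+x. ennreal ((u n x - u (r i) x)\<^sup>2) \<partial>lborel) = ennreal (ip (u n - u (r i)) (u n - u (r i)))" for i
      proof -
        have "u n - u (r i) \<in> L2" by (intro H_L2 H_diff u)
        from L2_sq_integrable[OF this] show ?thesis
          unfolding ip_self by (subst nn_integral_eq_integral) auto
      qed
      show "\<forall>\<^sub>F i in sequentially. (\<integral>\<^sup>+x. ennreal ((u n x - u (r i) x)\<^sup>2) \<partial>lborel) \<le> ennreal e"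
        unfolding eq using N rN by (intro eventually_sequentiallyI[of N] ennreal_leI less_imp_le) blast
    qed simp
    finally show ?thesis .
  qed
  have vL: "v \<in> L2"
  proof -
    obtain N where N: "\<And>i j. i \<ge> N \<Longrightarrow> j \<ge> N \<Longrightarrow> ip (u i - u j) (u i - u j) < 1"
      using cip[of 1] by auto
    have "(\<integral>\<^sup>+x. ennreal ((u N x - v x)\<^sup>2) \<partial>lborel) \<le> ennreal 1"
      by (rule fat[of 1 N N]) (use N in auto)
    then have "(\<integral>\<^sup>+x. ennreal ((u N x - v x)\<^sup>2) \<partial>lborel) < \<infinity>"
      by (rule le_less_trans) simp
    then have "integrable lborel (\<lambda>x. (u N x - v x)\<^sup>2)"
      by (intro integrableI_nonneg) auto
    then have "(\<lambda>x. u N x - v x) \<in> L2"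
      using v0 L2_zero[OF H_L2[OF u]] unfolding L2_zero_ext_def by simp
    from L2_lincomb[OF H_L2[OF u[of N]] this, of 1 "-1"] show ?thesis by simp
  qed
  have ip_lim: "(\<lambda>n. ip (u n - v) (u n - v)) \<longlonglongrightarrow> 0"
  proof (rule LIMSEQ_I)
    fix e :: real assume e: "e > 0"
    obtain N where N: "\<And>i j. i \<ge> N \<Longrightarrow> j \<ge> N \<Longrightarrow> ip (u i - u j) (u i - u j) < e / 2"
      using cip[of "e / 2"] e by auto
    have "ip (u n - v) (u n - v) \<le> e / 2" if "n \<ge> N" for n
    proof -
      have "u n - v \<in> L2" by (intro L2_diff H_L2 u vL)
      then have "ennreal (ip (u n - v) (u n - v)) = (\<integral>\<^sup>+x. ennreal ((u n x - v x)\<^sup>2) \<partial>lborel)"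
        unfolding ip_self using L2_sq_integrable by (subst nn_integral_eq_integral) fastforce+
      also have "\<dots> \<le> ennreal (e / 2)"
        by (rule fat[of "e / 2" N n]) (use N that e in auto)
      finally show ?thesis using e by simp
    qed
    then show "\<exists>no. \<forall>n\<ge>no. norm (ip (u n - v) (u n - v) - 0) < e"
    proof (intro exI[of _ N] allI impI)
      fix n assume "n \<ge> N"
      with \<open>\<And>n. N \<le> n \<Longrightarrow> ip (u n - v) (u n - v) \<le> e / 2\<close> have "ip (u n - v) (u n - v) < e"
        using e by (smt (verit) field_sum_of_halves)
      then show "norm (ip (u n - v) (u n - v) - 0) < e"
        using ip_nonneg[of "u n - v"] by simp
    qed
  qed
  \<comment> \<open>By \<open>L2_fourier_bound\<close>, convergence in \<open>ip\<close> entails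
    convergence of the transforms at every frequency, which Fatou's lemma takes as input for the
    weighted norm.\<close>
  have flim: "(\<lambda>i. fourier (u n - u (r i)) \<xi>) \<longlonglongrightarrow> fourier (u n - v) \<xi>" for n \<xi>
  proof -
    have "(\<lambda>i. fourier (u (r i) - v) \<xi>) \<longlonglongrightarrow> 0"
    proof (rule Lim_null_comparison)
      have "(\<lambda>i. ip (u (r i) - v) (u (r i) - v)) \<longlonglongrightarrow> 0"
        using LIMSEQ_subseq_LIMSEQ[OF ip_lim r] by (simp add: o_def)
      then have "(\<lambda>i. sqrt (volK * ip (u (r i) - v) (u (r i) - v))) \<longlonglongrightarrow> sqrt (volK * 0)"
        by (intro tendsto_intros)
      then show "(\<lambda>i. sqrt (volK * ip (u (r i) - v) (u (r i) - v))) \<longlonglongrightarrow> 0" by simp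
      show "\<forall>\<^sub>F i in sequentially. norm (fourier (u (r i) - v) \<xi>) \<le> sqrt (volK * ip (u (r i) - v) (u (r i) - v))"
        by (intro always_eventually allI real_le_rsqrt L2_fourier_bound L2_diff H_L2 u vL)
    qed
    from tendsto_diff[OF tendsto_const[of "fourier (u n - v) \<xi>"] this]
    have "(\<lambda>i. fourier (u n - v) \<xi> - fourier (u (r i) - v) \<xi>) \<longlonglongrightarrow> fourier (u n - v) \<xi>" by simp
    moreover have "fourier (u n - v) \<xi> - fourier (u (r i) - v) \<xi> = fourier (u n - u (r i)) \<xi>" for i
      unfolding fun_diff_def using H_integrable[OF u] L2_integrable[OF vL] by (simp add: fourier_diff)
    ultimately show ?thesis by simp
  qed
  have lnle: "log_norm_sq m (u n - v) \<le> ennreal e" if N: "\<And>i. i \<ge> N \<Longrightarrow> wn (u n - u i) < e" for n N e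
  proof -
    have [measurable]: "u n - u i \<in> borel_measurable borel" for i
      by (intro L2_measurable H_L2 H_diff u)
    have "log_norm_sq m (u n - v) = (\<integral>\<^sup>+\<xi>. liminf (\<lambda>i. ennreal (log_weight m \<xi> * (cmod (fourier (u n - u (r i)) \<xi>))\<^sup>2)) \<partial>lborel)"
      unfolding log_norm_sq_eq
    proof (rule nn_integral_cong)
      fix \<xi> :: 'a
      have "(\<lambda>i. ennreal (log_weight m \<xi> * (cmod (fourier (u n - u (r i)) \<xi>))\<^sup>2)) \<longlonglongrightarrow> ennreal (log_weight m \<xi> * (cmod (fourier (u n - v) \<xi>))\<^sup>2)"
        by (intro tendsto_ennrealI tendsto_intros flim)
      from lim_imp_Liminf[OF _ this] show "ennreal (log_weight m \<xi> * (cmod (fourier (u n - v) \<xi>))\<^sup>2) =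
        liminf (\<lambda>i. ennreal (log_weight m \<xi> * (cmod (fourier (u n - u (r i)) \<xi>))\<^sup>2))" by simp
    qed
    also have "\<dots> \<le> liminf (\<lambda>i. \<integral>\<^sup>+\<xi>. ennreal (log_weight m \<xi> * (cmod (fourier (u n - u (r i)) \<xi>))\<^sup>2) \<partial>lborel)"
      by (rule nn_integral_liminf) measurable
    also have "\<dots> = liminf (\<lambda>i. ennreal (wn (u n - u (r i))))"
      using H_weight_integrable(2)[OF H_diff[OF u u]] unfolding log_norm_sq_eq by simp
    also have "\<dots> \<le> ennreal e"
    proof (rule order_trans[OF Liminf_le_Limsup Limsup_bounded])
      show "\<forall>\<^sub>F i in sequentially. ennreal (wn (u n - u (r i))) \<le> ennreal e"
      proof (rule eventually_sequentiallyI[of N])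
        fix i assume "N \<le> i"
        then show "ennreal (wn (u n - u (r i))) \<le> ennreal e"
          using N[OF rN] by (intro ennreal_leI less_imp_le)
      qed
    qed simp
    finally show ?thesis .
  qed
  have ln_lim: "(\<lambda>n. log_norm_sq m (u n - v)) \<longlonglongrightarrow> 0"
  proof (rule order_tendstoI)
    fix a :: ennreal assume "0 < a"
    then obtain b where b: "0 < b" "b < a" using dense by blast
    then obtain e where "b = ennreal e" by (cases b) auto
    with b have e: "e > 0" "ennreal e < a" by auto
    obtain N where N: "\<And>i j. i \<ge> N \<Longrightarrow> j \<ge> N \<Longrightarrow> wn (u i - u j) < e"
      using cwn[OF e(1)] by auto
    show "\<forall>\<^sub>F n in sequentially. log_norm_sq m (u n - v) < a"
    proof (rule eventually_sequentiallyI[of N])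
      fix n assume n: "n \<ge> N"
      have "log_norm_sq m (u n - v) \<le> ennreal e" by (rule lnle[of N]) (use N n in auto)
      then show "log_norm_sq m (u n - v) < a" using e(2) by (rule le_less_trans)
    qed
  qed auto
  have vH: "v \<in> H"
  proof -
    have "\<exists>\<phi>. \<phi> \<in> test_functions \<Omega> \<and> log_norm_sq m (\<lambda>x. u n x - \<phi> x) < ennreal (1 / real (Suc n))" for n
    proof -
      obtain \<psi> where \<psi>: "\<And>k. \<psi> k \<in> test_functions \<Omega>" "(\<lambda>k::nat. log_norm_sq m (\<lambda>x. u n x - \<psi> k x)) \<longlonglongrightarrow> 0"
        using u[of n] by (auto simp: log_sobolev_def)
      have "\<forall>\<^sub>F k in sequentially. log_norm_sq m (\<lambda>x. u n x - \<psi> k x) < ennreal (1 / real (Suc n))"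
        using \<psi>(2) by (rule order_tendstoD) simp
      then show ?thesis using \<psi>(1) by (auto simp: eventually_sequentially)
    qed
    then obtain \<phi> where \<phi>: "\<And>n. \<phi> n \<in> test_functions \<Omega>"
      "\<And>n. log_norm_sq m (\<lambda>x. u n x - \<phi> n x) < ennreal (1 / real (Suc n))"
      by metis
    have "(\<lambda>n. log_norm_sq m (\<lambda>x. v x - \<phi> n x)) \<longlonglongrightarrow> 0"
    proof (rule tendsto_sandwich[OF _ _ tendsto_const])
      have "(\<lambda>n. ennreal (1 / real (Suc n))) \<longlonglongrightarrow> ennreal 0"
        using LIMSEQ_inverse_real_of_nat by (intro tendsto_ennrealI) (simp add: inverse_eq_divide)
      then have "(\<lambda>n. ennreal 2 * log_norm_sq m (u n - v) + ennreal 2 * ennreal (1 / real (Suc n))) \<longlonglongrightarrow> ennreal 2 * 0 + ennreal 2 * ennreal 0"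
        by (intro tendsto_add ennreal_tendsto_cmult ln_lim) auto
      then show "(\<lambda>n. ennreal 2 * log_norm_sq m (u n - v) + ennreal 2 * ennreal (1 / real (Suc n))) \<longlonglongrightarrow> 0" by simp
      show "\<forall>\<^sub>F n in sequentially. log_norm_sq m (\<lambda>x. v x - \<phi> n x) \<le> ennreal 2 * log_norm_sq m (u n - v) + ennreal 2 * ennreal (1 / real (Suc n))"
      proof (intro always_eventually allI)
        fix n
        have I: "integrable lborel (\<lambda>x. u n x - v x)" "integrable lborel (\<lambda>x. u n x - \<phi> n x)"
          using H_integrable[OF u] L2_integrable[OF vL] test_function_integrable(2)[OF \<phi>(1)] by auto
        have "log_norm_sq m (\<lambda>x. v x - \<phi> n x) = log_norm_sq m (\<lambda>x. - 1 * (u n x - v x) + 1 * (u n x - \<phi> n x))"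
          by (rule arg_cong[of _ _ "log_norm_sq m"]) auto
        also have "\<dots> \<le> ennreal 2 * log_norm_sq m (u n - v) + ennreal 2 * log_norm_sq m (\<lambda>x. u n x - \<phi> n x)"
          using log_norm_sq_lincomb[OF I, of m "- 1" 1] by (simp add: fun_diff_def)
        also have "\<dots> \<le> ennreal 2 * log_norm_sq m (u n - v) + ennreal 2 * ennreal (1 / real (Suc n))"
          using \<phi>(2)[of n] by (intro add_left_mono mult_left_mono) auto
        finally show "log_norm_sq m (\<lambda>x. v x - \<phi> n x) \<le> ennreal 2 * log_norm_sq m (u n - v) + ennreal 2 * ennreal (1 / real (Suc n))" .
      qed
    qed auto
    then show ?thesis unfolding log_sobolev_def using vL \<phi>(1) by blast
  qed
  have "(\<lambda>n. ennreal (wn (u n - v))) \<longlonglongrightarrow> ennreal 0"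
    using ln_lim unfolding H_weight_integrable(2)[OF H_diff[OF u vH]] by simp
  then have "(\<lambda>n. wn (u n - v)) \<longlonglongrightarrow> 0"
    by (subst (asm) tendsto_ennreal_iff) (auto simp: wn_nonneg)
  with vH show ?thesis by blast
qed

end

section \<open>The eigenbasis of the logarithmic form\<close>

context log_domain
begin

lemma ip_null_iff:
  assumes "u \<in> L2"
  shows "ip u u = 0 \<longleftrightarrow> (AE x in lborel. u x = 0)"
  unfolding ip_self using L2_sq_integrable[OF assms]
  by (subst integral_nonneg_eq_0_iff_AE) auto

text \<open>\<open>v\<close> is arbitrary: if the product is not measurable, it is not integrable,
  and the integral is zero by convention.\<close>

lemma ip_cong_AE_zero:
  fixes u :: "'a \<Rightarrow> real"
  assumes "AE x in lborel. u x = 0"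
  shows "ip u v = 0"
proof -
  have "ip u v = (LINT (x::'a)|lborel. (0::real))" if [measurable]: "(\<lambda>x. u x * v x) \<in> borel_measurable lborel"
    unfolding ip_def by (intro integral_cong_AE) (use assms in auto)
  then show ?thesis
    by (cases "(\<lambda>x. u x * v x) \<in> borel_measurable lborel")
       (auto simp: ip_def intro!: not_integrable_integral_eq dest: borel_measurable_integrable)
qed

text \<open>Bumps with disjoint supports are orthogonal, and a box inside \<Omega> has room for
  infinitely many.\<close>

lemma exists_orthonormal:
  "\<exists>f. (\<forall>i<n. f i \<in> H) \<and> (\<forall>i<n. \<forall>j<n. ip (f i) (f j) = (if i = (j::nat) then 1 else 0))"
proof -
  obtain x0 where "x0 \<in> \<Omega>" using nonempty_\<Omega> by blast
  then obtain a b where ab: "cbox a b \<subseteq> \<Omega>" "x0 \<in> box a b"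
    using open_contains_cbox[OF open_\<Omega>] by metis
  obtain e :: 'a where e: "e \<in> Basis" using nonempty_Basis by blast
  define d where "d = b \<bullet> e - a \<bullet> e"
  have lt: "a \<bullet> i < b \<bullet> i" if "i \<in> Basis" for i
    using ab(2) that by (force simp: mem_box)
  then have d: "d > 0" using e by (simp add: d_def)
  \<comment> \<open>Along the coordinate \<open>e\<close>, the \<open>j\<close>-th box spans the
    interval from \<open>a \<bullet> e + d / (j + 2)\<close> to
    \<open>a \<bullet> e + d / (j + 1)\<close>; in the other coordinates it is the whole box. The
    intervals are adjacent and open, hence disjoint.\<close>
  define A where "A = (\<lambda>j::nat. a + (d / (real j + 2)) *\<^sub>R e)"
  define B where "B = (\<lambda>j::nat. b + (d / (real j + 1) - d) *\<^sub>R e)"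
  have Ai: "A j \<bullet> i = a \<bullet> i + (if i = e then d / (real j + 2) else 0)"
    and Bi: "B j \<bullet> i = b \<bullet> i + (if i = e then d / (real j + 1) - d else 0)" if "i \<in> Basis" for i j
    using that e by (auto simp: A_def B_def inner_add_left inner_Basis)
  have dj: "0 \<le> d / (real j + 2)" "d / (real j + 1) \<le> d" "d / (real j + 2) < d / (real j + 1)" for j
    using d by (auto simp: field_simps)
  have sub: "box (A j) (B j) \<subseteq> cbox (A j) (B j)" "cbox (A j) (B j) \<subseteq> cbox a b" for j
  proof -
    show "cbox (A j) (B j) \<subseteq> cbox a b"
      using dj[of j] by (intro subset_box(1)[THEN iffD2] impI ballI) (auto simp: Ai Bi)
  qed (rule box_subset_cbox)
  have ne: "box (A j) (B j) \<noteq> {}" for j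
    unfolding box_ne_empty using dj[of j] lt by (auto simp: Ai Bi d_def)
  have disj: "x \<notin> box (A k) (B k)" if "x \<in> box (A j) (B j)" "j < k" for x j k
  proof
    assume "x \<in> box (A k) (B k)"
    then have "x \<bullet> e < b \<bullet> e + (d / (real k + 1) - d)" using e Bi[OF e, of k] by (force simp: mem_box)
    moreover have "a \<bullet> e + d / (real j + 2) < x \<bullet> e" using that(1) e Ai[OF e, of j] by (force simp: mem_box)
    moreover have "d / (real k + 1) \<le> d / (real j + 2)"
      using that(2) d by (intro divide_left_mono) auto
    ultimately show False by (simp add: d_def)
  qed
  define g where "g = (\<lambda>j. box_bump (A j) (B j))"
  have gt: "g j \<in> test_functions \<Omega>" for j
    unfolding g_def
  proof (rule test_functions_smooth_alg[OF box_bump_smooth_alg])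
    show "compact (cbox (A j) (B j))" by simp
    show "cbox (A j) (B j) \<subseteq> \<Omega>" using sub ab(1) by blast
    show "x \<in> cbox (A j) (B j)" if "box_bump (A j) (B j) x \<noteq> 0" for x
      using that box_bump_pos_iff[of "A j" "B j" x] box_bump_bounds(1)[of "A j" "B j" x] sub(1)[of j] by auto
  qed
  have gH: "g j \<in> H" for j by (rule test_functions_H[OF gt])
  have gz: "g j x * g k x = 0" if "j < k" for j k x
    using disj[of x j k] that box_bump_pos_iff[of "A j" "B j" x] box_bump_pos_iff[of "A k" "B k" x]
      box_bump_bounds(1)[of "A j" "B j" x] box_bump_bounds(1)[of "A k" "B k" x]
    unfolding g_def by (smt (verit) mult_eq_0_iff)
  have orth: "ip (g j) (g k) = 0" if "j \<noteq> k" for j k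
  proof -
    have z: "g j x * g k x = 0" for x
      using gz[of j k x] gz[of k j x] that by (cases "j < k") (auto simp: mult.commute)
    show ?thesis unfolding ip_def z by simp
  qed
  have pos: "ip (g j) (g j) > 0" for j
  proof (rule ccontr)
    assume "\<not> 0 < ip (g j) (g j)"
    then have "ip (g j) (g j) = 0" using ip_nonneg[of "g j"] by simp
    then have "AE x in lborel. g j x = 0"
      using ip_null_iff[OF H_L2[OF gH]] by simp
    then have "AE x in lborel. x \<notin> box (A j) (B j)"
      by eventually_elim (use box_bump_pos_iff in \<open>force simp: g_def\<close>)
    then have "box (A j) (B j) \<in> null_sets lborel"
      by (subst AE_iff_null_sets) auto
    then have "negligible (box (A j) (B j))"
      unfolding negligible_iff_null_sets by (rule null_sets_completionI)
    then show False using open_not_negligible[OF open_box ne] by blast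
  qed
  define f where "f = (\<lambda>j. (1 / sqrt (ip (g j) (g j))) *\<^sub>R g j)"
  have "f j \<in> H" for j unfolding f_def by (intro subspace_scale[OF H_subspace] gH)
  moreover have "ip (f i) (f j) = (if i = j then 1 else 0)" for i j
  proof -
    have "ip (f i) (f j) = (LINT x|lborel. (1 / sqrt (ip (g i) (g i)) * (1 / sqrt (ip (g j) (g j)))) * (g i x * g j x))"
      unfolding ip_def f_def by (intro Bochner_Integration.integral_cong refl) (simp add: ip_def[symmetric])
    also have "\<dots> = (1 / sqrt (ip (g i) (g i)) * (1 / sqrt (ip (g j) (g j)))) * ip (g i) (g j)"
      unfolding ip_def by (rule integral_mult_right_zero)
    also have "\<dots> = (if i = j then 1 else 0)"
      using orth[of i j] pos[of j] by auto
    finally show ?thesis .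
  qed
  ultimately show ?thesis by (intro exI[of _ f]) auto
qed

lemma L2_subspace: "subspace L2"
  unfolding subspace_def
proof (intro conjI ballI allI)
  show "0 \<in> L2" by (simp add: L2_zero_ext_def zero_fun_def)
  show "u + v \<in> L2" if "u \<in> L2" "v \<in> L2" for u v
    using L2_lincomb[OF that, of 1 1] by (simp add: plus_fun_def)
  show "c *\<^sub>R u \<in> L2" if "u \<in> L2" for u c
    using L2_lincomb[OF that that, of c 0] by (simp add: scaleR_fun_def)
qed

text \<open>The whole of \<open>L2\<close> is taken so that Bessel's inequality applies to plane
  waves cut off at the boundary of \<Omega>.\<close>

lemma semi_inner_ip: "semi_inner L2 ip"
proof
  show "ip (u + v) w = ip u w + ip v w" if "u \<in> L2" "v \<in> L2" "w \<in> L2" for u v w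
    using ip_lincomb[OF that, of 1 1] by (simp add: plus_fun_def)
  show "ip (c *\<^sub>R u) w = c * ip u w" if "u \<in> L2" "w \<in> L2" for u w c
    using ip_lincomb[OF that(1,1,2), of c 0] by (simp add: scaleR_fun_def)
qed (use L2_subspace ip_sym ip_nonneg in auto)

lemma semi_inner_ip_H: "semi_inner H ip"
proof -
  interpret semi_inner L2 ip by (rule semi_inner_ip)
  show ?thesis
    by unfold_locales (use H_subspace H_L2 B_add B_scale ip_sym ip_nonneg in auto)
qed

lemma compact_form_exists:
  obtains S where "compact_form H ip (\<lambda>u v. qf u v + S * ip u v)"
proof -
  obtain S E D where SED: "0 \<le> E" "0 \<le> D" "\<And>u. u \<in> H \<Longrightarrow> ip u u \<le> qf u u + S * ip u u"
    "\<And>u. u \<in> H \<Longrightarrow> wn u \<le> E * (qf u u + S * ip u u)"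
    "\<And>u. u \<in> H \<Longrightarrow> qf u u + S * ip u u \<le> D * wn u"
    by (rule qf_equiv_wn) blast
  interpret semi_inner H ip by (rule semi_inner_ip_H)
  let ?A = "\<lambda>u v. qf u v + S * ip u v"
  have "compact_form H ip ?A"
  proof (unfold_locales)
    show "?A (u + v) w = ?A u w + ?A v w" if "u \<in> H" "v \<in> H" "w \<in> H" for u v w
      using qf_lincomb[OF that, of 1 1] B_add[OF that] by (simp add: plus_fun_def algebra_simps)
    show "?A (c *\<^sub>R u) w = c * ?A u w" if "u \<in> H" "w \<in> H" for c u w
      using qf_lincomb[OF that(1,1,2), of c 0] B_scale[OF that] by (simp add: scaleR_fun_def algebra_simps)
    show "?A u v = ?A v u" for u v using qf_sym[of u v] ip_sym[of u v] by simp
    show "0 \<le> ?A u u" if "u \<in> H" for u using SED(3)[OF that] ip_nonneg[of u] by linarith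
    show "ip u u \<le> ?A u u" if "u \<in> H" for u by (rule SED(3)[OF that])
    show "\<exists>f. (\<forall>i<n. f i \<in> H) \<and> (\<forall>i<n. \<forall>j<n. ip (f i) (f j) = (if i = (j::nat) then 1 else 0))" for n
      by (rule exists_orthonormal)
  next
    fix u :: "nat \<Rightarrow> 'a \<Rightarrow> real" and C :: real
    assume u: "\<And>n. u n \<in> H" and C: "\<And>n. ?A (u n) (u n) \<le> C"
    show "\<exists>r. strict_mono (r::nat\<Rightarrow>nat) \<and> (\<forall>e>0. \<exists>N. \<forall>i\<ge>N. \<forall>j\<ge>N. ip (u (r i) - u (r j)) (u (r i) - u (r j)) < e)"
    proof (rule H_compact[OF u])
      show "ip (u n) (u n) \<le> C" for n using SED(3)[OF u] C by (rule order_trans)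
      show "wn (u n) \<le> E * C" for n using SED(4)[OF u[of n]] mult_left_mono[OF C[of n] SED(1)] by linarith
    qed
  next
    fix u :: "nat \<Rightarrow> 'a \<Rightarrow> real"
    assume u: "\<And>n. u n \<in> H"
      and cau: "\<And>e. e > 0 \<Longrightarrow> \<exists>N. \<forall>i\<ge>N. \<forall>j\<ge>N. ?A (u i - u j) (u i - u j) < e"
    have "\<exists>v\<in>H. (\<lambda>n. wn (u n - v)) \<longlonglongrightarrow> 0"
    proof (rule H_complete[OF u])
      fix e :: real assume e: "e > 0"
      show "\<exists>N. \<forall>i\<ge>N. \<forall>j\<ge>N. ip (u i - u j) (u i - u j) < e"
        using cau[OF e] le_less_trans[OF SED(3)[OF H_diff[OF u u]]] by fast
      have "e / (E + 1) > 0" using e SED(1) by simp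
      from cau[OF this] obtain N where N: "\<And>i j. i \<ge> N \<Longrightarrow> j \<ge> N \<Longrightarrow> ?A (u i - u j) (u i - u j) < e / (E + 1)"
        by blast
      have "wn (u i - u j) < e" if "i \<ge> N" "j \<ge> N" for i j
      proof -
        have nn: "0 \<le> ?A (u i - u j) (u i - u j)"
          by (rule order_trans[OF ip_nonneg SED(3)[OF H_diff[OF u u]]])
        have "wn (u i - u j) \<le> E * ?A (u i - u j) (u i - u j)" by (rule SED(4)[OF H_diff[OF u u]])
        also have "\<dots> \<le> (E + 1) * ?A (u i - u j) (u i - u j)" using nn by (intro mult_right_mono) auto
        also have "\<dots> < (E + 1) * (e / (E + 1))" using N[OF that] SED(1) by (intro mult_strict_left_mono) auto
        also have "\<dots> = e" using SED(1) by simp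
        finally show ?thesis .
      qed
      then show "\<exists>N. \<forall>i\<ge>N. \<forall>j\<ge>N. wn (u i - u j) < e" by blast
    qed
    then obtain v where v: "v \<in> H" "(\<lambda>n. wn (u n - v)) \<longlonglongrightarrow> 0" by blast
    have "(\<lambda>n. ?A (u n - v) (u n - v)) \<longlonglongrightarrow> 0"
    proof (rule tendsto_sandwich[OF _ _ tendsto_const])
      show "\<forall>\<^sub>F n in sequentially. 0 \<le> ?A (u n - v) (u n - v)"
        by (intro always_eventually allI order_trans[OF ip_nonneg SED(3)[OF H_diff[OF u v(1)]]])
      show "\<forall>\<^sub>F n in sequentially. ?A (u n - v) (u n - v) \<le> D * wn (u n - v)"
        using SED(5)[OF H_diff[OF u v(1)]] by (intro always_eventually allI)
      show "(\<lambda>n. D * wn (u n - v)) \<longlonglongrightarrow> 0"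
        using tendsto_mult_left[OF v(2), of D] by simp
    qed
    then show "\<exists>w\<in>H. (\<lambda>n. ?A (u n - w) (u n - w)) \<longlonglongrightarrow> 0" using v(1) by blast
  qed (use H_subspace in auto)
  then show ?thesis by (rule that)
qed

lemma mem_eigenspace_iff:
  "u \<in> eigenspace m \<Omega> \<mu> \<longleftrightarrow> u \<in> H \<and> (\<forall>v\<in>H. qf u v = \<mu> * ip u v)"
proof -
  have "(LINT x:\<Omega>|lborel. u x * v x) = ip u v" if "u \<in> H" for v
    unfolding set_lebesgue_integral_def ip_def
    by (intro Bochner_Integration.integral_cong refl) (use L2_zero[OF H_L2[OF that]] in \<open>auto simp: indicator_def\<close>)
  then show ?thesis
    unfolding eigenspace_def using log_form_real by (auto simp del: of_real_mult)
qed

text \<open>Everything that the asymptotics take from spectral theory: orthonormality and energies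
  for the upper bound, the variational inequality for the lower one, and the enumeration that
  identifies the eigenvalues. The shift \<open>S\<close> is undone here.\<close>

lemma eigenbasis_exists:
  obtains \<phi> :: "nat \<Rightarrow> 'a \<Rightarrow> real" and lam :: "nat \<Rightarrow> real" where
    "\<And>k. \<phi> k \<in> H" "\<And>i j. ip (\<phi> i) (\<phi> j) = (if i = j then 1 else 0)"
    "\<And>k. qf (\<phi> k) (\<phi> k) = lam k"
    "eigenvalue_enumeration m \<Omega> lam"
    "\<And>f n t. f \<in> H \<Longrightarrow> (\<And>k. k \<ge> n \<Longrightarrow> t \<le> lam k) \<Longrightarrow>
      t * ip f f - qf f f \<le> (\<Sum>k<n. max 0 (t - lam k) * (ip (\<phi> k) f)\<^sup>2)"
proof -
  obtain S where "compact_form H ip (\<lambda>u v. qf u v + S * ip u v)"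
    by (rule compact_form_exists)
  then interpret compact_form H ip "\<lambda>u v. qf u v + S * ip u v" .
  define lam where "lam = (\<lambda>k. eigval k - S)"
  have on: "ip (eigvec i) (eigvec j) = (if i = j then 1 else 0)" for i j by (rule eigvec_orthonormal)
  have eq: "qf (eigvec k) v = lam k * ip (eigvec k) v" if "v \<in> H" for k v
    using eigvec_eq[OF that, of k] by (simp add: lam_def algebra_simps)
  have un: "filterlim lam at_top sequentially"
    unfolding lam_def diff_conv_add_uminus add.commute[of _ "- S"]
    by (rule filterlim_tendsto_add_at_top[OF tendsto_const eigval_unbounded])
  have dim: "has_dim_ae (eigenspace m \<Omega> \<mu>) (card {k. lam k = \<mu>})" for \<mu>
  proof -
    define K where "K = {k. lam k = \<mu>}"
    have Keq: "K = {k. eigval k = \<mu> + S}" by (auto simp: K_def lam_def)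
    have "finite {k. lam k \<le> \<mu>}" by (rule finite_level_set[OF un])
    then have K: "finite K" by (rule finite_subset[rotated]) (auto simp: K_def)
    obtain h where h: "bij_betw h {..<card K} K"
      using ex_bij_betw_nat_finite[OF K] by (auto simp: atLeast0LessThan)
    have hK: "h i \<in> K" if "i < card K" for i using h that by (auto simp: bij_betw_def)
    have hinj: "h i = h j \<longleftrightarrow> i = j" if "i < card K" "j < card K" for i j
      using h that by (auto simp: bij_betw_def inj_on_def)
    define b where "b = (\<lambda>i. eigvec (h i))"
    have bE: "b i \<in> eigenspace m \<Omega> \<mu>" if "i < card K" for i
      using hK[OF that] eigvec_V eq by (auto simp: mem_eigenspace_iff b_def K_def)
    have bind: "\<forall>i<card K. c i = 0" if c: "AE x in lborel. (\<Sum>i<card K. c i * b i x) = 0" for c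
    proof (intro allI impI)
      fix j assume j: "j < card K"
      have f: "(\<lambda>x. \<Sum>i<card K. c i * b i x) = (\<Sum>i<card K. c i *\<^sub>R b i)" by (simp add: fun_eq_iff)
      have "ip (\<Sum>i<card K. c i *\<^sub>R b i) (b j) = 0"
        using ip_cong_AE_zero[OF c, of "b j"] unfolding f .
      moreover have "ip (\<Sum>i<card K. c i *\<^sub>R b i) (b j) = (\<Sum>i<card K. c i * ip (b i) (b j))"
        using eigvec_V by (intro B.B_sum) (auto simp: b_def)
      moreover have "\<dots> = (\<Sum>i<card K. if i = j then c i else 0)"
        using hinj j by (intro sum.cong refl) (auto simp: b_def on)
      ultimately show "c j = 0" using j by simp
    qed
    \<comment> \<open>By \<open>eigenvector_expansion\<close> the residual has
      \<open>ip\<close>-norm zero. In \<open>L2\<close> this means that it vanishes almost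
      everywhere, which is exactly the identification built into \<open>has_dim_ae\<close>.\<close>
    have span: "\<exists>c. AE x in lborel. u x = (\<Sum>i<card K. c i * b i x)" if u: "u \<in> eigenspace m \<Omega> \<mu>" for u
    proof -
      have uH: "u \<in> H" and ue: "\<And>v. v \<in> H \<Longrightarrow> qf u v + S * ip u v = (\<mu> + S) * ip u v"
        using u by (auto simp: mem_eigenspace_iff algebra_simps)
      define g where "g = u - (\<Sum>k\<in>K. ip (eigvec k) u *\<^sub>R eigvec k)"
      have "ip g g = 0"
        unfolding g_def Keq by (rule eigenvector_expansion(2)[OF uH ue])
      moreover have "g \<in> L2"
        unfolding g_def using uH eigvec_V by (intro H_L2 B.diff_V B.sum_V B.scale_V)
      ultimately have "AE x in lborel. g x = 0" using ip_null_iff by blast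
      moreover have "g x = u x - (\<Sum>i<card K. ip (b i) u * b i x)" for x
        unfolding g_def b_def using sum.reindex_bij_betw[OF h, of "\<lambda>k. ip (eigvec k) u * eigvec k x"] by simp
      ultimately show ?thesis by (intro exI[of _ "\<lambda>i. ip (b i) u"]) simp
    qed
    show ?thesis unfolding has_dim_ae_def K_def[symmetric] using bE bind span by blast
  qed
  show ?thesis
  proof (rule that[of eigvec lam])
    show "qf (eigvec k) (eigvec k) = lam k" for k
      using eq[OF eigvec_V, of k k] on[of k k] by simp
    show "eigenvalue_enumeration m \<Omega> lam"
      unfolding eigenvalue_enumeration_def using un dim eigval_mono by (auto simp: incseq_def lam_def)
    fix f :: "'a \<Rightarrow> real" and n :: nat and t :: real
    assume f: "f \<in> H" and n: "\<And>k. k \<ge> n \<Longrightarrow> t \<le> lam k"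
    have "(t + S) * ip f f - (qf f f + S * ip f f) \<le> (\<Sum>k<n. max 0 ((t + S) - eigval k) * (ip (eigvec k) f)\<^sup>2)"
      by (rule residual_form_le[OF f]) (use n in \<open>force simp: lam_def\<close>)
    then show "t * ip f f - qf f f \<le> (\<Sum>k<n. max 0 (t - lam k) * (ip (eigvec k) f)\<^sup>2)"
      by (simp add: lam_def algebra_simps)
  qed (use eigvec_V on in auto)
qed

end

subsection \<open>Berezin's bounds\<close>

text \<open>The functions in the form domain are real, so the plane wave enters as a pair. Writing A
  and B for the transforms of the cosine and sine parts, A + i B and A - i B are translates of the
  transform of \<open>w\<close>, and the claim is the parallelogram law.\<close>

lemma fourier_modulate:
  fixes w :: "'a::euclidean_space \<Rightarrow> real"
  assumes w: "integrable lborel w"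
  shows "(cmod (fourier (\<lambda>x. w x * cos (\<xi> \<bullet> x)) \<eta>))\<^sup>2 + (cmod (fourier (\<lambda>x. w x * sin (\<xi> \<bullet> x)) \<eta>))\<^sup>2 =
    ((cmod (fourier w (\<eta> - \<xi>)))\<^sup>2 + (cmod (fourier w (\<eta> + \<xi>)))\<^sup>2) / 2"
proof -
  have ci: "integrable lborel (\<lambda>x. w x * cos (\<xi> \<bullet> x))" "integrable lborel (\<lambda>x. w x * sin (\<xi> \<bullet> x))"
    using fourier_Re_Im(3,4)[OF w, of \<xi>] by (simp_all add: mult.commute)
  let ?A = "fourier (\<lambda>x. w x * cos (\<xi> \<bullet> x)) \<eta>" and ?B = "fourier (\<lambda>x. w x * sin (\<xi> \<bullet> x)) \<eta>"
  have e: "exp (- (\<i> * complex_of_real a)) * (complex_of_real (cos b) + \<i> * complex_of_real (sin b)) =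
      exp (- (\<i> * complex_of_real (a - b)))"
    "exp (- (\<i> * complex_of_real a)) * (complex_of_real (cos b) - \<i> * complex_of_real (sin b)) =
      exp (- (\<i> * complex_of_real (a + b)))" for a b
    by (simp_all add: complex_eq_iff Re_exp Im_exp cos_diff sin_diff cos_add sin_add algebra_simps)
  have "fourier w (\<eta> - \<xi>) = (LINT x|lborel. exp (- \<i> * complex_of_real (\<eta> \<bullet> x)) * complex_of_real (w x * cos (\<xi> \<bullet> x))
      + \<i> * (exp (- \<i> * complex_of_real (\<eta> \<bullet> x)) * complex_of_real (w x * sin (\<xi> \<bullet> x))))"
    unfolding fourier_def
  proof (intro Bochner_Integration.integral_cong refl)
    fix x
    show "exp (- \<i> * complex_of_real ((\<eta> - \<xi>) \<bullet> x)) * complex_of_real (w x) =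
      exp (- \<i> * complex_of_real (\<eta> \<bullet> x)) * complex_of_real (w x * cos (\<xi> \<bullet> x))
      + \<i> * (exp (- \<i> * complex_of_real (\<eta> \<bullet> x)) * complex_of_real (w x * sin (\<xi> \<bullet> x)))"
      using arg_cong[OF e(1)[of "\<eta> \<bullet> x" "\<xi> \<bullet> x"], of "\<lambda>z. z * complex_of_real (w x)"]
      by (simp add: inner_diff_left algebra_simps)
  qed
  also have "\<dots> = ?A + \<i> * ?B"
    unfolding fourier_def using fourier_Re_Im(5)[OF ci(1), of \<eta>] fourier_Re_Im(5)[OF ci(2), of \<eta>] by simp
  finally have 1: "fourier w (\<eta> - \<xi>) = ?A + \<i> * ?B" .
  have "fourier w (\<eta> + \<xi>) = (LINT x|lborel. exp (- \<i> * complex_of_real (\<eta> \<bullet> x)) * complex_of_real (w x * cos (\<xi> \<bullet> x))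
      - \<i> * (exp (- \<i> * complex_of_real (\<eta> \<bullet> x)) * complex_of_real (w x * sin (\<xi> \<bullet> x))))"
    unfolding fourier_def
  proof (intro Bochner_Integration.integral_cong refl)
    fix x
    show "exp (- \<i> * complex_of_real ((\<eta> + \<xi>) \<bullet> x)) * complex_of_real (w x) =
      exp (- \<i> * complex_of_real (\<eta> \<bullet> x)) * complex_of_real (w x * cos (\<xi> \<bullet> x))
      - \<i> * (exp (- \<i> * complex_of_real (\<eta> \<bullet> x)) * complex_of_real (w x * sin (\<xi> \<bullet> x)))"
      using arg_cong[OF e(2)[of "\<eta> \<bullet> x" "\<xi> \<bullet> x"], of "\<lambda>z. z * complex_of_real (w x)"]
      by (simp add: inner_add_left algebra_simps)
  qed
  also have "\<dots> = ?A - \<i> * ?B"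
    unfolding fourier_def using fourier_Re_Im(5)[OF ci(1), of \<eta>] fourier_Re_Im(5)[OF ci(2), of \<eta>] by simp
  finally have 2: "fourier w (\<eta> + \<xi>) = ?A - \<i> * ?B" .
  show ?thesis
    unfolding 1 2 cmod_power2 by (simp add: power2_eq_square algebra_simps)
qed

lemma log_power_le_linear:
  fixes r :: real
  assumes "0 \<le> r"
  shows "(1 + 2 * ln (1 + r)) ^ k \<le> 2 ^ k * fact k * exp (1 / 2) * (1 + r)"
proof -
  have "0 \<le> ln (1 + r)" using assms by simp
  then have "((1 + 2 * ln (1 + r)) / 2) ^ k \<le> fact k * exp ((1 + 2 * ln (1 + r)) / 2)"
    by (intro power_le_fact_exp) auto
  also have "exp ((1 + 2 * ln (1 + r)) / 2) = exp (1 / 2) * (1 + r)"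
    using assms by (simp add: add_divide_distrib exp_add)
  finally show ?thesis by (simp add: power_divide divide_simps mult_ac)
qed

text \<open>The logarithm at \<zeta> + \<sigma> exceeds that at \<sigma> by at most
  \<open>ln (1 + norm \<zeta> / norm \<sigma>)\<close>, which is small on the annulus. Where \<zeta>
  + \<sigma> falls into the unit ball the symbol itself is kept as a separate term. In
  \<open>C\<close>, the factor 2 m comes from the difference of powers, the middle one from
  \<open>log_power_le_linear\<close>, and the last 2 from bounding
  \<open>norm \<zeta> * (1 + norm \<zeta>)\<close>.\<close>

lemma log_symbol_shift:
  fixes \<sigma> \<zeta> :: "'a::euclidean_space" and m :: nat
  assumes s: "s \<ge> 1" and \<sigma>: "\<sigma> \<in> log_annulus s"
  defines "C \<equiv> 2 * real m * (2 ^ (m - 1) * fact (m - 1) * exp (1 / 2) * 2)"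
  shows "log_symbol m (\<zeta> + \<sigma>) \<le> \<bar>log_symbol m (\<zeta> + \<sigma>)\<bar> * indicator (cball 0 1) (\<zeta> + \<sigma>) + log_symbol m \<sigma>
    + s ^ (m - 1) * exp (- s / 4) * (C * (1 + (norm \<zeta>)\<^sup>2))"
proof -
  have n\<sigma>: "exp (s / 4) < norm \<sigma>" "norm \<sigma> \<le> exp (s / 2)" using \<sigma> by (auto simp: log_annulus_def)
  have "1 \<le> exp (s / 4)" using s by simp
  then have \<sigma>1: "norm \<sigma> > 1" using n\<sigma> by linarith
  define L where "L = 2 * ln (norm \<sigma>)"
  have L: "0 \<le> L" "L \<le> s"
  proof -
    show "0 \<le> L" using \<sigma>1 by (simp add: L_def)
    have "ln (norm \<sigma>) \<le> ln (exp (s / 2))" using n\<sigma>(2) \<sigma>1 by (intro ln_mono) auto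
    then show "L \<le> s" by (simp add: L_def)
  qed
  have C: "C \<ge> 0" by (simp add: C_def)
  have rest: "0 \<le> s ^ (m - 1) * exp (- s / 4) * (C * (1 + (norm \<zeta>)\<^sup>2))"
    using s C by (intro mult_nonneg_nonneg) auto
  have sig: "log_symbol m \<sigma> = L ^ m" by (simp add: log_symbol_def L_def)
  show ?thesis
  proof (cases "norm (\<zeta> + \<sigma>) \<le> 1")
    case True
    have "0 \<le> L ^ m" using L(1) by simp
    with rest abs_ge_self[of "log_symbol m (\<zeta> + \<sigma>)"] True show ?thesis
      unfolding sig by (simp only: mem_cball_0 indicator_simps mult_1_right)
  next
    case False
    \<comment> \<open>Two bounds for the increment are played against each other: \<open>y1\<close>
      carries the small factor \<open>exp (- s / 4)\<close>, while \<open>y2\<close> keeps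
      \<open>(s + y) ^ (m - 1)\<close> below \<open>s ^ (m - 1)\<close> times a power of a logarithm
      of \<zeta>.\<close>
    define y where "y = 2 * ln (1 + norm \<zeta> / norm \<sigma>)"
    have y0: "0 \<le> y" using \<sigma>1 by (simp add: y_def)
    have y1: "y \<le> 2 * norm \<zeta> * exp (- s / 4)"
    proof -
      have "ln (1 + norm \<zeta> / norm \<sigma>) \<le> norm \<zeta> / norm \<sigma>" using \<sigma>1 by (intro ln_add_one_self_le_self) auto
      also have "\<dots> \<le> norm \<zeta> / exp (s / 4)" using n\<sigma> \<sigma>1 by (intro divide_left_mono mult_pos_pos) auto
      also have "\<dots> = norm \<zeta> * exp (- (s / 4))" by (simp only: exp_minus divide_inverse)
      finally show ?thesis by (simp add: y_def)
    qed
    have y2: "y \<le> 2 * ln (1 + norm \<zeta>)"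
    proof -
      have "norm \<zeta> / norm \<sigma> \<le> norm \<zeta> / 1" using \<sigma>1 by (intro divide_left_mono) auto
      then have "ln (1 + norm \<zeta> / norm \<sigma>) \<le> ln (1 + norm \<zeta>)" using \<sigma>1 by (intro ln_mono) (auto intro: add_pos_nonneg)
      then show ?thesis by (simp add: y_def)
    qed
    have "norm (\<zeta> + \<sigma>) \<le> norm \<sigma> * (1 + norm \<zeta> / norm \<sigma>)"
      using norm_triangle_ineq[of \<zeta> \<sigma>] \<sigma>1 by (auto simp: distrib_left)
    then have "ln (norm (\<zeta> + \<sigma>)) \<le> ln (norm \<sigma> * (1 + norm \<zeta> / norm \<sigma>))"
      using False by (intro ln_mono) auto
    also have "\<dots> = ln (norm \<sigma>) + ln (1 + norm \<zeta> / norm \<sigma>)"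
    proof (rule ln_mult_pos)
      show "0 < norm \<sigma>" using \<sigma>1 by linarith
      show "0 < 1 + norm \<zeta> / norm \<sigma>" by (intro add_pos_nonneg) auto
    qed
    finally have "2 * ln (norm (\<zeta> + \<sigma>)) \<le> L + y" by (simp add: L_def y_def)
    then have "log_symbol m (\<zeta> + \<sigma>) \<le> (L + y) ^ m"
      unfolding log_symbol_def using False by (intro power_mono) auto
    also have "\<dots> \<le> L ^ m + real m * y * (s + y) ^ (m - 1)"
      using abs_power_diff_le[of "L + y" "s + y" L m] L y0 by (auto simp: abs_le_iff)
    also have "real m * y * (s + y) ^ (m - 1) \<le> real m * (2 * norm \<zeta> * exp (- s / 4)) * (s * (1 + 2 * ln (1 + norm \<zeta>))) ^ (m - 1)"
    proof (intro mult_mono power_mono)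
      have "s + y \<le> s + s * (2 * ln (1 + norm \<zeta>))"
        using y2 y0 s mult_right_mono[of 1 s "2 * ln (1 + norm \<zeta>)"] by auto
      then show "s + y \<le> s * (1 + 2 * ln (1 + norm \<zeta>))" by (simp add: algebra_simps)
    qed (use y1 y0 s in auto)
    also have "\<dots> = s ^ (m - 1) * exp (- s / 4) * (2 * real m * (norm \<zeta> * (1 + 2 * ln (1 + norm \<zeta>)) ^ (m - 1)))"
      by (simp add: power_mult_distrib mult_ac)
    also have "\<dots> \<le> s ^ (m - 1) * exp (- s / 4) * (2 * real m * (norm \<zeta> * (2 ^ (m - 1) * fact (m - 1) * exp (1 / 2) * (1 + norm \<zeta>))))"
      using s by (intro mult_left_mono log_power_le_linear) auto
    also have "\<dots> = s ^ (m - 1) * exp (- s / 4) * (2 * real m * (2 ^ (m - 1) * fact (m - 1) * exp (1 / 2)) * (norm \<zeta> * (1 + norm \<zeta>)))"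
      by (simp add: mult_ac)
    also have "\<dots> \<le> s ^ (m - 1) * exp (- s / 4) * (2 * real m * (2 ^ (m - 1) * fact (m - 1) * exp (1 / 2)) * (2 * (1 + (norm \<zeta>)\<^sup>2)))"
    proof (intro mult_left_mono)
      have "0 \<le> (norm \<zeta> - 1)\<^sup>2" by simp
      then have "2 * norm \<zeta> \<le> 1 + (norm \<zeta>)\<^sup>2" by (simp add: power2_diff)
      then show "norm \<zeta> * (1 + norm \<zeta>) \<le> 2 * (1 + (norm \<zeta>)\<^sup>2)"
        using norm_ge_zero[of \<zeta>] unfolding power2_eq_square distrib_left by (smt (verit))
    qed (use s in auto)
    also have "\<dots> = s ^ (m - 1) * exp (- s / 4) * (C * (1 + (norm \<zeta>)\<^sup>2))" by (simp add: C_def)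
    finally show ?thesis using False by (simp add: sig)
  qed
qed

section \<open>The two bounds for the Riesz means\<close>

context log_domain
begin

text \<open>The cosine and the sine wave on \<Omega> have squared norms of sum \<bar>\<Omega>\<bar>,
  because their squares add up to the indicator. The bound is uniform in the number of functions and
  in the frequency.\<close>

lemma bessel_plane_waves:
  assumes \<phi>: "\<And>k. k < n \<Longrightarrow> \<phi> k \<in> L2"
    and on: "\<And>i j. ip (\<phi> i) (\<phi> j) = (if i = (j::nat) then 1 else 0)"
  shows "(\<Sum>k<n. (cmod (fourier (\<phi> k) \<xi>))\<^sup>2) \<le> measure lborel \<Omega>"
proof -
  interpret semi_inner L2 ip by (rule semi_inner_ip)
  have i\<Omega>: "integrable lborel (indicator \<Omega> :: 'a \<Rightarrow> real)"
    using emeasure_\<Omega> by (intro integrable_real_indicator) auto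
  define c where "c = (\<lambda>x. cos (\<xi> \<bullet> x) * indicator \<Omega> x :: real)"
  define d where "d = (\<lambda>x. sin (\<xi> \<bullet> x) * indicator \<Omega> x :: real)"
  have [measurable]: "c \<in> borel_measurable borel" "d \<in> borel_measurable borel"
    unfolding c_def d_def by measurable
  have bound: "(c x)\<^sup>2 \<le> indicator \<Omega> x" "(d x)\<^sup>2 \<le> indicator \<Omega> x" for x
    by (auto simp: c_def d_def indicator_def abs_square_le_1)
  have I: "integrable lborel (\<lambda>x. (c x)\<^sup>2)" "integrable lborel (\<lambda>x. (d x)\<^sup>2)"
    by (rule Bochner_Integration.integrable_bound[OF i\<Omega>]; use bound in simp)+
  have cd: "c \<in> L2" "d \<in> L2"
    using I by (auto simp: L2_zero_ext_def c_def d_def)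
  have "(cmod (fourier (\<phi> k) \<xi>))\<^sup>2 = (ip (\<phi> k) c)\<^sup>2 + (ip (\<phi> k) d)\<^sup>2" if k: "k < n" for k
  proof -
    note z = L2_zero[OF \<phi>[OF k]]
    have "Re (fourier (\<phi> k) \<xi>) = ip (\<phi> k) c" "Im (fourier (\<phi> k) \<xi>) = - ip (\<phi> k) d"
      unfolding fourier_Re_Im(1,2)[OF L2_integrable[OF \<phi>[OF k]]] ip_def c_def d_def
      by (auto intro!: Bochner_Integration.integral_cong simp: indicator_def z)
    then show ?thesis by (simp add: cmod_power2)
  qed
  then have "(\<Sum>k<n. (cmod (fourier (\<phi> k) \<xi>))\<^sup>2) = (\<Sum>k<n. (ip (\<phi> k) c)\<^sup>2) + (\<Sum>k<n. (ip (\<phi> k) d)\<^sup>2)"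
    by (simp add: sum.distrib)
  also have "\<dots> \<le> ip c c + ip d d"
    using \<phi> on cd by (intro add_mono bessel) auto
  also have "\<dots> = (LINT x|lborel. (c x)\<^sup>2 + (d x)\<^sup>2)"
    unfolding ip_self using I by simp
  also have "(\<lambda>x. (c x)\<^sup>2 + (d x)\<^sup>2) = indicator \<Omega>"
    by (auto simp: c_def d_def indicator_def fun_eq_iff)
  finally show ?thesis by simp
qed

text \<open>Summing the estimates \<open>each\<close> brings the sum of the squared transforms under
  one integral, where \<open>bessel_plane_waves\<close> replaces it by the volume of \<Omega>. Every
  finite number of terms is allowed.\<close>

lemma berezin_upper:
  assumes \<phi>: "\<And>k. \<phi> k \<in> H" and on: "\<And>i j. ip (\<phi> i) (\<phi> j) = (if i = (j::nat) then 1 else 0)"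
    and lam: "\<And>k. qf (\<phi> k) (\<phi> k) = lam k"
    and I: "integrable lborel (\<lambda>\<xi>::'a. max 0 (t - log_symbol m \<xi>))"
  shows "(2 * pi) ^ DIM('a) * (\<Sum>k<n. max 0 (t - lam k)) \<le> measure lborel \<Omega> * (LINT \<xi>::'a|lborel. max 0 (t - log_symbol m \<xi>))"
proof -
  let ?c = "(2 * pi) ^ DIM('a)" and ?P = "\<lambda>\<xi>::'a. max 0 (t - log_symbol m \<xi>)"
  have Ik: "integrable lborel (\<lambda>\<xi>. ?P \<xi> * (cmod (fourier (\<phi> k) \<xi>))\<^sup>2)" for k
  proof (rule Bochner_Integration.integrable_bound)
    note [measurable] = L2_measurable[OF H_L2[OF \<phi>[of k]]]
    show "integrable lborel (\<lambda>\<xi>. \<bar>t\<bar> * (cmod (fourier (\<phi> k) \<xi>))\<^sup>2 + \<bar>log_symbol m \<xi>\<bar> * (cmod (fourier (\<phi> k) \<xi>))\<^sup>2)"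
      by (intro Bochner_Integration.integrable_add integrable_mult_right L2_plancherel(1) H_symbol_integrable_abs(1) H_L2 \<phi>)
    show "(\<lambda>\<xi>. ?P \<xi> * (cmod (fourier (\<phi> k) \<xi>))\<^sup>2) \<in> borel_measurable lborel" by measurable
    show "AE \<xi> in lborel. norm (?P \<xi> * (cmod (fourier (\<phi> k) \<xi>))\<^sup>2) \<le>
        norm (\<bar>t\<bar> * (cmod (fourier (\<phi> k) \<xi>))\<^sup>2 + \<bar>log_symbol m \<xi>\<bar> * (cmod (fourier (\<phi> k) \<xi>))\<^sup>2)"
    proof (intro AE_I2)
      fix \<xi> :: 'a
      have "\<bar>?P \<xi>\<bar> \<le> \<bar>t\<bar> + \<bar>log_symbol m \<xi>\<bar>" by auto
      from mult_right_mono[OF this zero_le_power2[of "cmod (fourier (\<phi> k) \<xi>)"]]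
      show "norm (?P \<xi> * (cmod (fourier (\<phi> k) \<xi>))\<^sup>2) \<le>
        norm (\<bar>t\<bar> * (cmod (fourier (\<phi> k) \<xi>))\<^sup>2 + \<bar>log_symbol m \<xi>\<bar> * (cmod (fourier (\<phi> k) \<xi>))\<^sup>2)"
        by (simp add: abs_mult distrib_right)
    qed
  qed
  \<comment> \<open>Jensen's inequality for the positive part: divided by (2 pi)^N, the squared
    transform of a normalised function is a probability density, under which
    \<open>t - log_symbol m \<xi>\<close> has mean \<open>t - lam k\<close>.\<close>
  have each: "?c * max 0 (t - lam k) \<le> (LINT \<xi>|lborel. ?P \<xi> * (cmod (fourier (\<phi> k) \<xi>))\<^sup>2)" for k
  proof -
    note i = L2_plancherel(1)[OF H_L2[OF \<phi>[of k]]] qf_self(2)[OF \<phi>[of k]]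
    have "?c * (t - lam k) = t * (?c * ip (\<phi> k) (\<phi> k)) - ?c * qf (\<phi> k) (\<phi> k)"
      using on[of k k] by (simp add: lam algebra_simps)
    also have "\<dots> = (LINT \<xi>|lborel. t * (cmod (fourier (\<phi> k) \<xi>))\<^sup>2 - log_symbol m \<xi> * (cmod (fourier (\<phi> k) \<xi>))\<^sup>2)"
      unfolding qf_self(1)[OF \<phi>] L2_plancherel(2)[OF H_L2[OF \<phi>], symmetric] using i by simp
    also have "\<dots> \<le> (LINT \<xi>|lborel. ?P \<xi> * (cmod (fourier (\<phi> k) \<xi>))\<^sup>2)"
    proof (intro integral_mono Bochner_Integration.integrable_diff integrable_mult_right i Ik)
      fix \<xi> :: 'a
      have "(t - log_symbol m \<xi>) * (cmod (fourier (\<phi> k) \<xi>))\<^sup>2 \<le> ?P \<xi> * (cmod (fourier (\<phi> k) \<xi>))\<^sup>2"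
        by (intro mult_right_mono) auto
      then show "t * (cmod (fourier (\<phi> k) \<xi>))\<^sup>2 - log_symbol m \<xi> * (cmod (fourier (\<phi> k) \<xi>))\<^sup>2 \<le> ?P \<xi> * (cmod (fourier (\<phi> k) \<xi>))\<^sup>2"
        by (simp add: left_diff_distrib)
    qed
    finally have 1: "?c * (t - lam k) \<le> (LINT \<xi>|lborel. ?P \<xi> * (cmod (fourier (\<phi> k) \<xi>))\<^sup>2)" .
    have 2: "0 \<le> (LINT \<xi>|lborel. ?P \<xi> * (cmod (fourier (\<phi> k) \<xi>))\<^sup>2)"
      by (intro Bochner_Integration.integral_nonneg mult_nonneg_nonneg) auto
    show ?thesis using 1 2 by (cases "t - lam k \<ge> 0") (auto simp: max_def)
  qed
  have "?c * (\<Sum>k<n. max 0 (t - lam k)) = (\<Sum>k<n. ?c * max 0 (t - lam k))"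
    by (rule sum_distrib_left)
  also have "\<dots> \<le> (\<Sum>k<n. (LINT \<xi>|lborel. ?P \<xi> * (cmod (fourier (\<phi> k) \<xi>))\<^sup>2))"
    by (intro sum_mono each)
  also have "\<dots> = (LINT \<xi>|lborel. (\<Sum>k<n. ?P \<xi> * (cmod (fourier (\<phi> k) \<xi>))\<^sup>2))"
    using Ik by (intro Bochner_Integration.integral_sum[symmetric]) auto
  also have "\<dots> \<le> (LINT \<xi>::'a|lborel. measure lborel \<Omega> * ?P \<xi>)"
  proof (intro integral_mono Bochner_Integration.integrable_sum Ik integrable_mult_right I)
    fix \<xi> :: 'a
    have "(\<Sum>k<n. ?P \<xi> * (cmod (fourier (\<phi> k) \<xi>))\<^sup>2) = ?P \<xi> * (\<Sum>k<n. (cmod (fourier (\<phi> k) \<xi>))\<^sup>2)"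
      by (rule sum_distrib_left[symmetric])
    also have "\<dots> \<le> ?P \<xi> * measure lborel \<Omega>"
      using \<phi> on by (intro mult_left_mono bessel_plane_waves H_L2) auto
    finally show "(\<Sum>k<n. ?P \<xi> * (cmod (fourier (\<phi> k) \<xi>))\<^sup>2) \<le> measure lborel \<Omega> * ?P \<xi>"
      by (simp add: mult.commute)
  qed
  also have "\<dots> = measure lborel \<Omega> * (LINT \<xi>::'a|lborel. ?P \<xi>)" by simp
  finally show ?thesis .
qed

text \<open>By \<open>fourier_modulate\<close> the joint energy of the two trial functions averages
  the symbol against the squared transform of \<open>w\<close> centred at \<xi> and at - \<xi>;
  \<open>log_symbol_shift\<close> evaluates it. \<open>C1\<close> comes from the decay of that
  transform, \<open>C2\<close> from the singularity of the symbol at the origin. Both are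
  independent of \<open>s\<close> and \<xi>.\<close>

lemma trial_energy:
  assumes w: "w \<in> smooth_alg" "w \<in> test_functions \<Omega>"
  obtains C1 C2 where "0 \<le> C1" "0 \<le> C2"
    "\<And>s \<xi>. s \<ge> 1 \<Longrightarrow> \<xi> \<in> log_annulus s \<Longrightarrow>
      (2 * pi) ^ DIM('a) * (qf (\<lambda>x. w x * cos (\<xi> \<bullet> x)) (\<lambda>x. w x * cos (\<xi> \<bullet> x)) + qf (\<lambda>x. w x * sin (\<xi> \<bullet> x)) (\<lambda>x. w x * sin (\<xi> \<bullet> x)))
      \<le> (2 * pi) ^ DIM('a) * ip w w * log_symbol m \<xi> + s ^ (m - 1) * exp (- s / 4) * C1 + C2"
proof -
  let ?c = "(2 * pi) ^ DIM('a)"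
  define C where "C = 2 * real m * (2 ^ (m - 1) * fact (m - 1) * exp (1 / 2) * 2)"
  define C1 where "C1 = (LINT \<zeta>|lborel. C * ((1 + (norm \<zeta>)\<^sup>2) * (cmod (fourier w \<zeta>))\<^sup>2))"
  define C2 where "C2 = symK * (volK * ip w w)"
  have wH: "w \<in> H" "w \<in> L2" using test_functions_H[OF w(2)] H_L2 by auto
  note [measurable] = L2_measurable[OF wH(2)]
  have half: "integrable lborel (\<lambda>\<eta>. log_symbol m \<eta> * (cmod (fourier w (\<eta> - \<sigma>)))\<^sup>2) \<Longrightarrow>
      (LINT \<eta>|lborel. log_symbol m \<eta> * (cmod (fourier w (\<eta> - \<sigma>)))\<^sup>2) \<le> ?c * ip w w * log_symbol m \<sigma> + s ^ (m - 1) * exp (- s / 4) * C1 + C2"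
    if s: "s \<ge> 1" and \<sigma>: "\<sigma> \<in> log_annulus s" for s \<sigma>
  proof -
    assume int: "integrable lborel (\<lambda>\<eta>. log_symbol m \<eta> * (cmod (fourier w (\<eta> - \<sigma>)))\<^sup>2)"
    have int': "integrable lborel (\<lambda>\<zeta>. log_symbol m (\<zeta> + \<sigma>) * (cmod (fourier w \<zeta>))\<^sup>2)"
      using lborel_integrable_affine_euclidean[OF int, of 1 \<sigma>] by (simp add: add.commute)
    have b1: "integrable lborel (\<lambda>\<zeta>. \<bar>log_symbol m (\<zeta> + \<sigma>)\<bar> * indicator (cball 0 1) (\<zeta> + \<sigma>) * (volK * ip w w))"
      using lborel_integrable_affine_euclidean[OF integrable_log_symbol_cball[of m], of 1 \<sigma>]
      by (intro integrable_mult_left) (simp add: add.commute)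
    have b1e: "(LINT \<zeta>|lborel. \<bar>log_symbol m (\<zeta> + \<sigma>)\<bar> * indicator (cball 0 1) (\<zeta> + \<sigma>) * (volK * ip w w)) = C2"
    proof -
      have "symK = (LINT \<zeta>|lborel. \<bar>log_symbol m (\<sigma> + 1 *\<^sub>R \<zeta>)\<bar> * indicator (cball 0 1) (\<sigma> + 1 *\<^sub>R \<zeta>))"
        unfolding symK_def by (subst lborel_integral_affine_euclidean[of _ 1 \<sigma>]) auto
      then show ?thesis unfolding C2_def by (simp add: add.commute)
    qed
    have "(LINT \<eta>|lborel. log_symbol m \<eta> * (cmod (fourier w (\<eta> - \<sigma>)))\<^sup>2) = (LINT \<zeta>|lborel. log_symbol m (\<zeta> + \<sigma>) * (cmod (fourier w \<zeta>))\<^sup>2)"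
      by (subst lborel_integral_affine_euclidean[of _ 1 \<sigma>]) (auto simp: add.commute)
    also have "\<dots> \<le> (LINT \<zeta>|lborel. \<bar>log_symbol m (\<zeta> + \<sigma>)\<bar> * indicator (cball 0 1) (\<zeta> + \<sigma>) * (volK * ip w w)
       + log_symbol m \<sigma> * (cmod (fourier w \<zeta>))\<^sup>2
       + s ^ (m - 1) * exp (- s / 4) * (C * ((1 + (norm \<zeta>)\<^sup>2) * (cmod (fourier w \<zeta>))\<^sup>2)))"
    proof (intro integral_mono int' Bochner_Integration.integrable_add integrable_mult_right b1 L2_plancherel(1) wH test_function_fourier_decay[OF w(2)])
      fix \<zeta> :: 'a
      let ?F = "(cmod (fourier w \<zeta>))\<^sup>2"
      have "log_symbol m (\<zeta> + \<sigma>) * ?F \<le> (\<bar>log_symbol m (\<zeta> + \<sigma>)\<bar> * indicator (cball 0 1) (\<zeta> + \<sigma>) + log_symbol m \<sigma>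
          + s ^ (m - 1) * exp (- s / 4) * (C * (1 + (norm \<zeta>)\<^sup>2))) * ?F"
        unfolding C_def by (intro mult_right_mono log_symbol_shift s \<sigma>) simp
      also have "\<dots> = \<bar>log_symbol m (\<zeta> + \<sigma>)\<bar> * indicator (cball 0 1) (\<zeta> + \<sigma>) * ?F + log_symbol m \<sigma> * ?F
          + s ^ (m - 1) * exp (- s / 4) * (C * ((1 + (norm \<zeta>)\<^sup>2) * ?F))"
        by (simp only: distrib_right mult.assoc)
      also have "\<dots> \<le> \<bar>log_symbol m (\<zeta> + \<sigma>)\<bar> * indicator (cball 0 1) (\<zeta> + \<sigma>) * (volK * ip w w) + log_symbol m \<sigma> * ?F
          + s ^ (m - 1) * exp (- s / 4) * (C * ((1 + (norm \<zeta>)\<^sup>2) * ?F))"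
        using L2_fourier_bound[OF wH(2)] by (intro add_right_mono mult_left_mono) auto
      finally show "log_symbol m (\<zeta> + \<sigma>) * ?F \<le> \<bar>log_symbol m (\<zeta> + \<sigma>)\<bar> * indicator (cball 0 1) (\<zeta> + \<sigma>) * (volK * ip w w) + log_symbol m \<sigma> * ?F
          + s ^ (m - 1) * exp (- s / 4) * (C * ((1 + (norm \<zeta>)\<^sup>2) * ?F))" .
    qed
    also have "\<dots> = C2 + log_symbol m \<sigma> * (LINT \<zeta>|lborel. (cmod (fourier w \<zeta>))\<^sup>2) + s ^ (m - 1) * exp (- s / 4) * C1"
      unfolding C1_def b1e[symmetric]
      using b1 L2_plancherel(1)[OF wH(2)] test_function_fourier_decay[OF w(2)] by simp
    also have "\<dots> = ?c * ip w w * log_symbol m \<sigma> + s ^ (m - 1) * exp (- s / 4) * C1 + C2"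
      unfolding L2_plancherel(2)[OF wH(2)] by simp
    finally show "(LINT \<eta>|lborel. log_symbol m \<eta> * (cmod (fourier w (\<eta> - \<sigma>)))\<^sup>2) \<le> ?c * ip w w * log_symbol m \<sigma> + s ^ (m - 1) * exp (- s / 4) * C1 + C2" .
  qed
  show ?thesis
  proof (rule that[of C1 C2])
    show "0 \<le> C1" unfolding C1_def C_def by (intro Bochner_Integration.integral_nonneg mult_nonneg_nonneg) auto
    show "0 \<le> C2" unfolding C2_def using symK_nonneg volK_pos ip_nonneg[of w] by (intro mult_nonneg_nonneg) auto
    fix s :: real and \<xi> :: 'a assume s: "s \<ge> 1" and \<xi>: "\<xi> \<in> log_annulus s"
    let ?f = "\<lambda>x. w x * cos (\<xi> \<bullet> x)" and ?g = "\<lambda>x. w x * sin (\<xi> \<bullet> x)"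
    have H: "?f \<in> H" "?g \<in> H"
      by (intro test_functions_H test_functions_mult_smooth_alg w smooth_alg.intros)+
    \<comment> \<open>Each translate is one of two nonnegative summands in
      \<open>fourier_modulate\<close>, so it inherits integrability from the trial functions, which
      belong to \<open>H\<close>.\<close>
    have sh: "integrable lborel (\<lambda>\<eta>. log_symbol m \<eta> * (cmod (fourier w (\<eta> - \<sigma>)))\<^sup>2)" if "\<sigma> = \<xi> \<or> \<sigma> = - \<xi>" for \<sigma>
    proof (rule Bochner_Integration.integrable_bound)
      show "integrable lborel (\<lambda>\<eta>. 2 * (\<bar>log_symbol m \<eta>\<bar> * (cmod (fourier ?f \<eta>))\<^sup>2 + \<bar>log_symbol m \<eta>\<bar> * (cmod (fourier ?g \<eta>))\<^sup>2))"
        by (intro integrable_mult_right Bochner_Integration.integrable_add H_symbol_integrable_abs(1) H)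
      show "(\<lambda>\<eta>. log_symbol m \<eta> * (cmod (fourier w (\<eta> - \<sigma>)))\<^sup>2) \<in> borel_measurable lborel" by measurable
      show "AE \<eta> in lborel. norm (log_symbol m \<eta> * (cmod (fourier w (\<eta> - \<sigma>)))\<^sup>2) \<le>
        norm (2 * (\<bar>log_symbol m \<eta>\<bar> * (cmod (fourier ?f \<eta>))\<^sup>2 + \<bar>log_symbol m \<eta>\<bar> * (cmod (fourier ?g \<eta>))\<^sup>2))"
      proof (intro AE_I2)
        fix \<eta> :: 'a
        have "(cmod (fourier w (\<eta> - \<sigma>)))\<^sup>2 \<le> 2 * ((cmod (fourier ?f \<eta>))\<^sup>2 + (cmod (fourier ?g \<eta>))\<^sup>2)"
          unfolding fourier_modulate[OF L2_integrable[OF wH(2)]] using that by auto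
        from mult_left_mono[OF this abs_ge_zero[of "log_symbol m \<eta>"]]
        show "norm (log_symbol m \<eta> * (cmod (fourier w (\<eta> - \<sigma>)))\<^sup>2) \<le>
          norm (2 * (\<bar>log_symbol m \<eta>\<bar> * (cmod (fourier ?f \<eta>))\<^sup>2 + \<bar>log_symbol m \<eta>\<bar> * (cmod (fourier ?g \<eta>))\<^sup>2))"
          by (simp add: abs_mult algebra_simps)
      qed
    qed
    have "?c * (qf ?f ?f + qf ?g ?g) = (LINT \<eta>|lborel. log_symbol m \<eta> * (cmod (fourier ?f \<eta>))\<^sup>2 + log_symbol m \<eta> * (cmod (fourier ?g \<eta>))\<^sup>2)"
      unfolding distrib_left qf_self(1)[OF H(1)] qf_self(1)[OF H(2)] using qf_self(2)[OF H(1)] qf_self(2)[OF H(2)] by simp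
    also have "\<dots> = (LINT \<eta>|lborel. (log_symbol m \<eta> * (cmod (fourier w (\<eta> - \<xi>)))\<^sup>2 + log_symbol m \<eta> * (cmod (fourier w (\<eta> - - \<xi>)))\<^sup>2) / 2)"
      unfolding distrib_left[symmetric] fourier_modulate[OF L2_integrable[OF wH(2)]] by simp
    also have "\<dots> = ((LINT \<eta>|lborel. log_symbol m \<eta> * (cmod (fourier w (\<eta> - \<xi>)))\<^sup>2) + (LINT \<eta>|lborel. log_symbol m \<eta> * (cmod (fourier w (\<eta> - - \<xi>)))\<^sup>2)) / 2"
      using sh[of \<xi>] sh[of "- \<xi>"] by simp
    also have "\<dots> \<le> ((?c * ip w w * log_symbol m \<xi> + s ^ (m - 1) * exp (- s / 4) * C1 + C2) + (?c * ip w w * log_symbol m (- \<xi>) + s ^ (m - 1) * exp (- s / 4) * C1 + C2)) / 2"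
      using \<xi> s by (intro divide_right_mono add_mono half sh) (auto simp: log_annulus_def)
    also have "\<dots> = ?c * ip w w * log_symbol m \<xi> + s ^ (m - 1) * exp (- s / 4) * C1 + C2"
    proof -
      have "log_symbol m (- \<xi>) = log_symbol m \<xi>" by (simp add: log_symbol_def)
      moreover have "(x + x) / 2 = x" for x :: real by simp
      ultimately show ?thesis by metis
    qed
    finally show "?c * (qf ?f ?f + qf ?g ?g) \<le> ?c * ip w w * log_symbol m \<xi> + s ^ (m - 1) * exp (- s / 4) * C1 + C2" .
  qed
qed

text \<open>The variational inequality for both trial functions is added up and integrated over
  \<xi> in the annulus. Their squared norms add up to that of \<open>w\<close>, and their
  coefficients combine to the squared transform of \<open>w\<close> times the eigenfunction. Its
  integral over all frequencies is at most (2 pi)^N, by Plancherel and because \<open>w\<close> is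
  at most 1.\<close>

lemma berezin_lower:
  assumes \<phi>: "\<And>k. \<phi> k \<in> H" and on: "\<And>i j. ip (\<phi> i) (\<phi> j) = (if i = (j::nat) then 1 else 0)"
    and ex: "\<And>f n t. f \<in> H \<Longrightarrow> (\<And>k. k \<ge> n \<Longrightarrow> t \<le> lam k) \<Longrightarrow>
      t * ip f f - qf f f \<le> (\<Sum>k<n. max 0 (t - lam k) * (ip (\<phi> k) f)\<^sup>2)"
    and w: "w \<in> smooth_alg" "w \<in> test_functions \<Omega>" "\<And>x. 0 \<le> w x" "\<And>x. w x \<le> 1"
  obtains C1 C2 where "0 \<le> C1" "0 \<le> C2"
    "\<And>s n. s \<ge> 1 \<Longrightarrow> (\<And>k. k \<ge> n \<Longrightarrow> s ^ m \<le> lam k) \<Longrightarrow>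
      ip w w * (LINT \<xi>::'a|lborel. (s ^ m - log_symbol m \<xi>) * indicator (log_annulus s) \<xi>)
      - (s ^ (m - 1) * exp (- s / 4) * C1 + C2) * measure lborel (log_annulus s :: 'a set)
      \<le> (2 * pi) ^ DIM('a) * (\<Sum>k<n. max 0 (s ^ m - lam k))"
proof -
  let ?c = "(2 * pi) ^ DIM('a)"
  have c: "?c > 0" by simp
  have wH: "w \<in> H" "w \<in> L2" using test_functions_H[OF w(2)] H_L2 by auto
  note [measurable] = L2_measurable[OF wH(2)]
  obtain C1 C2 where C: "0 \<le> C1" "0 \<le> C2"
    and en: "\<And>s \<xi>. s \<ge> 1 \<Longrightarrow> \<xi> \<in> log_annulus s \<Longrightarrow>
      ?c * (qf (\<lambda>x. w x * cos (\<xi> \<bullet> x)) (\<lambda>x. w x * cos (\<xi> \<bullet> x)) + qf (\<lambda>x. w x * sin (\<xi> \<bullet> x)) (\<lambda>x. w x * sin (\<xi> \<bullet> x)))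
      \<le> ?c * ip w w * log_symbol m \<xi> + s ^ (m - 1) * exp (- s / 4) * C1 + C2"
    using trial_energy[OF w(1,2)] by blast
  have wsq: "(w x * a)\<^sup>2 \<le> a\<^sup>2" for x a
    using w(3,4)[of x] by (simp add: power_mult_distrib mult_left_le_one_le power_le_one)
  have w\<phi>: "(\<lambda>x. w x * \<phi> k x) \<in> L2" for k
  proof -
    note [measurable] = L2_measurable[OF H_L2[OF \<phi>[of k]]]
    have "integrable lborel (\<lambda>x. (w x * \<phi> k x)\<^sup>2)"
      by (rule Bochner_Integration.integrable_bound[OF L2_sq_integrable[OF H_L2[OF \<phi>[of k]]]]) (auto simp: wsq)
    then show ?thesis using L2_zero[OF wH(2)] by (auto simp: L2_zero_ext_def)
  qed
  have w\<phi>1: "ip (\<lambda>x. w x * \<phi> k x) (\<lambda>x. w x * \<phi> k x) \<le> 1" for k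
  proof -
    have "ip (\<lambda>x. w x * \<phi> k x) (\<lambda>x. w x * \<phi> k x) \<le> ip (\<phi> k) (\<phi> k)"
      unfolding ip_self by (intro integral_mono L2_sq_integrable w\<phi> H_L2 \<phi> wsq)
    then show ?thesis using on by simp
  qed
  show ?thesis
  proof (rule that[of "C1 / ?c" "C2 / ?c"])
    show "0 \<le> C1 / ?c" "0 \<le> C2 / ?c" using C c by auto
    fix s :: real and n :: nat
    assume s: "s \<ge> 1" and n: "\<And>k. k \<ge> n \<Longrightarrow> s ^ m \<le> lam k"
    define D where "D = s ^ (m - 1) * exp (- s / 4) * (C1 / ?c) + C2 / ?c"
    let ?E = "log_annulus s :: 'a set"
    let ?S = "\<lambda>\<xi>. \<Sum>k<n. max 0 (s ^ m - lam k) * (cmod (fourier (\<lambda>x. w x * \<phi> k x) \<xi>))\<^sup>2"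
    have pt: "ip w w * (s ^ m - log_symbol m \<xi>) - D \<le> ?S \<xi>" if \<xi>: "\<xi> \<in> ?E" for \<xi>
    proof -
      let ?f = "\<lambda>x. w x * cos (\<xi> \<bullet> x)" and ?g = "\<lambda>x. w x * sin (\<xi> \<bullet> x)"
      have H: "?f \<in> H" "?g \<in> H"
        by (intro test_functions_H test_functions_mult_smooth_alg w smooth_alg.intros)+
      have norms: "ip ?f ?f + ip ?g ?g = ip w w"
      proof -
        have "ip ?f ?f + ip ?g ?g = (LINT x|lborel. (?f x)\<^sup>2 + (?g x)\<^sup>2)"
          unfolding ip_self using L2_sq_integrable[OF H_L2[OF H(1)]] L2_sq_integrable[OF H_L2[OF H(2)]] by simp
        also have "(\<lambda>x. (?f x)\<^sup>2 + (?g x)\<^sup>2) = (\<lambda>x. (w x)\<^sup>2)"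
          by (simp add: power_mult_distrib distrib_left[symmetric])
        finally show ?thesis by (simp add: ip_self)
      qed
      have coef: "(ip (\<phi> k) ?f)\<^sup>2 + (ip (\<phi> k) ?g)\<^sup>2 = (cmod (fourier (\<lambda>x. w x * \<phi> k x) \<xi>))\<^sup>2" for k
      proof -
        have "Re (fourier (\<lambda>x. w x * \<phi> k x) \<xi>) = ip (\<phi> k) ?f" "Im (fourier (\<lambda>x. w x * \<phi> k x) \<xi>) = - ip (\<phi> k) ?g"
          unfolding fourier_Re_Im(1,2)[OF L2_integrable[OF w\<phi>]] ip_def by (simp_all add: mult_ac)
        then show ?thesis by (simp add: cmod_power2)
      qed
      have "?c * (qf ?f ?f + qf ?g ?g) \<le> ?c * (ip w w * log_symbol m \<xi> + D)"
        using en[OF s \<xi>] c by (simp add: D_def distrib_left mult_ac)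
      then have q: "qf ?f ?f + qf ?g ?g \<le> ip w w * log_symbol m \<xi> + D"
        using c by (simp only: mult_le_cancel_left_pos)
      have "ip w w * (s ^ m - log_symbol m \<xi>) - D = s ^ m * (ip ?f ?f + ip ?g ?g) - (ip w w * log_symbol m \<xi> + D)"
        unfolding norms by (simp add: algebra_simps)
      also have "\<dots> \<le> (s ^ m * ip ?f ?f - qf ?f ?f) + (s ^ m * ip ?g ?g - qf ?g ?g)"
        using q by (simp add: distrib_left)
      also have "\<dots> \<le> (\<Sum>k<n. max 0 (s ^ m - lam k) * (ip (\<phi> k) ?f)\<^sup>2) + (\<Sum>k<n. max 0 (s ^ m - lam k) * (ip (\<phi> k) ?g)\<^sup>2)"
        by (intro add_mono ex H n)
      also have "\<dots> = ?S \<xi>"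
        unfolding coef[symmetric] by (simp add: sum.distrib distrib_left)
      finally show ?thesis .
    qed
    have S0: "0 \<le> ?S \<xi>" for \<xi> by (intro sum_nonneg mult_nonneg_nonneg) auto
    obtain U :: "real \<Rightarrow> real" where U: "\<And>s. s \<ge> 1 \<Longrightarrow> integrable lborel (\<lambda>\<xi>::'a. (s ^ m - log_symbol m \<xi>) * indicator (log_annulus s) \<xi>)"
      using berezin_lower_integral[where 'a='a and m=m] by blast
    have "emeasure lborel ?E \<le> emeasure lborel (cball (0::'a) (exp (s / 2)))"
      by (intro emeasure_mono) (auto simp: log_annulus_def)
    also have "\<dots> < top" by (rule emeasure_lborel_cball_less_top)
    finally have EI: "integrable lborel (indicator ?E :: 'a \<Rightarrow> real)"
      by (intro integrable_real_indicator) (auto simp: less_top)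
    have SI: "integrable lborel ?S"
      by (intro Bochner_Integration.integrable_sum integrable_mult_right L2_plancherel(1) w\<phi>)
    have "ip w w * (LINT \<xi>::'a|lborel. (s ^ m - log_symbol m \<xi>) * indicator ?E \<xi>) - D * measure lborel ?E =
        (LINT \<xi>|lborel. ip w w * ((s ^ m - log_symbol m \<xi>) * indicator ?E \<xi>) - D * indicator ?E \<xi>)"
      using U[OF s] EI by simp
    also have "\<dots> \<le> (LINT \<xi>|lborel. ?S \<xi>)"
    proof (intro integral_mono Bochner_Integration.integrable_diff integrable_mult_right U s EI SI)
      show "ip w w * ((s ^ m - log_symbol m \<xi>) * indicator ?E \<xi>) - D * indicator ?E \<xi> \<le> ?S \<xi>" for \<xi>
        using pt[of \<xi>] S0[of \<xi>] by (cases "\<xi> \<in> ?E") auto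
    qed
    also have "\<dots> = (\<Sum>k<n. max 0 (s ^ m - lam k) * (?c * ip (\<lambda>x. w x * \<phi> k x) (\<lambda>x. w x * \<phi> k x)))"
      unfolding L2_plancherel(2)[OF w\<phi>, symmetric] using L2_plancherel(1)[OF w\<phi>] by (simp add: Bochner_Integration.integral_sum)
    also have "\<dots> \<le> (\<Sum>k<n. max 0 (s ^ m - lam k) * (?c * 1))"
      using w\<phi>1 c by (intro sum_mono mult_left_mono) auto
    also have "\<dots> = ?c * (\<Sum>k<n. max 0 (s ^ m - lam k))"
      by (simp add: sum_distrib_left mult.commute)
    finally show "ip w w * (LINT \<xi>::'a|lborel. (s ^ m - log_symbol m \<xi>) * indicator (log_annulus s) \<xi>)
      - (s ^ (m - 1) * exp (- s / 4) * (C1 / ?c) + C2 / ?c) * measure lborel (log_annulus s :: 'a set)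
      \<le> ?c * (\<Sum>k<n. max 0 (s ^ m - lam k))" by (simp only: D_def)
  qed
qed

end

subsection \<open>From Riesz means to the counting function\<close>

lemma riesz_mean_eq_sum:
  fixes lam :: "nat \<Rightarrow> real"
  assumes "finite I" "\<And>k. lam k < t \<Longrightarrow> k \<in> I"
  shows "(\<Sum>k. max 0 (t - lam k)) = (\<Sum>k\<in>I. max 0 (t - lam k))"
  using assms(2) by (intro suminf_finite assms(1)) (force simp: max_def)

text \<open>The Riesz mean is a convex primitive of the counting function: from \<open>t\<close> to
  \<open>t'\<close>, a term grows by exactly \<open>t' - t\<close> if its eigenvalue is below
  \<open>t\<close>, by at most that much if it is below \<open>t'\<close>, and otherwise not at
  all.\<close>

lemma riesz_mean_increment:
  fixes lam :: "nat \<Rightarrow> real"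
  assumes lam: "filterlim lam at_top sequentially" and t: "t \<le> t'"
  shows "(t' - t) * real (card {k. lam k < t}) \<le> (\<Sum>k. max 0 (t' - lam k)) - (\<Sum>k. max 0 (t - lam k))"
    and "(\<Sum>k. max 0 (t' - lam k)) - (\<Sum>k. max 0 (t - lam k)) \<le> (t' - t) * real (card {k. lam k < t'})"
proof -
  define I where "I = {k. lam k \<le> t'}"
  have I: "finite I" unfolding I_def by (rule finite_level_set[OF lam])
  have eq: "(\<Sum>k. max 0 (t' - lam k)) - (\<Sum>k. max 0 (t - lam k)) = (\<Sum>k\<in>I. max 0 (t' - lam k) - max 0 (t - lam k))"
    using riesz_mean_eq_sum[OF I, of lam t'] riesz_mean_eq_sum[OF I, of lam t] t
    by (auto simp: I_def sum_subtractf)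
  have card: "(t' - t) * real (card {k. lam k < r}) = (\<Sum>k\<in>I. if lam k < r then t' - t else 0)" if "r \<le> t'" for r
  proof -
    have "{k. lam k < r} = {k\<in>I. lam k < r}" using that by (auto simp: I_def)
    then show ?thesis using I by (simp add: sum.inter_filter[symmetric] mult.commute)
  qed
  show "(t' - t) * real (card {k. lam k < t}) \<le> (\<Sum>k. max 0 (t' - lam k)) - (\<Sum>k. max 0 (t - lam k))"
    unfolding eq card[OF t] using t by (intro sum_mono) auto
  show "(\<Sum>k. max 0 (t' - lam k)) - (\<Sum>k. max 0 (t - lam k)) \<le> (t' - t) * real (card {k. lam k < t'})"
    unfolding eq card[OF order_refl] using t by (intro sum_mono) auto
qed

lemma counting_function_of_riesz_mean:
  fixes lam :: "nat \<Rightarrow> real"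
  assumes lam: "filterlim lam at_top sequentially" and m: "m \<ge> 1"
    and riesz: "((\<lambda>s. (\<Sum>k. max 0 (s ^ m - lam k)) / (s ^ (m - 1) * exp (a * s))) \<longlongrightarrow> \<rho>) at_top"
  shows "((\<lambda>s. exp (- a * s) * real (card {k. lam k < s ^ m})) \<longlongrightarrow> \<rho> * a / real m) at_top"
proof -
  define F where "F = (\<lambda>s. \<Sum>k. max 0 (s ^ m - lam k))"
  define Q where "Q = (\<lambda>\<tau> s. (F (s + \<tau>) - F s) / (((s + \<tau>) ^ m - s ^ m) * exp (a * s)))"
  \<comment> \<open>The limit of the quotient \<open>Q\<close>: in the numerator the exponential
    contributes \<open>exp (a * \<tau>) - 1\<close>, in the denominator
    \<open>(s + \<tau>) ^ m - s ^ m\<close> behaves like m \<tau> \<open>s ^ (m - 1)\<close>.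
    Positive \<tau> will give upper and negative \<tau> lower bounds for the counting
    function.\<close>
  define q where "q = (\<lambda>\<tau>. \<rho> * ((exp (a * \<tau>) - 1) / \<tau>) / real m)"
  have Qlim: "((\<lambda>s. Q \<tau> s) \<longlongrightarrow> q \<tau>) at_top" if \<tau>: "\<tau> \<noteq> 0" for \<tau>
  proof -
    have sh: "filterlim (\<lambda>s. s + \<tau>) at_top at_top" by real_asymp
    have 1: "((\<lambda>s. F s / (s ^ (m - 1) * exp (a * s))) \<longlongrightarrow> \<rho>) at_top"
      using riesz by (simp add: F_def)
    have 2: "((\<lambda>s. F (s + \<tau>) / ((s + \<tau>) ^ (m - 1) * exp (a * (s + \<tau>)))) \<longlongrightarrow> \<rho>) at_top"
      by (rule filterlim_compose[OF 1 sh])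
    have r: "((\<lambda>s. (s + \<tau>) / s) \<longlongrightarrow> 1) at_top" by real_asymp
    have 3: "((\<lambda>s. F (s + \<tau>) / ((s + \<tau>) ^ (m - 1) * exp (a * (s + \<tau>))) * ((s + \<tau>) / s) ^ (m - 1) * exp (a * \<tau>)) \<longlongrightarrow> \<rho> * 1 ^ (m - 1) * exp (a * \<tau>)) at_top"
      by (intro tendsto_intros 2 r)
    have 4: "((\<lambda>s. - ((s ^ m - (s - (- \<tau>)) ^ m) / s ^ (m - 1))) \<longlongrightarrow> - (real m * (- \<tau>))) at_top"
      by (intro tendsto_minus power_gap_tendsto)
    have "((\<lambda>s. (F (s + \<tau>) / ((s + \<tau>) ^ (m - 1) * exp (a * (s + \<tau>))) * ((s + \<tau>) / s) ^ (m - 1) * exp (a * \<tau>) - F s / (s ^ (m - 1) * exp (a * s)))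
        / (- ((s ^ m - (s - (- \<tau>)) ^ m) / s ^ (m - 1)))) \<longlongrightarrow> (\<rho> * 1 ^ (m - 1) * exp (a * \<tau>) - \<rho>) / (- (real m * (- \<tau>)))) at_top"
      using \<tau> m by (intro tendsto_divide tendsto_diff 1 3 4) auto
    moreover have "\<forall>\<^sub>F s in at_top. (F (s + \<tau>) / ((s + \<tau>) ^ (m - 1) * exp (a * (s + \<tau>))) * ((s + \<tau>) / s) ^ (m - 1) * exp (a * \<tau>) - F s / (s ^ (m - 1) * exp (a * s)))
        / (- ((s ^ m - (s - (- \<tau>)) ^ m) / s ^ (m - 1))) = Q \<tau> s"
      using eventually_gt_at_top[of 0] eventually_gt_at_top[of "- \<tau>"]
    proof eventually_elim
      case (elim s)
      have "F (s + \<tau>) / ((s + \<tau>) ^ (m - 1) * exp (a * (s + \<tau>))) * ((s + \<tau>) / s) ^ (m - 1) * exp (a * \<tau>) = F (s + \<tau>) / (s ^ (m - 1) * exp (a * s))"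
        using elim by (simp add: power_divide distrib_left exp_add)
      then have "F (s + \<tau>) / ((s + \<tau>) ^ (m - 1) * exp (a * (s + \<tau>))) * ((s + \<tau>) / s) ^ (m - 1) * exp (a * \<tau>) - F s / (s ^ (m - 1) * exp (a * s))
         = (F (s + \<tau>) - F s) / exp (a * s) / s ^ (m - 1)"
        by (simp add: diff_divide_distrib mult.commute)
      moreover have "- ((s ^ m - (s - (- \<tau>)) ^ m) / s ^ (m - 1)) = ((s + \<tau>) ^ m - s ^ m) / s ^ (m - 1)"
        by (simp add: diff_divide_distrib)
      moreover have "s ^ (m - 1) \<noteq> 0" using elim by simp
      ultimately show ?case
        unfolding Q_def by (simp only: divide_divide_eq_left divide_divide_eq_right) (simp add: mult_ac)
    qed
    ultimately have "((\<lambda>s. Q \<tau> s) \<longlongrightarrow> (\<rho> * 1 ^ (m - 1) * exp (a * \<tau>) - \<rho>) / (- (real m * (- \<tau>)))) at_top"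
      by (rule Lim_transform_eventually)
    also have "(\<rho> * 1 ^ (m - 1) * exp (a * \<tau>) - \<rho>) / (- (real m * (- \<tau>))) = q \<tau>"
      using \<tau> by (simp add: q_def field_simps)
    finally show ?thesis .
  qed
  have qlim: "(q \<longlongrightarrow> \<rho> * a / real m) (at 0)"
  proof -
    have "((\<lambda>x. exp (a * x)) has_real_derivative a) (at 0)"
      by (auto intro!: derivative_eq_intros)
    then have "((\<lambda>\<tau>. (exp (a * \<tau>) - 1) / \<tau>) \<longlongrightarrow> a) (at 0)" by (simp add: DERIV_def)
    then show ?thesis unfolding q_def using m by (intro tendsto_intros) auto
  qed
  define D where "D = (\<lambda>s. exp (- a * s) * real (card {k. lam k < s ^ m}))"
  have D_inverse: "D s = inverse (exp (a * s)) * real (card {k. lam k < s ^ m})" for s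
    by (simp add: D_def exp_minus)
  have arith: "h * n \<le> X \<Longrightarrow> inverse e * n \<le> X / (h * e)" "X \<le> h * n \<Longrightarrow> X / (h * e) \<le> inverse e * n"
    if "0 < h" "0 < e" for h n X e :: real
    using that by (auto simp: field_simps)
  have up: "\<forall>\<^sub>F s in at_top. D s \<le> Q \<tau> s" if \<tau>: "\<tau> > 0" for \<tau>
    using eventually_gt_at_top[of 0]
  proof eventually_elim
    case (elim s)
    have h: "(s + \<tau>) ^ m - s ^ m > 0" using \<tau> elim m by (simp add: power_strict_mono)
    have "((s + \<tau>) ^ m - s ^ m) * real (card {k. lam k < s ^ m}) \<le> F (s + \<tau>) - F s"
      unfolding F_def using h by (intro riesz_mean_increment(1)[OF lam]) simp
    then show ?case unfolding D_inverse Q_def by (rule arith(1)[OF h exp_gt_zero])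
  qed
  have low: "\<forall>\<^sub>F s in at_top. Q \<tau> s \<le> D s" if \<tau>: "\<tau> < 0" for \<tau>
    using eventually_gt_at_top[of 0] eventually_gt_at_top[of "- \<tau>"]
  proof eventually_elim
    case (elim s)
    have h: "s ^ m - (s + \<tau>) ^ m > 0" using \<tau> elim m by (simp add: power_strict_mono)
    have "F s - F (s + \<tau>) \<le> (s ^ m - (s + \<tau>) ^ m) * real (card {k. lam k < s ^ m})"
      unfolding F_def using h by (intro riesz_mean_increment(2)[OF lam]) simp
    then have "(F s - F (s + \<tau>)) / ((s ^ m - (s + \<tau>) ^ m) * exp (a * s)) \<le> D s"
      unfolding D_inverse by (rule arith(2)[OF h exp_gt_zero])
    moreover have "Q \<tau> s = (F s - F (s + \<tau>)) / ((s ^ m - (s + \<tau>) ^ m) * exp (a * s))"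
      unfolding Q_def by (metis minus_diff_eq minus_divide_divide mult_minus_left)
    ultimately show ?case by simp
  qed
  have "(D \<longlongrightarrow> \<rho> * a / real m) at_top"
  proof (rule order_tendstoI)
    fix y assume "y < \<rho> * a / real m"
    then have "\<forall>\<^sub>F \<tau> in at_left 0. y < q \<tau>"
      using order_tendstoD(1)[OF qlim] by (simp add: eventually_at_split)
    moreover have "\<forall>\<^sub>F \<tau> in at_left (0::real). \<tau> < 0" by (simp add: eventually_at_filter)
    ultimately have "\<forall>\<^sub>F \<tau> in at_left 0. \<tau> < 0 \<and> y < q \<tau>" by eventually_elim auto
    then obtain \<tau> where \<tau>: "\<tau> < 0" "y < q \<tau>"
      using eventually_happens[of _ "at_left (0::real)"] by force
    have "\<tau> \<noteq> 0" using \<tau>(1) by simp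
    from order_tendstoD(1)[OF Qlim[OF this] \<tau>(2)] low[OF \<tau>(1)]
    show "\<forall>\<^sub>F s in at_top. y < D s" by eventually_elim simp
  next
    fix y assume "\<rho> * a / real m < y"
    then have "\<forall>\<^sub>F \<tau> in at_right 0. q \<tau> < y"
      using order_tendstoD(2)[OF qlim] by (simp add: eventually_at_split)
    moreover have "\<forall>\<^sub>F \<tau> in at_right (0::real). 0 < \<tau>" by (simp add: eventually_at_filter)
    ultimately have "\<forall>\<^sub>F \<tau> in at_right 0. 0 < \<tau> \<and> q \<tau> < y" by eventually_elim auto
    then obtain \<tau> where \<tau>: "0 < \<tau>" "q \<tau> < y"
      using eventually_happens[of _ "at_right (0::real)"] by force
    have "\<tau> \<noteq> 0" using \<tau>(1) by simp
    from order_tendstoD(2)[OF Qlim[OF this] \<tau>(2)] up[OF \<tau>(1)]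
    show "\<forall>\<^sub>F s in at_top. D s < y" by eventually_elim simp
  qed
  then show ?thesis by (simp add: D_def)
qed

text \<open>The lower bound is taken in two stages. For a fixed cutoff \<open>w\<close> the limit in
  \<open>s\<close> yields \<open>ip w w\<close> in place of the volume, and only then does
  \<open>w\<close> approach the indicator of \<Omega>. The order matters, since the error constants
  depend on \<open>w\<close>.\<close>

lemma (in log_domain) riesz_mean_asymptotics:
  assumes m2: "2 \<le> m"
  defines "v \<equiv> unit_ball_vol (real DIM('a))"
  obtains lam where "eigenvalue_enumeration m \<Omega> lam"
    "((\<lambda>s. (\<Sum>k. max 0 (s ^ m - lam k)) / (s ^ (m - 1) * exp (real DIM('a) / 2 * s))) \<longlongrightarrow>
      measure lborel \<Omega> * (2 * real m * v / real DIM('a)) / (2 * pi) ^ DIM('a)) at_top"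
proof -
  let ?c = "(2 * pi) ^ DIM('a)" and ?N = "real DIM('a)"
  have c: "?c > 0" by simp
  define L where "L = 2 * real m * v / ?N"
  obtain \<phi> :: "nat \<Rightarrow> 'a \<Rightarrow> real" and lam :: "nat \<Rightarrow> real" where
    \<phi>: "\<And>k. \<phi> k \<in> H" "\<And>i j. ip (\<phi> i) (\<phi> j) = (if i = j then 1 else 0)"
    and q: "\<And>k. qf (\<phi> k) (\<phi> k) = lam k" and en: "eigenvalue_enumeration m \<Omega> lam"
    and ex: "\<And>f n t. f \<in> H \<Longrightarrow> (\<And>k. k \<ge> n \<Longrightarrow> t \<le> lam k) \<Longrightarrow>
      t * ip f f - qf f f \<le> (\<Sum>k<n. max 0 (t - lam k) * (ip (\<phi> k) f)\<^sup>2)"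
    by (rule eigenbasis_exists) blast
  have un: "filterlim lam at_top sequentially" using en by (simp add: eigenvalue_enumeration_def)
  define F where "F = (\<lambda>s. \<Sum>k. max 0 (s ^ m - lam k))"
  define G where "G = (\<lambda>s. F s / (s ^ (m - 1) * exp (?N / 2 * s)))"
  \<comment> \<open>Only finitely many eigenvalues lie below \<open>s ^ m\<close>, so the series is
    a finite sum, to which the bounds with \<open>n\<close> terms apply.\<close>
  have fin: "\<exists>n. (\<forall>k\<ge>n. s ^ m \<le> lam k) \<and> F s = (\<Sum>k<n. max 0 (s ^ m - lam k))" for s
  proof -
    obtain n where n: "\<And>k. k \<ge> n \<Longrightarrow> s ^ m \<le> lam k"
      using un unfolding filterlim_at_top eventually_sequentially by blast
    have "k \<in> {..<n}" if "lam k < s ^ m" for k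
      using n[of k] that by (auto simp: not_less[symmetric])
    from riesz_mean_eq_sum[OF finite_lessThan this] n show ?thesis
      unfolding F_def by blast
  qed
  have denpos: "s ^ (m - 1) * exp (?N / 2 * s) > 0" if "s \<ge> 1" for s using that by simp
  have upper: "\<forall>\<^sub>F s in at_top. G s < y" if y: "measure lborel \<Omega> * L / ?c < y" for y
  proof -
    obtain U :: "real \<Rightarrow> real" where U:
      "\<And>s. s \<ge> 1 \<Longrightarrow> integrable lborel (\<lambda>\<xi>::'a. max 0 (s ^ m - log_symbol m \<xi>))"
      "\<And>s. s \<ge> 1 \<Longrightarrow> (LINT \<xi>::'a|lborel. max 0 (s ^ m - log_symbol m \<xi>)) = exp (?N / 2 * s) * s ^ (m - 1) * U s"
      "(U \<longlongrightarrow> L) at_top"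
      by (rule berezin_upper_integral[OF m_pos, where 'a='a, folded v_def, folded L_def]) (rule that)
    have "((\<lambda>s. measure lborel \<Omega> * U s / ?c) \<longlongrightarrow> measure lborel \<Omega> * L / ?c) at_top"
      by (intro tendsto_intros U) simp
    from order_tendstoD(2)[OF this y] eventually_ge_at_top[of 1]
    show ?thesis
    proof eventually_elim
      case (elim s)
      obtain n where "F s = (\<Sum>k<n. max 0 (s ^ m - lam k))" using fin by blast
      then have "?c * F s \<le> measure lborel \<Omega> * (exp (?N / 2 * s) * s ^ (m - 1) * U s)"
        using berezin_upper[OF \<phi> q U(1)[OF elim(2)], of n] U(2)[OF elim(2)] by simp
      then have "F s \<le> measure lborel \<Omega> * U s / ?c * (s ^ (m - 1) * exp (?N / 2 * s))"
        using c by (simp add: field_simps)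
      then have "G s \<le> measure lborel \<Omega> * U s / ?c"
        unfolding G_def using denpos[OF elim(2)] by (simp only: pos_divide_le_eq)
      then show ?case using elim(1) by simp
    qed
  qed
  have lower: "\<forall>\<^sub>F s in at_top. y < G s"
    if w: "w \<in> smooth_alg" "w \<in> test_functions \<Omega>" "\<And>x. 0 \<le> w x" "\<And>x. w x \<le> 1" and y: "y < ip w w * L / ?c" for w y
  proof -
    obtain U :: "real \<Rightarrow> real" where U:
      "\<And>s. s \<ge> 1 \<Longrightarrow> (LINT \<xi>::'a|lborel. (s ^ m - log_symbol m \<xi>) * indicator (log_annulus s) \<xi>) = exp (?N / 2 * s) * s ^ (m - 1) * U s"
      "(U \<longlongrightarrow> L) at_top"
      by (rule berezin_lower_integral[where 'a='a and m=m, folded v_def, folded L_def]) (rule that)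
    obtain C1 C2 where C: "0 \<le> C1" "0 \<le> C2"
      and low: "\<And>s n. s \<ge> 1 \<Longrightarrow> (\<And>k. k \<ge> n \<Longrightarrow> s ^ m \<le> lam k) \<Longrightarrow>
        ip w w * (LINT \<xi>::'a|lborel. (s ^ m - log_symbol m \<xi>) * indicator (log_annulus s) \<xi>)
        - (s ^ (m - 1) * exp (- s / 4) * C1 + C2) * measure lborel (log_annulus s :: 'a set)
        \<le> ?c * (\<Sum>k<n. max 0 (s ^ m - lam k))"
    proof (rule berezin_lower[where lam = lam, OF \<phi> _ w])
      fix f n t assume f: "f \<in> H" and n: "\<And>k. k \<ge> n \<Longrightarrow> t \<le> lam k"
      show "t * ip f f - qf f f \<le> (\<Sum>k<n. max 0 (t - lam k) * (ip (\<phi> k) f)\<^sup>2)"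
        by (rule ex[OF f n])
    qed (blast intro: that)
    have e0: "((\<lambda>s::real. exp (- s / 4)) \<longlongrightarrow> 0) at_top" by real_asymp
    \<comment> \<open>Here \<open>m\<close> must be at least 2: the error \<open>C2\<close> times
      the volume of the annulus has the order of the exponential alone, which is of lower order only
      if \<open>s ^ (m - 1)\<close> tends to infinity.\<close>
    have i0: "((\<lambda>s::real. 1 / s ^ (m - 1)) \<longlongrightarrow> 0) at_top"
      using m2 by (intro tendsto_divide_0[OF tendsto_const] filterlim_at_top_imp_at_infinity filterlim_pow_at_top filterlim_ident) auto
    have "((\<lambda>s. (ip w w * U s - (exp (- s / 4) * C1 + C2 * (1 / s ^ (m - 1))) * v) / ?c) \<longlongrightarrow> (ip w w * L - (0 * C1 + C2 * 0) * v) / ?c) at_top"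
      by (intro tendsto_intros U e0 i0) simp
    then have "((\<lambda>s. (ip w w * U s - (exp (- s / 4) * C1 + C2 * (1 / s ^ (m - 1))) * v) / ?c) \<longlongrightarrow> ip w w * L / ?c) at_top"
      by simp
    from order_tendstoD(1)[OF this y] eventually_ge_at_top[of 1]
    show ?thesis
    proof eventually_elim
      case (elim s)
      let ?d = "s ^ (m - 1)" and ?e = "exp (?N / 2 * s)"
      have d: "?d > 0" using elim by simp
      obtain n where n: "\<And>k. k \<ge> n \<Longrightarrow> s ^ m \<le> lam k" "F s = (\<Sum>k<n. max 0 (s ^ m - lam k))" using fin by blast
      have ann: "measure lborel (log_annulus s :: 'a set) \<le> v * ?e"
      proof -
        have "measure lborel (log_annulus s :: 'a set) \<le> measure lborel (cball (0::'a) (exp (s / 2)))"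
          by (intro measure_mono_fmeasurable) (auto simp: log_annulus_def fmeasurable_def intro: emeasure_lborel_cball_less_top)
        also have "\<dots> = v * exp (s / 2) ^ DIM('a)"
          by (simp add: measure_def emeasure_cball v_def)
        also have "exp (s / 2) ^ DIM('a) = ?e" by (simp add: exp_of_nat_mult[symmetric])
        finally show ?thesis .
      qed
      have "ip w w * (?e * ?d * U s) - (?d * exp (- s / 4) * C1 + C2) * (v * ?e) \<le>
         ip w w * (?e * ?d * U s) - (?d * exp (- s / 4) * C1 + C2) * measure lborel (log_annulus s :: 'a set)"
        using ann C d by (intro diff_left_mono mult_left_mono) auto
      also have "\<dots> \<le> ?c * F s"
        using low[OF elim(2) n(1)] unfolding U(1)[OF elim(2)] n(2) .
      also have "ip w w * (?e * ?d * U s) - (?d * exp (- s / 4) * C1 + C2) * (v * ?e) =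
          (ip w w * U s - (exp (- s / 4) * C1 + C2 * (1 / ?d)) * v) * (?d * ?e)"
      proof -
        have "p * (e * d * u) - (d * x * C1 + C2) * (v * e) = (p * u - (x * C1 + C2 * (1 / d)) * v) * (d * e)"
          if "d > 0" for p e d u x :: real
          using that by (simp add: field_simps)
        from this[OF d] show ?thesis .
      qed
      finally have "(ip w w * U s - (exp (- s / 4) * C1 + C2 * (1 / ?d)) * v) / ?c * (?d * ?e) \<le> F s"
        using c by (simp add: divide_le_eq mult.commute)
      then have "(ip w w * U s - (exp (- s / 4) * C1 + C2 * (1 / ?d)) * v) / ?c \<le> G s"
        unfolding G_def using denpos[OF elim(2)] by (simp only: pos_le_divide_eq)
      then show ?case using elim(1) by simp
    qed
  qed
  have "(G \<longlongrightarrow> measure lborel \<Omega> * L / ?c) at_top"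
  proof (rule order_tendstoI)
    fix y assume y: "y < measure lborel \<Omega> * L / ?c"
    obtain w :: "nat \<Rightarrow> 'a \<Rightarrow> real" where w:
      "\<And>n. w n \<in> smooth_alg" "\<And>n. w n \<in> test_functions \<Omega>" "\<And>n x. 0 \<le> w n x" "\<And>n x. w n x \<le> 1"
      "\<And>x. x \<in> \<Omega> \<Longrightarrow> (\<lambda>n. w n x) \<longlonglongrightarrow> 1"
      by (rule exists_cutoffs[OF open_\<Omega> nonempty_\<Omega>]) blast
    have i\<Omega>: "integrable lborel (indicator \<Omega> :: 'a \<Rightarrow> real)"
      using emeasure_\<Omega> by (intro integrable_real_indicator) auto
    note [measurable] = L2_measurable[OF test_functions_L2[OF w(2)]]
    have "(\<lambda>n. LINT x|lborel. (w n x)\<^sup>2) \<longlonglongrightarrow> (LINT x|lborel. indicator \<Omega> x)"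
    proof (rule integral_dominated_convergence[OF _ _ i\<Omega>])
      have z: "w n x = 0" if "x \<notin> \<Omega>" for n x by (rule L2_zero[OF test_functions_L2[OF w(2)] that])
      have "(\<lambda>n. (w n x)\<^sup>2) \<longlonglongrightarrow> indicator \<Omega> x" for x
      proof (cases "x \<in> \<Omega>")
        case True
        have "(\<lambda>n. (w n x)\<^sup>2) \<longlonglongrightarrow> 1\<^sup>2" by (intro tendsto_intros w(5) True)
        then show ?thesis using True by simp
      qed (simp add: z)
      then show "AE x in lborel. (\<lambda>n. (w n x)\<^sup>2) \<longlonglongrightarrow> indicator \<Omega> x" by simp
      show "AE x in lborel. norm ((w n x)\<^sup>2) \<le> indicator \<Omega> x" for n
        using z w(3,4) by (intro AE_I2) (auto simp: indicator_def power_le_one)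
    qed auto
    then have "(\<lambda>n. ip (w n) (w n) * L / ?c) \<longlonglongrightarrow> measure lborel \<Omega> * L / ?c"
      unfolding ip_self by (intro tendsto_intros) auto
    from order_tendstoD(1)[OF this y] obtain n where "y < ip (w n) (w n) * L / ?c"
      by (auto simp: eventually_sequentially)
    then show "\<forall>\<^sub>F s in at_top. y < G s" by (rule lower[OF w(1) w(2) w(3) w(4)])
  qed (rule upper)
  then show ?thesis
    using that[OF en] unfolding G_def F_def L_def by blast
qed

theorem theorem1p1:
  fixes \<Omega> :: "'a::euclidean_space set" and m :: nat
  assumes m: "2 \<le> m"
    and domain: "open \<Omega>" "connected \<Omega>" "\<Omega> \<noteq> {}" "bounded \<Omega>"
    and lipschitz: "2 \<le> DIM('a) \<Longrightarrow> lipschitz_boundary \<Omega>"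
  shows "((\<lambda>t::real. exp (- (real DIM('a) / 2) * t powr (1 / real m)) *
             real (card {k. dirichlet_eigenvalue m \<Omega> k < t}))
           \<longlongrightarrow> T_const TYPE('a) * measure lebesgue \<Omega> / real DIM('a)) at_top \<and>
         ((\<lambda>t::real. t powr (- ((real m - 1) / real m)) *
             exp (- (real DIM('a) / 2) * t powr (1 / real m)) *
             (\<Sum>k. max 0 (t - dirichlet_eigenvalue m \<Omega> k)))
           \<longlongrightarrow> 2 * real m / (real DIM('a))\<^sup>2 * T_const TYPE('a) * measure lebesgue \<Omega>) at_top"
proof -
  interpret log_domain \<Omega> m
    by unfold_locales (use domain m in auto)
  let ?N = "real DIM('a)" and ?v = "unit_ball_vol (real DIM('a))" and ?c = "(2 * pi) ^ DIM('a)"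
  \<comment> \<open>With T_N = N v / (2 pi)^N this is 2 m T_N \<bar>\<Omega>\<bar> / N^2, the second
    constant. Multiplied by N / 2 and divided by m, as in the passage to the counting function, it
    becomes the first.\<close>
  define \<rho> where "\<rho> = measure lborel \<Omega> * (2 * real m * ?v / ?N) / ?c"
  obtain lam where en: "eigenvalue_enumeration m \<Omega> lam"
    and riesz: "((\<lambda>s. (\<Sum>k. max 0 (s ^ m - lam k)) / (s ^ (m - 1) * exp (?N / 2 * s))) \<longlongrightarrow> \<rho>) at_top"
    using riesz_mean_asymptotics[OF m] unfolding \<rho>_def by blast
  have lam: "dirichlet_eigenvalue m \<Omega> = lam" by (rule dirichlet_eigenvalue_eqI[OF en])
  have un: "filterlim lam at_top sequentially" using en by (simp add: eigenvalue_enumeration_def)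
  have count: "((\<lambda>s. exp (- (?N / 2) * s) * real (card {k. lam k < s ^ m})) \<longlongrightarrow> \<rho> * (?N / 2) / real m) at_top"
    using m by (intro counting_function_of_riesz_mean[OF un _ riesz]) simp
  have T: "T_const TYPE('a) = ?N * ?v / ?c"
    by (simp add: T_const_def sphere_measure_unit_sphere)
  have meas: "measure lebesgue \<Omega> = measure lborel \<Omega>" by (simp add: measure_completion)
  have s: "filterlim (\<lambda>t::real. t powr (1 / real m)) at_top at_top"
    using m by (intro real_powr_at_top) auto
  \<comment> \<open>The substitution s = t^(1/m), valid for positive t, turns the statements in
    \<open>s\<close> into those in \<open>t\<close>.\<close>
  have pow: "\<forall>\<^sub>F t in at_top. (t powr (1 / real m)) ^ m = (t::real) \<and>
      t powr (- ((real m - 1) / real m)) = 1 / (t powr (1 / real m)) ^ (m - 1)"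
    using eventually_gt_at_top[of 0]
  proof eventually_elim
    case (elim t)
    have p: "(t powr (1 / real m)) ^ j = t powr (real j / real m)" for j
      using elim by (simp add: powr_realpow[symmetric] powr_powr)
    have "real (m - 1) = real m - 1" using m by simp
    then show ?case using elim m by (simp add: p powr_minus_divide)
  qed
  have "((\<lambda>t. exp (- (?N / 2) * t powr (1 / real m)) * real (card {k. lam k < (t powr (1 / real m)) ^ m})) \<longlongrightarrow> \<rho> * (?N / 2) / real m) at_top"
    by (rule filterlim_compose[OF count s])
  then have 1: "((\<lambda>t. exp (- (?N / 2) * t powr (1 / real m)) * real (card {k. lam k < t})) \<longlongrightarrow> \<rho> * (?N / 2) / real m) at_top"
    by (rule Lim_transform_eventually) (use pow in \<open>eventually_elim, simp\<close>)
  have "((\<lambda>t. (\<Sum>k. max 0 ((t powr (1 / real m)) ^ m - lam k)) / ((t powr (1 / real m)) ^ (m - 1) * exp (?N / 2 * t powr (1 / real m)))) \<longlongrightarrow> \<rho>) at_top"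
    by (rule filterlim_compose[OF riesz s])
  then have 2: "((\<lambda>t. t powr (- ((real m - 1) / real m)) * exp (- (?N / 2) * t powr (1 / real m)) * (\<Sum>k. max 0 (t - lam k))) \<longlongrightarrow> \<rho>) at_top"
  proof (rule Lim_transform_eventually)
    show "\<forall>\<^sub>F t in at_top. (\<Sum>k. max 0 ((t powr (1 / real m)) ^ m - lam k)) / ((t powr (1 / real m)) ^ (m - 1) * exp (?N / 2 * t powr (1 / real m))) =
       t powr (- ((real m - 1) / real m)) * exp (- (?N / 2) * t powr (1 / real m)) * (\<Sum>k. max 0 (t - lam k))"
      using pow
    proof eventually_elim
      case (elim t)
      have "exp (- (?N / 2) * t powr (1 / real m)) = 1 / exp (?N / 2 * t powr (1 / real m))"
        by (simp only: mult_minus_left exp_minus inverse_eq_divide)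
      moreover have "x / (d * e) = 1 / d * (1 / e) * x" for x d e :: real by simp
      ultimately show ?case using elim by (simp only:)
    qed
  qed
  have c1: "\<rho> * (?N / 2) / real m = T_const TYPE('a) * measure lebesgue \<Omega> / ?N"
    using m unfolding T meas \<rho>_def by (simp add: field_simps)
  have c2: "\<rho> = 2 * real m / ?N\<^sup>2 * T_const TYPE('a) * measure lebesgue \<Omega>"
    unfolding T meas \<rho>_def by (simp add: field_simps power2_eq_square)
  show ?thesis
    unfolding lam by (intro conjI 1[unfolded c1] 2[unfolded c2])
qed

end
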